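(* Let $f\in L^2(\Omega)$ be non-negative and not identically zero in $\Omega$, let $g\in L^2(0,T)$, and let $u$ be the solution of the initial-boundary value problem $$\sum_{j=1}^\ell q_j\partial_t^{\alpha_j}u+A(x)u=g(t)f(x)\ \text{ in }\Omega\times(0,T),\qquad u(x,0)=0\ \text{ in }\Omega,\qquad u=0\ \text{ on }\partial\Omega\times(0,T).$$ Let $\omega$ be a fixed nonempty open subdomain of $\Omega$. If $\int_\omega u(x,t)\,dx=0$ for all $t\in(0,T)$, then $g=0$ in $(0,T)$.
   Context: $T>0$ is given, $\Omega\subset\mathbb R^d$ is a bounded domain (open, connected) with sufficiently smooth boundary $\partial\Omega$. The numbers $q_1,\dots,q_\ell$ are positive constants and $0<\alpha_\ell<\cdots<\alpha_1<1$. The operator $A$ has domain $D(A)=\{\psi\in H^2(\Omega):\psi=0\text{ on }\partial\Omega\}$ and is given by $A\psi(x)=-\sum_{i,j=1}^d\partial_j(a_{ij}(x)\partial_i\psi(x))+c(x)\psi(x)$, where $a_{ij}=a_{ji}\in C^1(\overline\Omega)$, $c\in L^\infty(\Omega)$, $c\ge0$, and there is $a_0>0$ with $\sum_{i,j}a_{ij}(x)\xi_i\xi_j\ge a_0\sum_i\xi_i^2$ for all $x\in\overline\Omega$, $\xi\in\mathbb R^d$. For $\alpha>0$, $J^\alpha g(t)=\frac1{\Gamma(\alpha)}\int_0^t(t-\tau)^{\alpha-1}g(\tau)\,d\tau$ is the Riemann-Liouville integral; $J^\alpha:L^2(0,T)\to\mathcal R(J^\alpha)$ is bijective onto its range. For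 $0<\alpha<1$, $\partial_t^\alpha:=(J^\alpha)^{-1}$ on $\mathcal R(J^\alpha)$, and $H_\alpha(0,T)$ denotes $\mathcal R(J^\alpha)$ with norm $\|(J^{\alpha})^{-1}\phi\|_{L^2(0,T)}$. The solution $u$ is the unique weak solution $u\in L^2(0,T;H^2(\Omega)\cap H_0^1(\Omega))$ with $u\in H_{\alpha_1}(0,T;L^2(\Omega))$ (this encodes the zero initial condition) satisfying the equation in $\Omega\times(0,T)$. Equalities between $L^2$ functions of $t$ are understood almost everywhere. *)

theory Defs
  imports "HOL-Analysis.Analysis"
begin

text \<open>
  Elements of Lebesgue and Sobolev spaces are represented by functions, to be read modulo equality
  almost everywhere. A function of time and space is curried, \<open>u t x\<close>, and
  \<open>L\<^sup>2(0,T; L\<^sup>2(\<Omega>))\<close> is identified with \<open>L\<^sup>2((0,T) \<times> \<Omega>)\<close>.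
\<close>

definition L2_space :: "'a::euclidean_space set \<Rightarrow> ('a \<Rightarrow> real) set" where
  "L2_space S = {f. f \<in> borel_measurable (lebesgue_on S) \<and> integrable (lebesgue_on S) (\<lambda>x. (f x)\<^sup>2)}"

definition Linf_space :: "'a::euclidean_space set \<Rightarrow> ('a \<Rightarrow> real) set" where
  "Linf_space S = {f. f \<in> borel_measurable (lebesgue_on S) \<and> (\<exists>M. AE x in lebesgue_on S. \<bar>f x\<bar> \<le> M)}"

definition L2_norm :: "'a::euclidean_space set \<Rightarrow> ('a \<Rightarrow> real) \<Rightarrow> real" where
  "L2_norm S f = sqrt (LINT x|lebesgue_on S. (f x)\<^sup>2)"

definition locally_integrable :: "'a::euclidean_space set \<Rightarrow> ('a \<Rightarrow> real) \<Rightarrow> bool" where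
  "locally_integrable S f \<longleftrightarrow> (\<forall>K. compact K \<and> K \<subseteq> S \<longrightarrow> set_integrable lebesgue K f)"

subsection \<open>Continuously differentiable functions and smooth boundaries\<close>

definition partial :: "'d \<Rightarrow> (real^'d \<Rightarrow> real) \<Rightarrow> real^'d \<Rightarrow> real" where
  "partial i f x = frechet_derivative f (at x) (axis i 1)"

text \<open>\<open>Ck k S f\<close>: \<open>f \<in> C\<^sup>k(S)\<close>, for open \<open>S\<close>.\<close>

primrec Ck :: "nat \<Rightarrow> (real^'d) set \<Rightarrow> (real^'d \<Rightarrow> real) \<Rightarrow> bool" where
  "Ck 0 S f \<longleftrightarrow> continuous_on S f"
| "Ck (Suc k) S f \<longleftrightarrow> (\<forall>x\<in>S. f differentiable (at x)) \<and> (\<forall>i. Ck k S (partial i f))"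

text \<open>\<open>C\<^sup>1\<close> up to the boundary: the function and its first partial derivatives in the open set
  \<open>S\<close> extend continuously to the closure.\<close>

definition C1_closure :: "(real^'d) set \<Rightarrow> (real^'d \<Rightarrow> real) \<Rightarrow> bool" where
  "C1_closure S f \<longleftrightarrow> Ck 1 S f \<and> continuous_on (closure S) f \<and>
     (\<forall>i. \<exists>h. continuous_on (closure S) h \<and> (\<forall>x\<in>S. h x = partial i f x))"

text \<open>Near every boundary point, after relabelling and reorienting the coordinate axes, the set is
  the part of a ball above the graph of a \<open>C\<^sup>k\<close> function \<open>\<gamma>\<close> of the other \<open>d - 1\<close>
  coordinates. Here \<open>m\<close> is the distinguished coordinate, \<open>s\<close> its orientation, and \<open>\<gamma>\<close> is
  a function on the whole space that does not depend on the \<open>m\<close>-th coordinate.\<close>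

definition Ck_boundary :: "nat \<Rightarrow> (real^'d) set \<Rightarrow> bool" where
  "Ck_boundary k S \<longleftrightarrow> (\<forall>x0\<in>frontier S. \<exists>r>0. \<exists>m. \<exists>s\<in>{-1, 1}. \<exists>\<gamma>.
     Ck k UNIV \<gamma> \<and> (\<forall>x y. (\<forall>i. i \<noteq> m \<longrightarrow> x $ i = y $ i) \<longrightarrow> \<gamma> x = \<gamma> y) \<and>
     S \<inter> ball x0 r = {x \<in> ball x0 r. s * x $ m > \<gamma> x})"

subsection \<open>Sobolev spaces\<close>

definition test_function :: "(real^'d) set \<Rightarrow> (real^'d \<Rightarrow> real) \<Rightarrow> bool" where
  "test_function S \<eta> \<longleftrightarrow>
     (\<forall>k. Ck k UNIV \<eta>) \<and> compact (closure {x. \<eta> x \<noteq> 0}) \<and> closure {x. \<eta> x \<noteq> 0} \<subseteq> S"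

definition has_weak_deriv :: "(real^'d) set \<Rightarrow> 'd \<Rightarrow> (real^'d \<Rightarrow> real) \<Rightarrow> (real^'d \<Rightarrow> real) \<Rightarrow> bool" where
  "has_weak_deriv S i f w \<longleftrightarrow> locally_integrable S f \<and> locally_integrable S w \<and>
     (\<forall>\<eta>. test_function S \<eta> \<longrightarrow>
        (LINT x|lebesgue_on S. f x * partial i \<eta> x) = - (LINT x|lebesgue_on S. w x * \<eta> x))"

text \<open>The chosen representative is unique only almost everywhere.\<close>

definition weak_deriv :: "(real^'d) set \<Rightarrow> 'd \<Rightarrow> (real^'d \<Rightarrow> real) \<Rightarrow> real^'d \<Rightarrow> real" where
  "weak_deriv S i f = (SOME w. has_weak_deriv S i f w)"

definition H1_space :: "(real^'d) set \<Rightarrow> (real^'d \<Rightarrow> real) set" where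
  "H1_space S = {f \<in> L2_space S. \<forall>i. \<exists>w \<in> L2_space S. has_weak_deriv S i f w}"

definition H2_space :: "(real^'d) set \<Rightarrow> (real^'d \<Rightarrow> real) set" where
  "H2_space S = {f \<in> L2_space S. \<forall>i. \<exists>w \<in> H1_space S. has_weak_deriv S i f w}"

definition H1_norm :: "(real^'d) set \<Rightarrow> (real^'d \<Rightarrow> real) \<Rightarrow> real" where
  "H1_norm S f = sqrt ((L2_norm S f)\<^sup>2 + (\<Sum>i\<in>UNIV. (L2_norm S (weak_deriv S i f))\<^sup>2))"

definition H2_norm :: "(real^'d) set \<Rightarrow> (real^'d \<Rightarrow> real) \<Rightarrow> real" where
  "H2_norm S f = sqrt ((L2_norm S f)\<^sup>2 + (\<Sum>i\<in>UNIV. (L2_norm S (weak_deriv S i f))\<^sup>2)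
     + (\<Sum>i\<in>UNIV. \<Sum>j\<in>UNIV. (L2_norm S (weak_deriv S j (weak_deriv S i f)))\<^sup>2))"

definition H10_space :: "(real^'d) set \<Rightarrow> (real^'d \<Rightarrow> real) set" where
  "H10_space S = {f \<in> H1_space S. \<exists>\<eta>. (\<forall>n. test_function S (\<eta> n)) \<and>
     (\<lambda>n::nat. H1_norm S (\<lambda>x. \<eta> n x - f x)) \<longlonglongrightarrow> 0}"

subsection \<open>The elliptic operator\<close>

definition elliptic_op :: "(real^'d) set \<Rightarrow> ('d \<Rightarrow> 'd \<Rightarrow> real^'d \<Rightarrow> real) \<Rightarrow> (real^'d \<Rightarrow> real)
    \<Rightarrow> (real^'d \<Rightarrow> real) \<Rightarrow> real^'d \<Rightarrow> real" where
  "elliptic_op S a c \<psi> x =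
     - (\<Sum>i\<in>UNIV. \<Sum>j\<in>UNIV. weak_deriv S j (\<lambda>y. a i j y * weak_deriv S i \<psi> y) x) + c x * \<psi> x"

subsection \<open>Fractional integrals and derivatives in time\<close>

definition RL_integral :: "real \<Rightarrow> (real \<Rightarrow> real) \<Rightarrow> real \<Rightarrow> real" where
  "RL_integral \<alpha> g t = (1 / Gamma \<alpha>) * (LINT \<tau>|lebesgue_on {0<..<t}. (t - \<tau>) powr (\<alpha> - 1) * g \<tau>)"

definition L2_L2 :: "real \<Rightarrow> (real^'d) set \<Rightarrow> (real \<Rightarrow> real^'d \<Rightarrow> real) set" where
  "L2_L2 T S = {u. (\<lambda>(t, x). u t x) \<in> L2_space ({0<..<T} \<times> S)}"

text \<open>\<open>v = (J\<^sup>\<alpha>)\<^sup>-\<^sup>1 u\<close>, where \<open>J\<^sup>\<alpha>\<close> acts on \<open>L\<^sup>2(0,T; L\<^sup>2(S))\<close>.\<close>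

definition has_frac_deriv :: "real \<Rightarrow> real \<Rightarrow> (real^'d) set \<Rightarrow> (real \<Rightarrow> real^'d \<Rightarrow> real)
    \<Rightarrow> (real \<Rightarrow> real^'d \<Rightarrow> real) \<Rightarrow> bool" where
  "has_frac_deriv \<alpha> T S u v \<longleftrightarrow> v \<in> L2_L2 T S \<and>
     (AE (t, x) in lebesgue_on ({0<..<T} \<times> S). u t x = RL_integral \<alpha> (\<lambda>s. v s x) t)"

definition H_frac :: "real \<Rightarrow> real \<Rightarrow> (real^'d) set \<Rightarrow> (real \<Rightarrow> real^'d \<Rightarrow> real) set" where
  "H_frac \<alpha> T S = {u. \<exists>v. has_frac_deriv \<alpha> T S u v}"

definition frac_deriv :: "real \<Rightarrow> real \<Rightarrow> (real^'d) set \<Rightarrow> (real \<Rightarrow> real^'d \<Rightarrow> real)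
    \<Rightarrow> real \<Rightarrow> real^'d \<Rightarrow> real" where
  "frac_deriv \<alpha> T S u = (SOME v. has_frac_deriv \<alpha> T S u v)"

subsection \<open>The initial-boundary value problem\<close>

definition L2_H2_H10 :: "real \<Rightarrow> (real^'d) set \<Rightarrow> (real \<Rightarrow> real^'d \<Rightarrow> real) set" where
  "L2_H2_H10 T S = {u \<in> L2_L2 T S. (AE t in lebesgue_on {0<..<T}. u t \<in> H2_space S \<inter> H10_space S) \<and>
     integrable (lebesgue_on {0<..<T}) (\<lambda>t. (H2_norm S (u t))\<^sup>2)}"

text \<open>The equation is an equality in \<open>L\<^sup>2(S)\<close> for almost every \<open>t\<close>. An almost-everywhere
  statement on the product \<open>(0,T) \<times> S\<close> would be inappropriate, because the representatives of the
  weak derivatives are chosen separately for every \<open>t\<close>. The boundary condition is the membership in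
  \<open>H\<^sup>1\<^sub>0\<close>, the initial condition the one in \<open>H\<^sub>\<alpha>\<close> for the largest exponent \<open>\<alpha> 1\<close>.\<close>

definition is_solution :: "real \<Rightarrow> (real^'d) set \<Rightarrow> nat \<Rightarrow> (nat \<Rightarrow> real) \<Rightarrow> (nat \<Rightarrow> real)
    \<Rightarrow> ('d \<Rightarrow> 'd \<Rightarrow> real^'d \<Rightarrow> real) \<Rightarrow> (real^'d \<Rightarrow> real) \<Rightarrow> (real \<Rightarrow> real^'d \<Rightarrow> real)
    \<Rightarrow> (real \<Rightarrow> real^'d \<Rightarrow> real) \<Rightarrow> bool" where
  "is_solution T S l q \<alpha> a c F u \<longleftrightarrow> u \<in> L2_H2_H10 T S \<and> u \<in> H_frac (\<alpha> 1) T S \<and>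
     (AE t in lebesgue_on {0<..<T}. AE x in lebesgue_on S.
        (\<Sum>j=1..l. q j * frac_deriv (\<alpha> j) T S u t x) + elliptic_op S a c (u t) x = F t x)"

end

theory Submission
  imports Defs
begin

text \<open>For \<open>\<mu> \<ge> 1\<close> take a nonnegative near-minimiser \<open>z\<close> of the quadratic energy of \<open>A z + \<mu> z = 1\<^sub>\<omega>\<close>.
  With \<open>\<mu> = (\<Sum>j. q j * s powr \<alpha> j)\<close>, pairing the equation for \<open>u\<close> with \<open>z\<close> and taking Laplace
  transforms over \<open>(0, T)\<close> shows that the transform of \<open>g\<close> at \<open>s\<close> times \<open>\<integral> f z\<close> is at most
  \<open>exp (- s * T)\<close> up to powers of \<open>s\<close>: the observation of \<open>u\<close> vanishes, and truncating the
  transform at \<open>T\<close> only costs this factor. Testing the elliptic equation with \<open>\<eta>\<^sup>2 / z\<close> bounds the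
  gradient of \<open>ln z\<close> by \<open>\<mu>\<close>, and propagating this bound from \<open>\<omega>\<close> through the connected set \<open>\<Omega>\<close>
  gives \<open>\<integral> f z \<ge> m * exp (- C * \<mu>)\<close>. As \<open>\<mu>\<close> grows like \<open>s powr \<alpha> 1\<close> with \<open>\<alpha> 1 < 1\<close>, the transform of \<open>g\<close>
  is \<open>O (exp (- s * b))\<close> for every \<open>b < T\<close>, and Mikusinski's moment argument gives \<open>g = 0\<close>.\<close>

subsection \<open>Smooth functions\<close>

text \<open>The source g is merely square integrable and u is known on (0, T) alone, so neither
  analyticity in time nor a transform over the half-line is at hand; this is why the truncation at T
  is estimated rather than avoided. The elliptic operator enters only through its symmetric bilinear
  form: no eigenfunctions, no solvability or regularity theory and no maximum principle are invoked,
  and near-minimisers in the class of test functions keep every auxiliary function smooth. Their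
  defect \<epsilon> is harmless because it can be taken as small as the truncation error itself. For
  the lower bound on the pairing of f with z it is enough to control ln z in the mean: convexity of
  exp turns averages of ln z into lower bounds for averages of z. Such averages can be moved from
  ball to ball once the gradient of ln z is bounded, at the price of a larger constant but with the
  same linear growth in \<mu>.\<close>

lemma partial_eq:
  assumes "(f has_derivative f') (at x)"
  shows "partial i f x = f' (axis i 1)"
  using frechet_derivative_at[OF assms] by (simp add: partial_def)

lemma has_derivative_partial:
  fixes f :: "real^'d \<Rightarrow> real"
  assumes "f differentiable (at x)"
  shows "(f has_derivative (\<lambda>h. \<Sum>i\<in>UNIV. h $ i * partial i f x)) (at x)"
proof -
  obtain f' where f': "(f has_derivative f') (at x)"
    using assms by (auto simp: differentiable_def)
  interpret bounded_linear f' using f' by (rule has_derivative_bounded_linear)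
  have "f' h = (\<Sum>i\<in>UNIV. h $ i * partial i f x)" for h
  proof -
    have "f' h = f' (\<Sum>i\<in>UNIV. h $ i *\<^sub>R axis i 1)"
      using basis_expansion[of h] by (simp add: scalar_mult_eq_scaleR)
    also have "\<dots> = (\<Sum>i\<in>UNIV. h $ i * partial i f x)"
      by (simp add: sum scaleR partial_eq[OF f'])
    finally show ?thesis .
  qed
  then have "f' = (\<lambda>h. \<Sum>i\<in>UNIV. h $ i * partial i f x)" by blast
  with f' show ?thesis by simp
qed

lemma partial_add:
  assumes "f differentiable (at x)" "g differentiable (at x)"
  shows "partial i (\<lambda>x. f x + g x) x = partial i f x + partial i g x"
proof -
  obtain f' g' where fg: "(f has_derivative f') (at x)" "(g has_derivative g') (at x)"
    using assms by (auto simp: differentiable_def)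
  show ?thesis using partial_eq[OF has_derivative_add[OF fg]] partial_eq[OF fg(1)] partial_eq[OF fg(2)]
    by simp
qed

lemma partial_mult:
  assumes "f differentiable (at x)" "g differentiable (at x)"
  shows "partial i (\<lambda>x. f x * g x) x = f x * partial i g x + partial i f x * g x"
proof -
  obtain f' g' where fg: "(f has_derivative f') (at x)" "(g has_derivative g') (at x)"
    using assms by (auto simp: differentiable_def)
  show ?thesis using partial_eq[OF has_derivative_mult[OF fg]] partial_eq[OF fg(1)] partial_eq[OF fg(2)]
    by simp
qed

lemma partial_const: "partial i (\<lambda>x. b) x = 0"
  using partial_eq[OF has_derivative_const[of b "at x"], of i] by simp

lemma partial_cmult:
  assumes "f differentiable (at x)"
  shows "partial i (\<lambda>x. b * f x) x = b * partial i f x"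
  using partial_mult[of "\<lambda>_. b" x f i] assms by (simp add: partial_const)

lemma partial_compose:
  assumes "(\<phi> has_real_derivative d) (at (f x))" "f differentiable (at x)"
  shows "partial i (\<lambda>x. \<phi> (f x)) x = d * partial i f x"
proof -
  obtain f' where f: "(f has_derivative f') (at x)"
    using assms by (auto simp: differentiable_def)
  have "((\<lambda>x. \<phi> (f x)) has_derivative (\<lambda>h. d * f' h)) (at x)"
    using has_derivative_compose[OF f] assms(1) by (simp add: has_field_derivative_def)
  from partial_eq[OF this] partial_eq[OF f] show ?thesis by simp
qed

lemma differentiable_compose1:
  fixes f :: "real^'d \<Rightarrow> real"
  assumes "(\<phi> has_real_derivative d) (at (f x))" "f differentiable (at x)"
  shows "(\<lambda>x. \<phi> (f x)) differentiable (at x)"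
  using assms has_derivative_compose[of f _ x UNIV \<phi> "(*) d"]
  by (force simp: differentiable_def has_field_derivative_def)

lemma Ck_Suc_imp: "Ck (Suc k) S f \<Longrightarrow> Ck k S f"
  by (induction k arbitrary: f)
    (auto intro!: differentiable_imp_continuous_on
      simp: differentiable_on_def differentiable_at_withinI)

lemma Ck_const: "Ck k UNIV (\<lambda>x. b)"
proof (induction k arbitrary: b)
  case (Suc k)
  have "partial i (\<lambda>x. b) = (\<lambda>x. 0)" for i :: 'a by (rule ext) (rule partial_const)
  with Suc[of 0] show ?case by simp
qed simp

lemma Ck_add: "Ck k UNIV f \<Longrightarrow> Ck k UNIV g \<Longrightarrow> Ck k UNIV (\<lambda>x. f x + g x)"
proof (induction k arbitrary: f g)
  case (Suc k)
  have "partial i (\<lambda>x. f x + g x) = (\<lambda>x. partial i f x + partial i g x)" for i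
    using Suc.prems by (intro ext partial_add) auto
  with Suc show ?case by auto
qed (auto intro: continuous_intros)

lemma Ck_mult: "Ck k UNIV f \<Longrightarrow> Ck k UNIV g \<Longrightarrow> Ck k UNIV (\<lambda>x. f x * g x)"
proof (induction k arbitrary: f g)
  case (Suc k)
  have *: "partial i (\<lambda>x. f x * g x) = (\<lambda>x. f x * partial i g x + partial i f x * g x)" for i
    using Suc.prems by (intro ext partial_mult) auto
  have "Ck k UNIV f" "Ck k UNIV g" using Suc.prems by (auto dest: Ck_Suc_imp simp del: Ck.simps)
  with Suc show ?case unfolding Ck.simps * by (auto intro!: Ck_add)
qed (auto intro: continuous_intros)

definition smooth :: "(real^'d \<Rightarrow> real) \<Rightarrow> bool" where
  "smooth f \<longleftrightarrow> (\<forall>k. Ck k UNIV f)"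

lemma smooth_differentiable: "smooth f \<Longrightarrow> f differentiable (at x)"
  unfolding smooth_def by (metis Ck.simps(2) UNIV_I)

lemma smooth_partial: "smooth f \<Longrightarrow> smooth (partial i f)"
  unfolding smooth_def by (metis Ck.simps(2))

lemma smooth_continuous: "smooth f \<Longrightarrow> continuous_on S f"
  unfolding smooth_def by (metis Ck.simps(1) continuous_on_subset subset_UNIV)

lemma smooth_const: "smooth (\<lambda>x. b)"
  by (simp add: smooth_def Ck_const)

lemma smooth_add: "smooth f \<Longrightarrow> smooth g \<Longrightarrow> smooth (\<lambda>x. f x + g x)"
  by (simp add: smooth_def Ck_add)

lemma smooth_mult: "smooth f \<Longrightarrow> smooth g \<Longrightarrow> smooth (\<lambda>x. f x * g x)"
  by (simp add: smooth_def Ck_mult)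

lemma smooth_diff: "smooth f \<Longrightarrow> smooth g \<Longrightarrow> smooth (\<lambda>x. f x - g x)"
  using smooth_add[of f "\<lambda>x. -1 * g x"] smooth_mult[OF smooth_const, of g "-1"] by simp

lemma smooth_prod:
  "(\<And>i. i \<in> I \<Longrightarrow> smooth (f i)) \<Longrightarrow> smooth (\<lambda>x. \<Prod>i\<in>I. f i x)"
  by (induction I rule: infinite_finite_induct) (auto intro: smooth_const smooth_mult)

lemma smooth_sum:
  "(\<And>i. i \<in> I \<Longrightarrow> smooth (f i)) \<Longrightarrow> smooth (\<lambda>x. \<Sum>i\<in>I. f i x)"
  by (induction I rule: infinite_finite_induct) (auto intro: smooth_const smooth_add)

lemma smooth_component: "smooth (\<lambda>x::real^'d. x $ i)"
proof -
  have d: "((\<lambda>x::real^'d. x $ i) has_derivative (\<lambda>x. x $ i)) (at x)" for x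
    by (rule bounded_linear_imp_has_derivative[OF bounded_linear_vec_nth])
  have *: "partial j (\<lambda>x::real^'d. x $ i) = (\<lambda>x. axis j 1 $ i)" for j
    by (rule ext) (rule partial_eq[OF d])
  have "Ck k UNIV (\<lambda>x::real^'d. x $ i)" for k
    by (cases k) (use d in \<open>auto simp: * Ck_const differentiable_def intro!: continuous_intros\<close>)
  then show ?thesis by (simp add: smooth_def)
qed

text \<open>The partial derivatives of 1 / f are products of two factors 1 / f with a partial
  derivative of f, so the induction on k reproduces its own claim.\<close>

lemma smooth_inverse:
  assumes "smooth f" "\<And>x. f x \<noteq> 0"
  shows "smooth (\<lambda>x. inverse (f x))"
proof -
  have "Ck k UNIV (\<lambda>x. inverse (f x))" for k
  proof (induction k)
    case 0
    show ?case using assms smooth_continuous by (auto intro!: continuous_intros)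
  next
    case (Suc k)
    have d: "(inverse has_real_derivative - (inverse (f x) * inverse (f x))) (at (f x))" for x
      using DERIV_inverse[OF assms(2)[of x]] by (simp add: power2_eq_square)
    have *: "partial i (\<lambda>x. inverse (f x)) =
        (\<lambda>x. (-1) * ((inverse (f x) * inverse (f x)) * partial i f x))" for i
      using partial_compose[OF d smooth_differentiable[OF assms(1)]] by auto
    have "Ck k UNIV (partial i f)" for i using smooth_partial[OF assms(1)] by (simp add: smooth_def)
    then show ?case
      unfolding Ck.simps *
      using differentiable_compose1[OF d smooth_differentiable[OF assms(1)]] Suc
      by (intro conjI ballI allI Ck_mult Ck_const; simp)
  qed
  then show ?thesis by (simp add: smooth_def)
qed

section \<open>Functions that are flat at the origin\<close>

definition flat_exp :: "nat \<Rightarrow> real \<Rightarrow> real" where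
  "flat_exp m x = (if x > 0 then inverse x ^ m * exp (- inverse x) else 0)"

lemma flat_exp_tendsto: "(flat_exp m \<longlongrightarrow> 0) (at_right 0)"
proof -
  have "((\<lambda>x. inverse x ^ m * exp (- inverse x)) \<longlongrightarrow> 0) (at_right (0::real))"
    using filterlim_compose[OF tendsto_power_div_exp_0[of m] filterlim_inverse_at_top_right]
    by (simp add: exp_minus divide_inverse)
  moreover have "\<forall>\<^sub>F x in at_right 0. inverse x ^ m * exp (- inverse x) = flat_exp m x"
    by (auto simp: eventually_at_right_field flat_exp_def intro!: exI[of _ 1])
  ultimately show ?thesis by (rule Lim_transform_eventually)
qed

text \<open>The factor \<open>inverse x ^ m\<close> is carried along because differentiation raises
  it: over all m the family is closed under derivatives up to linear combinations, which is what the
  induction in \<open>smooth_flat_exp\<close> consumes. For m = 0 it is the classical flat function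
  exp (- 1 / x).\<close>

lemma flat_exp_deriv:
  "(flat_exp m has_real_derivative flat_exp (m + 2) x - real m * flat_exp (Suc m) x) (at x)"
proof -
  consider "x > 0" | "x < 0" | "x = 0" by linarith
  then show ?thesis
  proof cases
    case 1
    have "((\<lambda>x. inverse x ^ m * exp (- inverse x)) has_real_derivative
       inverse x ^ m * (exp (- inverse x) * (inverse x * inverse x))
        + (real m * inverse x ^ (m - 1) * (- (inverse x * inverse x))) * exp (- inverse x)) (at x)"
      using 1 by (auto intro!: derivative_eq_intros)
    also have "inverse x ^ m * (exp (- inverse x) * (inverse x * inverse x))
        + (real m * inverse x ^ (m - 1) * (- (inverse x * inverse x))) * exp (- inverse x)
        = flat_exp (m + 2) x - real m * flat_exp (Suc m) x"
      using 1 by (cases m) (auto simp: flat_exp_def algebra_simps power2_eq_square)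
    finally show ?thesis
      by (rule has_field_derivative_transform_within_open[of _ _ _ "{0<..}"])
        (use 1 in \<open>auto simp: flat_exp_def\<close>)
  next
    case 2
    have "((\<lambda>x. 0) has_real_derivative flat_exp (m + 2) x - real m * flat_exp (Suc m) x) (at x)"
      using 2 by (simp add: flat_exp_def)
    then show ?thesis
      by (rule has_field_derivative_transform_within_open[of _ _ _ "{..<0}"])
        (use 2 in \<open>auto simp: flat_exp_def\<close>)
  next
    case 3
    \<comment> \<open>At the origin the right difference quotient is \<open>flat_exp (Suc m)\<close>
      itself, which tends to 0; to the left everything vanishes.\<close>
    have "((\<lambda>h. (flat_exp m h - flat_exp m 0) / (h - 0)) \<longlongrightarrow> 0) (at 0)"
      unfolding filterlim_at_split
    proof
      show "((\<lambda>h. (flat_exp m h - flat_exp m 0) / (h - 0)) \<longlongrightarrow> 0) (at_right 0)"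
        using flat_exp_tendsto[of "Suc m"]
        by (rule Lim_transform_eventually)
          (auto simp: eventually_at_right_field flat_exp_def divide_inverse intro!: exI[of _ 1])
      show "((\<lambda>h. (flat_exp m h - flat_exp m 0) / (h - 0)) \<longlongrightarrow> 0) (at_left 0)"
        by (rule Lim_transform_eventually[OF tendsto_const])
          (auto simp: eventually_at_left_field flat_exp_def intro!: exI[of _ "-1"])
    qed
    with 3 show ?thesis by (simp add: has_field_derivative_iff flat_exp_def)
  qed
qed

lemma smooth_flat_exp:
  assumes "smooth f"
  shows "smooth (\<lambda>x. flat_exp m (f x))"
proof -
  have "Ck k UNIV (\<lambda>x. flat_exp m (f x))" for k
  proof (induction k arbitrary: m)
    case 0
    have "continuous_on UNIV (flat_exp m)"
      by (intro DERIV_continuous_on) (use flat_exp_deriv in \<open>auto intro: has_field_derivative_at_within\<close>)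
    then show ?case
      using smooth_continuous[OF assms] continuous_on_compose2[of UNIV "flat_exp m" UNIV f] by simp
  next
    case (Suc k)
    have *: "partial i (\<lambda>x. flat_exp m (f x)) =
        (\<lambda>x. (flat_exp (m + 2) (f x) + (- real m) * flat_exp (Suc m) (f x)) * partial i f x)" for i
      using partial_compose[OF flat_exp_deriv smooth_differentiable[OF assms]] by auto
    have "Ck k UNIV (partial i f)" for i using smooth_partial[OF assms(1)] by (simp add: smooth_def)
    then show ?case unfolding Ck.simps *
      using differentiable_compose1[OF flat_exp_deriv smooth_differentiable[OF assms(1)]] Suc
      by (intro conjI ballI allI Ck_mult Ck_const Ck_add; simp)
  qed
  then show ?thesis by (simp add: smooth_def)
qed

lemma flat_exp_bounds: "0 \<le> flat_exp 0 x" "flat_exp 0 x \<le> 1" "0 < x \<Longrightarrow> 0 < flat_exp 0 x"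
  "x \<le> 0 \<Longrightarrow> flat_exp 0 x = 0" "x \<le> y \<Longrightarrow> flat_exp 0 x \<le> flat_exp 0 y"
  by (auto simp: flat_exp_def)

subsection \<open>Test functions\<close>

lemma test_functionI:
  assumes "smooth \<eta>" "compact K" "K \<subseteq> S" "\<And>x. x \<notin> K \<Longrightarrow> \<eta> x = 0"
  shows "test_function S \<eta>"
proof -
  have sub: "{x. \<eta> x \<noteq> 0} \<subseteq> K" using assms(4) by blast
  have "closure {x. \<eta> x \<noteq> 0} \<subseteq> K"
    by (rule closure_minimal[OF sub compact_imp_closed[OF assms(2)]])
  moreover have "compact (closure {x. \<eta> x \<noteq> 0})"
    unfolding compact_closure by (rule bounded_subset[OF compact_imp_bounded[OF assms(2)] sub])
  ultimately show ?thesis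
    using assms(1,3) unfolding test_function_def smooth_def by blast
qed

lemma test_function_support:
  assumes "test_function S \<eta>"
  shows "\<exists>K. compact K \<and> K \<subseteq> S \<and> (\<forall>x. x \<notin> K \<longrightarrow> \<eta> x = 0 \<and> (\<forall>i. partial i \<eta> x = 0))"
proof -
  obtain K where K: "K = closure {x. \<eta> x \<noteq> 0}" by blast
  have "compact K" "K \<subseteq> S" using assms by (simp_all add: test_function_def K)
  have 0: "\<eta> x = 0" if "x \<notin> K" for x
    using that closure_subset[of "{x. \<eta> x \<noteq> 0}"] unfolding K by blast
  have "open (- K)" unfolding K by blast
  have "partial i \<eta> x = 0" if "x \<notin> K" for x i
  proof -
    have "(\<eta> has_derivative (\<lambda>_. 0)) (at x)"
      by (rule has_derivative_transform_within_open[OF has_derivative_const \<open>open (- K)\<close>])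
        (use that 0 in auto)
    from partial_eq[OF this] show ?thesis by simp
  qed
  with 0 \<open>compact K\<close> \<open>K \<subseteq> S\<close> show ?thesis by blast
qed

lemma test_function_smooth: "test_function S \<eta> \<Longrightarrow> smooth \<eta>"
  by (auto simp: test_function_def smooth_def)

lemma test_function_zero: "test_function S (\<lambda>x. 0)"
  by (rule test_functionI[of _ "{}"]) (auto intro: smooth_const)

lemma test_function_mult:
  assumes "test_function S \<eta>" "smooth f"
  shows "test_function S (\<lambda>x. f x * \<eta> x)"
proof -
  obtain K where K: "compact K" "K \<subseteq> S" "\<And>x. x \<notin> K \<Longrightarrow> \<eta> x = 0"
    "\<And>x i. x \<notin> K \<Longrightarrow> partial i \<eta> x = 0"
    using test_function_support[OF assms(1)] by blast
  show ?thesis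
    by (rule test_functionI[OF smooth_mult[OF assms(2) test_function_smooth[OF assms(1)]] K(1,2)])
      (simp add: K(3))
qed

lemma test_function_cmult: "test_function S \<eta> \<Longrightarrow> test_function S (\<lambda>x. b * \<eta> x)"
  by (intro test_function_mult smooth_const)

lemma test_function_add:
  assumes "test_function S \<eta>" "test_function S \<zeta>"
  shows "test_function S (\<lambda>x. \<eta> x + \<zeta> x)"
proof -
  obtain K where K: "compact K" "K \<subseteq> S" "\<And>x. x \<notin> K \<Longrightarrow> \<eta> x = 0"
    "\<And>x i. x \<notin> K \<Longrightarrow> partial i \<eta> x = 0"
    using test_function_support[OF assms(1)] by blast
  obtain L where L: "compact L" "L \<subseteq> S" "\<And>x. x \<notin> L \<Longrightarrow> \<zeta> x = 0"
    "\<And>x i. x \<notin> L \<Longrightarrow> partial i \<zeta> x = 0"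
    using test_function_support[OF assms(2)] by blast
  show ?thesis
    by (rule test_functionI[OF smooth_add compact_Un[OF K(1) L(1)]])
      (use K(2,3) L(2,3) assms in \<open>auto intro: test_function_smooth\<close>)
qed

lemma test_function_partial:
  assumes "test_function S \<eta>"
  shows "test_function S (partial i \<eta>)"
proof -
  obtain K where K: "compact K" "K \<subseteq> S" "\<And>x. x \<notin> K \<Longrightarrow> partial i \<eta> x = 0"
    using test_function_support[OF assms(1)] by blast
  show ?thesis
    by (rule test_functionI[OF smooth_partial[OF test_function_smooth[OF assms(1)]] K(1,2)])
      (simp add: K(3))
qed

section \<open>Bump functions on balls and boxes\<close>

definition ball_bump :: "real^'d \<Rightarrow> real \<Rightarrow> real^'d \<Rightarrow> real" where
  "ball_bump x0 R x = flat_exp 0 (R\<^sup>2 - (\<Sum>i\<in>UNIV. (x $ i - x0 $ i) * (x $ i - x0 $ i)))"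

text \<open>The definition expands the squared distance in coordinates, so that smoothness follows
  from that of the components; here the metric form is recovered, from which support and lower
  bounds are read off.\<close>

lemma ball_bump_eq: "ball_bump x0 R x = flat_exp 0 (R\<^sup>2 - (dist x0 x)\<^sup>2)"
proof -
  have "(dist x0 x)\<^sup>2 = (\<Sum>i\<in>UNIV. (x $ i - x0 $ i) * (x $ i - x0 $ i))"
    unfolding dist_norm power2_norm_eq_inner by (simp add: inner_vec_def algebra_simps)
  then show ?thesis by (simp add: ball_bump_def)
qed

lemma smooth_ball_bump: "smooth (ball_bump x0 R)"
  unfolding ball_bump_def
  by (intro smooth_flat_exp smooth_diff smooth_const smooth_sum smooth_mult smooth_component)

lemma test_function_ball_bump:
  assumes "cball x0 R \<subseteq> S" "R \<ge> 0"
  shows "test_function S (ball_bump x0 R)"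
proof (rule test_functionI[OF smooth_ball_bump compact_cball assms(1)])
  fix x assume "x \<notin> cball x0 R"
  then have "R\<^sup>2 \<le> (dist x0 x)\<^sup>2" using assms(2) by (intro power_mono) auto
  then show "ball_bump x0 R x = 0" unfolding ball_bump_eq by (intro flat_exp_bounds) auto
qed

lemma ball_bump_bounds: "0 \<le> ball_bump x0 R x" "ball_bump x0 R x \<le> 1"
  by (auto simp: ball_bump_def flat_exp_bounds)

lemma ball_bump_ge:
  assumes "0 \<le> r" "r < R"
  shows "\<exists>b>0. \<forall>x\<in>ball x0 r. b \<le> ball_bump x0 R x"
proof (intro exI conjI ballI)
  show "flat_exp 0 (R\<^sup>2 - r\<^sup>2) > 0" using assms by (intro flat_exp_bounds) (auto intro!: power_strict_mono)
  show "flat_exp 0 (R\<^sup>2 - r\<^sup>2) \<le> ball_bump x0 R x" if "x \<in> ball x0 r" for x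
    unfolding ball_bump_eq using that assms by (intro flat_exp_bounds) (auto intro!: power_mono)
qed

text \<open>Scaling the distances to the faces by n + 1 drives each factor inside the box to 1,
  because exp (- 1 / x) tends to 1 as x grows, while the support stays in the closed box. The result
  is a bounded sequence of test functions converging pointwise to the indicator of the open
  box.\<close>

definition box_bump :: "real^'d \<Rightarrow> real^'d \<Rightarrow> nat \<Rightarrow> real^'d \<Rightarrow> real" where
  "box_bump a b n x = (\<Prod>i\<in>UNIV. flat_exp 0 (real (Suc n) * (x $ i - a $ i)) *
     flat_exp 0 (real (Suc n) * (b $ i - x $ i)))"

lemma test_function_box_bump:
  assumes "cbox a b \<subseteq> S"
  shows "test_function S (box_bump a b n)"
proof (rule test_functionI[OF _ compact_cbox assms])
  show "smooth (box_bump a b n)"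
    unfolding box_bump_def
    by (intro smooth_prod smooth_mult smooth_flat_exp smooth_diff smooth_const smooth_component)
  fix x assume "x \<notin> cbox a b"
  then obtain i where "x $ i < a $ i \<or> b $ i < x $ i"
    by (auto simp: mem_box_cart not_le)
  then have "flat_exp 0 (real (Suc n) * (x $ i - a $ i)) * flat_exp 0 (real (Suc n) * (b $ i - x $ i)) = 0"
    by (auto simp: flat_exp_bounds mult_le_0_iff)
  then show "box_bump a b n x = 0" unfolding box_bump_def by (intro prod_zero) auto
qed

lemma box_bump_bounds: "0 \<le> box_bump a b n x" "box_bump a b n x \<le> 1"
  unfolding box_bump_def
  by (auto intro!: prod_nonneg prod_le_1 mult_le_one simp: flat_exp_bounds)

lemma flat_exp_tendsto_one:
  assumes "x > 0"
  shows "(\<lambda>n. flat_exp 0 (real (Suc n) * x)) \<longlonglongrightarrow> 1"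
proof -
  have "(\<lambda>n. exp (- (inverse (real (Suc n)) * inverse x))) \<longlonglongrightarrow> exp (- (0 * inverse x))"
    by (intro tendsto_intros LIMSEQ_inverse_real_of_nat)
  moreover have "flat_exp 0 (real (Suc n) * x) = exp (- (inverse (real (Suc n)) * inverse x))" for n
    using assms by (simp add: flat_exp_def)
  ultimately show ?thesis by simp
qed

lemma box_bump_tendsto: "(\<lambda>n. box_bump a b n x) \<longlonglongrightarrow> indicator (box a b) x"
proof (cases "x \<in> box a b")
  case True
  then have "(\<lambda>n. box_bump a b n x) \<longlonglongrightarrow> (\<Prod>i\<in>(UNIV::'a set). 1 * 1)"
    unfolding box_bump_def
    by (intro tendsto_prod tendsto_mult flat_exp_tendsto_one) (auto simp: mem_box_cart)
  with True show ?thesis by simp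
next
  case False
  have "box_bump a b n x = 0" for n
  proof -
    obtain i where "x $ i \<le> a $ i \<or> b $ i \<le> x $ i" using False by (auto simp: mem_box_cart not_less)
    then have "flat_exp 0 (real (Suc n) * (x $ i - a $ i)) * flat_exp 0 (real (Suc n) * (b $ i - x $ i)) = 0"
      by (auto simp: flat_exp_bounds mult_le_0_iff)
    then show ?thesis unfolding box_bump_def by (intro prod_zero) auto
  qed
  with False show ?thesis by simp
qed

subsection \<open>Integrals of compactly supported functions\<close>

lemma integrable_continuous_compact:
  fixes f :: "'a::euclidean_space \<Rightarrow> real"
  assumes "continuous_on UNIV f" "compact K" "\<And>x. x \<notin> K \<Longrightarrow> f x = 0"
  shows "integrable lborel f"
proof -
  have "integrable lborel (\<lambda>x. indicator K x *\<^sub>R f x)"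
    using assms by (intro borel_integrable_compact) (auto intro: continuous_on_subset)
  moreover have "(\<lambda>x. indicator K x *\<^sub>R f x) = f"
    using assms(3) by (intro ext) (auto simp: indicator_def)
  ultimately show ?thesis by simp
qed

lemma bounded_continuous_compact:
  fixes f :: "'a::euclidean_space \<Rightarrow> real"
  assumes "continuous_on K f" "compact K"
  obtains M where "M > 0" "\<And>x. x \<in> K \<Longrightarrow> \<bar>f x\<bar> \<le> M"
proof -
  have "bounded (f ` K)" using assms by (intro compact_imp_bounded compact_continuous_image)
  then show ?thesis using that by (auto simp: bounded_pos)
qed

section \<open>Translation invariance and integration by parts\<close>

lemma lborel_integral_shift:
  fixes f :: "'a::euclidean_space \<Rightarrow> real"
  assumes [measurable]: "f \<in> borel_measurable borel"
  shows "(LINT x|lborel. f (c + x)) = (LINT x|lborel. f x)"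
proof -
  have "(LINT x|lborel. f x) = (LINT x|distr lborel borel ((+) c). f x)"
    by (simp add: lborel_distr_plus)
  also have "\<dots> = (LINT x|lborel. f (c + x))"
    by (subst integral_distr) auto
  finally show ?thesis by simp
qed

lemma lborel_integral_reflect:
  fixes f :: "'a::euclidean_space \<Rightarrow> real"
  assumes [measurable]: "f \<in> borel_measurable borel"
  shows "(LINT x|lborel. f (c - x)) = (LINT x|lborel. f x)"
proof -
  have "(lborel::'a measure) = distr lborel borel (\<lambda>x. c - x)"
    using lborel_affine[of "-1" c] by (simp add: density_1)
  then have "(LINT x|lborel. f x) = (LINT x|distr lborel borel (\<lambda>x. c - x). f x)"
    by simp
  also have "\<dots> = (LINT x|lborel. f (c - x))"
    by (subst integral_distr) auto
  finally show ?thesis by simp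
qed

text \<open>The coefficients \<open>a i j\<close> are only C^1, so their products with test
  functions need not be test functions; extended by zero they belong to this class.\<close>

definition C1_fun :: "(real^'d \<Rightarrow> real) \<Rightarrow> bool" where
  "C1_fun f \<longleftrightarrow> (\<forall>x. f differentiable (at x)) \<and> (\<forall>i. continuous_on UNIV (partial i f))"

lemma C1_fun_continuous: "C1_fun f \<Longrightarrow> continuous_on S f"
  unfolding C1_fun_def
  by (meson continuous_at_imp_continuous_on differentiable_imp_continuous_within)

lemma smooth_imp_C1: "smooth f \<Longrightarrow> C1_fun f"
  unfolding C1_fun_def by (simp add: smooth_differentiable smooth_continuous smooth_partial)

lemma partial_zero_outside:
  assumes "compact K" "\<And>x. x \<notin> K \<Longrightarrow> f x = 0" "x \<notin> K"
  shows "partial i f x = 0"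
proof -
  have "open (- K)" using assms(1) by (simp add: compact_imp_closed open_Compl)
  then have "(f has_derivative (\<lambda>_. 0)) (at x)"
    by (rule has_derivative_transform_within_open[OF has_derivative_const])
      (use assms in auto)
  from partial_eq[OF this] show ?thesis by simp
qed

lemma partial_line_derivative:
  assumes "\<And>x. f differentiable (at x)"
  shows "((\<lambda>t. f (x + t *\<^sub>R axis i 1)) has_real_derivative partial i f (x + t *\<^sub>R axis i 1)) (at t)"
proof -
  let ?g = "\<lambda>t. x + t *\<^sub>R axis i 1"
  have g: "(?g has_derivative (\<lambda>h. h *\<^sub>R axis i 1)) (at t)"
    by (auto intro!: derivative_eq_intros)
  have "((\<lambda>t. f (?g t)) has_derivative (\<lambda>h. \<Sum>j\<in>UNIV. (h *\<^sub>R axis i 1) $ j * partial j f (?g t))) (at t)"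
    by (rule has_derivative_compose[OF g has_derivative_partial[OF assms]])
  moreover have "(\<Sum>j\<in>UNIV. (h *\<^sub>R axis i 1) $ j * partial j f (?g t)) = partial i f (?g t) * h" for h
  proof -
    have "(\<Sum>j\<in>UNIV. (h *\<^sub>R axis i 1) $ j * partial j f (?g t)) =
        (\<Sum>j\<in>UNIV. if j = i then partial i f (?g t) * h else 0)"
      by (intro sum.cong) (auto simp: axis_def)
    then show ?thesis by simp
  qed
  ultimately show ?thesis by (simp add: has_field_derivative_def)
qed

text \<open>Difference quotients have integral zero by translation invariance.\<close>

lemma integral_partial_zero:
  fixes f :: "real^'d \<Rightarrow> real"
  assumes f: "C1_fun f" and K: "compact K" and zero: "\<And>x. x \<notin> K \<Longrightarrow> f x = 0"
  shows "(LINT x|lborel. partial i f x) = 0"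
proof -
  let ?e = "axis i 1 :: real^'d"
  define q where "q n x = (f (x + inverse (real (Suc n)) *\<^sub>R ?e) - f x) / inverse (real (Suc n))" for n x
  have diff: "f differentiable (at x)" for x using f by (simp add: C1_fun_def)
  have cont: "continuous_on UNIV (partial i f)" using f by (simp add: C1_fun_def)
  have fm[measurable]: "f \<in> borel_measurable borel"
    by (intro borel_measurable_continuous_onI C1_fun_continuous f)
  have pm[measurable]: "partial i f \<in> borel_measurable borel"
    by (intro borel_measurable_continuous_onI cont)
  have fint: "integrable lborel f"
    by (rule integrable_continuous_compact[OF C1_fun_continuous[OF f] K zero])
  have q_int: "(LINT x|lborel. q n x) = 0" for n
  proof -
    let ?c = "inverse (real (Suc n)) *\<^sub>R ?e"
    have "(LINT x|lborel. f (?c + x)) = (LINT x|lborel. f x)"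
      by (rule lborel_integral_shift) simp
    moreover have "integrable lborel (\<lambda>x. f (?c + x))"
    proof -
      have "integrable (distr lborel borel ((+) ?c)) f" using fint by (simp add: lborel_distr_plus)
      then show ?thesis by (subst (asm) integrable_distr_eq) auto
    qed
    ultimately show ?thesis
      unfolding q_def using fint by (simp add: add.commute)
  qed
  obtain R where R: "\<And>x. x \<in> K \<Longrightarrow> norm x \<le> R"
    using compact_imp_bounded[OF K] by (auto simp: bounded_iff)
  \<comment> \<open>The increments \<open>inverse (real (Suc n))\<close> are at most 1, so every
    difference quotient vanishes outside this ball; together with the mean value theorem this yields
    an integrable majorant.\<close>
  let ?L = "cball (0::real^'d) (R + 1)"
  obtain M where M: "M > 0" "\<And>x. x \<in> ?L \<Longrightarrow> \<bar>partial i f x\<bar> \<le> M"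
    using bounded_continuous_compact[OF continuous_on_subset[OF cont subset_UNIV] compact_cball] by blast
  have pM: "\<bar>partial i f x\<bar> \<le> M" for x
  proof (cases "x \<in> K")
    case True then show ?thesis using R[OF True] by (intro M) auto
  qed (use partial_zero_outside[OF K zero, where x = x and i = i] M in auto)
  have bound: "\<bar>q n x\<bar> \<le> M * indicator ?L x" for n x
  proof (cases "x \<in> ?L")
    case True
    let ?h = "inverse (real (Suc n))"
    have h: "?h > 0" by simp
    have "\<exists>z. z > 0 \<and> z < ?h \<and> f (x + ?h *\<^sub>R ?e) - f (x + 0 *\<^sub>R ?e) = (?h - 0) * partial i f (x + z *\<^sub>R ?e)"
      using partial_line_derivative[OF diff] by (intro MVT2) auto
    then obtain z where z: "f (x + ?h *\<^sub>R ?e) - f x = ?h * partial i f (x + z *\<^sub>R ?e)" by auto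
    have "q n x = partial i f (x + z *\<^sub>R ?e)" unfolding q_def z by simp
    then show ?thesis using pM True by simp
  next
    case False
    then have x: "norm x > R + 1" by simp
    have "norm (x + inverse (real (Suc n)) *\<^sub>R ?e) \<ge> norm x - norm (inverse (real (Suc n)) *\<^sub>R ?e)"
      by (rule norm_diff_ineq)
    moreover have "norm (inverse (real (Suc n)) *\<^sub>R ?e) \<le> 1"
      by (simp add: norm_axis_1 inverse_le_1_iff)
    ultimately have "f (x + inverse (real (Suc n)) *\<^sub>R ?e) = 0" "f x = 0"
      using R x zero by (smt (verit))+
    then show ?thesis using False by (simp add: q_def)
  qed
  have "(\<lambda>n. LINT x|lborel. q n x) \<longlonglongrightarrow> (LINT x|lborel. partial i f x)"
  proof (rule integral_dominated_convergence)
    show "integrable lborel (\<lambda>x. M * indicator ?L x)"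
      by (auto intro!: integrable_mult_right emeasure_compact_finite)
    show "AE x in lborel. (\<lambda>n. q n x) \<longlonglongrightarrow> partial i f x"
    proof (rule AE_I2)
      fix x
      have "((\<lambda>h. (f (x + (0 + h) *\<^sub>R ?e) - f (x + 0 *\<^sub>R ?e)) / h) \<longlongrightarrow> partial i f (x + 0 *\<^sub>R ?e)) (at 0)"
        using partial_line_derivative[OF diff, of x i 0] unfolding DERIV_def .
      then have "((\<lambda>h. (f (x + h *\<^sub>R ?e) - f x) / h) \<longlongrightarrow> partial i f x) (at 0)" by simp
      moreover have "filterlim (\<lambda>n. inverse (real (Suc n))) (at 0) sequentially"
        unfolding filterlim_at using LIMSEQ_inverse_real_of_nat by auto
      ultimately show "(\<lambda>n. q n x) \<longlonglongrightarrow> partial i f x"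
        unfolding q_def by (rule filterlim_compose)
    qed
  qed (use bound in \<open>auto simp: q_def\<close>)
  with q_int show ?thesis by (simp add: LIMSEQ_const_iff)
qed

lemma C1_fun_mult:
  assumes "C1_fun f" "C1_fun g" shows "C1_fun (\<lambda>x. f x * g x)"
proof -
  have "partial i (\<lambda>x. f x * g x) = (\<lambda>x. f x * partial i g x + partial i f x * g x)" for i
    by (intro ext partial_mult) (use assms in \<open>auto simp: C1_fun_def\<close>)
  then show ?thesis
    using assms C1_fun_continuous[of f] C1_fun_continuous[of g]
    by (auto simp: C1_fun_def intro!: continuous_intros)
qed

lemma integral_by_parts:
  fixes f g :: "real^'d \<Rightarrow> real"
  assumes f: "C1_fun f" and g: "C1_fun g" and K: "compact K" and zero: "\<And>x. x \<notin> K \<Longrightarrow> f x = 0"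
  shows "(LINT x|lborel. f x * partial i g x) = - (LINT x|lborel. partial i f x * g x)"
proof -
  have "(LINT x|lborel. partial i (\<lambda>x. f x * g x) x) = 0"
    by (rule integral_partial_zero[OF C1_fun_mult[OF f g] K]) (simp add: zero)
  moreover have "partial i (\<lambda>x. f x * g x) = (\<lambda>x. f x * partial i g x + partial i f x * g x)"
    by (intro ext partial_mult) (use f g in \<open>auto simp: C1_fun_def\<close>)
  moreover have "integrable lborel (\<lambda>x. f x * partial i g x)" "integrable lborel (\<lambda>x. partial i f x * g x)"
    using f g C1_fun_continuous[OF f] C1_fun_continuous[OF g] partial_zero_outside[OF K zero]
    by (auto intro!: integrable_continuous_compact[OF _ K] continuous_intros simp: C1_fun_def zero)
  ultimately show ?thesis by simp
qed

subsection \<open>Mollification\<close>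

definition conv :: "(real^'d \<Rightarrow> real) \<Rightarrow> (real^'d \<Rightarrow> real) \<Rightarrow> real^'d \<Rightarrow> real" where
  "conv \<rho> f x = (LINT y|lborel. f y * \<rho> (x - y))"

text \<open>Differentiation falls on the kernel, so the convolution inherits the smoothness of
  \<rho> even where f is merely continuous.\<close>

lemma conv_derivative:
  fixes f :: "real^'d \<Rightarrow> real"
  assumes \<rho>: "C1_fun \<rho>" and f: "continuous_on UNIV f" and K: "compact K" "\<And>x. x \<notin> K \<Longrightarrow> f x = 0"
  shows "conv \<rho> f differentiable (at x)" "partial i (conv \<rho> f) = conv (partial i \<rho>) f"
proof -
  obtain a b where ab: "K \<subseteq> cbox a b" using bounded_subset_cbox_symmetric[OF compact_imp_bounded[OF K(1)]] by blast
  have conv_eq: "conv \<sigma> f x = integral (cbox a b) (\<lambda>y. f y * \<sigma> (x - y))" if "continuous_on UNIV \<sigma>" for \<sigma> x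
  proof -
    have c: "continuous_on UNIV (\<lambda>y. f y * \<sigma> (x - y))"
      using that f by (auto intro!: continuous_intros continuous_on_compose2[OF that])
    have "conv \<sigma> f x = (LINT y : cbox a b | lborel. f y * \<sigma> (x - y))"
      unfolding conv_def set_lebesgue_integral_def
      using ab K(2) by (intro Bochner_Integration.integral_cong) (auto simp: indicator_def)
    also have "\<dots> = integral (cbox a b) (\<lambda>y. f y * \<sigma> (x - y))"
      unfolding set_integrable_def
      by (intro set_borel_integral_eq_integral, unfold set_integrable_def)
        (rule borel_integrable_compact[OF compact_cbox continuous_on_subset[OF c subset_UNIV]])
    finally show ?thesis .
  qed
  \<comment> \<open>The x-derivative of the integrand as a bounded linear functional, the form in
    which the Leibniz rule over a box takes it.\<close>
  define D where "D x y = (f y) *\<^sub>R (\<Sum>j\<in>UNIV. partial j \<rho> (x - y) *\<^sub>R blinfun_inner_right (axis j (1::real)))" for x y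
  have D: "blinfun_apply (D x y) h = f y * (\<Sum>j\<in>UNIV. h $ j * partial j \<rho> (x - y))" for x y h
    by (simp add: D_def blinfun.bilinear_simps inner_axis' sum_distrib_left mult.commute)
  have pc: "continuous_on UNIV (partial j \<rho>)" for j using \<rho> by (simp add: C1_fun_def)
  have der: "((\<lambda>x. integral (cbox a b) (\<lambda>y. f y * \<rho> (x - y))) has_derivative
      integral (cbox a b) (D x)) (at x within UNIV)" for x
  proof (rule leibniz_rule)
    fix x y
    have "((\<lambda>x. \<rho> (x - y)) has_derivative (\<lambda>h. \<Sum>j\<in>UNIV. h $ j * partial j \<rho> (x - y))) (at x)"
      by (rule has_derivative_compose[of "\<lambda>x. x - y" "\<lambda>h. h" x UNIV \<rho>, OF _ has_derivative_partial])
        (use \<rho> in \<open>auto simp: C1_fun_def intro!: derivative_eq_intros\<close>)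
    then show "((\<lambda>x. f y * \<rho> (x - y)) has_derivative blinfun_apply (D x y)) (at x within UNIV)"
      unfolding D[abs_def] D by (intro has_derivative_mult_right)
  next
    show "continuous_on (UNIV \<times> cbox a b) (\<lambda>(x, t). D x t)"
      unfolding D_def split_beta
      by (intro continuous_intros continuous_on_compose2[OF pc] continuous_on_compose2[OF f]) auto
    show "(\<lambda>y. f y * \<rho> (x - y)) integrable_on cbox a b" for x
      by (intro integrable_continuous continuous_intros continuous_on_compose2[OF f]
          continuous_on_compose2[OF C1_fun_continuous[OF \<rho>]]) auto
  qed auto
  have c\<rho>: "conv \<rho> f = (\<lambda>x. integral (cbox a b) (\<lambda>y. f y * \<rho> (x - y)))"
    by (rule ext) (rule conv_eq[OF C1_fun_continuous[OF \<rho>]])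
  show "conv \<rho> f differentiable (at x)"
    using der[of x] unfolding c\<rho> differentiable_def by blast
  have Dint: "D x integrable_on cbox a b" for x
    unfolding D_def[abs_def]
    by (intro integrable_continuous continuous_intros continuous_on_compose2[OF f]
          continuous_on_compose2[OF pc]) auto
  show "partial i (conv \<rho> f) = conv (partial i \<rho>) f"
  proof
    fix x
    have "partial i (conv \<rho> f) x = blinfun_apply (integral (cbox a b) (D x)) (axis i 1)"
      using partial_eq der[of x] unfolding c\<rho> by blast
    also have "\<dots> = integral (cbox a b) (\<lambda>y. blinfun_apply (D x y) (axis i 1))"
      by (rule blinfun_apply_integral[OF Dint])
    also have "(\<lambda>y. blinfun_apply (D x y) (axis i 1)) = (\<lambda>y. f y * partial i \<rho> (x - y))"
    proof
      fix y
      have "(\<Sum>j\<in>UNIV. axis i 1 $ j * partial j \<rho> (x - y)) =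
        (\<Sum>j\<in>UNIV. if j = i then partial i \<rho> (x - y) else 0)"
        by (intro sum.cong) (auto simp: axis_def)
      then show "blinfun_apply (D x y) (axis i 1) = f y * partial i \<rho> (x - y)" unfolding D by simp
    qed
    finally show "partial i (conv \<rho> f) x = conv (partial i \<rho>) f x"
      by (simp add: conv_eq[OF pc])
  qed
qed

lemma smooth_conv:
  assumes \<rho>: "smooth \<rho>" and f: "continuous_on UNIV f" and K: "compact K" "\<And>x. x \<notin> K \<Longrightarrow> f x = 0"
  shows "smooth (conv \<rho> f)"
proof -
  have "Ck k UNIV (conv \<rho> f)" if "smooth \<rho>" for k \<rho>
    using that
  proof (induction k arbitrary: \<rho>)
    case 0
    have "continuous_on UNIV (conv \<rho> f)"
      using conv_derivative(1)[OF smooth_imp_C1[OF 0] f K]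
      by (auto simp: differentiable_on_def intro!: differentiable_imp_continuous_on)
    then show ?case by simp
  next
    case (Suc k)
    show ?case
      using conv_derivative[OF smooth_imp_C1[OF Suc.prems] f K] Suc.IH smooth_partial[OF Suc.prems]
      by simp
  qed
  with \<rho> show ?thesis by (simp add: smooth_def)
qed

text \<open>Integration by parts moves the derivative from the kernel to f. In this form the
  derivatives of a mollified function are mollifications themselves, so their convergence and bounds
  come from the same facts as those of the function.\<close>

lemma conv_partial:
  assumes \<rho>: "C1_fun \<rho>" and f: "C1_fun f" and K: "compact K" "\<And>x. x \<notin> K \<Longrightarrow> f x = 0"
  shows "partial i (conv \<rho> f) = conv \<rho> (partial i f)"
proof
  fix x
  have d: "\<rho> differentiable (at x)" for x using \<rho> by (simp add: C1_fun_def)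
  have g: "((\<lambda>y. \<rho> (x - y)) has_derivative (\<lambda>h. \<Sum>j\<in>UNIV. (- h) $ j * partial j \<rho> (x - y))) (at y)" for y
    by (rule has_derivative_compose[of "\<lambda>y. x - y" "\<lambda>h. - h" y UNIV \<rho>, OF _ has_derivative_partial[OF d]])
      (auto intro!: derivative_eq_intros)
  have p: "partial j (\<lambda>y. \<rho> (x - y)) = (\<lambda>y. - partial j \<rho> (x - y))" for j
  proof
    fix y
    have "partial j (\<lambda>y. \<rho> (x - y)) y = (\<Sum>k\<in>UNIV. (- axis j 1) $ k * partial k \<rho> (x - y))"
      by (rule partial_eq[OF g])
    also have "\<dots> = (\<Sum>k\<in>UNIV. if k = j then - partial j \<rho> (x - y) else 0)"
      by (intro sum.cong) (auto simp: axis_def)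
    finally show "partial j (\<lambda>y. \<rho> (x - y)) y = - partial j \<rho> (x - y)" by simp
  qed
  have "C1_fun (\<lambda>y. \<rho> (x - y))"
    unfolding C1_fun_def p
  proof (intro conjI allI)
    show "(\<lambda>y. \<rho> (x - y)) differentiable (at y)" for y
      using g[of y] unfolding differentiable_def by blast
    have "continuous_on UNIV (partial i \<rho>)" for i using \<rho> by (simp add: C1_fun_def)
    note pc = this
    show "continuous_on UNIV (\<lambda>y. - partial i \<rho> (x - y))" for i
      by (rule continuous_on_minus, rule continuous_on_compose2[OF pc])
        (auto intro!: continuous_intros)
  qed
  from integral_by_parts[OF f this K, of i]
  have "(LINT y|lborel. f y * partial i \<rho> (x - y)) = (LINT y|lborel. partial i f y * \<rho> (x - y))"
    unfolding p by simp
  moreover have "partial i (conv \<rho> f) = conv (partial i \<rho>) f"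
    by (rule conv_derivative(2)[OF \<rho> C1_fun_continuous[OF f] K])
  ultimately show "partial i (conv \<rho> f) x = conv \<rho> (partial i f) x"
    unfolding conv_def by simp
qed

definition mollifier :: "real \<Rightarrow> (real^'d \<Rightarrow> real) \<Rightarrow> bool" where
  "mollifier r \<rho> \<longleftrightarrow> smooth \<rho> \<and> (\<forall>x. \<rho> x \<ge> 0) \<and> (\<forall>x. norm x \<ge> r \<longrightarrow> \<rho> x = 0) \<and>
     (LINT x|lborel. \<rho> x) = 1"

lemma mollifier_exists:
  assumes "r > 0"
  shows "\<exists>\<rho> :: real^'d \<Rightarrow> real. mollifier r \<rho>"
proof -
  let ?f = "ball_bump 0 r :: real^'d \<Rightarrow> real"
  have 0: "?f x = 0" if "norm x \<ge> r" for x
    using that assms unfolding ball_bump_eq by (intro flat_exp_bounds) (auto intro!: power_mono)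
  have int: "integrable lborel ?f"
    by (rule integrable_continuous_compact[OF smooth_continuous[OF smooth_ball_bump] compact_cball[of 0 r]])
      (use 0 in auto)
  have "\<exists>b>0. \<forall>x\<in>ball 0 (r / 2). b \<le> ?f x"
    by (rule ball_bump_ge) (use assms in auto)
  then obtain b where b: "b > 0" "\<And>x. x \<in> ball 0 (r / 2) \<Longrightarrow> b \<le> ?f x"
    by blast
  have "0 < b * measure lborel (ball (0::real^'d) (r / 2))"
    using b assms content_ball_pos[of "r/2" "0::real^'d"] by simp
  also have "\<dots> = (LINT x|lborel. b * indicator (ball (0::real^'d) (r / 2)) x)"
    by simp
  also have "\<dots> \<le> (LINT x|lborel. ?f x)"
  proof (rule integral_mono[OF _ int])
    show "integrable lborel (\<lambda>x. b * indicator (ball (0::real^'d) (r / 2)) x)"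
      by (intro integrable_mult_right integrable_real_indicator emeasure_bounded_finite) auto
    show "b * indicator (ball (0::real^'d) (r / 2)) x \<le> ?f x" for x
      using b(2)[of x] ball_bump_bounds(1)[of 0 r x] by (cases "x \<in> ball 0 (r / 2)") auto
  qed
  finally have pos: "(LINT x|lborel. ?f x) > 0" .
  have "smooth (\<lambda>x. inverse (LINT x|lborel. ?f x) * ?f x)"
    by (intro smooth_mult smooth_const smooth_ball_bump)
  then have "mollifier r (\<lambda>x. inverse (LINT x|lborel. ?f x) * ?f x)"
    using pos 0 ball_bump_bounds(1)[of 0 r]
    by (auto simp: mollifier_def intro!: mult_nonneg_nonneg)
  then show ?thesis by blast
qed

text \<open>\<open>conv \<rho> g x\<close> is a weighted mean of the values of g at distance less
  than r from x. Convergence, uniform bounds and vanishing far from the support are all instances,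
  for different choices of b and e.\<close>

lemma conv_close:
  fixes g :: "real^'d \<Rightarrow> real"
  assumes m: "mollifier r \<rho>"
    and g: "continuous_on UNIV g" and close: "\<And>y. dist x y < r \<Longrightarrow> \<bar>g y - b\<bar> \<le> e"
  shows "\<bar>conv \<rho> g x - b\<bar> \<le> e"
proof -
  have \<rho>: "smooth \<rho>" "\<And>x. \<rho> x \<ge> 0" "\<And>x. norm x \<ge> r \<Longrightarrow> \<rho> x = 0" "(LINT x|lborel. \<rho> x) = 1"
    using m by (simp_all add: mollifier_def)
  have c: "continuous_on UNIV (\<lambda>y. \<rho> (x - y))"
    by (rule continuous_on_compose2[OF smooth_continuous[OF \<rho>(1), of UNIV]]) (auto intro!: continuous_intros)
  have z: "\<rho> (x - y) = 0" if "y \<notin> cball x r" for y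
    using that by (intro \<rho>(3)) (auto simp: dist_norm)
  have [measurable]: "\<rho> \<in> borel_measurable borel"
    by (intro borel_measurable_continuous_onI smooth_continuous \<rho>)
  have one: "(LINT y|lborel. \<rho> (x - y)) = 1"
    using lborel_integral_reflect[of \<rho> x] \<rho>(4) by simp
  have i1: "integrable lborel (\<lambda>y. \<rho> (x - y))"
    by (rule integrable_continuous_compact[OF c compact_cball z])
  have i2: "integrable lborel (\<lambda>y. g y * \<rho> (x - y))"
    by (rule integrable_continuous_compact[OF continuous_on_mult[OF g c] compact_cball[of x r]]) (simp add: z)
  have "conv \<rho> g x - b = (LINT y|lborel. g y * \<rho> (x - y) - b * \<rho> (x - y))"
    unfolding conv_def using i1 i2 one by simp
  also have "\<bar>\<dots>\<bar> \<le> (LINT y|lborel. e * \<rho> (x - y))"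
  proof (rule integral_abs_bound[THEN order_trans], rule integral_mono)
    show "integrable lborel (\<lambda>y. \<bar>g y * \<rho> (x - y) - b * \<rho> (x - y)\<bar>)" using i1 i2 by simp
    show "integrable lborel (\<lambda>y. e * \<rho> (x - y))" using i1 by simp
    show "\<bar>g y * \<rho> (x - y) - b * \<rho> (x - y)\<bar> \<le> e * \<rho> (x - y)" for y
    proof (cases "dist x y < r")
      case True
      have "\<bar>g y * \<rho> (x - y) - b * \<rho> (x - y)\<bar> = \<bar>g y - b\<bar> * \<rho> (x - y)"
        using \<rho>(2)[of "x - y"] by (simp add: left_diff_distrib[symmetric] abs_mult)
      then show ?thesis using close[OF True] \<rho>(2)[of "x - y"] by (simp add: mult_right_mono)
    next
      case False
      then have "\<rho> (x - y) = 0" by (intro \<rho>(3)) (simp add: dist_norm)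
      then show ?thesis by simp
    qed
  qed
  also have "\<dots> = e" using one by simp
  finally show ?thesis .
qed

text \<open>What dominated convergence against a locally integrable function asks for: a common
  compact support, a common bound and pointwise convergence, for the functions and for their first
  partial derivatives.\<close>

definition C1_approximants :: "(real^'d) set \<Rightarrow> (real^'d \<Rightarrow> real) \<Rightarrow> (nat \<Rightarrow> real^'d \<Rightarrow> real) \<Rightarrow>
    (real^'d) set \<Rightarrow> real \<Rightarrow> bool" where
  "C1_approximants S f F K M \<longleftrightarrow> compact K \<and> K \<subseteq> S \<and> (\<forall>n. smooth (F n)) \<and>
     (\<forall>n. \<forall>x. x \<notin> K \<longrightarrow> F n x = 0) \<and> (\<forall>n i. \<forall>x. x \<notin> K \<longrightarrow> partial i (F n) x = 0) \<and>
     (\<forall>x. (\<lambda>n. F n x) \<longlonglongrightarrow> f x) \<and> (\<forall>i x. (\<lambda>n. partial i (F n) x) \<longlonglongrightarrow> partial i f x) \<and>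
     (\<forall>n x. \<bar>F n x\<bar> \<le> M) \<and> (\<forall>n i x. \<bar>partial i (F n) x\<bar> \<le> M)"

lemma C1_approx:
  fixes f :: "real^'d \<Rightarrow> real"
  assumes f: "C1_fun f" and K: "compact K" "K \<subseteq> S" "open S" and zero: "\<And>x. x \<notin> K \<Longrightarrow> f x = 0"
  shows "\<exists>F K' M. C1_approximants S f F K' M"
proof -
  obtain e where e: "e > 0" "(\<Union>x\<in>K. ball x e) \<subseteq> S"
    using compact_subset_open_imp_ball_epsilon_subset[OF K(1,3,2)] by blast
  \<comment> \<open>Radii of at most e / 2 keep all supports in the closed e / 2 neighbourhood
    \<open>K'\<close> of K, which is compact and still contained in S.\<close>
  define r where "r n = e / 2 / real (Suc n)" for n
  have r: "r n > 0" "r n \<le> e / 2" for n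
    using e(1) by (auto simp: r_def divide_simps)
  have "\<forall>n. \<exists>\<rho>::real^'d \<Rightarrow> real. mollifier (r n) \<rho>"
    using mollifier_exists[OF r(1)] by blast
  then obtain \<rho> :: "nat \<Rightarrow> real^'d \<Rightarrow> real" where "\<forall>n. mollifier (r n) (\<rho> n)"
    by (rule choice[THEN exE]) blast
  then have \<rho>: "\<And>n. mollifier (r n) (\<rho> n)" "\<And>n. smooth (\<rho> n)" by (auto simp: mollifier_def)
  have close: "\<bar>conv (\<rho> n) g x - b\<bar> \<le> d" if "continuous_on UNIV g" "\<And>y. dist x y < r n \<Longrightarrow> \<bar>g y - b\<bar> \<le> d"
    for g x b d n
    by (rule conv_close[OF \<rho>(1) that])
  define K' where "K' = {x + y |x y. x \<in> K \<and> y \<in> cball 0 (e / 2)}"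
  have K'c: "compact K'" unfolding K'_def by (intro compact_sums K compact_cball)
  have K'S: "K' \<subseteq> S"
  proof
    fix z assume "z \<in> K'"
    then obtain x y where "z = x + y" "x \<in> K" "norm y \<le> e / 2" by (auto simp: K'_def)
    then have "z \<in> ball x e" using e(1) by (simp add: dist_norm)
    with e(2) \<open>x \<in> K\<close> show "z \<in> S" by blast
  qed
  have far: "y \<notin> K" if "x \<notin> K'" "dist x y < r n" for x y n
  proof
    assume "y \<in> K"
    moreover have "x - y \<in> cball 0 (e / 2)" using that(2) r(2)[of n] by (simp add: dist_norm norm_minus_commute)
    moreover have "x = y + (x - y)" by simp
    ultimately have "x \<in> K'" unfolding K'_def by blast
    with that show False by simp
  qed
  have czero: "conv (\<rho> n) g x = 0" if "continuous_on UNIV g" "\<And>x. x \<notin> K \<Longrightarrow> g x = 0" "x \<notin> K'" for g x n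
    using close[OF that(1), of x n 0 0] far[OF that(3)] that(2) by simp
  have clim: "(\<lambda>n. conv (\<rho> n) g x) \<longlonglongrightarrow> g x" if g: "continuous_on UNIV g" for g x
    unfolding tendsto_iff
  proof safe
    fix d :: real assume d: "d > 0"
    have "isCont g x" using g by (simp add: continuous_on_eq_continuous_at)
    then obtain s where s: "s > 0" "\<And>y. dist y x < s \<Longrightarrow> dist (g y) (g x) < d / 2"
      using half_gt_zero[OF d] unfolding continuous_at_eps_delta by blast
    have "(\<lambda>n. e / 2 * inverse (real (Suc n))) \<longlonglongrightarrow> e / 2 * 0"
      by (intro tendsto_intros LIMSEQ_inverse_real_of_nat)
    moreover have "r = (\<lambda>n. e / 2 * inverse (real (Suc n)))"
      by (intro ext) (simp only: r_def divide_inverse)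
    ultimately have "r \<longlonglongrightarrow> 0" by simp
    then have "\<forall>\<^sub>F n in sequentially. r n < s" by (rule order_tendstoD(2)[OF _ s(1)])
    then show "\<forall>\<^sub>F n in sequentially. dist (conv (\<rho> n) g x) (g x) < d"
    proof eventually_elim
      case (elim n)
      have "\<bar>conv (\<rho> n) g x - g x\<bar> \<le> d / 2"
      proof (rule close[OF g])
        show "\<bar>g y - g x\<bar> \<le> d / 2" if "dist x y < r n" for y
          using s(2)[of y] that elim by (simp add: dist_commute dist_real_def abs_minus_commute)
      qed
      then show ?case using d by (simp add: dist_real_def)
    qed
  qed
  have cb: "\<bar>conv (\<rho> n) g x\<bar> \<le> B" if "continuous_on UNIV g" "\<And>x. \<bar>g x\<bar> \<le> B" for g x n B
    using close[OF that(1), of x n 0 B] that(2) by simp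
  have pc: "continuous_on UNIV (partial i f)" for i using f by (simp add: C1_fun_def)
  have pz: "partial i f x = 0" if "x \<notin> K" for i x by (rule partial_zero_outside[OF K(1) zero that])
  have cf: "continuous_on UNIV f" by (rule C1_fun_continuous[OF f])
  have bd: "\<exists>B. \<forall>x. \<bar>g x\<bar> \<le> B" if gc: "continuous_on UNIV g" and gz: "\<And>x. x \<notin> K \<Longrightarrow> g x = 0" for g :: "real^'d \<Rightarrow> real"
  proof -
    obtain B where B: "B > 0" "\<And>x. x \<in> K \<Longrightarrow> \<bar>g x\<bar> \<le> B"
      using bounded_continuous_compact[OF continuous_on_subset[OF gc subset_UNIV] K(1)] by blast
    have "\<bar>g x\<bar> \<le> B" for x using B gz[of x] by (cases "x \<in> K") auto
    then show ?thesis by blast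
  qed
  obtain B0 where B0: "\<And>x. \<bar>f x\<bar> \<le> B0" using bd[OF cf zero] by blast
  have "\<exists>B. \<forall>x. \<bar>partial i f x\<bar> \<le> B" for i by (rule bd[OF pc pz])
  then obtain B where "\<forall>i. \<forall>x. \<bar>partial i f x\<bar> \<le> B i" using choice[of "\<lambda>i b. \<forall>x. \<bar>partial i f x\<bar> \<le> b"] by blast
  then have B: "\<bar>partial i f x\<bar> \<le> B i" for i x by blast
  define M where "M = B0 + (\<Sum>i\<in>UNIV. B i)"
  have B_nn: "B i \<ge> 0" "B0 \<ge> 0" for i using B[of i 0] B0[of 0] by linarith+
  have M: "B0 \<le> M" "B i \<le> M" for i
    using B_nn member_le_sum[of i UNIV B] unfolding M_def by (auto simp: sum_nonneg add_increasing)
  have cp: "partial i (conv (\<rho> n) f) = conv (\<rho> n) (partial i f)" for i n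
    by (rule conv_partial[OF smooth_imp_C1[OF \<rho>(2)] f K(1) zero])
  have "C1_approximants S f (\<lambda>n. conv (\<rho> n) f) K' M"
    unfolding C1_approximants_def
  proof (intro conjI allI impI)
    show "compact K'" "K' \<subseteq> S" by fact+
    show "smooth (conv (\<rho> n) f)" for n by (rule smooth_conv[OF \<rho>(2) cf K(1) zero])
    show "conv (\<rho> n) f x = 0" if "x \<notin> K'" for n x by (rule czero[OF cf zero that])
    show "partial i (conv (\<rho> n) f) x = 0" if "x \<notin> K'" for n x i
      unfolding cp by (rule czero[OF pc pz that])
    show "(\<lambda>n. conv (\<rho> n) f x) \<longlonglongrightarrow> f x" for x by (rule clim[OF cf])
    show "(\<lambda>n. partial i (conv (\<rho> n) f) x) \<longlonglongrightarrow> partial i f x" for x i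
      unfolding cp by (rule clim[OF pc])
    show "\<bar>conv (\<rho> n) f x\<bar> \<le> M" for n x by (rule cb[OF cf order_trans[OF B0 M(1)]])
    show "\<bar>partial i (conv (\<rho> n) f) x\<bar> \<le> M" for n i x
      unfolding cp by (rule cb[OF pc order_trans[OF B M(2)]])
  qed
  then show ?thesis by blast
qed

subsection \<open>Weak derivatives\<close>

lemma LINT_lebesgue_on_open:
  fixes h :: "'a::euclidean_space \<Rightarrow> real"
  assumes "open S"
  shows "(LINT x|lebesgue_on S. h x) = (LINT x|lebesgue. indicator S x * h x)"
  using assms by (subst integral_restrict_space) auto

text \<open>The indicator of K makes h integrable on the whole space, so that integrals over S
  against bounded functions supported in K can be compared by dominated convergence although h is
  only locally integrable.\<close>

lemma locally_integrable_times:
  fixes h :: "'a::euclidean_space \<Rightarrow> real"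
  assumes S: "open S" and h: "locally_integrable S h" and K: "compact K" "K \<subseteq> S"
    and \<phi>: "\<phi> \<in> borel_measurable borel" "\<And>x. x \<notin> K \<Longrightarrow> \<phi> x = 0" "\<And>x. \<bar>\<phi> x\<bar> \<le> M"
  shows "integrable lebesgue (\<lambda>x. (indicator K x * h x) * \<phi> x)"
    "integrable (lebesgue_on S) (\<lambda>x. h x * \<phi> x)"
    "(LINT x|lebesgue_on S. h x * \<phi> x) = (LINT x|lebesgue. (indicator K x * h x) * \<phi> x)"
proof -
  have hK: "integrable lebesgue (\<lambda>x. indicator K x * h x)"
    using h K by (simp add: locally_integrable_def set_integrable_def)
  have [measurable]: "\<phi> \<in> borel_measurable lebesgue" using \<phi>(1) by (simp add: measurable_completion)
  note [measurable] = borel_measurable_integrable[OF hK]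
  show 1: "integrable lebesgue (\<lambda>x. (indicator K x * h x) * \<phi> x)"
  proof (rule Bochner_Integration.integrable_bound)
    show "integrable lebesgue (\<lambda>x. M * (indicator K x * h x))" using hK by simp
    show "AE x in lebesgue. norm ((indicator K x * h x) * \<phi> x) \<le> norm (M * (indicator K x * h x))"
    proof (rule AE_I2)
      fix x
      have "\<bar>\<phi> x\<bar> \<le> \<bar>M\<bar>" using \<phi>(3)[of x] by linarith
      then show "norm ((indicator K x * h x) * \<phi> x) \<le> norm (M * (indicator K x * h x))"
        by (simp add: abs_mult mult.commute mult_right_mono)
    qed
  qed simp
  have eq: "(indicator S x * (h x * \<phi> x)) = (indicator K x * h x) * \<phi> x" for x
    using K(2) \<phi>(2)[of x] by (auto simp: indicator_def)
  show "integrable (lebesgue_on S) (\<lambda>x. h x * \<phi> x)"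
    using 1 S by (subst integrable_restrict_space) (auto simp: eq)
  show "(LINT x|lebesgue_on S. h x * \<phi> x) = (LINT x|lebesgue. (indicator K x * h x) * \<phi> x)"
    unfolding LINT_lebesgue_on_open[OF S] eq ..
qed

lemma test_function_bounded:
  assumes "test_function S \<eta>"
  obtains K M where "compact K" "K \<subseteq> S" "\<And>x. x \<notin> K \<Longrightarrow> \<eta> x = 0" "\<And>x. \<bar>\<eta> x\<bar> \<le> M"
    "\<eta> \<in> borel_measurable borel" "M > 0"
proof -
  obtain K where K: "compact K" "K \<subseteq> S" "\<And>x. x \<notin> K \<Longrightarrow> \<eta> x = 0"
    using test_function_support[OF assms] by blast
  obtain M where M: "M > 0" "\<And>x. x \<in> K \<Longrightarrow> \<bar>\<eta> x\<bar> \<le> M"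
    using bounded_continuous_compact[OF smooth_continuous[OF test_function_smooth[OF assms]] K(1)] by blast
  have "\<bar>\<eta> x\<bar> \<le> M" for x using M K(3)[of x] by (cases "x \<in> K") auto
  moreover have "\<eta> \<in> borel_measurable borel"
    by (intro borel_measurable_continuous_onI smooth_continuous test_function_smooth[OF assms])
  ultimately show thesis using K M(1) that by blast
qed

lemma integrable_locally_integrable_test:
  assumes "open S" "locally_integrable S h" "test_function S \<eta>"
  shows "integrable (lebesgue_on S) (\<lambda>x. h x * \<eta> x)"
proof -
  from test_function_bounded[OF assms(3)] obtain K M where K: "compact K" "K \<subseteq> S" "\<And>x. x \<notin> K \<Longrightarrow> \<eta> x = 0" "\<And>x. \<bar>\<eta> x\<bar> \<le> M"
    "\<eta> \<in> borel_measurable borel" "M > 0" by blast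
  show ?thesis by (rule locally_integrable_times(2)[OF assms(1,2) K(1,2,5,3,4)])
qed

text \<open>Both sides of the defining identity converge when f is replaced by its mollifications,
  which are test functions. The enlarged class of admissible functions is what the product rule with
  a C^1 coefficient needs.\<close>

lemma has_weak_deriv_C1:
  fixes f :: "real^'d \<Rightarrow> real"
  assumes S: "open S" and w: "has_weak_deriv S j v w"
    and f: "C1_fun f" and K: "compact K" "K \<subseteq> S" and zero: "\<And>x. x \<notin> K \<Longrightarrow> f x = 0"
  shows "(LINT x|lebesgue_on S. v x * partial j f x) = - (LINT x|lebesgue_on S. w x * f x)"
proof -
  obtain F K' M where "C1_approximants S f F K' M"
    using C1_approx[OF f K S zero] by blast
  then have F: "compact K'" "K' \<subseteq> S" "\<And>n. smooth (F n)" "\<And>n x. x \<notin> K' \<Longrightarrow> F n x = 0"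
    "\<And>n i x. x \<notin> K' \<Longrightarrow> partial i (F n) x = 0"
    "\<And>x. (\<lambda>n::nat. F n x) \<longlonglongrightarrow> f x" "\<And>i x. (\<lambda>n. partial i (F n) x) \<longlonglongrightarrow> partial i f x"
    "\<And>n x. \<bar>F n x\<bar> \<le> M" "\<And>n i x. \<bar>partial i (F n) x\<bar> \<le> M"
    unfolding C1_approximants_def by simp_all
  have lv: "locally_integrable S v" and lw: "locally_integrable S w"
    using w by (auto simp: has_weak_deriv_def)
  have test: "test_function S (F n)" for n by (rule test_functionI[OF F(3) F(1,2) F(4)])
  have lim: "(\<lambda>n. LINT x|lebesgue_on S. h x * G n x) \<longlonglongrightarrow> (LINT x|lebesgue_on S. h x * g x)"
    if h: "locally_integrable S h" and G: "\<And>n. continuous_on UNIV (G n)" "\<And>n x. x \<notin> K' \<Longrightarrow> G n x = 0"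
      "\<And>x. (\<lambda>n. G n x) \<longlonglongrightarrow> g x" "\<And>n x. \<bar>G n x\<bar> \<le> M" for h g and G :: "nat \<Rightarrow> real^'d \<Rightarrow> real"
  proof -
    have Gm[measurable]: "G n \<in> borel_measurable borel" for n by (intro borel_measurable_continuous_onI G)
    have gm[measurable]: "g \<in> borel_measurable borel" by (rule borel_measurable_LIMSEQ_real[OF G(3)]) simp
    have gz: "g x = 0" if "x \<notin> K'" for x
      using G(3)[of x] G(2)[OF that] by (simp add: LIMSEQ_const_iff)
    have gM: "\<bar>g x\<bar> \<le> M" for x
      by (rule LIMSEQ_le_const2[OF tendsto_rabs[OF G(3)]]) (use G(4) in auto)
    have hK: "integrable lebesgue (\<lambda>x. indicator K' x * h x)"
      using h F(1,2) by (simp add: locally_integrable_def set_integrable_def)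
    note 1 = locally_integrable_times[OF S h F(1,2) Gm G(2) G(4)]
    note 2 = locally_integrable_times[OF S h F(1,2) gm gz gM]
    have eq: "(LINT x|lebesgue_on S. h x * G n x) = (LINT x|lebesgue. (indicator K' x * h x) * G n x)"
      "(LINT x|lebesgue_on S. h x * g x) = (LINT x|lebesgue. (indicator K' x * h x) * g x)" for n
      using 1(3) 2(3) by simp_all
    show ?thesis unfolding eq
    proof (rule integral_dominated_convergence)
      show "integrable lebesgue (\<lambda>x. M * \<bar>indicator K' x * h x\<bar>)" using hK by simp
      show "AE x in lebesgue. (\<lambda>n. indicator K' x * h x * G n x) \<longlonglongrightarrow> indicator K' x * h x * g x"
        by (intro AE_I2 tendsto_intros G)
      show "AE x in lebesgue. norm (indicator K' x * h x * G n x) \<le> M * \<bar>indicator K' x * h x\<bar>" for n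
        using G(4)[of n] by (intro AE_I2) (auto simp: abs_mult mult.commute mult_right_mono)
    qed (use 1(1) 2(1) in auto)
  qed
  have "(\<lambda>n. LINT x|lebesgue_on S. v x * partial j (F n) x) \<longlonglongrightarrow> (LINT x|lebesgue_on S. v x * partial j f x)"
    by (rule lim[OF lv smooth_continuous[OF smooth_partial[OF F(3)]] F(5) F(7) F(9)])
  moreover have "(\<lambda>n. LINT x|lebesgue_on S. w x * F n x) \<longlonglongrightarrow> (LINT x|lebesgue_on S. w x * f x)"
    by (rule lim[OF lw smooth_continuous[OF F(3)] F(4) F(6) F(8)])
  moreover have "(LINT x|lebesgue_on S. v x * partial j (F n) x) = - (LINT x|lebesgue_on S. w x * F n x)" for n
    using w test by (auto simp: has_weak_deriv_def)
  ultimately have "(\<lambda>n. - (LINT x|lebesgue_on S. w x * F n x)) \<longlonglongrightarrow> (LINT x|lebesgue_on S. v x * partial j f x)"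
    "(\<lambda>n. - (LINT x|lebesgue_on S. w x * F n x)) \<longlonglongrightarrow> - (LINT x|lebesgue_on S. w x * f x)"
    by (auto intro: tendsto_minus)
  then show ?thesis by (rule LIMSEQ_unique)
qed

text \<open>S and the complement of K are open and cover the space, and f vanishes on the second
  set; regularity in S is thereby glued to the extension by zero.\<close>

lemma C1_fun_local:
  assumes S: "open S" and K: "compact K" "K \<subseteq> S" and zero: "\<And>x. x \<notin> K \<Longrightarrow> f x = 0"
    and d: "\<And>x. x \<in> S \<Longrightarrow> f differentiable (at x)" and c: "\<And>i. continuous_on S (partial i f)"
  shows "C1_fun f"
  unfolding C1_fun_def
proof (intro conjI allI)
  have o: "open (- K)" using K(1) by (simp add: compact_imp_closed open_Compl)
  have out: "(f has_derivative (\<lambda>_. 0)) (at x)" if "x \<notin> K" for x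
    by (rule has_derivative_transform_within_open[OF has_derivative_const o])
      (use that zero in auto)
  show "f differentiable (at x)" for x
    using d[of x] out[of x] K(2) unfolding differentiable_def by blast
  show "continuous_on UNIV (partial i f)" for i
  proof -
    have "continuous_on (- K) (partial i f)"
    proof (subst continuous_on_cong[OF refl])
      show "partial i f x = 0" if "x \<in> - K" for x using partial_eq[OF out] that by auto
    qed simp
    from continuous_on_open_Un[OF S o c this] have "continuous_on (S \<union> - K) (partial i f)" .
    moreover have "S \<union> - K = UNIV" using K(2) by blast
    ultimately show ?thesis by simp
  qed
qed

lemma locally_integrable_mult_continuous:
  fixes h :: "'a::euclidean_space \<Rightarrow> real"
  assumes "locally_integrable S h" "continuous_on S b"
  shows "locally_integrable S (\<lambda>x. b x * h x)"
  unfolding locally_integrable_def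
proof (intro allI impI)
  fix K assume K: "compact K \<and> K \<subseteq> S"
  then have hK: "integrable lebesgue (\<lambda>x. indicator K x * h x)"
    using assms(1) by (simp add: locally_integrable_def set_integrable_def)
  have bK: "continuous_on K b" using assms(2) K continuous_on_subset by blast
  obtain M where M: "M > 0" "\<And>x. x \<in> K \<Longrightarrow> \<bar>b x\<bar> \<le> M"
    using bounded_continuous_compact[OF bK] K by blast
  have "(\<lambda>x. indicator K x *\<^sub>R b x) \<in> borel_measurable borel"
    using K bK by (intro borel_measurable_continuous_on_indicator borel_compact) auto
  then have [measurable]: "(\<lambda>x. indicator K x * b x) \<in> borel_measurable lebesgue"
    by (simp add: measurable_completion)
  note [measurable] = borel_measurable_integrable[OF hK]
  have "integrable lebesgue (\<lambda>x. (indicator K x * b x) * (indicator K x * h x))"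
  proof (rule Bochner_Integration.integrable_bound)
    show "integrable lebesgue (\<lambda>x. M * (indicator K x * h x))" using hK by simp
    show "AE x in lebesgue. norm ((indicator K x * b x) * (indicator K x * h x)) \<le> norm (M * (indicator K x * h x))"
      using M by (intro AE_I2) (auto simp: abs_mult indicator_def mult_right_mono)
  qed simp
  then show "set_integrable lebesgue K (\<lambda>x. b x * h x)"
    unfolding set_integrable_def
    by (rule Bochner_Integration.integrable_cong[THEN iffD1, rotated -1]) (auto simp: indicator_def)
qed

lemma locally_integrable_add:
  "locally_integrable S f \<Longrightarrow> locally_integrable S g \<Longrightarrow> locally_integrable S (\<lambda>x. f x + g x)"
  by (auto simp: locally_integrable_def intro!: set_integral_add)

text \<open>The function b * \<eta> is admissible in the identity for v, and its classical product
  rule rearranges to the claim. Applied to \<open>a i j\<close> and the gradient of u, this provides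
  weak derivatives of the fluxes, without which the choice made inside \<open>elliptic_op\<close>
  would be arbitrary.\<close>

lemma has_weak_deriv_mult:
  fixes b :: "real^'d \<Rightarrow> real"
  assumes S: "open S" and w: "has_weak_deriv S j v w" and b: "Ck 1 S b"
  shows "has_weak_deriv S j (\<lambda>x. b x * v x) (\<lambda>x. b x * w x + partial j b x * v x)"
proof -
  have lv: "locally_integrable S v" and lw: "locally_integrable S w"
    using w by (auto simp: has_weak_deriv_def)
  have bd: "b differentiable (at x)" if "x \<in> S" for x using b that by simp
  have bp: "continuous_on S (partial i b)" for i using b by simp
  have bc: "continuous_on S b" using Ck_Suc_imp[of 0 S b] b by simp
  have l1: "locally_integrable S (\<lambda>x. b x * v x)" "locally_integrable S (\<lambda>x. b x * w x)"
    "locally_integrable S (\<lambda>x. partial j b x * v x)"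
    by (intro locally_integrable_mult_continuous lv lw bc bp)+
  have "(LINT x|lebesgue_on S. b x * v x * partial j \<eta> x) =
      - (LINT x|lebesgue_on S. (b x * w x + partial j b x * v x) * \<eta> x)" if \<eta>: "test_function S \<eta>" for \<eta>
  proof -
    obtain K where K: "compact K" "K \<subseteq> S" "\<And>x. x \<notin> K \<Longrightarrow> \<eta> x = 0"
      using test_function_support[OF \<eta>] by blast
    have \<eta>d: "\<eta> differentiable (at x)" for x by (rule smooth_differentiable[OF test_function_smooth[OF \<eta>]])
    let ?f = "\<lambda>x. b x * \<eta> x"
    have pf: "partial i ?f x = b x * partial i \<eta> x + partial i b x * \<eta> x" if "x \<in> S" for i x
      by (rule partial_mult[OF bd[OF that] \<eta>d])
    have C: "C1_fun ?f"
    proof (rule C1_fun_local[OF S K(1,2)])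
      show "?f differentiable (at x)" if "x \<in> S" for x by (intro differentiable_mult bd \<eta>d that)
      have "continuous_on S (\<lambda>x. b x * partial i \<eta> x + partial i b x * \<eta> x)" for i
        using smooth_continuous[OF test_function_smooth[OF \<eta>], of S]
          smooth_continuous[OF smooth_partial[OF test_function_smooth[OF \<eta>]], of S i] bc bp
        by (intro continuous_intros)
      then show "continuous_on S (partial i ?f)" for i
        by (subst continuous_on_cong[OF refl pf]) auto
    qed (simp add: K)
    have "(LINT x|lebesgue_on S. v x * partial j ?f x) = - (LINT x|lebesgue_on S. w x * ?f x)"
      by (rule has_weak_deriv_C1[OF S w C K(1,2)]) (simp add: K)
    moreover have "(LINT x|lebesgue_on S. v x * partial j ?f x) =
        (LINT x|lebesgue_on S. b x * v x * partial j \<eta> x + partial j b x * v x * \<eta> x)"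
      by (rule Bochner_Integration.integral_cong) (simp_all only: pf space_lebesgue_on, simp add: algebra_simps)
    moreover have "integrable (lebesgue_on S) (\<lambda>x. b x * v x * partial j \<eta> x)"
      "integrable (lebesgue_on S) (\<lambda>x. b x * w x * \<eta> x)"
      "integrable (lebesgue_on S) (\<lambda>x. partial j b x * v x * \<eta> x)"
      by (intro integrable_locally_integrable_test S l1 \<eta> test_function_partial)+
    ultimately show ?thesis by (simp add: algebra_simps)
  qed
  with l1 show ?thesis by (auto simp: has_weak_deriv_def intro: locally_integrable_add)
qed

section \<open>Fundamental lemma of the calculus of variations\<close>

lemma fundamental_lemma_box:
  fixes h :: "real^'d \<Rightarrow> real"
  assumes S: "open S" and h: "locally_integrable S h"
    and zero: "\<And>\<eta>. test_function S \<eta> \<Longrightarrow> (LINT x|lebesgue_on S. h x * \<eta> x) = 0"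
    and sub: "cbox a b \<subseteq> S"
  shows "(LINT x|lebesgue. indicator (box a b) x * h x) = 0"
proof -
  have hK: "integrable lebesgue (\<lambda>x. indicator (cbox a b) x * h x)"
    using h sub by (simp add: locally_integrable_def set_integrable_def)
  let ?\<eta> = "box_bump a b"
  have t: "test_function S (?\<eta> n)" for n by (rule test_function_box_bump[OF sub])
  have m[measurable]: "?\<eta> n \<in> borel_measurable borel" for n
    by (intro borel_measurable_continuous_onI smooth_continuous test_function_smooth[OF t])
  have z: "?\<eta> n x = 0" if "x \<notin> cbox a b" for n x
    using test_function_support[OF test_function_box_bump[of a b "cbox a b" n]] that by blast
  have bd: "\<bar>?\<eta> n x\<bar> \<le> 1" for n x using box_bump_bounds[of a b n x] by simp
  note 1 = locally_integrable_times[OF S h compact_cbox sub m z bd]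
  have 2: "(LINT x|lebesgue. (indicator (cbox a b) x * h x) * ?\<eta> n x) = 0" for n
    using zero[OF t[of n]] 1(3)[of n] by simp
  have "(\<lambda>n. LINT x|lebesgue. (indicator (cbox a b) x * h x) * ?\<eta> n x) \<longlonglongrightarrow>
      (LINT x|lebesgue. (indicator (cbox a b) x * h x) * indicator (box a b) x)"
  proof (rule integral_dominated_convergence)
    show "integrable lebesgue (\<lambda>x. \<bar>indicator (cbox a b) x * h x\<bar>)" using hK by simp
    show "AE x in lebesgue. (\<lambda>n. indicator (cbox a b) x * h x * ?\<eta> n x) \<longlonglongrightarrow>
        indicator (cbox a b) x * h x * indicator (box a b) x"
      by (intro AE_I2 tendsto_intros box_bump_tendsto)
    show "AE x in lebesgue. norm (indicator (cbox a b) x * h x * ?\<eta> n x) \<le> \<bar>indicator (cbox a b) x * h x\<bar>" for n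
      using bd[of n] by (intro AE_I2) (auto simp: abs_mult mult_left_le)
    show "(\<lambda>x. indicator (cbox a b) x * h x * indicator (box a b) x) \<in> borel_measurable lebesgue"
      by (intro borel_measurable_times[OF borel_measurable_integrable[OF hK]]
          borel_measurable_indicator sets_completionI_sets) simp
  qed (use 1(1) in auto)
  then have "(LINT x|lebesgue. (indicator (cbox a b) x * h x) * indicator (box a b) x) = 0"
    unfolding 2 by (simp add: LIMSEQ_const_iff)
  also have "(LINT x|lebesgue. (indicator (cbox a b) x * h x) * indicator (box a b) x) =
      (LINT x|lebesgue. indicator (box a b) x * h x)"
    using box_subset_cbox[of a b] by (intro Bochner_Integration.integral_cong) (auto simp: indicator_def)
  finally show ?thesis .
qed

text \<open>Boxes are an intersection-stable generator of the Borel sets, and the sets over which H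
  integrates to zero are closed under complements and countable disjoint unions. A function whose
  integral over every Borel set vanishes is zero almost everywhere.\<close>

lemma integral_borel_sets_zero:
  fixes H :: "'a::euclidean_space \<Rightarrow> real"
  assumes H: "integrable lborel H"
    and zero: "\<And>c d. (LINT x|lborel. indicator (box c d) x * H x) = 0"
  shows "AE x in lborel. H x = 0"
proof (rule density_unique_real[OF H, of "\<lambda>_. 0"])
  fix A :: "'a set" assume "A \<in> sets lborel"
  then have A: "A \<in> sigma_sets UNIV (range (\<lambda>(a, b). box a b))"
    by (simp add: borel_eq_box)
  have meas: "sigma_sets UNIV (range (\<lambda>(a, b). box a b)) = sets (borel :: 'a measure)"
    by (simp add: borel_eq_box)
  have int: "integrable lborel (\<lambda>x. indicator B x * H x)" if "B \<in> sets borel" for B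
    using integrable_mult_indicator[OF _ H, of B] that by simp
  define P where "P B \<longleftrightarrow> (LINT x|lborel. indicator B x * H x) = 0" for B
  \<comment> \<open>The complement step needs the integral over the whole space, which is the limit
    of the integrals over boxes exhausting it.\<close>
  have full: "(LINT x|lborel. H x) = 0"
  proof -
    define Bn :: "nat \<Rightarrow> 'a set" where "Bn n = box (- (real n *\<^sub>R One)) (real n *\<^sub>R One)" for n
    have "(\<lambda>n. LINT x|lborel. indicator (Bn n) x * H x) \<longlonglongrightarrow> (LINT x|lborel. H x)"
    proof (rule integral_dominated_convergence)
      show "integrable lborel (\<lambda>x. \<bar>H x\<bar>)" using H by simp
      show "AE x in lborel. (\<lambda>n. indicator (Bn n) x * H x) \<longlonglongrightarrow> H x"
      proof (rule AE_I2)
        fix x :: "'a"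
        obtain N :: nat where N: "norm x < real N" using reals_Archimedean2 by blast
        have "x \<in> Bn n" if "n \<ge> N" for n
        proof -
          have "\<bar>x \<bullet> i\<bar> < real n" if "i \<in> Basis" for i
            using N \<open>n \<ge> N\<close> Basis_le_norm[OF that, of x] by linarith
          then show ?thesis by (auto simp: Bn_def mem_box abs_less_iff)  (smt (verit))
        qed
        then have "\<forall>\<^sub>F n in sequentially. H x = indicator (Bn n) x * H x"
          unfolding eventually_sequentially by (intro exI[of _ N]) auto
        then show "(\<lambda>n. indicator (Bn n) x * H x) \<longlonglongrightarrow> H x"
          by (rule Lim_transform_eventually[OF tendsto_const])
      qed
      show "(\<lambda>x. indicator (Bn n) x * H x) \<in> borel_measurable lborel" for n
        using int[of "Bn n"] by (auto simp: Bn_def intro: borel_measurable_integrable)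
    qed (use H in \<open>auto simp: indicator_def\<close>)
    then show ?thesis unfolding Bn_def zero by (simp add: LIMSEQ_const_iff)
  qed
  have "P A"
  proof (rule sigma_sets_induct_disjoint[OF _ _ A])
    show "Int_stable (range (\<lambda>(a, b). box a b :: 'a set))"
      by (auto simp: Int_stable_def box_Int_box)
    show "range (\<lambda>(a, b). box a b) \<subseteq> Pow (UNIV :: 'a set)" by simp
    show "P B" if "B \<in> range (\<lambda>(a, b). box a b)" for B
      using that zero by (auto simp: P_def)
    show "P {}" by (simp add: P_def)
    show "P (UNIV - B)" if "B \<in> sigma_sets UNIV (range (\<lambda>(a, b). box a b))" "P B" for B
    proof -
      have B: "B \<in> sets borel" using that(1) meas by simp
      have "(LINT x|lborel. indicator (UNIV - B) x * H x) = (LINT x|lborel. H x - indicator B x * H x)"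
        by (intro Bochner_Integration.integral_cong) (auto simp: indicator_def)
      also have "\<dots> = 0" using H int[OF B] full that(2) by (simp add: P_def)
      finally show ?thesis by (simp add: P_def)
    qed
    show "P (\<Union>i::nat. B i)" if "disjoint_family B"
      "range B \<subseteq> sigma_sets UNIV (range (\<lambda>(a, b). box a b))" "\<And>i. P (B i)" for B
    proof -
      have B: "B i \<in> sets borel" for i using that(2) meas by blast
      have "set_integrable lborel (\<Union>i. B i) H"
        using int[of "\<Union>i. B i"] B by (simp add: set_integrable_def)
      then have "(LINT x:(\<Union>i. B i)|lborel. H x) = (\<Sum>i. (LINT x:(B i)|lborel. H x))"
        using B that(1) by (intro lebesgue_integral_countable_add) (auto simp: disjoint_family_on_def)
      then show ?thesis using that(3) by (simp add: P_def set_lebesgue_integral_def)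
    qed
  qed
  then show "(LINT x:A|lborel. H x) = (LINT x:A|lborel. 0)"
    by (simp add: P_def set_lebesgue_integral_def)
qed simp

text \<open>On a closed box inside S the function h is integrable and has a Borel version, to which
  the criterion on boxes applies; countably many such boxes cover S.\<close>

lemma fundamental_lemma:
  fixes h :: "real^'d \<Rightarrow> real"
  assumes S: "open S" and h: "locally_integrable S h"
    and zero: "\<And>\<eta>. test_function S \<eta> \<Longrightarrow> (LINT x|lebesgue_on S. h x * \<eta> x) = 0"
  shows "AE x in lebesgue_on S. h x = 0"
proof -
  have box: "AE x in lebesgue. x \<in> cbox a b \<longrightarrow> h x = 0" if sub: "cbox a b \<subseteq> S" for a b
  proof -
    define H where "H x = indicator (cbox a b) x * h x" for x
    have H: "integrable lebesgue H"
      using h sub by (simp add: locally_integrable_def set_integrable_def H_def[abs_def])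
    obtain H' where H'm: "H' \<in> borel_measurable lborel" and H'eq: "AE x in lborel. H x = H' x"
      using completion_ex_borel_measurable_real[OF borel_measurable_integrable[OF H]] by auto
    have eqc: "AE x in lebesgue. H x = H' x" using H'eq by (rule AE_completion)
    have "integrable lebesgue H'"
      by (rule integrable_cong_AE_imp[OF H]) (use H'm eqc in \<open>auto simp: measurable_completion\<close>)
    then have H'i: "integrable lborel H'" using H'm by (simp add: integrable_completion)
    have "(LINT x|lborel. indicator (box c d) x * H' x) = 0" for c d
    proof -
      \<comment> \<open>The intersection of two boxes is again a box, and its closed version stays
        in S, so \<open>fundamental_lemma_box\<close> applies to it.\<close>
      let ?u = "\<Sum>i\<in>Basis. max (a\<bullet>i) (c\<bullet>i) *\<^sub>R i" and ?v = "\<Sum>i\<in>Basis. min (b\<bullet>i) (d\<bullet>i) *\<^sub>R i"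
      have "cbox ?u ?v \<subseteq> S" using sub Int_interval[of a b c d] by blast
      from fundamental_lemma_box[OF S h zero this]
      have 0: "(LINT x|lebesgue. indicator (box a b \<inter> box c d) x * h x) = 0"
        by (simp only: box_Int_box)
      have bm: "box c d \<in> sets lebesgue" "box a b \<inter> box c d \<in> sets lebesgue"
        by (auto intro!: sets_completionI_sets)
      have "AE x in lebesgue. x \<notin> cbox a b - box a b"
        using negligible_frontier_interval[of a b] by (intro AE_not_in) (simp add: negligible_iff_null_sets)
      then have "AE x in lebesgue. indicator (box c d) x * H' x = indicator (box a b \<inter> box c d) x * h x"
        using eqc
      proof eventually_elim
        case (elim x)
        then show ?case using box_subset_cbox[of a b] by (auto simp: H_def indicator_def)
      qed
      moreover have "(\<lambda>x. indicator (box c d) x * H' x) \<in> borel_measurable lebesgue"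
        using H'm bm(1) by (intro borel_measurable_times) (auto simp: measurable_completion)
      moreover have "(\<lambda>x. indicator (box a b \<inter> box c d) x * h x) \<in> borel_measurable lebesgue"
      proof -
        have "(\<lambda>x. indicator (box a b \<inter> box c d) x * h x) = (\<lambda>x. indicator (box a b \<inter> box c d) x * H x)"
          using box_subset_cbox[of a b] by (intro ext) (auto simp: H_def indicator_def)
        then show ?thesis
          using borel_measurable_times[OF borel_measurable_indicator[OF bm(2)] borel_measurable_integrable[OF H]]
          by simp
      qed
      ultimately have "(LINT x|lebesgue. indicator (box c d) x * H' x) =
          (LINT x|lebesgue. indicator (box a b \<inter> box c d) x * h x)"
        by (intro integral_cong_AE)
      also have "(LINT x|lebesgue. indicator (box c d) x * H' x) = (LINT x|lborel. indicator (box c d) x * H' x)"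
        using H'm by (intro integral_completion) auto
      finally show ?thesis using 0 by simp
    qed
    from integral_borel_sets_zero[OF H'i this] have "AE x in lebesgue. H' x = 0" by (rule AE_completion)
    with eqc show ?thesis by eventually_elim (auto simp: H_def)
  qed
  obtain \<D> where D: "countable \<D>" "\<D> \<subseteq> Pow S" "\<And>X. X \<in> \<D> \<Longrightarrow> \<exists>a b. X = cbox a b" "\<Union>\<D> = S"
    using open_countable_Union_open_cbox[OF S] by blast
  have "AE x in lebesgue. \<forall>X\<in>\<D>. x \<in> X \<longrightarrow> h x = 0"
  proof (rule AE_ball_countable'[OF _ D(1)])
    fix X assume "X \<in> \<D>"
    with D(2,3) obtain a b where "X = cbox a b" "cbox a b \<subseteq> S" by blast
    then show "AE x in lebesgue. x \<in> X \<longrightarrow> h x = 0" using box by simp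
  qed
  then have "AE x in lebesgue. x \<in> S \<longrightarrow> h x = 0" by eventually_elim (use D(4) in auto)
  then show ?thesis using S by (subst AE_restrict_space_iff) auto
qed

lemma locally_integrable_diff:
  "locally_integrable S f \<Longrightarrow> locally_integrable S g \<Longrightarrow> locally_integrable S (\<lambda>x. f x - g x)"
  by (auto simp: locally_integrable_def)

text \<open>\<open>weak_deriv\<close> is the result of a choice. Uniqueness lets every property that
  is insensitive to null sets pass from a known weak derivative to the chosen one.\<close>

lemma has_weak_deriv_unique:
  assumes S: "open S" and w: "has_weak_deriv S i f w" and w': "has_weak_deriv S i f w'"
  shows "AE x in lebesgue_on S. w x = w' x"
proof -
  have l: "locally_integrable S w" "locally_integrable S w'" using w w' by (auto simp: has_weak_deriv_def)
  have "AE x in lebesgue_on S. w x - w' x = 0"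
  proof (rule fundamental_lemma[OF S locally_integrable_diff[OF l]])
    fix \<eta> assume \<eta>: "test_function S \<eta>"
    have "(LINT x|lebesgue_on S. w x * \<eta> x) = (LINT x|lebesgue_on S. w' x * \<eta> x)"
      using w w' \<eta> by (auto simp: has_weak_deriv_def)
    then show "(LINT x|lebesgue_on S. (w x - w' x) * \<eta> x) = 0"
      using integrable_locally_integrable_test[OF S l(1) \<eta>] integrable_locally_integrable_test[OF S l(2) \<eta>]
      by (simp add: left_diff_distrib)
  qed
  then show ?thesis by simp
qed

lemma weak_deriv_works: "has_weak_deriv S i f w \<Longrightarrow> has_weak_deriv S i f (weak_deriv S i f)"
  unfolding weak_deriv_def by (rule someI[of "has_weak_deriv S i f"])

lemma has_weak_deriv_diff:
  assumes S: "open S" and "has_weak_deriv S i f w" and "has_weak_deriv S i g v"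
  shows "has_weak_deriv S i (\<lambda>x. f x - g x) (\<lambda>x. w x - v x)"
proof -
  have l: "locally_integrable S f" "locally_integrable S g" "locally_integrable S w" "locally_integrable S v"
    using assms by (auto simp: has_weak_deriv_def)
  have "(LINT x|lebesgue_on S. (f x - g x) * partial i \<eta> x) = - (LINT x|lebesgue_on S. (w x - v x) * \<eta> x)"
    if \<eta>: "test_function S \<eta>" for \<eta>
    using assms \<eta> l integrable_locally_integrable_test[OF S _ \<eta>]
      integrable_locally_integrable_test[OF S _ test_function_partial[OF \<eta>]]
    by (simp add: left_diff_distrib has_weak_deriv_def)
  with l show ?thesis by (simp add: has_weak_deriv_def locally_integrable_diff)
qed

lemma locally_integrable_continuous:
  fixes f :: "'a::euclidean_space \<Rightarrow> real"
  assumes "continuous_on S f" shows "locally_integrable S f"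
  unfolding locally_integrable_def set_integrable_def
proof (intro allI impI)
  fix K assume K: "compact K \<and> K \<subseteq> S"
  then have 1: "integrable lborel (\<lambda>x. indicator K x *\<^sub>R f x)"
    using assms by (intro borel_integrable_compact) (auto intro: continuous_on_subset)
  then show "integrable lebesgue (\<lambda>x. indicator K x *\<^sub>R f x)"
    using integrable_completion[OF borel_measurable_integrable[OF 1]] by simp
qed

lemma LINT_lebesgue_on_supported:
  fixes g :: "'a::euclidean_space \<Rightarrow> real"
  assumes "open S" "g \<in> borel_measurable borel" "\<And>x. x \<notin> S \<Longrightarrow> g x = 0"
  shows "(LINT x|lebesgue_on S. g x) = (LINT x|lborel. g x)"
proof -
  have "(LINT x|lebesgue_on S. g x) = (LINT x|lebesgue. g x)"
    unfolding LINT_lebesgue_on_open[OF assms(1)]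
    by (intro Bochner_Integration.integral_cong) (use assms(3) in \<open>auto simp: indicator_def\<close>)
  also have "\<dots> = (LINT x|lborel. g x)" using assms(2) by (intro integral_completion) simp
  finally show ?thesis .
qed

lemma has_weak_deriv_C1_fun:
  assumes S: "open S" and f: "C1_fun f"
  shows "has_weak_deriv S i f (partial i f)"
  unfolding has_weak_deriv_def
proof (intro conjI allI impI)
  have pc: "continuous_on UNIV (partial i f)" using f by (simp add: C1_fun_def)
  show "locally_integrable S f" "locally_integrable S (partial i f)"
    using C1_fun_continuous[OF f] pc by (auto intro!: locally_integrable_continuous intro: continuous_on_subset)
  fix \<eta> assume \<eta>: "test_function S \<eta>"
  obtain K where K: "compact K" "K \<subseteq> S" "\<And>x. x \<notin> K \<Longrightarrow> \<eta> x = 0" "\<And>x. x \<notin> K \<Longrightarrow> partial i \<eta> x = 0"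
    using test_function_support[OF \<eta>] by blast
  have C: "C1_fun \<eta>" by (rule smooth_imp_C1[OF test_function_smooth[OF \<eta>]])
  then have e: "continuous_on UNIV \<eta>" "continuous_on UNIV (partial i \<eta>)"
    by (auto simp: C1_fun_def intro: C1_fun_continuous)
  note [measurable] = borel_measurable_continuous_onI[OF e(1)] borel_measurable_continuous_onI[OF e(2)]
    borel_measurable_continuous_onI[OF pc] borel_measurable_continuous_onI[OF C1_fun_continuous[OF f]]
  have "(LINT x|lborel. \<eta> x * partial i f x) = - (LINT x|lborel. partial i \<eta> x * f x)"
    by (rule integral_by_parts[OF C f K(1,3)])
  moreover have "(LINT x|lebesgue_on S. f x * partial i \<eta> x) = (LINT x|lborel. f x * partial i \<eta> x)"
    by (rule LINT_lebesgue_on_supported[OF S]) (use K in auto)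
  moreover have "(LINT x|lebesgue_on S. partial i f x * \<eta> x) = (LINT x|lborel. partial i f x * \<eta> x)"
    by (rule LINT_lebesgue_on_supported[OF S]) (use K in auto)
  ultimately show "(LINT x|lebesgue_on S. f x * partial i \<eta> x) = - (LINT x|lebesgue_on S. partial i f x * \<eta> x)"
    by (simp add: mult.commute)
qed

subsection \<open>Square integrable functions\<close>

text \<open>Stated for an arbitrary measure because it is applied both to \<open>lebesgue_on\<close>
  in space and to \<open>lborel\<close> in time.\<close>

definition sqint :: "'a measure \<Rightarrow> ('a \<Rightarrow> real) \<Rightarrow> bool" where
  "sqint M f \<longleftrightarrow> f \<in> borel_measurable M \<and> integrable M (\<lambda>x. (f x)\<^sup>2)"

lemma L2_space_iff: "f \<in> L2_space S \<longleftrightarrow> sqint (lebesgue_on S) f"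
  by (simp add: L2_space_def sqint_def)

lemma sqint_mult:
  assumes "sqint M f" "sqint M g" shows "integrable M (\<lambda>x. f x * g x)"
proof (rule Bochner_Integration.integrable_bound)
  show "integrable M (\<lambda>x. (f x)\<^sup>2 + (g x)\<^sup>2)" using assms by (simp add: sqint_def)
  show "AE x in M. norm (f x * g x) \<le> norm ((f x)\<^sup>2 + (g x)\<^sup>2)"
  proof (rule AE_I2)
    fix x
    have "2 * (\<bar>f x\<bar> * \<bar>g x\<bar>) \<le> (f x)\<^sup>2 + (g x)\<^sup>2"
      using sum_squares_bound[of "\<bar>f x\<bar>" "\<bar>g x\<bar>"] by simp
    moreover have "0 \<le> \<bar>f x\<bar> * \<bar>g x\<bar>" by simp
    ultimately show "norm (f x * g x) \<le> norm ((f x)\<^sup>2 + (g x)\<^sup>2)"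
      unfolding real_norm_def abs_mult by linarith
  qed
qed (use assms in \<open>auto simp: sqint_def\<close>)

lemma sqint_add:
  assumes "sqint M f" "sqint M g" shows "sqint M (\<lambda>x. f x + g x)"
proof -
  have "(\<lambda>x. (f x + g x)\<^sup>2) = (\<lambda>x. (f x)\<^sup>2 + (g x)\<^sup>2 + 2 * (f x * g x))"
    by (intro ext) (simp add: power2_sum)
  then show ?thesis using assms sqint_mult[OF assms] by (auto simp: sqint_def)
qed

lemma sqint_cmult: "sqint M f \<Longrightarrow> sqint M (\<lambda>x. b * f x)"
  unfolding sqint_def by (auto simp: power_mult_distrib)

lemma sqint_diff:
  assumes "sqint M f" "sqint M g" shows "sqint M (\<lambda>x. f x - g x)"
  using sqint_add[OF assms(1) sqint_cmult[OF assms(2), of "-1"]] by simp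

lemma sqint_bounded_mult:
  assumes f: "sqint M f" and b: "b \<in> borel_measurable M" "AE x in M. \<bar>b x\<bar> \<le> B"
  shows "sqint M (\<lambda>x. b x * f x)"
  unfolding sqint_def
proof
  show "(\<lambda>x. b x * f x) \<in> borel_measurable M" using f b by (auto simp: sqint_def)
  show "integrable M (\<lambda>x. (b x * f x)\<^sup>2)"
  proof (rule Bochner_Integration.integrable_bound)
    show "integrable M (\<lambda>x. B\<^sup>2 * (f x)\<^sup>2)" using f by (simp add: sqint_def)
    show "AE x in M. norm ((b x * f x)\<^sup>2) \<le> norm (B\<^sup>2 * (f x)\<^sup>2)"
      using b(2)
    proof eventually_elim
      case (elim x)
      then have "(b x)\<^sup>2 \<le> B\<^sup>2" by (simp add: power2_le_iff_abs_le)
      then show ?case by (simp add: power_mult_distrib mult_right_mono)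
    qed
  qed (use f b in \<open>auto simp: sqint_def\<close>)
qed

lemma sqint_Cauchy_Schwarz:
  assumes "sqint M f" "sqint M g"
  shows "\<bar>LINT x|M. f x * g x\<bar> \<le> sqrt (LINT x|M. (f x)\<^sup>2) * sqrt (LINT x|M. (g x)\<^sup>2)"
proof -
  let ?A = "LINT x|M. (f x)\<^sup>2" and ?B = "LINT x|M. (g x)\<^sup>2" and ?C = "LINT x|M. f x * g x"
  have nn: "?A \<ge> 0" "?B \<ge> 0" by (auto intro: integral_nonneg_AE)
  have q: "0 \<le> s\<^sup>2 * ?A + 2 * s * ?C + ?B" for s :: real
  proof -
    have "0 \<le> (LINT x|M. (s * f x + g x)\<^sup>2)" by (intro integral_nonneg_AE) auto
    also have "\<dots> = (LINT x|M. s\<^sup>2 * (f x)\<^sup>2 + (2 * s) * (f x * g x) + (g x)\<^sup>2)"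
      by (intro Bochner_Integration.integral_cong) (auto simp: power2_eq_square algebra_simps)
    also have "\<dots> = s\<^sup>2 * ?A + 2 * s * ?C + ?B"
      using assms sqint_mult[OF assms] by (simp add: sqint_def)
    finally show ?thesis .
  qed
  have "?C\<^sup>2 \<le> ?A * ?B"
  proof (cases "?A = 0")
    case True
    have "?C = 0"
    proof (rule ccontr)
      assume "?C \<noteq> 0"
      \<comment> \<open>For ?A = 0 the quadratic is affine in s and takes the value -1 at this
        point.\<close>
      then show False using q[of "- (?B + 1) / (2 * ?C)"] True nn by (simp add: field_simps)
    qed
    then show ?thesis using True by simp
  next
    case False
    with nn(1) have "?A > 0" by linarith
    have "0 \<le> (?C / ?A)\<^sup>2 * ?A + 2 * (- ?C / ?A) * ?C + ?B" using q[of "- ?C / ?A"] by simp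
    with \<open>?A > 0\<close> show ?thesis by (simp add: field_simps power2_eq_square)
  qed
  then have "sqrt (?C\<^sup>2) \<le> sqrt (?A * ?B)" by (rule real_sqrt_le_mono)
  then show ?thesis by (simp add: real_sqrt_mult)
qed

lemma sqint_cong_AE:
  assumes "sqint M f" "g \<in> borel_measurable M" "AE x in M. f x = g x"
  shows "sqint M g"
  unfolding sqint_def
proof
  show "integrable M (\<lambda>x. (g x)\<^sup>2)"
    by (rule integrable_cong_AE_imp[of M "\<lambda>x. (f x)\<^sup>2"]) (use assms in \<open>auto simp: sqint_def\<close>)
qed (use assms in simp)

lemma sqint_imp_integrable:
  assumes f: "sqint M f" and M: "finite_measure M"
  shows "integrable M f"
proof -
  interpret finite_measure M by fact
  have "sqint M (\<lambda>x. 1)" by (simp add: sqint_def)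
  from sqint_mult[OF f this] show ?thesis by simp
qed

text \<open>Completeness of Lebesgue measure. Representatives selected by choice, such as
  \<open>weak_deriv\<close>, are known to be measurable only through another function that equals
  them almost everywhere.\<close>

lemma borel_measurable_lebesgue_on_AE:
  fixes f g :: "'a::euclidean_space \<Rightarrow> real"
  assumes S: "S \<in> sets lebesgue" and f: "f \<in> borel_measurable (lebesgue_on S)"
    and eq: "AE x in lebesgue_on S. f x = g x"
  shows "g \<in> borel_measurable (lebesgue_on S)"
proof -
  have "AE x in lebesgue. x \<in> S \<longrightarrow> f x = g x"
    using eq S by (subst (asm) AE_restrict_space_iff) auto
  then have "AE x in lebesgue. (if x \<in> S then f x else 0) = (if x \<in> S then g x else 0)"
    by eventually_elim auto
  from borel_measurable_AE[OF borel_measurable_if_I[OF f S] this]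
  show ?thesis by (rule borel_measurable_if_D)
qed

lemma integrable_lebesgue_on_supported:
  fixes f :: "'a::euclidean_space \<Rightarrow> real"
  assumes S: "open S" and f: "continuous_on UNIV f" and K: "compact K" "\<And>x. x \<notin> K \<Longrightarrow> f x = 0"
  shows "integrable (lebesgue_on S) f"
proof -
  have 1: "integrable lborel f" by (rule integrable_continuous_compact[OF f K])
  then have "integrable lebesgue f" using integrable_completion[OF borel_measurable_integrable[OF 1]] by simp
  then have "integrable lebesgue (\<lambda>x. indicator S x *\<^sub>R f x)"
    using S by (intro integrable_mult_indicator sets_completionI_sets) auto
  then show ?thesis using S by (subst integrable_restrict_space) auto
qed

lemma continuous_sqint:
  assumes S: "open S" and f: "continuous_on UNIV f" and K: "compact K" "\<And>x. x \<notin> K \<Longrightarrow> f x = 0"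
  shows "sqint (lebesgue_on S) f"
  unfolding sqint_def
proof
  show "integrable (lebesgue_on S) (\<lambda>x. (f x)\<^sup>2)"
    by (rule integrable_lebesgue_on_supported[OF S _ K(1)]) (use f K(2) in \<open>auto intro!: continuous_intros\<close>)
  show "f \<in> borel_measurable (lebesgue_on S)"
    by (rule borel_measurable_integrable[OF integrable_lebesgue_on_supported[OF S f K]])
qed

lemma test_function_sqint:
  assumes S: "open S" and \<eta>: "test_function S \<eta>"
  shows "sqint (lebesgue_on S) \<eta>" "sqint (lebesgue_on S) (partial i \<eta>)"
proof -
  obtain K where K: "compact K" "K \<subseteq> S" "\<And>x. x \<notin> K \<Longrightarrow> \<eta> x = 0" "\<And>x. x \<notin> K \<Longrightarrow> partial i \<eta> x = 0"
    using test_function_support[OF \<eta>] by blast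
  show "sqint (lebesgue_on S) \<eta>"
    by (rule continuous_sqint[OF S smooth_continuous[OF test_function_smooth[OF \<eta>]] K(1,3)])
  show "sqint (lebesgue_on S) (partial i \<eta>)"
    by (rule continuous_sqint[OF S smooth_continuous[OF smooth_partial[OF test_function_smooth[OF \<eta>]]] K(1,4)])
qed

text \<open>Membership in \<open>H1_space\<close> speaks of some square integrable derivative;
  uniqueness almost everywhere hands its integrability to the chosen one.\<close>

lemma weak_deriv_sqint:
  assumes S: "open S" and f: "f \<in> H1_space S"
  shows "has_weak_deriv S i f (weak_deriv S i f)" "sqint (lebesgue_on S) (weak_deriv S i f)"
    "sqint (lebesgue_on S) f"
proof -
  show "sqint (lebesgue_on S) f" using f by (simp add: H1_space_def L2_space_iff)
  obtain w where "w \<in> L2_space S" and wf: "has_weak_deriv S i f w"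
    using f unfolding H1_space_def by blast
  then have w: "sqint (lebesgue_on S) w" "has_weak_deriv S i f w"
    by (simp_all add: L2_space_iff)
  show wd: "has_weak_deriv S i f (weak_deriv S i f)" by (rule weak_deriv_works[OF w(2)])
  have eq: "AE x in lebesgue_on S. w x = weak_deriv S i f x"
    by (rule has_weak_deriv_unique[OF S w(2) wd])
  have "S \<in> sets lebesgue" using S by (simp add: sets_completionI_sets)
  from borel_measurable_lebesgue_on_AE[OF this _ eq] w(1)
  show "sqint (lebesgue_on S) (weak_deriv S i f)"
    by (intro sqint_cong_AE[OF w(1) _ eq]) (auto simp: sqint_def)
qed

text \<open>\<open>H1_norm\<close> of a difference contains the chosen weak derivative of that
  difference, which agrees almost everywhere with the difference of the derivatives. After this
  replacement each of the finitely many nonnegative summands is bounded by the squared norm.\<close>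

lemma H10_approx:
  assumes S: "open S" and u: "u \<in> H10_space S"
  shows "\<exists>\<eta>. (\<forall>n::nat. test_function S (\<eta> n)) \<and>
     (\<lambda>n. LINT x|lebesgue_on S. (\<eta> n x - u x)\<^sup>2) \<longlonglongrightarrow> 0 \<and>
     (\<forall>i. (\<lambda>n. LINT x|lebesgue_on S. (partial i (\<eta> n) x - weak_deriv S i u x)\<^sup>2) \<longlonglongrightarrow> 0)"
proof -
  let ?M = "lebesgue_on S"
  obtain \<eta> where \<eta>: "\<And>n::nat. test_function S (\<eta> n)" and lim: "(\<lambda>n. H1_norm S (\<lambda>x. \<eta> n x - u x)) \<longlonglongrightarrow> 0"
    using u by (auto simp: H10_space_def)
  have u1: "u \<in> H1_space S" using u by (simp add: H10_space_def)
  define e where "e n i = (LINT x|?M. (partial i (\<eta> n) x - weak_deriv S i u x)\<^sup>2)" for n i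
  have en: "e n i \<ge> 0" for n i unfolding e_def by (intro integral_nonneg_AE) auto
  have wd: "(L2_norm S (weak_deriv S i (\<lambda>x. \<eta> n x - u x)))\<^sup>2 = e n i" for n i
  proof -
    have h: "has_weak_deriv S i (\<lambda>x. \<eta> n x - u x) (\<lambda>x. partial i (\<eta> n) x - weak_deriv S i u x)"
      by (rule has_weak_deriv_diff[OF S has_weak_deriv_C1_fun[OF S smooth_imp_C1[OF test_function_smooth[OF \<eta>]]]
            weak_deriv_sqint(1)[OF S u1]])
    have sq: "sqint ?M (\<lambda>x. partial i (\<eta> n) x - weak_deriv S i u x)"
      by (rule sqint_diff[OF test_function_sqint(2)[OF S \<eta>] weak_deriv_sqint(2)[OF S u1]])
    have eq: "AE x in ?M. partial i (\<eta> n) x - weak_deriv S i u x = weak_deriv S i (\<lambda>x. \<eta> n x - u x) x"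
      by (rule has_weak_deriv_unique[OF S h weak_deriv_works[OF h]])
    have "S \<in> sets lebesgue" using S by (simp add: sets_completionI_sets)
    from borel_measurable_lebesgue_on_AE[OF this _ eq] sq
    have m: "weak_deriv S i (\<lambda>x. \<eta> n x - u x) \<in> borel_measurable ?M" by (simp add: sqint_def)
    have "(LINT x|?M. (weak_deriv S i (\<lambda>x. \<eta> n x - u x) x)\<^sup>2) = e n i"
      unfolding e_def by (rule integral_cong_AE) (use m sq eq in \<open>auto simp: sqint_def\<close>)
    then show ?thesis using en by (simp add: L2_norm_def)
  qed
  have u0: "(L2_norm S (\<lambda>x. \<eta> n x - u x))\<^sup>2 = (LINT x|?M. (\<eta> n x - u x)\<^sup>2)" for n
  proof -
    have "(LINT x|?M. (\<eta> n x - u x)\<^sup>2) \<ge> 0" by (intro integral_nonneg_AE) auto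
    then show ?thesis by (simp add: L2_norm_def)
  qed
  define N where "N n = (LINT x|?M. (\<eta> n x - u x)\<^sup>2) + (\<Sum>i\<in>UNIV. e n i)" for n
  have nn0: "(LINT x|?M. (\<eta> n x - u x)\<^sup>2) \<ge> 0" for n by (intro integral_nonneg_AE) auto
  have "N n \<ge> 0" for n unfolding N_def using nn0 en by (intro add_nonneg_nonneg sum_nonneg) auto
  then have "(H1_norm S (\<lambda>x. \<eta> n x - u x))\<^sup>2 = N n" for n
    unfolding H1_norm_def u0 wd N_def[symmetric] by simp
  moreover have "(\<lambda>n. (H1_norm S (\<lambda>x. \<eta> n x - u x))\<^sup>2) \<longlonglongrightarrow> 0\<^sup>2" by (intro tendsto_intros lim)
  ultimately have N: "N \<longlonglongrightarrow> 0" by simp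
  have "(\<lambda>n. LINT x|?M. (\<eta> n x - u x)\<^sup>2) \<longlonglongrightarrow> 0"
    by (rule tendsto_sandwich[OF _ _ tendsto_const N])
      (use nn0 en in \<open>auto simp: N_def sum_nonneg\<close>)
  moreover have "(\<lambda>n. e n i) \<longlonglongrightarrow> 0" for i
  proof (rule tendsto_sandwich[OF _ _ tendsto_const N])
    show "\<forall>\<^sub>F n in sequentially. e n i \<le> N n"
      using nn0 en member_le_sum[of i UNIV "e _"] unfolding N_def by (auto intro!: add_increasing always_eventually)
  qed (use en in auto)
  ultimately show ?thesis using \<eta> unfolding e_def by blast
qed

section \<open>Discriminants and a smooth positive part\<close>

lemma discriminant_bound:
  fixes A B C :: real
  assumes "\<And>t. 0 \<le> A + 2 * t * C + t\<^sup>2 * B" "B \<ge> 0"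
  shows "C\<^sup>2 \<le> A * B"
proof (cases "B = 0")
  case True
  have "C = 0"
  proof (rule ccontr)
    assume C: "C \<noteq> 0"
    have "2 * (- (A + 1) / (2 * C)) * C = - (A + 1)" using C by simp
    then show False using assms(1)[of "- (A + 1) / (2 * C)"] True by simp
  qed
  then show ?thesis using True by simp
next
  case False
  with assms(2) have B: "B > 0" by simp
  have "0 \<le> A + 2 * (- C / B) * C + (- C / B)\<^sup>2 * B" by (rule assms(1))
  also have "\<dots> = A - C\<^sup>2 / B" using B by (simp add: field_simps power2_eq_square)
  finally show ?thesis using B by (simp add: field_simps)
qed

text \<open>For s > 0 this is s * exp (- \<kappa> / s), and 0 otherwise: a smooth stand-in for the
  positive part of s, at scale \<kappa>. The exact positive part would lead out of the class of test
  functions.\<close>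

definition cut :: "real \<Rightarrow> real \<Rightarrow> real" where
  "cut \<kappa> s = s * flat_exp 0 (s / \<kappa>)"

definition cut_deriv :: "real \<Rightarrow> real \<Rightarrow> real" where
  "cut_deriv \<kappa> s = flat_exp 0 (s / \<kappa>) + s / \<kappa> * flat_exp 2 (s / \<kappa>)"

text \<open>The nontrivial bounds come from 1 + t \<le> exp t. With t = \<kappa> / s > 0 the
  derivative is exp (- t) * (1 + t), hence at most 1, which keeps gradients from growing; the lower
  bound s - \<kappa> limits the loss in linear terms.\<close>

lemma cut_bounds:
  assumes "\<kappa> > 0"
  shows "0 \<le> cut \<kappa> s" "\<bar>cut \<kappa> s\<bar> \<le> \<bar>s\<bar>" "s - \<kappa> \<le> cut \<kappa> s"
    "0 \<le> cut_deriv \<kappa> s" "cut_deriv \<kappa> s \<le> 1"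
proof -
  show "0 \<le> cut \<kappa> s" using assms by (auto simp: cut_def flat_exp_def zero_less_divide_iff)
  show "\<bar>cut \<kappa> s\<bar> \<le> \<bar>s\<bar>" unfolding cut_def abs_mult
    using flat_exp_bounds(1,2)[of "s / \<kappa>"] by (intro mult_left_le) auto
  show "s - \<kappa> \<le> cut \<kappa> s"
  proof (cases "s > 0")
    case True
    have "1 - \<kappa> / s \<le> exp (- (\<kappa> / s))" using exp_ge_add_one_self[of "- (\<kappa> / s)"] by simp
    then have "s * (1 - \<kappa> / s) \<le> s * exp (- (\<kappa> / s))" using True by (intro mult_left_mono) auto
    then show ?thesis using True assms by (simp add: cut_def flat_exp_def right_diff_distrib)
  next
    case False
    then have "s / \<kappa> \<le> 0" using assms by (simp add: divide_le_0_iff)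
    then show ?thesis using False assms by (simp add: cut_def flat_exp_def)
  qed
  have fnn: "0 \<le> flat_exp m y" for m y by (simp add: flat_exp_def)
  show "0 \<le> cut_deriv \<kappa> s"
  proof (cases "s / \<kappa> > 0")
    case True
    then show ?thesis unfolding cut_deriv_def using fnn by (intro add_nonneg_nonneg mult_nonneg_nonneg) auto
  qed (simp add: cut_deriv_def flat_exp_def)
  show "cut_deriv \<kappa> s \<le> 1"
  proof (cases "s / \<kappa> > 0")
    case True
    define t where "t = inverse (s / \<kappa>)"
    have t: "t > 0" "s / \<kappa> = inverse t" using True unfolding t_def by (simp_all only: inverse_inverse_eq inverse_positive_iff_positive)
    have "cut_deriv \<kappa> s = exp (- t) * (1 + t)"
      unfolding cut_deriv_def t(2) using t(1) by (simp add: flat_exp_def power2_eq_square algebra_simps)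
    also have "\<dots> \<le> exp (- t) * exp t" using exp_ge_add_one_self[of t] by (intro mult_left_mono) auto
    also have "\<dots> = 1" by (simp add: exp_minus)
    finally show ?thesis .
  qed (simp add: cut_deriv_def flat_exp_def)
qed

lemma cut_has_derivative:
  assumes "\<kappa> > 0"
  shows "(cut \<kappa> has_real_derivative cut_deriv \<kappa> s) (at s)"
proof -
  have "((\<lambda>s. flat_exp 0 (s / \<kappa>)) has_real_derivative flat_exp 2 (s / \<kappa>) * (1 / \<kappa>)) (at s)"
  proof -
    have "((\<lambda>s. s / \<kappa>) has_real_derivative 1 / \<kappa>) (at s)" by (rule DERIV_cdivide[OF DERIV_ident])
    from DERIV_chain2[where f = "flat_exp 0" and g = "\<lambda>s. s / \<kappa>", OF flat_exp_deriv this]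
    show ?thesis by (simp add: numeral_2_eq_2)
  qed
  from DERIV_mult[OF DERIV_ident this] show ?thesis
    unfolding cut_def[abs_def] cut_deriv_def by (simp add: algebra_simps)
qed

lemma test_function_cut:
  assumes "test_function S z"
  shows "test_function S (\<lambda>x. cut \<kappa> (z x))"
proof -
  have "smooth (\<lambda>x. flat_exp 0 (inverse \<kappa> * z x))"
    by (intro smooth_flat_exp smooth_mult smooth_const test_function_smooth[OF assms])
  from test_function_mult[OF assms this] show ?thesis
    by (simp add: cut_def divide_inverse mult.commute)
qed

subsection \<open>The energy form\<close>

locale elliptic =
  fixes \<Omega> :: "(real^'d) set" and a :: "'d \<Rightarrow> 'd \<Rightarrow> real^'d \<Rightarrow> real" and c :: "real^'d \<Rightarrow> real" and a0 :: real
  assumes open_dom: "open \<Omega>" and bounded_dom: "bounded \<Omega>"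
    and a_C1: "\<And>i j. C1_closure \<Omega> (a i j)"
    and a_sym: "\<And>i j x. x \<in> closure \<Omega> \<Longrightarrow> a i j x = a j i x"
    and a0_pos: "a0 > 0"
    and a_elliptic: "\<And>x \<xi>. x \<in> closure \<Omega> \<Longrightarrow>
           (\<Sum>i\<in>UNIV. \<Sum>j\<in>UNIV. a i j x * \<xi> $ i * \<xi> $ j) \<ge> a0 * (\<Sum>i\<in>UNIV. (\<xi> $ i)\<^sup>2)"
    and c_Linf: "c \<in> Linf_space \<Omega>" and c_nonneg: "AE x in lebesgue_on \<Omega>. c x \<ge> 0"
begin

abbreviation "M \<equiv> lebesgue_on \<Omega>"

text \<open>Gradients enter as families over the coordinates rather than as vectors, matching
  \<open>partial\<close> and \<open>weak_deriv\<close>, which deliver one function per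
  coordinate.\<close>

definition aq :: "real^'d \<Rightarrow> ('d \<Rightarrow> real) \<Rightarrow> ('d \<Rightarrow> real) \<Rightarrow> real" where
  "aq x p r = (\<Sum>i\<in>UNIV. \<Sum>j\<in>UNIV. a i j x * p i * r j)"

lemma finite_M: "finite_measure M"
  by (intro finite_measure_lebesgue_on lmeasurable_open bounded_dom open_dom)

definition "vol = measure M (space M)"

lemma vol_nonneg: "vol \<ge> 0" by (simp add: vol_def)

lemma integrable_const_M: "integrable M (\<lambda>x. b :: real)"
  using finite_M by (simp add: finite_measure.integrable_const)

lemma LINT_const_M: "(LINT x|M. (b :: real)) = b * vol"
  by (simp add: vol_def mult.commute)

lemma a_bounded: "\<exists>A>0. \<forall>i j. \<forall>x\<in>closure \<Omega>. \<bar>a i j x\<bar> \<le> A"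
proof -
  have comp: "compact (closure \<Omega>)" using bounded_dom by (simp add: compact_closure)
  have "\<exists>B. \<forall>x\<in>closure \<Omega>. \<bar>a i j x\<bar> \<le> B" for i j
  proof -
    have "continuous_on (closure \<Omega>) (a i j)" using a_C1[of i j] by (simp add: C1_closure_def)
    from bounded_continuous_compact[OF this comp] show ?thesis by metis
  qed
  then have "\<forall>p. \<exists>B. \<forall>x\<in>closure \<Omega>. \<bar>a (fst p) (snd p) x\<bar> \<le> B" by blast
  from choice[OF this] obtain B where B: "\<And>p x. x \<in> closure \<Omega> \<Longrightarrow> \<bar>a (fst p) (snd p) x\<bar> \<le> B p" by blast
  have "\<bar>a i j x\<bar> \<le> 1 + (\<Sum>p\<in>UNIV. \<bar>B p\<bar>)" if "x \<in> closure \<Omega>" for i j x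
  proof -
    have "\<bar>a i j x\<bar> \<le> \<bar>B (i, j)\<bar>" using B[OF that, of "(i, j)"] by simp
    also have "\<dots> \<le> (\<Sum>p\<in>UNIV. \<bar>B p\<bar>)" by (rule member_le_sum) auto
    finally show ?thesis by simp
  qed
  moreover have "1 + (\<Sum>p\<in>UNIV. \<bar>B p\<bar>) > 0" by (intro add_pos_nonneg sum_nonneg) auto
  ultimately show ?thesis by blast
qed

definition "amax = (SOME A. A > 0 \<and> (\<forall>i j. \<forall>x\<in>closure \<Omega>. \<bar>a i j x\<bar> \<le> A))"

lemma amax: "amax > 0" "x \<in> \<Omega> \<Longrightarrow> \<bar>a i j x\<bar> \<le> amax"
proof -
  have "\<exists>A. A > 0 \<and> (\<forall>i j. \<forall>x\<in>closure \<Omega>. \<bar>a i j x\<bar> \<le> A)" using a_bounded by blast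
  from someI_ex[OF this] have "amax > 0 \<and> (\<forall>i j. \<forall>x\<in>closure \<Omega>. \<bar>a i j x\<bar> \<le> amax)"
    unfolding amax_def .
  then show "amax > 0" "x \<in> \<Omega> \<Longrightarrow> \<bar>a i j x\<bar> \<le> amax"
    using subsetD[OF closure_subset, of x \<Omega>] by simp_all
qed

definition "cmax = (SOME B. B \<ge> 0 \<and> (AE x in M. \<bar>c x\<bar> \<le> B))"

lemma cmax: "cmax \<ge> 0" "AE x in M. \<bar>c x\<bar> \<le> cmax"
proof -
  obtain B where "AE x in M. \<bar>c x\<bar> \<le> B" using c_Linf by (auto simp: Linf_space_def)
  then have "AE x in M. \<bar>c x\<bar> \<le> max 0 B" by eventually_elim auto
  then have "\<exists>B. B \<ge> 0 \<and> (AE x in M. \<bar>c x\<bar> \<le> B)" by (intro exI[of _ "max 0 B"]) auto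
  from someI_ex[OF this] have "cmax \<ge> 0 \<and> (AE x in M. \<bar>c x\<bar> \<le> cmax)"
    unfolding cmax_def .
  then show "cmax \<ge> 0" "AE x in M. \<bar>c x\<bar> \<le> cmax" by simp_all
qed

lemma c_measurable: "c \<in> borel_measurable M"
  using c_Linf by (simp add: Linf_space_def)

lemma a_continuous: "continuous_on \<Omega> (a i j)"
  using a_C1[of i j] by (auto simp: C1_closure_def intro: continuous_on_subset[OF _ closure_subset])

lemma a_measurable: "a i j \<in> borel_measurable M"
  by (rule continuous_imp_measurable_on_sets_lebesgue[OF a_continuous])
    (use open_dom in \<open>simp add: sets_completionI_sets\<close>)

lemma aq_sym: "x \<in> \<Omega> \<Longrightarrow> aq x p r = aq x r p"
proof -
  assume "x \<in> \<Omega>"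
  then have s: "a i j x = a j i x" for i j using a_sym closure_subset by blast
  have "aq x p r = (\<Sum>j\<in>UNIV. \<Sum>i\<in>UNIV. a i j x * p i * r j)"
    unfolding aq_def by (rule sum.swap)
  also have "\<dots> = (\<Sum>j\<in>UNIV. \<Sum>i\<in>UNIV. a j i x * r j * p i)"
    by (intro sum.cong refl) (subst s, simp)
  finally show ?thesis by (simp add: aq_def)
qed

lemma aq_add: "aq x (\<lambda>i. p i + p' i) r = aq x p r + aq x p' r"
  by (simp add: aq_def algebra_simps sum.distrib)

lemma aq_scale: "aq x (\<lambda>i. s * p i) r = s * aq x p r"
  by (simp add: aq_def algebra_simps sum_distrib_left)

lemma aq_add_right: "aq x p (\<lambda>i. r i + r' i) = aq x p r + aq x p r'"
  by (simp add: aq_def algebra_simps sum.distrib)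

lemma aq_scale_right: "aq x p (\<lambda>i. s * r i) = s * aq x p r"
  by (simp add: aq_def algebra_simps sum_distrib_left)

lemma aq_ge: "x \<in> \<Omega> \<Longrightarrow> a0 * (\<Sum>i\<in>UNIV. (p i)\<^sup>2) \<le> aq x p p"
  using a_elliptic[of x "\<chi> i. p i"] closure_subset[of \<Omega>] by (auto simp: aq_def)

lemma aq_nonneg: "x \<in> \<Omega> \<Longrightarrow> 0 \<le> aq x p p"
  using aq_ge[of x p] a0_pos by (smt (verit) mult_nonneg_nonneg sum_nonneg zero_le_power2)

text \<open>The upper ellipticity constant: a product of two components is at most half the sum of
  their squares, and summation over all pairs then counts every square \<open>CARD('d)\<close>
  times.\<close>

definition "A1 = amax * real CARD('d)"

lemma A1_pos: "A1 > 0" using amax(1) by (simp add: A1_def)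

lemma aq_le: assumes "x \<in> \<Omega>" shows "aq x p p \<le> A1 * (\<Sum>i\<in>UNIV. (p i)\<^sup>2)"
proof -
  have "aq x p p \<le> (\<Sum>i\<in>UNIV. \<Sum>j\<in>UNIV. amax * ((p i)\<^sup>2 + (p j)\<^sup>2) / 2)"
    unfolding aq_def
  proof (intro sum_mono)
    fix i j
    have "2 * \<bar>p i * p j\<bar> \<le> (p i)\<^sup>2 + (p j)\<^sup>2"
      using sum_squares_bound[of "\<bar>p i\<bar>" "\<bar>p j\<bar>"] by (simp add: abs_mult)
    then have 1: "\<bar>p i * p j\<bar> \<le> ((p i)\<^sup>2 + (p j)\<^sup>2) / 2" by (simp only: le_divide_eq_numeral1 mult.commute)
    have "a i j x * p i * p j \<le> \<bar>a i j x\<bar> * \<bar>p i * p j\<bar>"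
      unfolding mult.assoc by (simp add: abs_mult[symmetric])
    also have "\<dots> \<le> amax * (((p i)\<^sup>2 + (p j)\<^sup>2) / 2)"
      using amax assms 1 by (intro mult_mono) auto
    finally show "a i j x * p i * p j \<le> amax * ((p i)\<^sup>2 + (p j)\<^sup>2) / 2" by simp
  qed
  also have "\<dots> = A1 * (\<Sum>i\<in>UNIV. (p i)\<^sup>2)"
    by (simp add: A1_def sum.distrib sum_distrib_left[symmetric] sum_divide_distrib[symmetric] algebra_simps)
  finally show ?thesis .
qed

text \<open>Nonnegativity of the quadratic form at s * p + r / s and at s * p - r / s.\<close>

lemma aq_Young:
  assumes x: "x \<in> \<Omega>" and "s \<noteq> 0"
  shows "2 * \<bar>aq x p r\<bar> \<le> s\<^sup>2 * aq x p p + aq x r r / s\<^sup>2"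
proof -
  have q: "0 \<le> s\<^sup>2 * aq x p p + 2 * t * aq x p r + aq x r r / s\<^sup>2" if t: "t = 1 \<or> t = -1" for t :: real
  proof -
    have "0 \<le> aq x (\<lambda>i. s * p i + (t / s) * r i) (\<lambda>i. s * p i + (t / s) * r i)" by (rule aq_nonneg[OF x])
    also have "\<dots> = s\<^sup>2 * aq x p p + 2 * t * aq x p r + t\<^sup>2 * aq x r r / s\<^sup>2"
      using \<open>s \<noteq> 0\<close> aq_sym[OF x, of r p]
      by (simp only: aq_add aq_add_right aq_scale aq_scale_right) (simp add: field_simps power2_eq_square)
    finally show ?thesis using t by auto
  qed
  show ?thesis using q[of 1] q[of "-1"] by linarith
qed

text \<open>A function together with a candidate for its gradient, treated as independent data. In
  this way one bilinear form serves test functions with \<open>partial\<close> as well as the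
  solution with its chosen weak derivatives.\<close>

definition adm :: "(real^'d \<Rightarrow> real) \<Rightarrow> ('d \<Rightarrow> real^'d \<Rightarrow> real) \<Rightarrow> bool" where
  "adm \<phi> p \<longleftrightarrow> sqint M \<phi> \<and> (\<forall>i. sqint M (p i))"

definition form_density :: "real \<Rightarrow> (real^'d \<Rightarrow> real) \<Rightarrow> ('d \<Rightarrow> real^'d \<Rightarrow> real) \<Rightarrow>
    (real^'d \<Rightarrow> real) \<Rightarrow> ('d \<Rightarrow> real^'d \<Rightarrow> real) \<Rightarrow> real^'d \<Rightarrow> real" where
  "form_density \<mu> \<phi> p \<psi> r x = aq x (\<lambda>i. p i x) (\<lambda>i. r i x) + (c x + \<mu>) * (\<phi> x * \<psi> x)"

text \<open>The bilinear form of the operator A + \<mu>; the shift \<mu> is the parameter that is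
  later tied to the Laplace variable.\<close>

definition form :: "real \<Rightarrow> (real^'d \<Rightarrow> real) \<Rightarrow> ('d \<Rightarrow> real^'d \<Rightarrow> real) \<Rightarrow>
    (real^'d \<Rightarrow> real) \<Rightarrow> ('d \<Rightarrow> real^'d \<Rightarrow> real) \<Rightarrow> real" where
  "form \<mu> \<phi> p \<psi> r = (LINT x|M. form_density \<mu> \<phi> p \<psi> r x)"

lemma aq_integrable:
  assumes "\<And>i. sqint M (p i)" "\<And>i. sqint M (r i)"
  shows "integrable M (\<lambda>x. aq x (\<lambda>i. p i x) (\<lambda>i. r i x))"
  unfolding aq_def mult.assoc
proof (intro Bochner_Integration.integrable_sum)
  fix i j
  have "AE x in M. \<bar>a i j x\<bar> \<le> amax" using amax(2) by (intro AE_I2) (simp add: space_restrict_space)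
  from sqint_mult[OF sqint_bounded_mult[OF assms(1) a_measurable this] assms(2)]
  show "integrable M (\<lambda>x. a i j x * (p i x * r j x))" by (simp add: mult.assoc)
qed

lemma c_integrable:
  assumes "sqint M \<phi>" "sqint M \<psi>"
  shows "integrable M (\<lambda>x. c x * (\<phi> x * \<psi> x))"
  using sqint_mult[OF sqint_bounded_mult[OF assms(1) c_measurable cmax(2)] assms(2)] by (simp add: mult.assoc)

lemma form_integrable:
  assumes "adm \<phi> p" "adm \<psi> r"
  shows "integrable M (form_density \<mu> \<phi> p \<psi> r)"
  unfolding form_density_def[abs_def] distrib_right
  using assms
  by (intro Bochner_Integration.integrable_add aq_integrable c_integrable integrable_mult_right sqint_mult)
    (auto simp: adm_def)

lemma adm_add:
  assumes "adm \<phi> p" "adm \<psi> r" shows "adm (\<lambda>x. \<phi> x + \<psi> x) (\<lambda>i x. p i x + r i x)"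
  using assms by (auto simp: adm_def intro: sqint_add)

lemma adm_cmult:
  assumes "adm \<phi> p" shows "adm (\<lambda>x. s * \<phi> x) (\<lambda>i x. s * p i x)"
  using assms by (auto simp: adm_def intro: sqint_cmult)

lemma adm_diff:
  assumes "adm \<phi> p" "adm \<psi> r" shows "adm (\<lambda>x. \<phi> x - \<psi> x) (\<lambda>i x. p i x - r i x)"
  using assms by (auto simp: adm_def intro: sqint_diff)

lemma form_sym: "form \<mu> \<phi> p \<psi> r = form \<mu> \<psi> r \<phi> p"
  unfolding form_def
  by (rule Bochner_Integration.integral_cong)
    (auto simp: form_density_def space_restrict_space mult.commute aq_sym)

lemma form_add:
  assumes "adm \<phi> p" "adm \<phi>' p'" "adm \<psi> r"
  shows "form \<mu> (\<lambda>x. \<phi> x + \<phi>' x) (\<lambda>i x. p i x + p' i x) \<psi> r = form \<mu> \<phi> p \<psi> r + form \<mu> \<phi>' p' \<psi> r"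
proof -
  have "form_density \<mu> (\<lambda>x. \<phi> x + \<phi>' x) (\<lambda>i x. p i x + p' i x) \<psi> r =
      (\<lambda>x. form_density \<mu> \<phi> p \<psi> r x + form_density \<mu> \<phi>' p' \<psi> r x)"
    by (intro ext) (simp add: form_density_def aq_add algebra_simps)
  then show ?thesis
    unfolding form_def using form_integrable[OF assms(1,3)] form_integrable[OF assms(2,3)] by simp
qed

lemma form_cmult: "form \<mu> (\<lambda>x. s * \<phi> x) (\<lambda>i x. s * p i x) \<psi> r = s * form \<mu> \<phi> p \<psi> r"
proof -
  have "form_density \<mu> (\<lambda>x. s * \<phi> x) (\<lambda>i x. s * p i x) \<psi> r = (\<lambda>x. s * form_density \<mu> \<phi> p \<psi> r x)"
    by (intro ext) (simp add: form_density_def aq_scale algebra_simps)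
  then show ?thesis unfolding form_def by simp
qed

lemma form_diff:
  assumes "adm \<phi> p" "adm \<phi>' p'" "adm \<psi> r"
  shows "form \<mu> (\<lambda>x. \<phi> x - \<phi>' x) (\<lambda>i x. p i x - p' i x) \<psi> r = form \<mu> \<phi> p \<psi> r - form \<mu> \<phi>' p' \<psi> r"
  using form_add[OF assms(1) adm_cmult[OF assms(2), of "-1"] assms(3), of \<mu>]
    form_cmult[of \<mu> "-1" \<phi>' p' \<psi> r] by simp

lemma form_density_ge:
  assumes "x \<in> \<Omega>" "c x \<ge> 0"
  shows "\<mu> * (\<phi> x)\<^sup>2 \<le> form_density \<mu> \<phi> p \<phi> p x"
  using aq_nonneg[OF assms(1)] assms(2) unfolding form_density_def
  by (simp add: distrib_right power2_eq_square[symmetric] add_increasing)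

lemma form_ge:
  assumes "adm \<phi> p"
  shows "\<mu> * (LINT x|M. (\<phi> x)\<^sup>2) \<le> form \<mu> \<phi> p \<phi> p"
proof -
  have "(LINT x|M. \<mu> * (\<phi> x)\<^sup>2) \<le> form \<mu> \<phi> p \<phi> p"
    unfolding form_def
  proof (rule integral_mono_AE)
    show "AE x in M. \<mu> * (\<phi> x)\<^sup>2 \<le> form_density \<mu> \<phi> p \<phi> p x"
      using c_nonneg AE_space by eventually_elim (auto intro: form_density_ge simp: space_restrict_space)
  qed (use assms form_integrable in \<open>auto simp: adm_def sqint_def\<close>)
  then show ?thesis by simp
qed

lemma form_nonneg: "adm \<phi> p \<Longrightarrow> \<mu> \<ge> 0 \<Longrightarrow> 0 \<le> form \<mu> \<phi> p \<phi> p"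
  using form_ge[of \<phi> p \<mu>] by (smt (verit) integral_nonneg_AE AE_I2 mult_nonneg_nonneg zero_le_power2)

lemma form_le:
  assumes "adm \<phi> p" "\<mu> \<ge> 0"
  shows "form \<mu> \<phi> p \<phi> p \<le> (A1 + cmax + \<mu>) * ((LINT x|M. (\<phi> x)\<^sup>2) + (\<Sum>i\<in>UNIV. LINT x|M. (p i x)\<^sup>2))"
proof -
  let ?B = "A1 + cmax + \<mu>"
  have i: "integrable M (\<lambda>x. (\<phi> x)\<^sup>2)" "integrable M (\<lambda>x. (p i x)\<^sup>2)" for i
    using assms by (auto simp: adm_def sqint_def)
  have "form \<mu> \<phi> p \<phi> p \<le> (LINT x|M. ?B * ((\<phi> x)\<^sup>2 + (\<Sum>i\<in>UNIV. (p i x)\<^sup>2)))"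
    unfolding form_def
  proof (rule integral_mono_AE)
    show "integrable M (\<lambda>x. ?B * ((\<phi> x)\<^sup>2 + (\<Sum>i\<in>UNIV. (p i x)\<^sup>2)))" using i by auto
    show "AE x in M. form_density \<mu> \<phi> p \<phi> p x \<le> ?B * ((\<phi> x)\<^sup>2 + (\<Sum>i\<in>UNIV. (p i x)\<^sup>2))"
      using cmax(2) AE_space
    proof eventually_elim
      case (elim x)
      have s: "0 \<le> (\<Sum>i\<in>UNIV. (p i x)\<^sup>2)" by (intro sum_nonneg) auto
      have "aq x (\<lambda>i. p i x) (\<lambda>i. p i x) \<le> A1 * (\<Sum>i\<in>UNIV. (p i x)\<^sup>2)"
        using elim by (intro aq_le) (simp add: space_restrict_space)
      also have "\<dots> \<le> ?B * (\<Sum>i\<in>UNIV. (p i x)\<^sup>2)"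
        using s cmax(1) assms(2) by (intro mult_right_mono) auto
      finally have 1: "aq x (\<lambda>i. p i x) (\<lambda>i. p i x) \<le> ?B * (\<Sum>i\<in>UNIV. (p i x)\<^sup>2)" .
      have "(c x + \<mu>) * (\<phi> x * \<phi> x) \<le> ?B * (\<phi> x * \<phi> x)"
        using elim A1_pos by (intro mult_right_mono) auto
      with 1 show ?case unfolding form_density_def by (simp add: distrib_left power2_eq_square)
    qed
  qed (use assms form_integrable in auto)
  also have "\<dots> = ?B * ((LINT x|M. (\<phi> x)\<^sup>2) + (\<Sum>i\<in>UNIV. LINT x|M. (p i x)\<^sup>2))"
    using i by simp
  finally show ?thesis .
qed

lemma form_quadratic:
  assumes "adm \<phi> p" "adm \<psi> r"
  shows "form \<mu> (\<lambda>x. \<phi> x + t * \<psi> x) (\<lambda>i x. p i x + t * r i x) (\<lambda>x. \<phi> x + t * \<psi> x) (\<lambda>i x. p i x + t * r i x) =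
    form \<mu> \<phi> p \<phi> p + 2 * t * form \<mu> \<phi> p \<psi> r + t\<^sup>2 * form \<mu> \<psi> r \<psi> r"
proof -
  let ?A = "form \<mu> \<phi> p \<phi> p" and ?B = "form \<mu> \<psi> r \<psi> r" and ?C = "form \<mu> \<phi> p \<psi> r"
  note ad = adm_add[OF assms(1) adm_cmult[OF assms(2), of t]]
  have "form \<mu> (\<lambda>x. \<phi> x + t * \<psi> x) (\<lambda>i x. p i x + t * r i x) (\<lambda>x. \<phi> x + t * \<psi> x) (\<lambda>i x. p i x + t * r i x)
      = form \<mu> \<phi> p (\<lambda>x. \<phi> x + t * \<psi> x) (\<lambda>i x. p i x + t * r i x) +
      t * form \<mu> \<psi> r (\<lambda>x. \<phi> x + t * \<psi> x) (\<lambda>i x. p i x + t * r i x)"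
    unfolding form_cmult[symmetric] by (rule form_add[OF assms(1) adm_cmult[OF assms(2)] ad])
  also have "form \<mu> \<phi> p (\<lambda>x. \<phi> x + t * \<psi> x) (\<lambda>i x. p i x + t * r i x) = ?A + t * ?C"
    unfolding form_sym[of \<mu> \<phi> p "\<lambda>x. \<phi> x + t * \<psi> x"]
    unfolding form_add[OF assms(1) adm_cmult[OF assms(2)] assms(1)] form_cmult
    by (simp add: form_sym[of \<mu> \<psi> r \<phi> p])
  also have "form \<mu> \<psi> r (\<lambda>x. \<phi> x + t * \<psi> x) (\<lambda>i x. p i x + t * r i x) = ?C + t * ?B"
    unfolding form_sym[of \<mu> \<psi> r "\<lambda>x. \<phi> x + t * \<psi> x"]
    unfolding form_add[OF assms(1) adm_cmult[OF assms(2)] assms(2)] form_cmult by simp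
  finally show ?thesis by (simp add: algebra_simps power2_eq_square)
qed

lemma form_Cauchy_Schwarz:
  assumes "adm \<phi> p" "adm \<psi> r" "\<mu> \<ge> 0"
  shows "(form \<mu> \<phi> p \<psi> r)\<^sup>2 \<le> form \<mu> \<phi> p \<phi> p * form \<mu> \<psi> r \<psi> r"
proof (rule discriminant_bound)
  show "0 \<le> form \<mu> \<phi> p \<phi> p + 2 * t * form \<mu> \<phi> p \<psi> r + t\<^sup>2 * form \<mu> \<psi> r \<psi> r" for t
    unfolding form_quadratic[OF assms(1,2), symmetric] by (intro form_nonneg adm_add adm_cmult assms)
  show "0 \<le> form \<mu> \<psi> r \<psi> r" by (intro form_nonneg assms)
qed

end

subsection \<open>Approximate solutions of the elliptic problem\<close>

locale observation = elliptic \<Omega> a c a0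
  for \<Omega> :: "(real^'d) set" and a :: "'d \<Rightarrow> 'd \<Rightarrow> real^'d \<Rightarrow> real" and c :: "real^'d \<Rightarrow> real" and a0 :: real +
  fixes \<omega> :: "(real^'d) set"
  assumes open_obs: "open \<omega>" and obs_sub: "\<omega> \<subseteq> \<Omega>"
begin

abbreviation "tform \<mu> \<phi> \<psi> \<equiv> form \<mu> \<phi> (\<lambda>i. partial i \<phi>) \<psi> (\<lambda>i. partial i \<psi>)"

text \<open>A double role: applied to u this is the observed quantity, applied to test functions it
  is the functional given by the right-hand side 1_\<omega> of the auxiliary elliptic problem. This
  coincidence is why the observation drops out of the final estimate.\<close>

definition "obs \<phi> = (LINT x|M. indicator \<omega> x * \<phi> x)"

lemma test_adm: "test_function \<Omega> \<phi> \<Longrightarrow> adm \<phi> (\<lambda>i. partial i \<phi>)"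
  by (simp add: adm_def test_function_sqint[OF open_dom])

lemma obs_measurable: "indicat_real \<omega> \<in> borel_measurable M"
  using open_obs
  by (intro measurable_restrict_space1 borel_measurable_indicator sets_completionI_sets) simp

lemma obs_integrable:
  assumes "sqint M \<phi>" shows "integrable M (\<lambda>x. indicator \<omega> x * \<phi> x)"
proof -
  have "AE x in M. \<bar>indicat_real \<omega> x\<bar> \<le> 1" by (auto simp: indicator_def)
  from sqint_imp_integrable[OF sqint_bounded_mult[OF assms obs_measurable this] finite_M]
  show ?thesis .
qed

lemma obs_add:
  assumes "sqint M \<phi>" "sqint M \<psi>"
  shows "obs (\<lambda>x. \<phi> x + t * \<psi> x) = obs \<phi> + t * obs \<psi>"
proof -
  have "(\<lambda>x. indicator \<omega> x * (\<phi> x + t * \<psi> x)) = (\<lambda>x. indicator \<omega> x * \<phi> x + t * (indicator \<omega> x * \<psi> x))"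
    by (intro ext) (simp add: algebra_simps)
  then show ?thesis unfolding obs_def using obs_integrable[OF assms(1)] obs_integrable[OF assms(2)] by simp
qed

lemma obs_le:
  assumes \<phi>: "sqint M \<phi>" and s: "s > 0"
  shows "obs \<phi> \<le> s * (LINT x|M. (\<phi> x)\<^sup>2) + vol / (4 * s)"
proof -
  have i: "integrable M (\<lambda>x. (\<phi> x)\<^sup>2)" using \<phi> by (simp add: sqint_def)
  have "obs \<phi> \<le> (LINT x|M. s * (\<phi> x)\<^sup>2 + 1 / (4 * s))"
    unfolding obs_def
  proof (rule integral_mono)
    show "integrable M (\<lambda>x. s * (\<phi> x)\<^sup>2 + 1 / (4 * s))"
      using i integrable_const_M by (intro Bochner_Integration.integrable_add integrable_mult_right)
    show "indicator \<omega> x * \<phi> x \<le> s * (\<phi> x)\<^sup>2 + 1 / (4 * s)" for x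
    proof -
      have "0 \<le> (2 * s * \<phi> x - 1)\<^sup>2 / (4 * s)" using s by simp
      also have "\<dots> = s * (\<phi> x)\<^sup>2 + 1 / (4 * s) - \<phi> x" using s by (simp add: power2_eq_square field_simps)
      finally have "\<phi> x \<le> s * (\<phi> x)\<^sup>2 + 1 / (4 * s)" by simp
      moreover have "0 \<le> s * (\<phi> x)\<^sup>2 + 1 / (4 * s)" using s by simp
      ultimately show ?thesis by (simp add: indicator_def)
    qed
  qed (rule obs_integrable[OF \<phi>])
  also have "\<dots> = s * (LINT x|M. (\<phi> x)\<^sup>2) + vol / (4 * s)"
    using i integrable_const_M[of "1 / (4 * s)"] LINT_const_M[of "1 / (4 * s)"] by simp
  finally show ?thesis .
qed

definition energy :: "real \<Rightarrow> (real^'d \<Rightarrow> real) \<Rightarrow> real" where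
  "energy \<mu> \<phi> = tform \<mu> \<phi> \<phi> / 2 - obs \<phi>"

lemma energy_ge:
  assumes "test_function \<Omega> \<phi>" "\<mu> > 0"
  shows "- vol / (2 * \<mu>) \<le> energy \<mu> \<phi>"
proof -
  \<comment> \<open>With s = \<mu> / 2 the quadratic term is exactly what half of the form
    dominates.\<close>
  have "obs \<phi> \<le> \<mu> / 2 * (LINT x|M. (\<phi> x)\<^sup>2) + vol / (2 * \<mu>)"
    using obs_le[OF test_function_sqint(1)[OF open_dom assms(1)], of "\<mu> / 2"] assms(2) by simp
  then show ?thesis
    using form_ge[OF test_adm[OF assms(1)], of \<mu>] unfolding energy_def by simp
qed

text \<open>The coefficient of t is the residual of the weak equation for \<phi>, tested with
  \<psi>. Near-minimality therefore bounds the residual through a discriminant.\<close>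

lemma energy_add:
  assumes \<phi>: "test_function \<Omega> \<phi>" and \<psi>: "test_function \<Omega> \<psi>"
  shows "energy \<mu> (\<lambda>x. \<phi> x + t * \<psi> x) =
    energy \<mu> \<phi> + t * (tform \<mu> \<phi> \<psi> - obs \<psi>) + t\<^sup>2 / 2 * tform \<mu> \<psi> \<psi>"
proof -
  have d: "\<phi> differentiable (at x)" "\<psi> differentiable (at x)" for x
    using \<phi> \<psi> by (auto intro: smooth_differentiable test_function_smooth)
  have "partial i (\<lambda>x. \<phi> x + t * \<psi> x) = (\<lambda>x. partial i \<phi> x + t * partial i \<psi> x)" for i
    by (intro ext) (simp add: partial_add partial_cmult d)
  then show ?thesis
    unfolding energy_def obs_add[OF test_function_sqint(1)[OF open_dom \<phi>] test_function_sqint(1)[OF open_dom \<psi>]]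
    using form_quadratic[OF test_adm[OF \<phi>] test_adm[OF \<psi>], of \<mu> t] by (simp add: field_simps)
qed

text \<open>The quadratic part shrinks pointwise, because both the values and the derivative factor
  of \<open>cut\<close> are controlled and c + \<mu> is nonnegative. The linear part loses at most
  \<kappa> at each point, hence at most \<kappa> * vol in total.\<close>

lemma energy_cut:
  assumes z: "test_function \<Omega> z" and \<kappa>: "\<kappa> > 0" and \<mu>: "\<mu> \<ge> 0"
  shows "energy \<mu> (\<lambda>x. cut \<kappa> (z x)) \<le> energy \<mu> z + \<kappa> * vol"
proof -
  let ?y = "\<lambda>x. cut \<kappa> (z x)"
  have y: "test_function \<Omega> ?y" by (rule test_function_cut[OF z])
  have p: "partial i ?y x = cut_deriv \<kappa> (z x) * partial i z x" for i x
    by (rule partial_compose[OF cut_has_derivative[OF \<kappa>] smooth_differentiable[OF test_function_smooth[OF z]]])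
  have "tform \<mu> ?y ?y \<le> tform \<mu> z z"
    unfolding form_def
  proof (rule integral_mono_AE)
    show "AE x in M. form_density \<mu> ?y (\<lambda>i. partial i ?y) ?y (\<lambda>i. partial i ?y) x
      \<le> form_density \<mu> z (\<lambda>i. partial i z) z (\<lambda>i. partial i z) x"
      using c_nonneg AE_space
    proof eventually_elim
      case (elim x)
      let ?d = "cut_deriv \<kappa> (z x)" and ?q = "aq x (\<lambda>i. partial i z x) (\<lambda>i. partial i z x)"
      have q: "?q \<ge> 0" using elim by (intro aq_nonneg) (simp add: space_restrict_space)
      have "?d * ?d \<le> 1 * 1" using cut_bounds(4,5)[OF \<kappa>, of "z x"] by (intro mult_mono) auto
      then have "?d * (?d * ?q) \<le> ?q" using mult_right_mono[OF _ q, of "?d * ?d" 1] by simp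
      moreover have "cut \<kappa> (z x) * cut \<kappa> (z x) \<le> z x * z x"
        using abs_le_square_iff[of "cut \<kappa> (z x)" "z x"] cut_bounds(2)[OF \<kappa>, of "z x"]
        by (simp add: power2_eq_square)
      then have "(c x + \<mu>) * (cut \<kappa> (z x) * cut \<kappa> (z x)) \<le> (c x + \<mu>) * (z x * z x)"
        using elim \<mu> by (intro mult_left_mono) auto
      ultimately show ?case unfolding form_density_def p aq_scale aq_scale_right by (rule add_mono)
    qed
  qed (intro form_integrable test_adm y z)+
  moreover have "obs z - \<kappa> * vol \<le> obs ?y"
  proof -
    have "obs z - \<kappa> * vol = (LINT x|M. indicator \<omega> x * z x - \<kappa>)"
      unfolding obs_def LINT_const_M[symmetric]
      by (rule Bochner_Integration.integral_diff[symmetric, OF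
            obs_integrable[OF test_function_sqint(1)[OF open_dom z]] integrable_const_M])
    also have "\<dots> \<le> obs ?y"
      unfolding obs_def
    proof (rule integral_mono)
      show "indicator \<omega> x * z x - \<kappa> \<le> indicator \<omega> x * cut \<kappa> (z x)" for x
        using cut_bounds(3)[OF \<kappa>, of "z x"] \<kappa> by (auto simp: indicator_def)
    qed (auto intro!: obs_integrable test_function_sqint(1)[OF open_dom] y z integrable_const_M)
    finally show ?thesis .
  qed
  ultimately show ?thesis unfolding energy_def by (simp add: field_simps)
qed

text \<open>The residual is measured in the norm dual to the energy norm, in squared form;
  \<epsilon> = 0 would be the exact equation against test functions. The bound on the square
  integral involves neither \<mu> nor \<epsilon>.\<close>

definition approx_sol :: "real \<Rightarrow> real \<Rightarrow> (real^'d \<Rightarrow> real) \<Rightarrow> bool" where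
  "approx_sol \<mu> \<epsilon> z \<longleftrightarrow> test_function \<Omega> z \<and> (\<forall>x. 0 \<le> z x) \<and> (LINT x|M. (z x)\<^sup>2) \<le> 4 * vol + 2 \<and>
     (\<forall>\<psi>. test_function \<Omega> \<psi> \<longrightarrow> (tform \<mu> z \<psi> - obs \<psi>)\<^sup>2 \<le> \<epsilon>\<^sup>2 * tform \<mu> \<psi> \<psi>)"

text \<open>Truncation does not increase the energy, so near-minimisers can be chosen nonnegative: this
  replaces the weak maximum principle.\<close>

lemma approx_sol_exists:
  assumes \<mu>: "\<mu> \<ge> 1" and \<epsilon>: "0 < \<epsilon>" "\<epsilon> \<le> 1"
  shows "\<exists>z. approx_sol \<mu> \<epsilon> z"
proof -
  \<comment> \<open>The function z will be within 2 * \<delta> of the infimum, one \<delta> for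
    near-minimality and one for the truncation. The discriminant then yields the factor 4 *
    \<delta>, which is the square of \<epsilon>.\<close>
  define \<delta> where "\<delta> = \<epsilon>\<^sup>2 / 4"
  have \<delta>: "\<delta> > 0" "2 * \<delta> \<le> 1 / 2" using \<epsilon> power_le_one[of \<epsilon> 2] by (auto simp: \<delta>_def)
  let ?J = "energy \<mu> ` {\<phi>. test_function \<Omega> \<phi>}"
  have bdd: "bdd_below ?J" using energy_ge[of _ \<mu>] \<mu> by (auto intro!: bdd_belowI2[of _ "- vol / (2 * \<mu>)"])
  have ne: "?J \<noteq> {}" using test_function_zero by auto
  have "\<exists>y\<in>?J. y < Inf ?J + \<delta>" using cInf_lessD[OF ne, of "Inf ?J + \<delta>"] \<delta> by auto
  then obtain z0 where z0: "test_function \<Omega> z0" "energy \<mu> z0 < Inf ?J + \<delta>" by auto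
  have z0min: "energy \<mu> z0 \<le> energy \<mu> \<phi> + \<delta>" if "test_function \<Omega> \<phi>" for \<phi>
    using cInf_lower[OF _ bdd, of "energy \<mu> \<phi>"] that z0(2) by force
  \<comment> \<open>Small enough for the truncation to cost at most \<delta>; the summand 1 keeps
    the denominator positive.\<close>
  define \<kappa> where "\<kappa> = \<delta> / (vol + 1)"
  have \<kappa>: "\<kappa> > 0" "\<kappa> * vol \<le> \<delta>" using \<delta>(1) vol_nonneg by (auto simp: \<kappa>_def field_simps)
  define z where "z x = cut \<kappa> (z0 x)" for x
  have z: "test_function \<Omega> z" unfolding z_def[abs_def] by (rule test_function_cut[OF z0(1)])
  have zmin: "energy \<mu> z \<le> energy \<mu> \<phi> + 2 * \<delta>" if "test_function \<Omega> \<phi>" for \<phi>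
    using energy_cut[OF z0(1) \<kappa>(1), of \<mu>] z0min[OF that] \<kappa>(2) \<mu> unfolding z_def[abs_def] by simp
  have nn: "0 \<le> z x" for x unfolding z_def by (rule cut_bounds(1)[OF \<kappa>(1)])
  have "(tform \<mu> z \<psi> - obs \<psi>)\<^sup>2 \<le> \<epsilon>\<^sup>2 * tform \<mu> \<psi> \<psi>" if \<psi>: "test_function \<Omega> \<psi>" for \<psi>
  proof -
    have "((tform \<mu> z \<psi> - obs \<psi>) / 2)\<^sup>2 \<le> (2 * \<delta>) * (tform \<mu> \<psi> \<psi> / 2)"
    proof (rule discriminant_bound)
      fix t
      have "test_function \<Omega> (\<lambda>x. z x + t * \<psi> x)" by (intro test_function_add z test_function_cmult \<psi>)
      from zmin[OF this] show "0 \<le> 2 * \<delta> + 2 * t * ((tform \<mu> z \<psi> - obs \<psi>) / 2) + t\<^sup>2 * (tform \<mu> \<psi> \<psi> / 2)"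
        unfolding energy_add[OF z \<psi>] by simp
      show "tform \<mu> \<psi> \<psi> / 2 \<ge> 0" using form_nonneg[OF test_adm[OF \<psi>], of \<mu>] \<mu> by simp
    qed
    then show ?thesis by (simp add: \<delta>_def power_divide field_simps)
  qed
  moreover have "(LINT x|M. (z x)\<^sup>2) \<le> 4 * vol + 2"
  proof -
    let ?I = "LINT x|M. (z x)\<^sup>2"
    have e0: "energy \<mu> (\<lambda>x. 0) = 0"
      by (simp add: energy_def obs_def form_def form_density_def aq_def partial_const)
    have "energy \<mu> z \<le> 1 / 2" using zmin[OF test_function_zero] \<delta>(2) e0 by simp
    moreover have "\<mu> * ?I \<le> tform \<mu> z z" by (rule form_ge[OF test_adm[OF z]])
    \<comment> \<open>The parameter \<mu> / 4 uses up half of the coercive term \<mu> / 2. What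
      remains is \<mu> * ?I / 4 \<le> vol / \<mu> + 1 / 2, and \<mu> \<ge> 1 gives the bound 4 * vol
      + 2.\<close>
    moreover have "obs z \<le> \<mu> / 4 * ?I + vol / \<mu>"
      using obs_le[OF test_function_sqint(1)[OF open_dom z], of "\<mu> / 4"] \<mu> by simp
    ultimately have "\<mu> * ?I / 4 \<le> vol / \<mu> + 1 / 2" unfolding energy_def by (simp add: field_simps)
    moreover have "vol / \<mu> \<le> vol" using \<mu> vol_nonneg by (simp add: divide_le_eq mult_left_le mult_le_cancel_left1)
    moreover have "?I \<le> \<mu> * ?I" using \<mu> by (intro mult_right_mono[of 1 \<mu> ?I, simplified] integral_nonneg_AE) auto
    ultimately show ?thesis by linarith
  qed
  ultimately have "approx_sol \<mu> \<epsilon> z" using z nn by (simp add: approx_sol_def)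
  then show ?thesis by blast
qed

end

context observation
begin

subsection \<open>Logarithmic estimate\<close>

lemma aq_Young': assumes x: "x \<in> \<Omega>" and "t > 0" shows "2 * aq x p r \<le> t * aq x p p + aq x r r / t"
  using aq_Young[OF x, of "sqrt t" p r] assms(2) by simp

lemma aq_diff_le:
  assumes x: "x \<in> \<Omega>"
  shows "aq x (\<lambda>i. p i - r i) (\<lambda>i. p i - r i) \<le> 2 * aq x p p + 2 * aq x r r"
proof -
  have "aq x (\<lambda>i. p i + (-1) * r i) (\<lambda>i. p i + (-1) * r i) = aq x p p - 2 * aq x p r + aq x r r"
    using aq_sym[OF x, of r p] unfolding aq_add aq_add_right aq_scale aq_scale_right by simp
  moreover have "- 2 * aq x p r \<le> aq x p p + aq x r r"
    using aq_Young[OF x, of 1 p r] by simp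
  ultimately show ?thesis by simp
qed

lemma approx_solD:
  assumes "approx_sol \<mu> \<epsilon> z"
  shows "test_function \<Omega> z" "0 \<le> z x" "(LINT x|M. (z x)\<^sup>2) \<le> 4 * vol + 2"
    "test_function \<Omega> \<psi> \<Longrightarrow> (tform \<mu> z \<psi> - obs \<psi>)\<^sup>2 \<le> \<epsilon>\<^sup>2 * tform \<mu> \<psi> \<psi>"
  using assms by (auto simp: approx_sol_def)

text \<open>The equation is tested with \<open>\<eta>\<^sup>2 / (z + \<epsilon>)\<close>.\<close>

lemma log_estimate:
  assumes \<eta>: "test_function \<Omega> \<eta>" and \<eta>b: "\<And>x. 0 \<le> \<eta> x" "\<And>x. \<eta> x \<le> 1"
    and \<mu>: "\<mu> \<ge> 1" and \<epsilon>: "0 < \<epsilon>" "\<epsilon> \<le> 1" and z: "approx_sol \<mu> \<epsilon> z"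
    and p_def: "\<And>i x. p i x = partial i z x / (z x + \<epsilon>)"
    and C_def: "C = 12 * (LINT x|M. aq x (\<lambda>i. partial i \<eta> x) (\<lambda>i. partial i \<eta> x)) + 8 * (cmax + 1) * vol + 8"
  shows "integrable M (\<lambda>x. (\<eta> x)\<^sup>2 * aq x (\<lambda>i. p i x) (\<lambda>i. p i x))"
    "(LINT x|M. (\<eta> x)\<^sup>2 * aq x (\<lambda>i. p i x) (\<lambda>i. p i x)) \<le> C * \<mu>"
    "integrable M (\<lambda>x. indicator \<omega> x * ((\<eta> x)\<^sup>2 / (z x + \<epsilon>)))"
    "(LINT x|M. indicator \<omega> x * ((\<eta> x)\<^sup>2 / (z x + \<epsilon>))) \<le> C * \<mu>"
proof -
  note zt = approx_solD(1)[OF z] and z0 = approx_solD(2)[OF z]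
  \<comment> \<open>As z may vanish, its reciprocal is regularised, with the very \<epsilon> that
    measures the residual of z. In the residual term every factor w is then accompanied by a factor
    \<epsilon>, and \<epsilon> * w \<le> 1 keeps that term bounded.\<close>
  define w where "w x = inverse (z x + \<epsilon>)" for x
  have zpos: "z x + \<epsilon> > 0" for x using z0[of x] \<epsilon>(1) by simp
  have w: "w x > 0" "w x * (z x + \<epsilon>) = 1" "w x * \<epsilon> \<le> 1" "w x * z x \<le> 1" for x
    using zpos[of x] z0[of x] \<epsilon>(1) by (auto simp: w_def field_simps)
  have ws: "smooth w"
    unfolding w_def[abs_def]
    by (intro smooth_inverse smooth_add smooth_const test_function_smooth[OF zt]) (use zpos in \<open>auto simp: less_imp_neq[symmetric]\<close>)
  have p: "p i x = w x * partial i z x" for i x by (simp add: p_def w_def divide_inverse mult.commute)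
  have dz: "z differentiable (at x)" "\<eta> differentiable (at x)" "w differentiable (at x)" for x
    using zt \<eta> ws by (auto intro: smooth_differentiable test_function_smooth)
  have pw: "partial i w x = - (w x * p i x)" for i x
  proof -
    have "(inverse has_real_derivative - (w x * w x)) (at (z x + \<epsilon>))"
      using DERIV_inverse[of "z x + \<epsilon>"] zpos[of x] by (simp add: w_def power2_eq_square)
    from partial_compose[where f = "\<lambda>x. z x + \<epsilon>", OF this, of i]
    have "partial i w x = - (w x * w x) * partial i (\<lambda>x. z x + \<epsilon>) x"
      unfolding w_def[abs_def] using dz(1) by (simp add: w_def)
    also have "partial i (\<lambda>x. z x + \<epsilon>) x = partial i z x"
      using partial_add[of z x "\<lambda>_. \<epsilon>" i] dz(1) by (simp add: partial_const)
    finally show ?thesis by (simp add: p)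
  qed
  let ?\<psi> = "\<lambda>x. (\<eta> x * w x) * \<eta> x"
  have \<psi>t: "test_function \<Omega> ?\<psi>"
    by (rule test_function_mult[OF \<eta> smooth_mult[OF test_function_smooth[OF \<eta>] ws]])
  have p\<psi>: "partial i ?\<psi> x = w x * (2 * \<eta> x * partial i \<eta> x - \<eta> x * (\<eta> x * p i x))" for i x
  proof -
    have 1: "partial i (\<lambda>x. \<eta> x * w x) x = \<eta> x * partial i w x + partial i \<eta> x * w x"
      by (rule partial_mult[OF dz(2,3)])
    have "(\<lambda>x. \<eta> x * w x) differentiable (at x)" by (intro differentiable_mult dz)
    from partial_mult[OF this dz(2), of i] show ?thesis
      unfolding 1 pw by (simp add: algebra_simps)
  qed
  let ?X = "\<lambda>x. aq x (\<lambda>i. \<eta> x * p i x) (\<lambda>i. \<eta> x * p i x)"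
  let ?E = "\<lambda>x. aq x (\<lambda>i. partial i \<eta> x) (\<lambda>i. partial i \<eta> x)"
  have X_eq: "(\<eta> x)\<^sup>2 * aq x (\<lambda>i. p i x) (\<lambda>i. p i x) = ?X x" for x
    by (simp add: aq_scale aq_scale_right power2_eq_square)
  have "sqint M (\<lambda>x. \<eta> x * p i x)" for i
  proof -
    have t: "test_function \<Omega> (\<lambda>x. (w x * partial i z x) * \<eta> x)"
      by (rule test_function_mult[OF \<eta> smooth_mult[OF ws smooth_partial[OF test_function_smooth[OF zt]]]])
    have e: "(\<lambda>x. (w x * partial i z x) * \<eta> x) = (\<lambda>x. \<eta> x * p i x)"
      by (intro ext) (simp add: p)
    show ?thesis using test_function_sqint(1)[OF open_dom t] unfolding e .
  qed
  note sq = this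
  have Xi: "integrable M ?X"
    by (rule aq_integrable[of "\<lambda>i x. \<eta> x * p i x" "\<lambda>i x. \<eta> x * p i x", OF sq sq])
  have Ei: "integrable M ?E" by (intro aq_integrable test_function_sqint(2)[OF open_dom \<eta>])
  have Xnn: "?X x \<ge> 0" and Enn: "?E x \<ge> 0" if "x \<in> \<Omega>" for x
    using that by (auto intro: aq_nonneg)
  have eta2: "\<eta> x * \<eta> x \<le> 1" "0 \<le> \<eta> x * \<eta> x" for x
    using mult_mono[of "\<eta> x" 1 "\<eta> x" 1] \<eta>b by auto
  let ?XX = "LINT x|M. ?X x" and ?EE = "LINT x|M. ?E x" and ?N = "tform \<mu> ?\<psi> ?\<psi>"
  have const: "integrable M (\<lambda>x. cmax + \<mu>)" by (rule integrable_const_M)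
  \<comment> \<open>Pairing the gradients of z and ?\<psi> gives minus the form at \<eta> * p plus a
    cross term with the gradient of \<eta>; Young's inequality with weight 1/2 leaves half of the
    good term. The term of order zero is bounded because w * z \<le> 1.\<close>
  have f1: "tform \<mu> z ?\<psi> \<le> - ?XX / 2 + 2 * ?EE + (cmax + \<mu>) * vol"
  proof -
    have "tform \<mu> z ?\<psi> \<le> (LINT x|M. (- 1 / 2) * ?X x + 2 * ?E x + (cmax + \<mu>))"
      unfolding form_def
    proof (rule integral_mono_AE)
      show "AE x in M. form_density \<mu> z (\<lambda>i. partial i z) ?\<psi> (\<lambda>i. partial i ?\<psi>) x
          \<le> (- 1 / 2) * ?X x + 2 * ?E x + (cmax + \<mu>)"
        using cmax(2) c_nonneg AE_space
      proof eventually_elim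
        case (elim x)
        then have x: "x \<in> \<Omega>" by (simp add: space_restrict_space)
        let ?pe = "aq x (\<lambda>i. \<eta> x * p i x) (\<lambda>i. partial i \<eta> x)"
        have "aq x (\<lambda>i. partial i z x) (\<lambda>i. partial i ?\<psi> x)
            = aq x (\<lambda>i. p i x) (\<lambda>i. 2 * \<eta> x * partial i \<eta> x + (- \<eta> x) * (\<eta> x * p i x))"
          unfolding p\<psi> p aq_scale aq_scale_right by (simp add: algebra_simps)
        also have "\<dots> = 2 * ?pe - ?X x"
          unfolding aq_add_right aq_scale aq_scale_right by (simp add: algebra_simps)
        finally have 1: "aq x (\<lambda>i. partial i z x) (\<lambda>i. partial i ?\<psi> x) = 2 * ?pe - ?X x" .
        have 2: "2 * ?pe \<le> ?X x / 2 + 2 * ?E x"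
          using aq_Young'[OF x, of "1/2" "\<lambda>i. \<eta> x * p i x" "\<lambda>i. partial i \<eta> x"] by simp
        have "(c x + \<mu>) * (z x * ?\<psi> x) = (c x + \<mu>) * ((w x * z x) * (\<eta> x * \<eta> x))" by simp
        also have "\<dots> \<le> (cmax + \<mu>) * (1 * 1)"
          using elim \<mu> w z0[of x] eta2[of x] w(1)[of x] cmax(1)
          by (intro mult_mono) (auto simp: less_imp_le)
        finally show ?case unfolding form_density_def 1 using 2 by simp
      qed
      show "integrable M (\<lambda>x. (- 1 / 2) * ?X x + 2 * ?E x + (cmax + \<mu>))"
        by (intro Bochner_Integration.integrable_add integrable_mult_right Xi Ei const)
    qed (intro form_integrable test_adm zt \<psi>t)
    also have "\<dots> = (LINT x|M. (- 1 / 2) * ?X x + 2 * ?E x) + (LINT x|M. cmax + \<mu>)"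
      by (intro Bochner_Integration.integral_add Bochner_Integration.integrable_add integrable_mult_right Xi Ei const)
    also have "(LINT x|M. (- 1 / 2) * ?X x + 2 * ?E x) = - ?XX / 2 + 2 * ?EE"
      using Xi Ei by simp
    finally show ?thesis unfolding LINT_const_M .
  qed
  have f2: "\<epsilon>\<^sup>2 * ?N \<le> 2 * ?XX + 8 * ?EE + (cmax + \<mu>) * vol"
  proof -
    have "\<epsilon>\<^sup>2 * ?N = (LINT x|M. \<epsilon>\<^sup>2 * form_density \<mu> ?\<psi> (\<lambda>i. partial i ?\<psi>) ?\<psi> (\<lambda>i. partial i ?\<psi>) x)"
      by (simp add: form_def)
    also have "\<dots> \<le> (LINT x|M. 2 * ?X x + 8 * ?E x + (cmax + \<mu>))"
    proof (rule integral_mono_AE)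
      show "AE x in M. \<epsilon>\<^sup>2 * form_density \<mu> ?\<psi> (\<lambda>i. partial i ?\<psi>) ?\<psi> (\<lambda>i. partial i ?\<psi>) x
          \<le> 2 * ?X x + 8 * ?E x + (cmax + \<mu>)"
        using cmax(2) c_nonneg AE_space
      proof eventually_elim
        case (elim x)
        then have x: "x \<in> \<Omega>" by (simp add: space_restrict_space)
        have e: "\<epsilon> * w x \<ge> 0" "\<epsilon> * w x \<le> 1" using w(1,3)[of x] \<epsilon> by (auto simp: mult.commute)
        have e2: "(\<epsilon> * w x) * (\<epsilon> * w x) \<le> 1" "(\<epsilon> * w x) * (\<epsilon> * w x) \<ge> 0"
          using mult_mono[OF e(2) e(2)] e by auto
        let ?q = "aq x (\<lambda>i. (2 * \<eta> x) * partial i \<eta> x - \<eta> x * (\<eta> x * p i x))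
            (\<lambda>i. (2 * \<eta> x) * partial i \<eta> x - \<eta> x * (\<eta> x * p i x))"
        have q0: "?q \<ge> 0" by (rule aq_nonneg[OF x])
        have "?q \<le> 2 * aq x (\<lambda>i. (2 * \<eta> x) * partial i \<eta> x) (\<lambda>i. (2 * \<eta> x) * partial i \<eta> x)
           + 2 * aq x (\<lambda>i. \<eta> x * (\<eta> x * p i x)) (\<lambda>i. \<eta> x * (\<eta> x * p i x))"
          by (rule aq_diff_le[OF x])
        also have "\<dots> = 8 * ((\<eta> x * \<eta> x) * ?E x) + 2 * ((\<eta> x * \<eta> x) * ?X x)"
          unfolding aq_scale[of x "2 * \<eta> x"] aq_scale_right[of x _ "2 * \<eta> x"]
            aq_scale[of x "\<eta> x" "\<lambda>i. \<eta> x * p i x"] aq_scale_right[of x _ "\<eta> x" "\<lambda>i. \<eta> x * p i x"]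
          by simp
        also have "\<dots> \<le> 8 * ?E x + 2 * ?X x"
          using mult_left_le_one_le[OF Enn[OF x] eta2(2,1)[of x]] mult_left_le_one_le[OF Xnn[OF x] eta2(2,1)[of x]]
          by (intro add_mono mult_left_mono) auto
        finally have q1: "?q \<le> 8 * ?E x + 2 * ?X x" .
        have "\<epsilon>\<^sup>2 * aq x (\<lambda>i. partial i ?\<psi> x) (\<lambda>i. partial i ?\<psi> x) = ((\<epsilon> * w x) * (\<epsilon> * w x)) * ?q"
          unfolding p\<psi> aq_scale[of x "w x"] aq_scale_right[of x _ "w x"] by (simp add: power2_eq_square)
        also have "\<dots> \<le> ?q" by (rule mult_left_le_one_le[OF q0 e2(2,1)])
        finally have 1: "\<epsilon>\<^sup>2 * aq x (\<lambda>i. partial i ?\<psi> x) (\<lambda>i. partial i ?\<psi> x) \<le> 8 * ?E x + 2 * ?X x"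
          using q1 by simp
        have "\<epsilon>\<^sup>2 * ((c x + \<mu>) * (?\<psi> x * ?\<psi> x)) =
            (c x + \<mu>) * (((\<epsilon> * w x) * (\<epsilon> * w x)) * ((\<eta> x * \<eta> x) * (\<eta> x * \<eta> x)))"
          by (simp add: power2_eq_square)
        also have "\<dots> \<le> (cmax + \<mu>) * (1 * (1 * 1))"
          using elim \<mu> e2 eta2[of x] cmax(1) \<eta>b(1)[of x] \<epsilon>(1) less_imp_le[OF w(1)[of x]]
          by (intro mult_mono mult_nonneg_nonneg) auto
        finally show ?case using 1 unfolding form_density_def distrib_left by simp
      qed
      show "integrable M (\<lambda>x. 2 * ?X x + 8 * ?E x + (cmax + \<mu>))"
        by (intro Bochner_Integration.integrable_add integrable_mult_right Xi Ei const)
    qed (intro form_integrable integrable_mult_right test_adm \<psi>t)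
    also have "\<dots> = (LINT x|M. 2 * ?X x + 8 * ?E x) + (LINT x|M. cmax + \<mu>)"
      by (intro Bochner_Integration.integral_add Bochner_Integration.integrable_add integrable_mult_right Xi Ei const)
    also have "(LINT x|M. 2 * ?X x + 8 * ?E x) = 2 * ?XX + 8 * ?EE"
      using Xi Ei by simp
    finally show ?thesis unfolding LINT_const_M .
  qed
  have \<psi>_eq: "?\<psi> x = (\<eta> x)\<^sup>2 / (z x + \<epsilon>)" for x
    by (simp add: w_def divide_inverse power2_eq_square)
  have N0: "?N \<ge> 0" using form_nonneg[OF test_adm[OF \<psi>t], of \<mu>] \<mu> by simp
  have XX0: "?XX \<ge> 0" using Xnn by (intro integral_nonneg_AE AE_I2) (simp add: space_restrict_space)
  have EE0: "?EE \<ge> 0" using Enn by (intro integral_nonneg_AE AE_I2) (simp add: space_restrict_space)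
  have Y0: "obs ?\<psi> \<ge> 0" unfolding obs_def
    by (intro integral_nonneg_AE AE_I2 mult_nonneg_nonneg) (use \<eta>b w in \<open>auto simp: less_imp_le\<close>)
  \<comment> \<open>The weight 1/8 is chosen so that the contribution 2 * ?XX of the residual
    becomes ?XX / 4, which the good term ?XX / 2 absorbs; the summand 2 is the price of completing
    the square.\<close>
  have s: "\<bar>tform \<mu> z ?\<psi> - obs ?\<psi>\<bar> \<le> \<epsilon>\<^sup>2 * ?N / 8 + 2"
  proof -
    let ?D = "tform \<mu> z ?\<psi> - obs ?\<psi>" and ?Q = "\<epsilon>\<^sup>2 * ?N"
    have Q: "?D\<^sup>2 \<le> ?Q" by (rule approx_solD(4)[OF z \<psi>t])
    have "0 \<le> (\<bar>?D\<bar> - 4)\<^sup>2" by simp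
    then have "8 * \<bar>?D\<bar> \<le> ?D\<^sup>2 + 16" by (simp add: power2_diff)
    with Q show ?thesis by simp
  qed
  have main: "?XX / 4 + obs ?\<psi> \<le> 3 * ?EE + 2 * (cmax + \<mu>) * vol + 2"
  proof -
    obtain k where k: "k = (cmax + \<mu>) * vol" by blast
    have "0 \<le> k" unfolding k using cmax(1) vol_nonneg \<mu> by simp
    moreover have "obs ?\<psi> - tform \<mu> z ?\<psi> \<le> \<epsilon>\<^sup>2 * ?N / 8 + 2" using s by linarith
    ultimately have "?XX / 4 + obs ?\<psi> \<le> 3 * ?EE + 2 * k + 2"
      using f1 f2 unfolding k[symmetric] by linarith
    then show ?thesis by (simp only: k mult.assoc)
  qed
  \<comment> \<open>Since \<mu> \<ge> 1, each term is at most a multiple of \<mu>. Four times the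
    coefficients on the left gives the constants 12 and 8 in C.\<close>
  also have "\<dots> \<le> C / 4 * \<mu>"
  proof -
    have m: "t \<le> t * \<mu>" if "t \<ge> 0" for t using mult_left_mono[OF \<mu> that] by simp
    have "cmax * vol \<le> cmax * vol * \<mu>" using cmax(1) vol_nonneg by (intro m) simp
    then show ?thesis using m[OF EE0] m[of 2] unfolding C_def by (simp add: algebra_simps)
  qed
  finally have fin: "?XX / 4 + obs ?\<psi> \<le> C / 4 * \<mu>" .
  show "integrable M (\<lambda>x. (\<eta> x)\<^sup>2 * aq x (\<lambda>i. p i x) (\<lambda>i. p i x))"
    "(LINT x|M. (\<eta> x)\<^sup>2 * aq x (\<lambda>i. p i x) (\<lambda>i. p i x)) \<le> C * \<mu>"
    unfolding X_eq using Xi fin Y0 by auto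
  have "C * \<mu> \<ge> 0" using fin XX0 Y0 by simp
  show "integrable M (\<lambda>x. indicator \<omega> x * ((\<eta> x)\<^sup>2 / (z x + \<epsilon>)))"
    "(LINT x|M. indicator \<omega> x * ((\<eta> x)\<^sup>2 / (z x + \<epsilon>))) \<le> C * \<mu>"
    using obs_integrable[OF test_function_sqint(1)[OF open_dom \<psi>t]] fin XX0 \<open>C * \<mu> \<ge> 0\<close>
    unfolding \<psi>_eq obs_def by auto
qed

end

subsection \<open>Propagation of the logarithmic bound\<close>

lemma nn_integral_le_LINT:
  fixes g h :: "'a::euclidean_space \<Rightarrow> real"
  assumes S: "open S" and h: "integrable (lebesgue_on S) h"
    and le: "\<And>x. x \<in> B \<Longrightarrow> g x \<le> h x" and nn: "\<And>x. x \<in> S \<Longrightarrow> 0 \<le> h x" and B: "B \<subseteq> S"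
  shows "(\<integral>\<^sup>+x. ennreal (g x) * indicator B x \<partial>lborel) \<le> ennreal (LINT x|lebesgue_on S. h x)"
proof -
  have "(\<integral>\<^sup>+x. ennreal (g x) * indicator B x \<partial>lborel) = (\<integral>\<^sup>+x. ennreal (g x) * indicator B x \<partial>lebesgue)"
    by (rule nn_integral_completion[symmetric])
  also have "\<dots> \<le> (\<integral>\<^sup>+x. ennreal (h x) * indicator S x \<partial>lebesgue)"
    using le B by (intro nn_integral_mono) (auto simp: indicator_def ennreal_leI)
  also have "\<dots> = (\<integral>\<^sup>+x. ennreal (h x) \<partial>lebesgue_on S)"
    using S by (intro nn_integral_restrict_space[symmetric]) (simp add: sets_completionI_sets)
  also have "\<dots> = ennreal (LINT x|lebesgue_on S. h x)"
    by (rule nn_integral_eq_integral[OF h]) (use nn in \<open>auto simp: space_restrict_space\<close>)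
  finally show ?thesis .
qed

lemma nn_integral_ball_shift:
  fixes F :: "'a::euclidean_space \<Rightarrow> ennreal"
  assumes [measurable]: "F \<in> borel_measurable borel"
  shows "(\<integral>\<^sup>+x. F x * indicator (ball (y + h) r) x \<partial>lborel) = (\<integral>\<^sup>+x. F (h + x) * indicator (ball y r) x \<partial>lborel)"
proof -
  have [measurable]: "ball (y + h) r \<in> sets borel" by simp
  have "(\<integral>\<^sup>+x. F x * indicator (ball (y + h) r) x \<partial>lborel) =
      (\<integral>\<^sup>+x. F x * indicator (ball (y + h) r) x \<partial>distr lborel borel ((+) h))"
    by (simp add: lborel_distr_plus)
  also have "\<dots> = (\<integral>\<^sup>+x. F (h + x) * indicator (ball (y + h) r) (h + x) \<partial>lborel)"
    by (subst nn_integral_distr) auto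
  also have "\<dots> = (\<integral>\<^sup>+x. F (h + x) * indicator (ball y r) x \<partial>lborel)"
    by (intro nn_integral_cong) (auto simp: indicator_def dist_norm)
  finally show ?thesis .
qed

text \<open>Fundamental theorem of calculus along the segment from x to h + x, with every component
  of h bounded by its norm. The bound is an extended nonnegative integral so that Tonelli can be
  applied to it directly.\<close>

lemma segment_increment_bound:
  fixes v :: "real^'d \<Rightarrow> real"
  assumes v: "C1_fun v"
  defines "G \<equiv> \<lambda>x. \<Sum>i\<in>UNIV. \<bar>partial i v x\<bar>"
  shows "ennreal \<bar>v (h + x) - v x\<bar> \<le> (\<integral>\<^sup>+s. ennreal (norm h * G (x + s *\<^sub>R h)) * indicator {0..1} s \<partial>lborel)"
proof -
  have pc: "continuous_on UNIV (partial i v)" for i using v by (simp add: C1_fun_def)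
  let ?g = "\<lambda>s. \<Sum>i\<in>UNIV. h $ i * partial i v (x + s *\<^sub>R h)"
  let ?G = "\<lambda>s. norm h * G (x + s *\<^sub>R h)"
  have cG: "continuous_on {0..1} ?G"
    unfolding G_def by (intro continuous_intros continuous_on_compose2[OF pc]) auto
  have der: "((\<lambda>s. v (x + s *\<^sub>R h)) has_vector_derivative ?g s) (at s within {0..1})" for s
  proof -
    have "((\<lambda>s. x + s *\<^sub>R h) has_derivative (\<lambda>t. t *\<^sub>R h)) (at s)" by (auto intro!: derivative_eq_intros)
    moreover have "(v has_derivative (\<lambda>k. \<Sum>i\<in>UNIV. k $ i * partial i v (x + s *\<^sub>R h))) (at (x + s *\<^sub>R h))"
      using v by (intro has_derivative_partial) (simp add: C1_fun_def)
    ultimately have "((\<lambda>s. v (x + s *\<^sub>R h)) has_derivative (\<lambda>t. \<Sum>i\<in>UNIV. (t *\<^sub>R h) $ i * partial i v (x + s *\<^sub>R h))) (at s)"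
      by (rule has_derivative_compose)
    then have "((\<lambda>s. v (x + s *\<^sub>R h)) has_derivative (\<lambda>t. t *\<^sub>R ?g s)) (at s)"
      by (simp add: sum_distrib_left mult.assoc)
    then show ?thesis unfolding has_vector_derivative_def by (rule has_derivative_at_withinI)
  qed
  have "(?g has_integral (v (x + 1 *\<^sub>R h) - v (x + 0 *\<^sub>R h))) {0..1}"
    by (rule fundamental_theorem_of_calculus[OF _ der]) simp
  then have gi: "(?g has_integral (v (h + x) - v x)) {0..1}" by (simp add: add.commute)
  have Gi: "?G integrable_on {0..1}" by (rule integrable_continuous_real[OF cG])
  have le: "norm (?g s) \<le> ?G s" for s
  proof -
    have "norm (?g s) \<le> (\<Sum>i\<in>UNIV. norm (h $ i * partial i v (x + s *\<^sub>R h)))" by (rule norm_sum)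
    also have "\<dots> \<le> (\<Sum>i\<in>UNIV. norm h * \<bar>partial i v (x + s *\<^sub>R h)\<bar>)"
      using component_le_norm_cart[of h] by (intro sum_mono) (simp add: abs_mult mult_right_mono)
    finally show ?thesis by (simp add: G_def sum_distrib_left)
  qed
  have "\<bar>v (h + x) - v x\<bar> = norm (integral {0..1} ?g)" using gi by (simp add: integral_unique)
  also have "\<dots> \<le> integral {0..1} ?G"
    by (rule integral_norm_bound_integral) (use gi Gi le in auto)
  finally have "\<bar>v (h + x) - v x\<bar> \<le> integral {0..1} ?G" .
  then have "ennreal \<bar>v (h + x) - v x\<bar> \<le> ennreal (integral {0..1} ?G)" by (rule ennreal_leI)
  also have "\<dots> = (\<integral>\<^sup>+s. ennreal (?G s) * indicator {0..1} s \<partial>lborel)"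
    by (rule nn_integral_has_integral_lebesgue'[symmetric, OF _ integrable_integral[OF Gi]])
      (auto simp: G_def sum_nonneg)
  finally show ?thesis .
qed

text \<open>The increments along segments in direction h are integrated over the ball and the
  integrals exchanged: for fixed s the inner integral is that of the gradient over the ball
  translated by s times h. A gradient bound along the path of balls therefore controls the change of
  the L^1 norm.\<close>

lemma ball_transport:
  fixes v :: "real^'d \<Rightarrow> real"
  assumes v: "C1_fun v"
    and D: "\<And>s. s \<in> {0..1} \<Longrightarrow>
      (\<integral>\<^sup>+x. ennreal (\<Sum>i\<in>UNIV. \<bar>partial i v x\<bar>) * indicator (ball (y + s *\<^sub>R h) r) x \<partial>lborel) \<le> D"
  shows "(\<integral>\<^sup>+x. ennreal \<bar>v x\<bar> * indicator (ball (y + h) r) x \<partial>lborel) \<le>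
    (\<integral>\<^sup>+x. ennreal \<bar>v x\<bar> * indicator (ball y r) x \<partial>lborel) + ennreal (norm h) * D"
proof -
  define G where "G x = (\<Sum>i\<in>UNIV. \<bar>partial i v x\<bar>)" for x
  have pc: "continuous_on UNIV (partial i v)" for i using v by (simp add: C1_fun_def)
  have vm[measurable]: "v \<in> borel_measurable borel"
    by (intro borel_measurable_continuous_onI C1_fun_continuous v)
  have Gm[measurable]: "G \<in> borel_measurable borel"
    unfolding G_def[abs_def] by (intro borel_measurable_continuous_onI continuous_intros pc)
  have [measurable]: "ball y r \<in> sets borel" by simp
  let ?B = "indicator (ball y r) :: real^'d \<Rightarrow> ennreal"
  let ?I = "indicator {0..1} :: real \<Rightarrow> ennreal"
  have "(\<integral>\<^sup>+x. ennreal \<bar>v x\<bar> * indicator (ball (y + h) r) x \<partial>lborel) = (\<integral>\<^sup>+x. ennreal \<bar>v (h + x)\<bar> * ?B x \<partial>lborel)"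
    by (rule nn_integral_ball_shift) measurable
  also have "\<dots> \<le> (\<integral>\<^sup>+x. ennreal \<bar>v x\<bar> * ?B x +
      (\<integral>\<^sup>+s. ennreal (norm h * G (x + s *\<^sub>R h)) * ?I s * ?B x \<partial>lborel) \<partial>lborel)"
  proof (rule nn_integral_mono)
    fix x
    have "ennreal \<bar>v (h + x)\<bar> \<le> ennreal (\<bar>v x\<bar> + \<bar>v (h + x) - v x\<bar>)" by (intro ennreal_leI) simp
    also have "\<dots> = ennreal \<bar>v x\<bar> + ennreal \<bar>v (h + x) - v x\<bar>" by (simp add: ennreal_plus)
    also have "\<dots> \<le> ennreal \<bar>v x\<bar> + (\<integral>\<^sup>+s. ennreal (norm h * G (x + s *\<^sub>R h)) * ?I s \<partial>lborel)"
      using segment_increment_bound[OF v, of h x] unfolding G_def by (intro add_left_mono)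
    finally show "ennreal \<bar>v (h + x)\<bar> * ?B x \<le> ennreal \<bar>v x\<bar> * ?B x +
        (\<integral>\<^sup>+s. ennreal (norm h * G (x + s *\<^sub>R h)) * ?I s * ?B x \<partial>lborel)"
      by (cases "x \<in> ball y r") auto
  qed
  also have "\<dots> = (\<integral>\<^sup>+x. ennreal \<bar>v x\<bar> * ?B x \<partial>lborel) +
      (\<integral>\<^sup>+x. (\<integral>\<^sup>+s. ennreal (norm h * G (x + s *\<^sub>R h)) * ?I s * ?B x \<partial>lborel) \<partial>lborel)"
    by (rule nn_integral_add) auto
  also have "(\<integral>\<^sup>+x. (\<integral>\<^sup>+s. ennreal (norm h * G (x + s *\<^sub>R h)) * ?I s * ?B x \<partial>lborel) \<partial>lborel) =
      (\<integral>\<^sup>+s. (\<integral>\<^sup>+x. ennreal (norm h * G (x + s *\<^sub>R h)) * ?I s * ?B x \<partial>lborel) \<partial>lborel)"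
    by (rule lborel_pair.Fubini') measurable
  also have "\<dots> \<le> (\<integral>\<^sup>+s. (ennreal (norm h) * D) * ?I s \<partial>lborel)"
  proof (rule nn_integral_mono)
    fix s :: real
    show "(\<integral>\<^sup>+x. ennreal (norm h * G (x + s *\<^sub>R h)) * ?I s * ?B x \<partial>lborel) \<le> (ennreal (norm h) * D) * ?I s"
    proof (cases "s \<in> {0..1}")
      case True
      have Gnn: "G x \<ge> 0" for x by (simp add: G_def sum_nonneg)
      have "(\<integral>\<^sup>+x. ennreal (norm h * G (x + s *\<^sub>R h)) * ?I s * ?B x \<partial>lborel) =
          (\<integral>\<^sup>+x. ennreal (norm h) * (ennreal (G (s *\<^sub>R h + x)) * ?B x) \<partial>lborel)"
        using True Gnn by (intro nn_integral_cong) (simp add: ennreal_mult mult.assoc add.commute)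
      also have "\<dots> = ennreal (norm h) * (\<integral>\<^sup>+x. ennreal (G (s *\<^sub>R h + x)) * ?B x \<partial>lborel)"
        by (rule nn_integral_cmult) measurable
      also have "(\<integral>\<^sup>+x. ennreal (G (s *\<^sub>R h + x)) * ?B x \<partial>lborel) =
          (\<integral>\<^sup>+x. ennreal (G x) * indicator (ball (y + s *\<^sub>R h) r) x \<partial>lborel)"
        by (rule nn_integral_ball_shift[symmetric]) measurable
      also have "\<dots> \<le> D" unfolding G_def by (rule D[OF True])
      finally show ?thesis using True by (simp add: mult_left_mono)
    qed simp
  qed
  also have "\<dots> = ennreal (norm h) * D"
    by (subst nn_integral_cmult_indicator) auto
  finally show ?thesis by (simp add: add_left_mono)
qed

section \<open>Logarithmic mass on balls and its transport through the domain\<close>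

locale source_problem = observation \<Omega> a c a0 \<omega>
  for \<Omega> :: "(real^'d) set" and a :: "'d \<Rightarrow> 'd \<Rightarrow> real^'d \<Rightarrow> real" and c :: "real^'d \<Rightarrow> real" and a0 :: real
    and \<omega> :: "(real^'d) set" +
  assumes connected_dom: "connected \<Omega>" and obs_nonempty: "\<omega> \<noteq> {}"
begin

lemma log_C1:
  assumes z: "approx_sol \<mu> \<epsilon> z" and \<epsilon>: "0 < \<epsilon>"
  shows "C1_fun (\<lambda>x. ln (z x + \<epsilon>))" "partial i (\<lambda>x. ln (z x + \<epsilon>)) x = partial i z x / (z x + \<epsilon>)"
proof -
  have pos: "z x + \<epsilon> > 0" for x using approx_solD(2)[OF z, of x] \<epsilon> by simp
  have zs: "smooth z" by (rule test_function_smooth[OF approx_solD(1)[OF z]])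
  have s: "smooth (\<lambda>x. z x + \<epsilon>)" by (intro smooth_add zs smooth_const)
  have d: "(ln has_real_derivative 1 / (z x + \<epsilon>)) (at (z x + \<epsilon>))" for x
    using DERIV_ln_divide[OF pos[of x]] .
  have pz: "partial i (\<lambda>x. z x + \<epsilon>) x = partial i z x" for i x
    using partial_add[where f = z and g = "\<lambda>_. \<epsilon>" and x = x and i = i,
      OF smooth_differentiable[OF zs] smooth_differentiable[OF smooth_const]]
    by (simp add: partial_const)
  have p: "partial i (\<lambda>x. ln (z x + \<epsilon>)) x = partial i z x / (z x + \<epsilon>)" for i x
    using partial_compose[where f = "\<lambda>x. z x + \<epsilon>", OF d smooth_differentiable[OF s], of i]
    unfolding pz by simp
  then show "partial i (\<lambda>x. ln (z x + \<epsilon>)) x = partial i z x / (z x + \<epsilon>)" .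
  have "partial i (\<lambda>x. ln (z x + \<epsilon>)) = (\<lambda>x. partial i z x / (z x + \<epsilon>))" for i
    by (intro ext p)
  moreover have "(\<lambda>x. ln (z x + \<epsilon>)) differentiable (at x)" for x
    by (rule differentiable_compose1[where f = "\<lambda>x. z x + \<epsilon>", OF d smooth_differentiable[OF s]])
  moreover have "z x + \<epsilon> \<noteq> 0" for x using pos[of x] by simp
  ultimately show "C1_fun (\<lambda>x. ln (z x + \<epsilon>))"
    unfolding C1_fun_def
    using smooth_continuous[OF smooth_partial[OF zs]] smooth_continuous[OF s]
    by (auto intro!: continuous_on_divide)
qed

definition log_mass :: "real \<Rightarrow> (real^'d \<Rightarrow> real) \<Rightarrow> real^'d \<Rightarrow> real \<Rightarrow> ennreal" where
  "log_mass \<epsilon> z x r = (\<integral>\<^sup>+y. ennreal \<bar>ln (z y + \<epsilon>)\<bar> * indicator (ball x r) y \<partial>lborel)"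

text \<open>The constant C is uniform over all \<mu>, \<epsilon> and z, and the growth in \<mu> is
  linear. This is the property that survives transport from point to point, while r may shrink and C
  may grow.\<close>

definition good :: "real^'d \<Rightarrow> real \<Rightarrow> real \<Rightarrow> bool" where
  "good x r C \<longleftrightarrow> r > 0 \<and> C \<ge> 0 \<and> (\<forall>\<mu> \<epsilon> z. 1 \<le> \<mu> \<longrightarrow> 0 < \<epsilon> \<longrightarrow> \<epsilon> \<le> 1 \<longrightarrow> approx_sol \<mu> \<epsilon> z \<longrightarrow>
     log_mass \<epsilon> z x r \<le> ennreal (C * \<mu>))"

lemma log_mass_mono: "r \<le> r' \<Longrightarrow> log_mass \<epsilon> z x r \<le> log_mass \<epsilon> z x r'"
  unfolding log_mass_def by (intro nn_integral_mono) (auto simp: indicator_def)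

text \<open>On the inner ball the cut-off is at least some b > 0, so ellipticity and
  \<open>log_estimate\<close> bound the squared gradient of the logarithm in the mean; |t| \<le> 1 +
  t^2 in each coordinate turns this into an L^1 bound that is still linear in \<mu>.\<close>

lemma gradient_ball:
  assumes R: "cball x R \<subseteq> \<Omega>" "0 < r" "r < R"
  shows "\<exists>C\<ge>0. \<forall>\<mu> \<epsilon> z. 1 \<le> \<mu> \<longrightarrow> 0 < \<epsilon> \<longrightarrow> \<epsilon> \<le> 1 \<longrightarrow> approx_sol \<mu> \<epsilon> z \<longrightarrow>
    (\<integral>\<^sup>+y. ennreal (\<Sum>i\<in>UNIV. \<bar>partial i (\<lambda>x. ln (z x + \<epsilon>)) y\<bar>) * indicator (ball x r) y \<partial>lborel) \<le> ennreal (C * \<mu>)"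
proof -
  let ?\<eta> = "ball_bump x R"
  have \<eta>: "test_function \<Omega> ?\<eta>" by (rule test_function_ball_bump) (use R in auto)
  obtain b where b: "b > 0" "\<And>y. y \<in> ball x r \<Longrightarrow> b \<le> ?\<eta> y"
    using ball_bump_ge[of r R x] R by auto
  define C0 where "C0 = 12 * (LINT x|M. aq x (\<lambda>i. partial i ?\<eta> x) (\<lambda>i. partial i ?\<eta> x)) + 8 * (cmax + 1) * vol + 8"
  let ?d = "real CARD('d)"
  define C where "C = ?d * vol + \<bar>C0\<bar> / (a0 * b\<^sup>2)"
  have C: "C \<ge> 0" unfolding C_def using vol_nonneg a0_pos b by simp
  have "(\<integral>\<^sup>+y. ennreal (\<Sum>i\<in>UNIV. \<bar>partial i (\<lambda>x. ln (z x + \<epsilon>)) y\<bar>) * indicator (ball x r) y \<partial>lborel) \<le> ennreal (C * \<mu>)"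
    if as: "1 \<le> \<mu>" "0 < \<epsilon>" "\<epsilon> \<le> 1" "approx_sol \<mu> \<epsilon> z" for \<mu> \<epsilon> z
  proof -
    define p where "p i y = partial i z y / (z y + \<epsilon>)" for i y
    note est = log_estimate(1,2)[OF \<eta> ball_bump_bounds as p_def C0_def]
    define X where "X y = (?\<eta> y)\<^sup>2 * aq y (\<lambda>i. p i y) (\<lambda>i. p i y)" for y
    define h where "h y = ?d + inverse (a0 * b\<^sup>2) * X y" for y
    have Xnn: "X y \<ge> 0" if "y \<in> \<Omega>" for y unfolding X_def using aq_nonneg[OF that] by simp
    have k: "inverse (a0 * b\<^sup>2) \<ge> 0" using a0_pos by simp
    have "(\<integral>\<^sup>+y. ennreal (\<Sum>i\<in>UNIV. \<bar>partial i (\<lambda>x. ln (z x + \<epsilon>)) y\<bar>) * indicator (ball x r) y \<partial>lborel)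
        \<le> ennreal (LINT y|M. h y)"
    proof (rule nn_integral_le_LINT[OF open_dom])
      show "integrable M h" unfolding h_def[abs_def] X_def[abs_def]
        by (intro Bochner_Integration.integrable_add integrable_const_M integrable_mult_right est)
      show "0 \<le> h y" if "y \<in> \<Omega>" for y unfolding h_def using Xnn[OF that] k by (intro add_nonneg_nonneg mult_nonneg_nonneg) auto
      show B: "ball x r \<subseteq> \<Omega>" using R by force
      show "(\<Sum>i\<in>UNIV. \<bar>partial i (\<lambda>x. ln (z x + \<epsilon>)) y\<bar>) \<le> h y" if y: "y \<in> ball x r" for y
      proof -
        have yD: "y \<in> \<Omega>" using y B by blast
        have "(\<Sum>i\<in>UNIV. \<bar>partial i (\<lambda>x. ln (z x + \<epsilon>)) y\<bar>) = (\<Sum>i\<in>UNIV. \<bar>p i y\<bar>)"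
          by (simp add: log_C1(2)[OF as(4,2)] p_def)
        also have "\<dots> \<le> (\<Sum>i\<in>UNIV. 1 + (p i y)\<^sup>2)"
        proof (rule sum_mono)
          fix i
          have "0 \<le> (\<bar>p i y\<bar> - 1)\<^sup>2" by simp
          then have "2 * \<bar>p i y\<bar> \<le> 1 + (p i y)\<^sup>2" by (simp add: power2_diff)
          then show "\<bar>p i y\<bar> \<le> 1 + (p i y)\<^sup>2" by simp
        qed
        also have "\<dots> = ?d + (\<Sum>i\<in>UNIV. (p i y)\<^sup>2)" by (simp add: sum.distrib)
        also have "(\<Sum>i\<in>UNIV. (p i y)\<^sup>2) \<le> inverse (a0 * b\<^sup>2) * X y"
        proof -
          have s0: "0 \<le> (\<Sum>i\<in>UNIV. (p i y)\<^sup>2)" by (intro sum_nonneg) auto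
          have "b\<^sup>2 * (a0 * (\<Sum>i\<in>UNIV. (p i y)\<^sup>2)) \<le> (?\<eta> y)\<^sup>2 * aq y (\<lambda>i. p i y) (\<lambda>i. p i y)"
            using aq_ge[OF yD, of "\<lambda>i. p i y"] b(1) b(2)[OF y] s0 a0_pos
            by (intro mult_mono power_mono) auto
          then have "(a0 * b\<^sup>2) * (\<Sum>i\<in>UNIV. (p i y)\<^sup>2) \<le> X y" by (simp add: X_def mult_ac)
          moreover have "a0 * b\<^sup>2 > 0" using a0_pos b by simp
          ultimately show ?thesis by (simp add: field_simps)
        qed
        finally show ?thesis by (simp add: h_def)
      qed
    qed
    also have "(LINT y|M. h y) \<le> C * \<mu>"
    proof -
      have "(LINT y|M. h y) = ?d * vol + inverse (a0 * b\<^sup>2) * (LINT y|M. X y)"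
        unfolding h_def X_def LINT_const_M[symmetric]
        by (subst Bochner_Integration.integral_add[OF integrable_const_M integrable_mult_right[OF est(1)]]) simp
      also have "\<dots> \<le> ?d * vol * \<mu> + inverse (a0 * b\<^sup>2) * (\<bar>C0\<bar> * \<mu>)"
      proof (intro add_mono mult_left_mono[OF _ k])
        show "?d * vol \<le> ?d * vol * \<mu>" using mult_left_mono[OF as(1), of "?d * vol"] vol_nonneg by simp
        have "C0 * \<mu> \<le> \<bar>C0\<bar> * \<mu>" using as(1) by (intro mult_right_mono) auto
        with est(2) show "(LINT y|M. X y) \<le> \<bar>C0\<bar> * \<mu>" unfolding X_def by simp
      qed
      finally show ?thesis by (simp add: C_def algebra_simps divide_inverse)
    qed
    finally show ?thesis by (simp add: ennreal_leI)
  qed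
  with C show ?thesis by blast
qed

text \<open>Inside \<omega> the right-hand side 1_\<omega> of the elliptic problem makes
  \<open>log_estimate\<close> control the integral of 1 / (z + \<epsilon>), so z cannot be too small
  there in the mean. Both signs of the logarithm are covered by |ln t| \<le> t + 1 / t.\<close>

lemma good_start:
  assumes R: "cball x R \<subseteq> \<omega>" "R > 0"
  shows "\<exists>C. good x (R / 2) C"
proof -
  let ?\<eta> = "ball_bump x R"
  have \<eta>: "test_function \<Omega> ?\<eta>" by (rule test_function_ball_bump) (use R obs_sub in auto)
  obtain b where b: "b > 0" "\<And>y. y \<in> ball x (R / 2) \<Longrightarrow> b \<le> ?\<eta> y"
    using ball_bump_ge[of "R / 2" R x] R by auto
  define C0 where "C0 = 12 * (LINT x|M. aq x (\<lambda>i. partial i ?\<eta> x) (\<lambda>i. partial i ?\<eta> x)) + 8 * (cmax + 1) * vol + 8"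
  \<comment> \<open>The summand 6 * vol + 2 is 2 * vol plus the bound 4 * vol + 2 for the square
    integral of z.\<close>
  define C where "C = (6 * vol + 2) + \<bar>C0\<bar> / b\<^sup>2"
  have C: "C \<ge> 0" unfolding C_def using vol_nonneg b by simp
  have "log_mass \<epsilon> z x (R / 2) \<le> ennreal (C * \<mu>)"
    if as: "1 \<le> \<mu>" "0 < \<epsilon>" "\<epsilon> \<le> 1" "approx_sol \<mu> \<epsilon> z" for \<mu> \<epsilon> z
  proof -
    note est = log_estimate(3,4)[OF \<eta> ball_bump_bounds as refl C0_def]
    have pos: "z y + \<epsilon> > 0" for y using approx_solD(2)[OF as(4), of y] as(2) by simp
    define Y where "Y y = indicator \<omega> y * ((?\<eta> y)\<^sup>2 / (z y + \<epsilon>))" for y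
    define h where "h y = 2 + (z y)\<^sup>2 + inverse (b\<^sup>2) * Y y" for y
    have zi: "integrable M (\<lambda>y. (z y)\<^sup>2)"
      using test_function_sqint(1)[OF open_dom approx_solD(1)[OF as(4)]] by (simp add: sqint_def)
    have Ynn: "Y y \<ge> 0" for y unfolding Y_def using pos[of y] by simp
    have "log_mass \<epsilon> z x (R / 2) \<le> ennreal (LINT y|M. h y)"
      unfolding log_mass_def
    proof (rule nn_integral_le_LINT[OF open_dom])
      show "integrable M h" unfolding h_def[abs_def] Y_def[abs_def]
        by (intro Bochner_Integration.integrable_add integrable_const_M integrable_mult_right est zi)
      show "0 \<le> h y" for y unfolding h_def using Ynn[of y] by simp
      have B: "ball x (R / 2) \<subseteq> \<omega>" using R by force
      then show "ball x (R / 2) \<subseteq> \<Omega>" using obs_sub by blast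
      show "\<bar>ln (z y + \<epsilon>)\<bar> \<le> h y" if y: "y \<in> ball x (R / 2)" for y
      proof -
        let ?s = "z y + \<epsilon>"
        have "ln ?s \<le> ?s - 1" using ln_le_minus_one[OF pos] .
        moreover have "- ln ?s \<le> 1 / ?s - 1"
          using ln_le_minus_one[of "1 / ?s"] pos[of y] by (simp add: ln_div)
        moreover have "1 / ?s > 0" using pos[of y] by simp
        ultimately have "\<bar>ln ?s\<bar> \<le> ?s + 1 / ?s" using pos[of y] by linarith
        moreover have "?s \<le> 2 + (z y)\<^sup>2"
        proof -
          have "0 \<le> (z y - 1)\<^sup>2" by simp
          then have "2 * z y \<le> 1 + (z y)\<^sup>2" by (simp add: power2_diff)
          then show ?thesis using as(3) approx_solD(2)[OF as(4), of y] by linarith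
        qed
        moreover have "1 / ?s \<le> inverse (b\<^sup>2) * Y y"
        proof -
          have "b\<^sup>2 * (1 / ?s) \<le> (?\<eta> y)\<^sup>2 * (1 / ?s)"
            using b(1) b(2)[OF y] pos[of y] by (intro mult_right_mono power_mono) auto
          then have "b\<^sup>2 * (1 / ?s) \<le> Y y" using B y by (auto simp: Y_def)
          then show ?thesis using b(1) by (simp add: field_simps)
        qed
        ultimately show ?thesis by (simp add: h_def)
      qed
    qed
    also have "(LINT y|M. h y) \<le> C * \<mu>"
    proof -
      have "(LINT y|M. h y) = (LINT y|M. 2 + (z y)\<^sup>2) + (LINT y|M. inverse (b\<^sup>2) * Y y)"
        unfolding h_def Y_def
        by (intro Bochner_Integration.integral_add Bochner_Integration.integrable_add integrable_const_M integrable_mult_right est zi)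
      also have "(LINT y|M. 2 + (z y)\<^sup>2) = 2 * vol + (LINT y|M. (z y)\<^sup>2)"
        unfolding LINT_const_M[symmetric] by (intro Bochner_Integration.integral_add integrable_const_M zi)
      also have "(LINT y|M. inverse (b\<^sup>2) * Y y) = inverse (b\<^sup>2) * (LINT y|M. Y y)" by simp
      finally have 1: "(LINT y|M. h y) = 2 * vol + (LINT y|M. (z y)\<^sup>2) + inverse (b\<^sup>2) * (LINT y|M. Y y)" .
      have "C0 * \<mu> \<le> \<bar>C0\<bar> * \<mu>" using as(1) by (intro mult_right_mono) auto
      with est(2) have "(LINT y|M. Y y) \<le> \<bar>C0\<bar> * \<mu>" unfolding Y_def by simp
      then have "inverse (b\<^sup>2) * (LINT y|M. Y y) \<le> inverse (b\<^sup>2) * (\<bar>C0\<bar> * \<mu>)"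
        by (intro mult_left_mono) auto
      moreover have "(6 * vol + 2) \<le> (6 * vol + 2) * \<mu>"
        using mult_left_mono[OF as(1), of "6 * vol + 2"] vol_nonneg by simp
      moreover have "C * \<mu> = (6 * vol + 2) * \<mu> + inverse (b\<^sup>2) * (\<bar>C0\<bar> * \<mu>)"
        by (simp add: C_def divide_inverse algebra_simps)
      ultimately show ?thesis
        using 1 approx_solD(3)[OF as(4)] by linarith
    qed
    finally show ?thesis by (simp add: ennreal_leI)
  qed
  with C R show ?thesis unfolding good_def by auto
qed

text \<open>The factor 3 is a budget of radii: centres move along a segment inside the ball of
  radius R, balls of radius at most R around them stay within radius 2 * R, and the cut-off behind
  the gradient bound needs room up to 3 * R.\<close>

lemma good_transport:
  assumes R: "cball x (3 * R) \<subseteq> \<Omega>" "R > 0" and y: "y \<in> ball x R" and q: "q \<in> ball x R" and g: "good y r0 C0"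
  shows "\<exists>r C. good q r C"
proof -
  define r where "r = min r0 R"
  have r: "r > 0" "r \<le> r0" "r \<le> R" using g R(2) by (auto simp: r_def good_def)
  obtain CG where CG: "CG \<ge> 0" and G: "\<And>\<mu> \<epsilon> z. 1 \<le> \<mu> \<Longrightarrow> 0 < \<epsilon> \<Longrightarrow> \<epsilon> \<le> 1 \<Longrightarrow> approx_sol \<mu> \<epsilon> z \<Longrightarrow>
    (\<integral>\<^sup>+y. ennreal (\<Sum>i\<in>UNIV. \<bar>partial i (\<lambda>x. ln (z x + \<epsilon>)) y\<bar>) * indicator (ball x (2 * R)) y \<partial>lborel) \<le> ennreal (CG * \<mu>)"
    using gradient_ball[OF R(1), of "2 * R"] R(2) by auto
  define C where "C = C0 + norm (q - y) * CG"
  have C0: "C0 \<ge> 0" using g by (simp add: good_def)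
  have C: "C \<ge> 0" using C0 CG by (simp add: C_def)
  have "log_mass \<epsilon> z q r \<le> ennreal (C * \<mu>)"
    if as: "1 \<le> \<mu>" "0 < \<epsilon>" "\<epsilon> \<le> 1" "approx_sol \<mu> \<epsilon> z" for \<mu> \<epsilon> z
  proof -
    have "log_mass \<epsilon> z (y + (q - y)) r \<le> log_mass \<epsilon> z y r + ennreal (norm (q - y)) * ennreal (CG * \<mu>)"
      unfolding log_mass_def
    proof (rule ball_transport[OF log_C1(1)[OF as(4,2)]])
      fix s :: real assume s: "s \<in> {0..1}"
      have "y + s *\<^sub>R (q - y) = (1 - s) *\<^sub>R y + s *\<^sub>R q" by (simp add: algebra_simps)
      moreover have "(1 - s) *\<^sub>R y + s *\<^sub>R q \<in> ball x R"
        using convexD[OF convex_ball y q, of "1 - s" s] s by simp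
      ultimately have m: "dist x (y + s *\<^sub>R (q - y)) < R" by simp
      have "ball (y + s *\<^sub>R (q - y)) r \<subseteq> ball x (2 * R)"
      proof
        fix w assume "w \<in> ball (y + s *\<^sub>R (q - y)) r"
        then have "dist x w < R + r" using m dist_triangle[of x w "y + s *\<^sub>R (q - y)"] by simp
        then show "w \<in> ball x (2 * R)" using r by simp
      qed
      then have "(\<integral>\<^sup>+w. ennreal (\<Sum>i\<in>UNIV. \<bar>partial i (\<lambda>x. ln (z x + \<epsilon>)) w\<bar>) * indicator (ball (y + s *\<^sub>R (q - y)) r) w \<partial>lborel)
        \<le> (\<integral>\<^sup>+w. ennreal (\<Sum>i\<in>UNIV. \<bar>partial i (\<lambda>x. ln (z x + \<epsilon>)) w\<bar>) * indicator (ball x (2 * R)) w \<partial>lborel)"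
        by (intro nn_integral_mono) (auto simp: indicator_def)
      also have "\<dots> \<le> ennreal (CG * \<mu>)" by (rule G[OF as])
      finally show "(\<integral>\<^sup>+w. ennreal (\<Sum>i\<in>UNIV. \<bar>partial i (\<lambda>x. ln (z x + \<epsilon>)) w\<bar>) * indicator (ball (y + s *\<^sub>R (q - y)) r) w \<partial>lborel)
        \<le> ennreal (CG * \<mu>)" .
    qed
    also have "log_mass \<epsilon> z y r \<le> ennreal (C0 * \<mu>)"
      using log_mass_mono[OF r(2)] g as unfolding good_def by (meson order_trans)
    also have "ennreal (C0 * \<mu>) + ennreal (norm (q - y)) * ennreal (CG * \<mu>) = ennreal (C * \<mu>)"
      using C0 CG as(1) by (simp add: C_def distrib_right mult.assoc flip: ennreal_mult ennreal_plus)
    finally show ?thesis by (simp add: add_right_mono)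
  qed
  with C r(1) have "good q r C" unfolding good_def by blast
  then show ?thesis by blast
qed

text \<open>Within a small ball the goodness of one point implies that of every other, so goodness
  spreads from the observation region through the connected domain.\<close>

lemma good_everywhere:
  assumes "x \<in> \<Omega>" shows "\<exists>r C. good x r C"
proof -
  obtain y where y: "y \<in> \<omega>" using obs_nonempty by blast
  obtain e where e: "e > 0" "cball y e \<subseteq> \<omega>" using open_contains_cball_eq[OF open_obs] y by blast
  have start: "\<exists>r C. good y r C" using good_start[OF e(2,1)] by blast
  show ?thesis
  proof (rule connected_induction_simple[OF connected_dom, where P = "\<lambda>x. \<exists>r C. good x r C"])
    show "y \<in> \<Omega>" "x \<in> \<Omega>" using y obs_sub assms by auto
    show "\<exists>r C. good y r C" by (rule start)
    fix w assume "w \<in> \<Omega>"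
    then obtain e where e: "e > 0" "cball w e \<subseteq> \<Omega>" using open_contains_cball_eq[OF open_dom] by blast
    define R where "R = e / 3"
    have R: "R > 0" "cball w (3 * R) \<subseteq> \<Omega>" using e by (auto simp: R_def)
    have "ball w R \<subseteq> \<Omega>" using R by force
    then have "openin (top_of_set \<Omega>) (ball w R)" by (simp add: openin_open_eq open_dom)
    then show "\<exists>T. openin (top_of_set \<Omega>) T \<and> w \<in> T \<and>
        (\<forall>x\<in>T. \<forall>y\<in>T. (\<exists>r C. good x r C) \<longrightarrow> (\<exists>r C. good y r C))"
      using good_transport[OF R(2,1)] R(1) by (intro exI[of _ "ball w R"]) auto
  qed
qed

end

section \<open>Lower bound for the source and passage from test functions to the solution\<close>

lemma sqint_tendsto_mult:
  assumes f: "\<And>n. sqint M (F n)" "sqint M f" and g: "sqint M g"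
    and lim: "(\<lambda>n. LINT x|M. (F n x - f x)\<^sup>2) \<longlonglongrightarrow> 0"
  shows "(\<lambda>n. LINT x|M. F n x * g x) \<longlonglongrightarrow> (LINT x|M. f x * g x)"
proof -
  let ?e = "\<lambda>n. sqrt (LINT x|M. (F n x - f x)\<^sup>2) * sqrt (LINT x|M. (g x)\<^sup>2)"
  have "?e \<longlonglongrightarrow> sqrt 0 * sqrt (LINT x|M. (g x)\<^sup>2)" by (intro tendsto_intros lim)
  then have e: "?e \<longlonglongrightarrow> 0" by simp
  have "(\<lambda>n. (LINT x|M. F n x * g x) - (LINT x|M. f x * g x)) \<longlonglongrightarrow> 0"
  proof (rule Lim_null_comparison[OF always_eventually e], rule allI)
    fix n
    have "(LINT x|M. F n x * g x) - (LINT x|M. f x * g x) = (LINT x|M. (F n x - f x) * g x)"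
      using sqint_mult[OF f(1) g, of n] sqint_mult[OF f(2) g] by (simp add: left_diff_distrib)
    then show "norm ((LINT x|M. F n x * g x) - (LINT x|M. f x * g x)) \<le> ?e n"
      using sqint_Cauchy_Schwarz[OF sqint_diff[OF f(1) f(2)] g, of n] by simp
  qed
  then show ?thesis by (simp add: LIM_zero_iff)
qed

lemma sqint_tendsto_square:
  assumes f: "\<And>n. sqint M (F n)" "sqint M f"
    and lim: "(\<lambda>n. LINT x|M. (F n x - f x)\<^sup>2) \<longlonglongrightarrow> 0"
  shows "(\<lambda>n. LINT x|M. (F n x)\<^sup>2) \<longlonglongrightarrow> (LINT x|M. (f x)\<^sup>2)"
proof -
  have eq: "(LINT x|M. (F n x)\<^sup>2) =
      (LINT x|M. (F n x - f x)\<^sup>2) + 2 * (LINT x|M. F n x * f x) - (LINT x|M. f x * f x)" for n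
  proof -
    have "(LINT x|M. (F n x - f x)\<^sup>2) = (LINT x|M. (F n x)\<^sup>2 - 2 * (F n x * f x) + f x * f x)"
      by (intro Bochner_Integration.integral_cong) (auto simp: power2_eq_square algebra_simps)
    also have "\<dots> = (LINT x|M. (F n x)\<^sup>2) - 2 * (LINT x|M. F n x * f x) + (LINT x|M. f x * f x)"
      using f sqint_mult[OF f(1) f(2), of n] sqint_mult[OF f(2) f(2)] by (simp add: sqint_def)
    finally show ?thesis by simp
  qed
  have "(\<lambda>n. (LINT x|M. (F n x - f x)\<^sup>2) + 2 * (LINT x|M. F n x * f x) - (LINT x|M. f x * f x))
      \<longlonglongrightarrow> 0 + 2 * (LINT x|M. f x * f x) - (LINT x|M. f x * f x)"
    by (intro tendsto_intros lim sqint_tendsto_mult f)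
  then show ?thesis unfolding eq by (simp add: power2_eq_square)
qed

lemma has_weak_deriv_cong_AE:
  assumes S: "open S" and f: "has_weak_deriv S i f w" and g: "locally_integrable S g"
    and eq: "AE x in lebesgue_on S. f x = g x"
  shows "has_weak_deriv S i g w"
  unfolding has_weak_deriv_def
proof (intro conjI allI impI)
  show "locally_integrable S g" "locally_integrable S w" using f g by (auto simp: has_weak_deriv_def)
  fix \<eta> assume \<eta>: "test_function S \<eta>"
  have lf: "locally_integrable S f" using f by (auto simp: has_weak_deriv_def)
  have "(LINT x|lebesgue_on S. g x * partial i \<eta> x) = (LINT x|lebesgue_on S. f x * partial i \<eta> x)"
  proof (rule integral_cong_AE)
    show "AE x in lebesgue_on S. g x * partial i \<eta> x = f x * partial i \<eta> x" using eq by eventually_elim simp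
  qed (intro borel_measurable_integrable integrable_locally_integrable_test S lf g test_function_partial \<eta>)+
  with f \<eta> show "(LINT x|lebesgue_on S. g x * partial i \<eta> x) = - (LINT x|lebesgue_on S. w x * \<eta> x)"
    by (simp add: has_weak_deriv_def)
qed

text \<open>\<open>H2_space\<close> speaks of some first derivative in H^1; the chosen one differs
  from it on a null set, which weak differentiability does not see.\<close>

lemma H2_weak_deriv_weak_deriv:
  assumes S: "open S" and u: "u \<in> H2_space S"
  shows "\<exists>w. has_weak_deriv S j (weak_deriv S i u) w"
proof -
  obtain v where v: "v \<in> H1_space S" "has_weak_deriv S i u v" using u unfolding H2_space_def by blast
  obtain w where w: "has_weak_deriv S j v w" using v(1) unfolding H1_space_def by blast
  note wd = weak_deriv_works[OF v(2)]
  have "AE x in lebesgue_on S. v x = weak_deriv S i u x" by (rule has_weak_deriv_unique[OF S v(2) wd])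
  moreover have "locally_integrable S (weak_deriv S i u)" using wd by (simp add: has_weak_deriv_def)
  ultimately show ?thesis using has_weak_deriv_cong_AE[OF S w] by blast
qed

context source_problem
begin

text \<open>One good ball that carries mass of f is enough. For a weight F of mass m with weighted
  integral of |ln (z + \<epsilon>)| at most C * \<mu>, convexity of exp bounds the integral of F *
  (z + \<epsilon>) from below by m * exp (- C * \<mu> / m); removing the regularisation costs at
  most \<epsilon> * vol.\<close>

lemma source_lower_bound:
  assumes f: "f \<in> L2_space \<Omega>" "AE x in M. f x \<ge> 0" "\<not> (AE x in M. f x = 0)"
  shows "\<exists>m>0. \<exists>C\<ge>0. \<forall>\<mu> \<epsilon> z. 1 \<le> \<mu> \<longrightarrow> 0 < \<epsilon> \<longrightarrow> \<epsilon> \<le> 1 \<longrightarrow> approx_sol \<mu> \<epsilon> z \<longrightarrow>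
    m * exp (- C * \<mu>) - \<epsilon> * vol \<le> (LINT x|M. f x * z x)"
proof -
  have fs: "sqint M f" using f(1) by (simp add: L2_space_iff)
  have fm[measurable]: "f \<in> borel_measurable M" using fs by (simp add: sqint_def)
  have "\<forall>x\<in>\<Omega>. \<exists>p. good x (fst p) (snd p)" using good_everywhere by simp
  from bchoice[OF this] obtain p where p: "\<And>x. x \<in> \<Omega> \<Longrightarrow> good x (fst (p x)) (snd (p x))" by blast
  define rad where "rad x = fst (p x)" for x
  have rad: "rad x > 0" if "x \<in> \<Omega>" for x using p[OF that] by (simp add: good_def rad_def)
  \<comment> \<open>Otherwise countably many of these balls would cover the domain, by Lindelof, and
    f would vanish almost everywhere.\<close>
  have "\<exists>x\<in>\<Omega>. \<not> (AE y in M. y \<in> ball x (rad x) \<longrightarrow> f y = 0)"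
  proof (rule ccontr)
    assume "\<not> ?thesis"
    then have all: "AE y in M. y \<in> ball x (rad x) \<longrightarrow> f y = 0" if "x \<in> \<Omega>" for x using that by blast
    have "\<And>B. B \<in> (\<lambda>x. ball x (rad x)) ` \<Omega> \<Longrightarrow> open B" by auto
    from Lindelof[OF this] obtain F' where F': "F' \<subseteq> (\<lambda>x. ball x (rad x)) ` \<Omega>" "countable F'"
      "\<Union>F' = \<Union>((\<lambda>x. ball x (rad x)) ` \<Omega>)" by blast
    have "AE y in M. \<forall>B\<in>F'. y \<in> B \<longrightarrow> f y = 0"
      by (rule AE_ball_countable'[OF _ F'(2)]) (use F'(1) all in blast)
    then have "AE y in M. f y = 0"
      using AE_space
    proof eventually_elim
      case (elim y)
      then have "y \<in> \<Omega>" by (simp add: space_restrict_space)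
      then have "y \<in> \<Union>((\<lambda>x. ball x (rad x)) ` \<Omega>)" using rad by force
      then show ?case using elim(1) F'(3) by blast
    qed
    with f(3) show False by simp
  qed
  then obtain x where x: "x \<in> \<Omega>" "\<not> (AE y in M. y \<in> ball x (rad x) \<longrightarrow> f y = 0)" by blast
  let ?r = "rad x"
  obtain C where g: "good x ?r C" using p[OF x(1)] unfolding rad_def by blast
  have bm[measurable]: "indicat_real (ball x ?r) \<in> borel_measurable M"
    by (intro measurable_restrict_space1 borel_measurable_indicator sets_completionI_sets) simp
  \<comment> \<open>Cutting f off at height 1 and to the ball gives a weight that lies below f
    almost everywhere and below the indicator of the ball, so both the pairing with f and the
    logarithmic bound can be used.\<close>
  define F where "F y = indicat_real (ball x ?r) y * min 1 (max 0 (f y))" for y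
  have Fm[measurable]: "F \<in> borel_measurable M" unfolding F_def[abs_def] by measurable
  have F: "0 \<le> F y" "F y \<le> 1" "F y \<le> indicator (ball x ?r) y" for y by (auto simp: F_def indicator_def)
  have Fi: "integrable M F"
    by (rule Bochner_Integration.integrable_bound[OF integrable_const_M[of 1] Fm]) (use F in auto)
  define m where "m = (LINT y|M. F y)"
  have "m > 0"
  proof -
    have "m \<ge> 0" unfolding m_def using F by (intro integral_nonneg_AE) auto
    moreover have "m \<noteq> 0"
    proof
      assume "m = 0"
      then have "AE y in M. F y = 0"
        using integral_nonneg_eq_0_iff_AE[OF Fi] F unfolding m_def by auto
      then have "AE y in M. y \<in> ball x ?r \<longrightarrow> f y = 0"
        using f(2) by eventually_elim (auto simp: F_def min_def max_def split: if_splits)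
      with x(2) show False by simp
    qed
    ultimately show ?thesis by simp
  qed
  have "m \<le> vol"
  proof -
    have "m \<le> (LINT y|M. 1)" unfolding m_def by (rule integral_mono[OF Fi integrable_const_M F(2)])
    then show ?thesis using LINT_const_M[of 1] by simp
  qed
  have C0: "C \<ge> 0" using g by (simp add: good_def)
  have main: "m * exp (- (C / m) * \<mu>) - \<epsilon> * vol \<le> (LINT x|M. f x * z x)"
    if as: "1 \<le> \<mu>" "0 < \<epsilon>" "\<epsilon> \<le> 1" "approx_sol \<mu> \<epsilon> z" for \<mu> \<epsilon> z
  proof -
    have pos: "z y + \<epsilon> > 0" for y using approx_solD(2)[OF as(4), of y] as(2) by simp
    have zs: "sqint M z" by (rule test_function_sqint(1)[OF open_dom approx_solD(1)[OF as(4)]])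
    let ?v = "\<lambda>y. ln (z y + \<epsilon>)"
    have "continuous_on UNIV ?v" by (rule C1_fun_continuous[OF log_C1(1)[OF as(4,2)]])
    then have "?v \<in> borel_measurable borel" by (rule borel_measurable_continuous_onI)
    then have vm[measurable]: "?v \<in> borel_measurable M"
      by (intro measurable_restrict_space1 measurable_completion) simp
    have nn: "(\<integral>\<^sup>+y. ennreal (F y * \<bar>?v y\<bar>) \<partial>M) \<le> ennreal (C * \<mu>)"
    proof -
      have "(\<integral>\<^sup>+y. ennreal (F y * \<bar>?v y\<bar>) \<partial>M) = (\<integral>\<^sup>+y. ennreal (F y * \<bar>?v y\<bar>) * indicator \<Omega> y \<partial>lebesgue)"
        using open_dom by (intro nn_integral_restrict_space) (simp add: sets_completionI_sets)
      also have "\<dots> \<le> (\<integral>\<^sup>+y. ennreal \<bar>?v y\<bar> * indicator (ball x ?r) y \<partial>lebesgue)"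
      proof (rule nn_integral_mono)
        fix y
        show "ennreal (F y * \<bar>?v y\<bar>) * indicator \<Omega> y \<le> ennreal \<bar>?v y\<bar> * indicator (ball x ?r) y"
        proof (cases "y \<in> ball x ?r")
          case True
          have "F y * \<bar>?v y\<bar> \<le> \<bar>?v y\<bar>" using F(1,2)[of y] by (intro mult_left_le_one_le) auto
          then show ?thesis using True by (auto simp: indicator_def intro: ennreal_leI)
        next
          case False
          then have "F y = 0" by (simp add: F_def)
          then show ?thesis by simp
        qed
      qed
      also have "\<dots> = log_mass \<epsilon> z x ?r" unfolding log_mass_def by (rule nn_integral_completion)
      also have "\<dots> \<le> ennreal (C * \<mu>)" using g as by (simp add: good_def)
      finally show ?thesis .
    qed
    have Fvi: "integrable M (\<lambda>y. F y * \<bar>?v y\<bar>)"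
    proof (rule integrableI_bounded)
      show "(\<integral>\<^sup>+ y. ennreal (norm (F y * \<bar>?v y\<bar>)) \<partial>M) < \<infinity>"
        using nn F(1) by (simp add: abs_mult le_less_trans[OF _ ennreal_less_top])
    qed measurable
    have Fv: "(LINT y|M. F y * \<bar>?v y\<bar>) \<le> C * \<mu>"
    proof -
      have "ennreal (LINT y|M. F y * \<bar>?v y\<bar>) \<le> ennreal (C * \<mu>)"
        using nn nn_integral_eq_integral[OF Fvi] F(1) by simp
      then show ?thesis using C0 as(1) by (simp add: ennreal_le_iff)
    qed
    have "AE y in M. \<bar>F y\<bar> \<le> 1" using F by simp
    from sqint_imp_integrable[OF sqint_bounded_mult[OF zs Fm this] finite_M]
    have Fzi: "integrable M (\<lambda>y. F y * z y)" .
    \<comment> \<open>An upper bound for the mean of |ln (z + \<epsilon>)| with respect to F / m.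
      The tangent of exp at - k then expresses Jensen's inequality, in the form exp (v + k) \<ge> 1
      + v + k.\<close>
    define k where "k = C * \<mu> / m"
    have "exp (- k) * ((1 + k) * m - (LINT y|M. F y * \<bar>?v y\<bar>)) =
        (LINT y|M. exp (- k) * ((1 + k) * F y - F y * \<bar>?v y\<bar>))"
      unfolding m_def using Fi Fvi by simp
    also have "\<dots> \<le> (LINT y|M. F y * z y + \<epsilon> * F y)"
    proof (rule integral_mono)
      show "exp (- k) * ((1 + k) * F y - F y * \<bar>?v y\<bar>) \<le> F y * z y + \<epsilon> * F y" for y
      proof -
        have "1 + k - \<bar>?v y\<bar> \<le> exp (?v y + k)" using exp_ge_add_one_self[of "?v y + k"] by linarith
        also have "\<dots> = (z y + \<epsilon>) * exp k" using pos[of y] by (simp add: exp_add)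
        finally have "exp (- k) * (1 + k - \<bar>?v y\<bar>) \<le> exp (- k) * ((z y + \<epsilon>) * exp k)"
          by (intro mult_left_mono) auto
        also have "\<dots> = z y + \<epsilon>" by (simp add: exp_minus)
        finally have "F y * (exp (- k) * (1 + k - \<bar>?v y\<bar>)) \<le> F y * (z y + \<epsilon>)"
          using F(1) by (intro mult_left_mono)
        then show ?thesis by (simp add: algebra_simps)
      qed
    qed (use Fi Fvi Fzi in auto)
    also have "\<dots> = (LINT y|M. F y * z y) + \<epsilon> * m"
      unfolding m_def using Fi Fzi by simp
    also have "(LINT y|M. F y * z y) \<le> (LINT y|M. f y * z y)"
    proof (rule integral_mono_AE[OF Fzi sqint_mult[OF fs zs]])
      show "AE y in M. F y * z y \<le> f y * z y"
        using f(2)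
      proof eventually_elim
        case (elim y)
        then have "F y \<le> f y" by (auto simp: F_def indicator_def)
        then show ?case using approx_solD(2)[OF as(4)] by (intro mult_right_mono)
      qed
    qed
    finally have 1: "exp (- k) * ((1 + k) * m - (LINT y|M. F y * \<bar>?v y\<bar>)) \<le> (LINT y|M. f y * z y) + \<epsilon> * m"
      by simp
    have "m \<le> (1 + k) * m - (LINT y|M. F y * \<bar>?v y\<bar>)"
      using Fv \<open>m > 0\<close> by (simp add: k_def distrib_right)
    then have "exp (- k) * m \<le> exp (- k) * ((1 + k) * m - (LINT y|M. F y * \<bar>?v y\<bar>))"
      by (intro mult_left_mono) auto
    moreover have "\<epsilon> * m \<le> \<epsilon> * vol" using \<open>m \<le> vol\<close> as(2) by (intro mult_left_mono) auto
    ultimately have "m * exp (- k) - \<epsilon> * vol \<le> (LINT y|M. f y * z y)"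
      using 1 unfolding mult.commute[of m] by linarith
    then show ?thesis by (simp add: k_def)
  qed
  show ?thesis
    by (intro exI[of _ m] exI[of _ "C / m"] conjI allI impI main) (use \<open>m > 0\<close> C0 in auto)
qed

text \<open>By symmetry of the form, pairing A u with z amounts to testing the equation of z with u,
  so the residual estimate for z applies. As u lies only in the closure of the test functions, the
  estimate is carried to it by approximation; the H^2 regularity of u permits integrating the
  elliptic operator by parts.\<close>

lemma weak_form_bound:
  assumes u: "u \<in> H2_space \<Omega>" "u \<in> H10_space \<Omega>"
    and \<mu>: "1 \<le> \<mu>" and \<epsilon>: "0 < \<epsilon>" and z: "approx_sol \<mu> \<epsilon> z"
  shows "integrable M (\<lambda>x. elliptic_op \<Omega> a c u x * z x)"
    "\<bar>(LINT x|M. elliptic_op \<Omega> a c u x * z x) + \<mu> * (LINT x|M. u x * z x) - obs u\<bar>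
      \<le> \<epsilon> * sqrt (A1 + cmax + \<mu>) * H2_norm \<Omega> u"
proof -
  note zt = approx_solD(1)[OF z]
  note zs = test_function_sqint[OF open_dom zt]
  have u1: "u \<in> H1_space \<Omega>" using u(2) by (simp add: H10_space_def)
  define w where "w i = weak_deriv \<Omega> i u" for i
  have us: "sqint M u" and ws: "sqint M (w i)" for i
    using weak_deriv_sqint(2,3)[OF open_dom u1] by (auto simp: w_def)
  have adu: "adm u w" using us ws by (simp add: adm_def)
  have adz: "adm z (\<lambda>i. partial i z)" by (rule test_adm[OF zt])
  define W where "W i j = weak_deriv \<Omega> j (\<lambda>y. a i j y * w i y)" for i j
  \<comment> \<open>The derivative chosen inside \<open>elliptic_op\<close> is a genuine one: u lies
    in H^2 and the coefficient is C^1, so the flux is weakly differentiable.\<close>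
  have W: "has_weak_deriv \<Omega> j (\<lambda>y. a i j y * w i y) (W i j)" for i j
  proof -
    obtain w' where "has_weak_deriv \<Omega> j (w i) w'"
      using H2_weak_deriv_weak_deriv[OF open_dom u(1), of j i] unfolding w_def by blast
    moreover have "Ck 1 \<Omega> (a i j)" using a_C1[of i j] by (simp add: C1_closure_def)
    ultimately show ?thesis
      unfolding W_def using has_weak_deriv_mult[OF open_dom] weak_deriv_works by blast
  qed
  have Wi: "integrable M (\<lambda>x. W i j x * z x)" for i j
    using W[of j i] by (intro integrable_locally_integrable_test[OF open_dom _ zt]) (simp add: has_weak_deriv_def)
  have Wz: "(LINT x|M. W i j x * z x) = - (LINT x|M. a i j x * w i x * partial j z x)" for i j
    using W[of j i] zt by (simp add: has_weak_deriv_def)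
  have ell: "elliptic_op \<Omega> a c u x * z x = - (\<Sum>i\<in>UNIV. \<Sum>j\<in>UNIV. W i j x * z x) + c x * (u x * z x)" for x
    by (simp add: elliptic_op_def W_def w_def left_diff_distrib sum_distrib_right)
  have ci: "integrable M (\<lambda>x. c x * (u x * z x))" by (rule c_integrable[OF us zs(1)])
  have ai: "integrable M (\<lambda>x. a i j x * w i x * partial j z x)" for i j
  proof -
    have "AE x in M. \<bar>a i j x\<bar> \<le> amax" using amax(2) by (intro AE_I2) (simp add: space_restrict_space)
    from sqint_mult[OF sqint_bounded_mult[OF ws a_measurable this] zs(2)] show ?thesis .
  qed
  show "integrable M (\<lambda>x. elliptic_op \<Omega> a c u x * z x)"
    unfolding ell
    by (intro Bochner_Integration.integrable_add Bochner_Integration.integrable_minus Bochner_Integration.integrable_sum Wi ci)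
  have "(LINT x|M. elliptic_op \<Omega> a c u x * z x) = - (\<Sum>i\<in>UNIV. \<Sum>j\<in>UNIV. LINT x|M. W i j x * z x) + (LINT x|M. c x * (u x * z x))"
    unfolding ell using Wi ci
    by (subst Bochner_Integration.integral_add) (auto intro!: Bochner_Integration.integrable_sum simp: Bochner_Integration.integral_sum)
  then have e1: "(LINT x|M. elliptic_op \<Omega> a c u x * z x) =
      (\<Sum>i\<in>UNIV. \<Sum>j\<in>UNIV. LINT x|M. a i j x * w i x * partial j z x) + (LINT x|M. c x * (u x * z x))"
    by (simp add: Wz sum_negf)
  have e2: "(LINT x|M. aq x (\<lambda>i. w i x) (\<lambda>i. partial i z x)) =
      (\<Sum>i\<in>UNIV. \<Sum>j\<in>UNIV. LINT x|M. a i j x * w i x * partial j z x)"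
    unfolding aq_def using ai by (simp add: Bochner_Integration.integral_sum)
  have uz: "integrable M (\<lambda>x. u x * z x)" by (rule sqint_mult[OF us zs(1)])
  have "form \<mu> u w z (\<lambda>i. partial i z) = (LINT x|M. aq x (\<lambda>i. w i x) (\<lambda>i. partial i z x)) +
      (LINT x|M. c x * (u x * z x) + \<mu> * (u x * z x))"
    unfolding form_def form_density_def distrib_right
    using aq_integrable[OF ws zs(2)] ci uz by (intro Bochner_Integration.integral_add) auto
  also have "(LINT x|M. c x * (u x * z x) + \<mu> * (u x * z x)) = (LINT x|M. c x * (u x * z x)) + \<mu> * (LINT x|M. u x * z x)"
    using ci uz by simp
  finally have lhs: "(LINT x|M. elliptic_op \<Omega> a c u x * z x) + \<mu> * (LINT x|M. u x * z x) = form \<mu> u w z (\<lambda>i. partial i z)"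
    unfolding e1 e2 by simp
  obtain \<eta> where \<eta>: "\<And>n::nat. test_function \<Omega> (\<eta> n)" and l0: "(\<lambda>n. LINT x|M. (\<eta> n x - u x)\<^sup>2) \<longlonglongrightarrow> 0"
    and l1: "\<And>i. (\<lambda>n. LINT x|M. (partial i (\<eta> n) x - w i x)\<^sup>2) \<longlonglongrightarrow> 0"
    using H10_approx[OF open_dom u(2)] unfolding w_def by blast
  note \<eta>s = test_function_sqint[OF open_dom \<eta>]
  let ?B = "A1 + cmax + \<mu>"
  define N where "N = (LINT x|M. (u x)\<^sup>2) + (\<Sum>i\<in>UNIV. LINT x|M. (w i x)\<^sup>2)"
  define Nn where "Nn n = (LINT x|M. (\<eta> n x)\<^sup>2) + (\<Sum>i\<in>UNIV. LINT x|M. (partial i (\<eta> n) x)\<^sup>2)" for n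
  have Nlim: "Nn \<longlonglongrightarrow> N"
    unfolding Nn_def[abs_def] N_def
    by (intro tendsto_add tendsto_sum sqint_tendsto_square \<eta>s us ws l0 l1)
  \<comment> \<open>Cauchy-Schwarz for the form reduces this to the energy of \<eta> n - u, which
    \<open>form_le\<close> bounds by the H^1 distance.\<close>
  have flim: "(\<lambda>n. tform \<mu> (\<eta> n) z) \<longlonglongrightarrow> form \<mu> u w z (\<lambda>i. partial i z)"
  proof -
    define E where "E n = (LINT x|M. (\<eta> n x - u x)\<^sup>2) + (\<Sum>i\<in>UNIV. LINT x|M. (partial i (\<eta> n) x - w i x)\<^sup>2)" for n
    have "E \<longlonglongrightarrow> 0 + (\<Sum>i\<in>(UNIV::'d set). 0)" unfolding E_def[abs_def] by (intro tendsto_intros l0 l1)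
    then have E: "E \<longlonglongrightarrow> 0" by simp
    let ?F = "tform \<mu> z z"
    have F0: "?F \<ge> 0" using form_nonneg[OF adz, of \<mu>] \<mu> by simp
    have "(\<lambda>n. sqrt (?B * E n * ?F)) \<longlonglongrightarrow> sqrt (?B * 0 * ?F)" by (intro tendsto_intros E)
    then have lim: "(\<lambda>n. sqrt (?B * E n * ?F)) \<longlonglongrightarrow> 0" by simp
    have "(\<lambda>n. tform \<mu> (\<eta> n) z - form \<mu> u w z (\<lambda>i. partial i z)) \<longlonglongrightarrow> 0"
    proof (rule Lim_null_comparison[OF always_eventually lim], rule allI)
      fix n
      let ?d = "\<lambda>x. \<eta> n x - u x" and ?dp = "\<lambda>i x. partial i (\<eta> n) x - w i x"
      have ad: "adm ?d ?dp" by (rule adm_diff[OF test_adm[OF \<eta>] adu])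
      have "(form \<mu> ?d ?dp z (\<lambda>i. partial i z))\<^sup>2 \<le> form \<mu> ?d ?dp ?d ?dp * ?F"
        by (rule form_Cauchy_Schwarz[OF ad adz]) (use \<mu> in simp)
      also have "\<dots> \<le> ?B * E n * ?F"
        unfolding E_def by (intro mult_right_mono form_le[OF ad] F0) (use \<mu> in simp)
      finally have "(\<bar>form \<mu> ?d ?dp z (\<lambda>i. partial i z)\<bar>)\<^sup>2 \<le> ?B * E n * ?F"
        unfolding power2_abs .
      then have "\<bar>form \<mu> ?d ?dp z (\<lambda>i. partial i z)\<bar> \<le> sqrt (?B * E n * ?F)"
        by (rule real_le_rsqrt)
      then show "norm (tform \<mu> (\<eta> n) z - form \<mu> u w z (\<lambda>i. partial i z)) \<le> sqrt (?B * E n * ?F)"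
        using form_diff[OF test_adm[OF \<eta>[of n]] adu adz, of \<mu>] by simp
    qed
    then show ?thesis by (simp add: LIM_zero_iff)
  qed
  have ind: "sqint M (indicat_real \<omega>)"
  proof -
    have "sqint M (\<lambda>x. 1)" using integrable_const_M[of 1] by (simp add: sqint_def)
    moreover have "AE x in M. \<bar>indicat_real \<omega> x\<bar> \<le> 1" by (auto simp: indicator_def)
    ultimately show ?thesis using sqint_bounded_mult[OF _ obs_measurable] by fastforce
  qed
  have olim: "(\<lambda>n. obs (\<eta> n)) \<longlonglongrightarrow> obs u"
    using sqint_tendsto_mult[OF \<eta>s(1) us ind l0] by (simp add: obs_def mult.commute)
  have "(form \<mu> u w z (\<lambda>i. partial i z) - obs u)\<^sup>2 \<le> \<epsilon>\<^sup>2 * (?B * N)"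
  proof (rule LIMSEQ_le)
    show "(\<lambda>n. (tform \<mu> (\<eta> n) z - obs (\<eta> n))\<^sup>2) \<longlonglongrightarrow> (form \<mu> u w z (\<lambda>i. partial i z) - obs u)\<^sup>2"
      by (intro tendsto_intros flim olim)
    show "(\<lambda>n. \<epsilon>\<^sup>2 * (?B * Nn n)) \<longlonglongrightarrow> \<epsilon>\<^sup>2 * (?B * N)" by (intro tendsto_intros Nlim)
    have "(tform \<mu> (\<eta> n) z - obs (\<eta> n))\<^sup>2 \<le> \<epsilon>\<^sup>2 * (?B * Nn n)" for n
    proof -
      have "(tform \<mu> (\<eta> n) z - obs (\<eta> n))\<^sup>2 \<le> \<epsilon>\<^sup>2 * tform \<mu> (\<eta> n) (\<eta> n)"
        using approx_solD(4)[OF z \<eta>[of n]] form_sym[of \<mu> z "\<lambda>i. partial i z" "\<eta> n" "\<lambda>i. partial i (\<eta> n)"] by simp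
      also have "\<dots> \<le> \<epsilon>\<^sup>2 * (?B * Nn n)"
        unfolding Nn_def by (intro mult_left_mono form_le test_adm \<eta>) (use \<mu> in auto)
      finally show ?thesis .
    qed
    then show "\<exists>N0. \<forall>n\<ge>N0. (tform \<mu> (\<eta> n) z - obs (\<eta> n))\<^sup>2 \<le> \<epsilon>\<^sup>2 * (?B * Nn n)" by blast
  qed
  \<comment> \<open>The full H^2 norm takes over here because its square is the function of time
    whose integrability \<open>L2_H2_H10\<close> provides.\<close>
  also have "\<dots> \<le> \<epsilon>\<^sup>2 * (?B * (H2_norm \<Omega> u)\<^sup>2)"
  proof (intro mult_left_mono)
    have L2sq: "(L2_norm \<Omega> h)\<^sup>2 = (LINT x|M. (h x)\<^sup>2)" for h
    proof -
      have "(LINT x|M. (h x)\<^sup>2) \<ge> 0" by (intro integral_nonneg_AE) auto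
      then show ?thesis by (simp add: L2_norm_def)
    qed
    have s2: "0 \<le> (\<Sum>i\<in>UNIV. \<Sum>j\<in>UNIV. (L2_norm \<Omega> (weak_deriv \<Omega> j (weak_deriv \<Omega> i u)))\<^sup>2)"
      by (intro sum_nonneg) auto
    have "(H2_norm \<Omega> u)\<^sup>2 = N + (\<Sum>i\<in>UNIV. \<Sum>j\<in>UNIV. (L2_norm \<Omega> (weak_deriv \<Omega> j (weak_deriv \<Omega> i u)))\<^sup>2)"
      unfolding H2_norm_def N_def w_def L2sq[symmetric] using s2
      by (intro real_sqrt_pow2 add_nonneg_nonneg sum_nonneg) auto
    with s2 show "N \<le> (H2_norm \<Omega> u)\<^sup>2" by simp
    show "0 \<le> ?B" using A1_pos cmax(1) \<mu> by simp
  qed simp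
  also have "\<dots> = (\<epsilon> * sqrt ?B * H2_norm \<Omega> u)\<^sup>2"
    using A1_pos cmax(1) \<mu> by (simp add: power_mult_distrib)
  finally have "\<bar>form \<mu> u w z (\<lambda>i. partial i z) - obs u\<bar> \<le> \<bar>\<epsilon> * sqrt ?B * H2_norm \<Omega> u\<bar>"
    by (simp add: abs_le_square_iff)
  moreover have "0 \<le> \<epsilon> * sqrt ?B * H2_norm \<Omega> u"
  proof -
    have "0 \<le> H2_norm \<Omega> u" unfolding H2_norm_def
      by (intro real_sqrt_ge_zero add_nonneg_nonneg sum_nonneg) auto
    then show ?thesis using \<epsilon> A1_pos cmax(1) \<mu> by simp
  qed
  ultimately show "\<bar>(LINT x|M. elliptic_op \<Omega> a c u x * z x) + \<mu> * (LINT x|M. u x * z x) - obs u\<bar>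
      \<le> \<epsilon> * sqrt ?B * H2_norm \<Omega> u"
    unfolding lhs by simp
qed

end

subsection \<open>The Riemann-Liouville kernel\<close>

text \<open>With the kernel extended by zero, the upper limit of integration is built in and
  J^\<alpha> becomes a convolution over the whole line.\<close>

definition rl_kernel :: "real \<Rightarrow> real \<Rightarrow> real" where
  "rl_kernel \<alpha> r = (if r > 0 then r powr (\<alpha> - 1) / Gamma \<alpha> else 0)"

lemma rl_kernel_measurable[measurable]: "rl_kernel \<alpha> \<in> borel_measurable borel"
  unfolding rl_kernel_def[abs_def] by measurable

lemma rl_kernel_nonneg: "\<alpha> > 0 \<Longrightarrow> 0 \<le> rl_kernel \<alpha> r"
  using Gamma_real_pos[of \<alpha>] by (auto simp: rl_kernel_def)

lemma nn_integral_rl_kernel_exp: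
  assumes \<alpha>: "\<alpha> > 0" and l: "l > 0"
  shows "(\<integral>\<^sup>+t. ennreal (exp (- l * t) * rl_kernel \<alpha> t) \<partial>lborel) = ennreal (l powr (- \<alpha>))"
proof -
  have G: "Gamma \<alpha> > 0" using Gamma_real_pos[OF \<alpha>] .
  have "ennreal (Gamma \<alpha>) = (\<integral>\<^sup>+t. ennreal (indicator {0..} t * t powr (\<alpha> - 1) / exp t) \<partial>lborel)"
    by (rule Gamma_conv_nn_integral_real[OF \<alpha>])
  also have "\<dots> = l * (\<integral>\<^sup>+t. ennreal (indicator {0..} (0 + l * t) * (0 + l * t) powr (\<alpha> - 1) / exp (0 + l * t)) \<partial>lborel)"
    using nn_integral_real_affine[of "\<lambda>t. ennreal (indicator {0..} t * t powr (\<alpha> - 1) / exp t)" l 0] l by simp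
  also have "(\<integral>\<^sup>+t. ennreal (indicator {0..} (0 + l * t) * (0 + l * t) powr (\<alpha> - 1) / exp (0 + l * t)) \<partial>lborel)
      = (\<integral>\<^sup>+t. ennreal (Gamma \<alpha> * l powr (\<alpha> - 1)) * ennreal (exp (- l * t) * rl_kernel \<alpha> t) \<partial>lborel)"
  proof (rule nn_integral_cong)
    fix t :: real
    have "indicator {0..} (0 + l * t) * (0 + l * t) powr (\<alpha> - 1) / exp (0 + l * t) =
        Gamma \<alpha> * l powr (\<alpha> - 1) * (exp (- l * t) * rl_kernel \<alpha> t)"
      using l G by (cases "t > 0") (auto simp: rl_kernel_def powr_mult exp_minus field_simps indicator_def zero_le_mult_iff)
    then show "ennreal (indicator {0..} (0 + l * t) * (0 + l * t) powr (\<alpha> - 1) / exp (0 + l * t)) =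
        ennreal (Gamma \<alpha> * l powr (\<alpha> - 1)) * ennreal (exp (- l * t) * rl_kernel \<alpha> t)"
      using G rl_kernel_nonneg[OF \<alpha>, of t] by (simp add: ennreal_mult[symmetric])
  qed
  also have "\<dots> = ennreal (Gamma \<alpha> * l powr (\<alpha> - 1)) * (\<integral>\<^sup>+t. ennreal (exp (- l * t) * rl_kernel \<alpha> t) \<partial>lborel)"
    by (rule nn_integral_cmult) measurable
  finally have *: "ennreal (Gamma \<alpha>) = ennreal (l * (Gamma \<alpha> * l powr (\<alpha> - 1))) *
      (\<integral>\<^sup>+t. ennreal (exp (- l * t) * rl_kernel \<alpha> t) \<partial>lborel)" (is "_ = _ * ?I")
    using l G by (simp add: ennreal_mult mult.assoc)
  have c: "l * (Gamma \<alpha> * l powr (\<alpha> - 1)) = Gamma \<alpha> * l powr \<alpha>"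
    using l by (simp add: powr_diff)
  have p: "Gamma \<alpha> * l powr \<alpha> > 0" using G l by simp
  \<comment> \<open>The identity lives in the extended reals, so finiteness comes before cancelling
    the positive factor.\<close>
  have "?I < \<infinity>"
  proof (rule ccontr)
    assume "\<not> ?I < \<infinity>"
    then have "?I = \<infinity>" by (simp add: less_top[symmetric])
    with * p G l show False unfolding c by (simp add: ennreal_mult_top)
  qed
  then obtain r where r: "?I = ennreal r" "r \<ge> 0" by (cases ?I) auto
  have "Gamma \<alpha> = Gamma \<alpha> * l powr \<alpha> * r"
    using * p r G unfolding c r(1) by (simp add: ennreal_mult[symmetric] ennreal_inj)
  then have "r = l powr (- \<alpha>)" using G l by (simp add: powr_minus field_simps)
  then show ?thesis using r(1) by simp
qed

lemma nn_integral_rl_kernel_exp_shift: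
  assumes \<alpha>: "\<alpha> > 0" and l: "l > 0"
  shows "(\<integral>\<^sup>+t. ennreal (exp (- l * t) * rl_kernel \<alpha> (t - s)) \<partial>lborel) = ennreal (exp (- l * s) * l powr (- \<alpha>))"
proof -
  have "(\<integral>\<^sup>+t. ennreal (exp (- l * t) * rl_kernel \<alpha> (t - s)) \<partial>lborel) =
      (\<integral>\<^sup>+t. ennreal (exp (- l * (s + 1 * t)) * rl_kernel \<alpha> (s + 1 * t - s)) \<partial>lborel)"
    using nn_integral_real_affine[of "\<lambda>t. ennreal (exp (- l * t) * rl_kernel \<alpha> (t - s))" 1 s] by simp
  also have "\<dots> = (\<integral>\<^sup>+t. ennreal (exp (- l * s)) * ennreal (exp (- l * t) * rl_kernel \<alpha> t) \<partial>lborel)"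
    using rl_kernel_nonneg[OF \<alpha>]
    by (intro nn_integral_cong) (simp add: ennreal_mult[symmetric] exp_add[symmetric] algebra_simps flip: mult.assoc)
  also have "\<dots> = ennreal (exp (- l * s)) * ennreal (l powr (- \<alpha>))"
    using nn_integral_rl_kernel_exp[OF assms] by (subst nn_integral_cmult) auto
  finally show ?thesis by (simp add: ennreal_mult)
qed

text \<open>On this window exp (s + T - t) is at least 1, so the mass is bounded by the Laplace
  transform at rate 1. The constant exp T is crude but the same for all exponents.\<close>

lemma nn_integral_rl_kernel_le:
  assumes \<alpha>: "\<alpha> > 0"
  shows "(\<integral>\<^sup>+t. ennreal (rl_kernel \<alpha> (t - s)) * indicator {..<s + T} t \<partial>lborel) \<le> ennreal (exp T)"
proof -
  have "(\<integral>\<^sup>+t. ennreal (rl_kernel \<alpha> (t - s)) * indicator {..<s + T} t \<partial>lborel) \<le>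
      (\<integral>\<^sup>+t. ennreal (exp (s + T)) * ennreal (exp (- 1 * t) * rl_kernel \<alpha> (t - s)) \<partial>lborel)"
  proof (rule nn_integral_mono)
    fix t
    have "rl_kernel \<alpha> (t - s) \<le> exp (s + T) * (exp (- 1 * t) * rl_kernel \<alpha> (t - s))" if "t < s + T"
    proof -
      have "1 \<le> exp (s + T - t)" using that by simp
      from mult_right_mono[OF this rl_kernel_nonneg[OF \<alpha>, of "t - s"]] show ?thesis
        by (simp add: exp_diff exp_minus field_simps)
    qed
    then show "ennreal (rl_kernel \<alpha> (t - s)) * indicator {..<s + T} t \<le>
        ennreal (exp (s + T)) * ennreal (exp (- 1 * t) * rl_kernel \<alpha> (t - s))"
      using rl_kernel_nonneg[OF \<alpha>] by (auto simp: indicator_def ennreal_mult[symmetric] intro!: ennreal_leI)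
  qed
  also have "\<dots> = ennreal (exp (s + T)) * ennreal (exp (- 1 * s) * 1 powr (- \<alpha>))"
    using nn_integral_rl_kernel_exp_shift[OF \<alpha>, of 1 s] by (subst nn_integral_cmult) auto
  also have "\<dots> = ennreal (exp T)" by (simp add: ennreal_mult[symmetric] exp_add[symmetric])
  finally show ?thesis .
qed

text \<open>The substitution s = r + (t - r) * x produces a Beta integral. This is the semigroup law
  of fractional integration on the level of kernels.\<close>

lemma nn_integral_rl_kernel_conv:
  assumes \<beta>: "\<beta> > 0" and \<delta>: "\<delta> > 0"
  shows "(\<integral>\<^sup>+s. ennreal (rl_kernel \<beta> (t - s) * rl_kernel \<delta> (s - r)) \<partial>lborel) = ennreal (rl_kernel (\<beta> + \<delta>) (t - r))"
proof (cases "t > r")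
  case False
  then have *: "rl_kernel \<beta> (t - s) * rl_kernel \<delta> (s - r) = 0" for s by (auto simp: rl_kernel_def)
  show ?thesis unfolding * using False by (simp add: rl_kernel_def)
next
  case True
  define \<tau> where "\<tau> = t - r"
  have \<tau>: "\<tau> > 0" using True by (simp add: \<tau>_def)
  have G: "Gamma \<beta> > 0" "Gamma \<delta> > 0" "Gamma (\<beta> + \<delta>) > 0" using Gamma_real_pos assms by auto
  define k where "k = \<tau> powr (\<beta> - 1) * \<tau> powr (\<delta> - 1) / (Gamma \<beta> * Gamma \<delta>)"
  have k: "k \<ge> 0" using G by (simp add: k_def)
  let ?b = "\<lambda>x. x powr (\<delta> - 1) * (1 - x) powr (\<beta> - 1)"
  have "(\<integral>\<^sup>+s. ennreal (rl_kernel \<beta> (t - s) * rl_kernel \<delta> (s - r)) \<partial>lborel) =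
      \<tau> * (\<integral>\<^sup>+x. ennreal (rl_kernel \<beta> (t - (r + \<tau> * x)) * rl_kernel \<delta> (r + \<tau> * x - r)) \<partial>lborel)"
    using nn_integral_real_affine[of "\<lambda>s. ennreal (rl_kernel \<beta> (t - s) * rl_kernel \<delta> (s - r))" \<tau> r] \<tau> by simp
  also have "(\<integral>\<^sup>+x. ennreal (rl_kernel \<beta> (t - (r + \<tau> * x)) * rl_kernel \<delta> (r + \<tau> * x - r)) \<partial>lborel) =
      (\<integral>\<^sup>+x. ennreal k * (ennreal (?b x) * indicator {0..1} x) \<partial>lborel)"
  proof (rule nn_integral_cong)
    fix x :: real
    have e: "t - (r + \<tau> * x) = \<tau> * (1 - x)" "r + \<tau> * x - r = \<tau> * x" by (simp_all add: \<tau>_def algebra_simps)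
    have "rl_kernel \<beta> (\<tau> * (1 - x)) * rl_kernel \<delta> (\<tau> * x) = k * (?b x * indicator {0..1} x)"
      using \<tau> by (auto simp: rl_kernel_def k_def powr_mult zero_less_mult_iff indicator_def)
    then show "ennreal (rl_kernel \<beta> (t - (r + \<tau> * x)) * rl_kernel \<delta> (r + \<tau> * x - r)) =
        ennreal k * (ennreal (?b x) * indicator {0..1} x)"
      unfolding e using k by (simp add: ennreal_mult indicator_def)
  qed
  also have "\<dots> = ennreal k * (\<integral>\<^sup>+x. ennreal (?b x) * indicator {0..1} x \<partial>lborel)"
    by (rule nn_integral_cmult) measurable
  also have "(\<integral>\<^sup>+x. ennreal (?b x) * indicator {0..1} x \<partial>lborel) = ennreal (Beta \<delta> \<beta>)"
    by (rule nn_integral_has_integral_lebesgue'[OF _ has_integral_Beta_real[OF \<delta> \<beta>]]) auto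
  also have "ennreal \<tau> * (ennreal k * ennreal (Beta \<delta> \<beta>)) = ennreal (rl_kernel (\<beta> + \<delta>) (t - r))"
  proof -
    have B: "Beta \<delta> \<beta> = Gamma \<delta> * Gamma \<beta> / Gamma (\<beta> + \<delta>)" by (simp add: Beta_def add.commute)
    have B0: "Beta \<delta> \<beta> \<ge> 0" unfolding B using G by simp
    have "\<tau> * (\<tau> powr (\<beta> - 1) * \<tau> powr (\<delta> - 1)) = \<tau> powr (\<beta> + \<delta> - 1)"
      using \<tau> by (simp add: powr_add[symmetric] powr_mult_base add.commute algebra_simps)
    then have "\<tau> * (k * Beta \<delta> \<beta>) = rl_kernel (\<beta> + \<delta>) \<tau>"
      using \<tau> G unfolding B k_def rl_kernel_def by (simp add: field_simps)
    then show ?thesis using \<tau> k B0 by (simp add: ennreal_mult[symmetric] \<tau>_def)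
  qed
  finally show ?thesis .
qed

text \<open>Fubini combined with the transform of the kernel. As Y lives on positive times, exp (- l
  * s) is at most 1 there and integrability of Y carries over. The last conclusion is an absolute
  bound, which serves for the tail beyond T in \<open>laplace_truncation\<close>.\<close>

lemma laplace_rl_conv:
  fixes Y :: "real \<Rightarrow> real"
  assumes \<alpha>: "\<alpha> > 0" and l: "l > 0" and Y: "integrable lborel Y" "\<And>s. s \<le> 0 \<Longrightarrow> Y s = 0"
  shows "integrable lborel (\<lambda>t. exp (- l * t) * (LINT s|lborel. rl_kernel \<alpha> (t - s) * Y s))"
    "(LINT t|lborel. exp (- l * t) * (LINT s|lborel. rl_kernel \<alpha> (t - s) * Y s)) =
      l powr (- \<alpha>) * (LINT s|lborel. exp (- l * s) * Y s)"
    "(\<integral>\<^sup>+t. ennreal \<bar>exp (- l * t) * (LINT s|lborel. rl_kernel \<alpha> (t - s) * Y s)\<bar> \<partial>lborel) \<le>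
      ennreal (l powr (- \<alpha>) * (LINT s|lborel. \<bar>Y s\<bar>))"
proof -
  note Ym[measurable] = borel_measurable_integrable[OF Y(1)]
  let ?F = "\<lambda>s t. exp (- l * t) * rl_kernel \<alpha> (t - s) * Y s"
  have nnF: "(\<integral>\<^sup>+t. ennreal \<bar>?F s t\<bar> \<partial>lborel) = ennreal (l powr (- \<alpha>) * (exp (- l * s) * \<bar>Y s\<bar>))" for s
  proof -
    have "(\<integral>\<^sup>+t. ennreal \<bar>?F s t\<bar> \<partial>lborel) = (\<integral>\<^sup>+t. ennreal \<bar>Y s\<bar> * ennreal (exp (- l * t) * rl_kernel \<alpha> (t - s)) \<partial>lborel)"
      using rl_kernel_nonneg[OF \<alpha>]
      by (intro nn_integral_cong) (simp add: abs_mult ennreal_mult[symmetric] mult_ac)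
    also have "\<dots> = ennreal \<bar>Y s\<bar> * ennreal (exp (- l * s) * l powr (- \<alpha>))"
      using nn_integral_rl_kernel_exp_shift[OF \<alpha> l, of s] by (subst nn_integral_cmult) auto
    finally show ?thesis by (simp add: ennreal_mult[symmetric] mult_ac)
  qed
  have eY: "exp (- l * s) * \<bar>Y s\<bar> \<le> \<bar>Y s\<bar>" for s
    using Y(2)[of s] l by (cases "s \<le> 0") (auto intro!: mult_left_le_one_le)
  have tot: "(\<integral>\<^sup>+s. (\<integral>\<^sup>+t. ennreal \<bar>?F s t\<bar> \<partial>lborel) \<partial>lborel) \<le> ennreal (l powr (- \<alpha>) * (LINT s|lborel. \<bar>Y s\<bar>))"
  proof -
    have "(\<integral>\<^sup>+s. (\<integral>\<^sup>+t. ennreal \<bar>?F s t\<bar> \<partial>lborel) \<partial>lborel) \<le> (\<integral>\<^sup>+s. ennreal (l powr (- \<alpha>) * \<bar>Y s\<bar>) \<partial>lborel)"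
      unfolding nnF by (intro nn_integral_mono ennreal_leI mult_left_mono eY) simp
    also have "\<dots> = ennreal (LINT s|lborel. l powr (- \<alpha>) * \<bar>Y s\<bar>)"
      using Y(1) by (intro nn_integral_eq_integral) auto
    finally show ?thesis by simp
  qed
  have Fm: "(\<lambda>(s, t). ?F s t) \<in> borel_measurable (lborel \<Otimes>\<^sub>M lborel)" by measurable
  have int: "integrable (lborel \<Otimes>\<^sub>M lborel) (\<lambda>(s, t). ?F s t)"
  proof (rule integrableI_bounded[OF Fm])
    have "(\<integral>\<^sup>+p. ennreal (norm (case p of (s, t) \<Rightarrow> ?F s t)) \<partial>(lborel \<Otimes>\<^sub>M lborel)) =
        (\<integral>\<^sup>+s. (\<integral>\<^sup>+t. ennreal \<bar>?F s t\<bar> \<partial>lborel) \<partial>lborel)"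
      by (subst lborel.nn_integral_fst[symmetric]) auto
    also have "\<dots> < \<infinity>" using tot by (rule le_less_trans) simp
    finally show "(\<integral>\<^sup>+p. ennreal (norm (case p of (s, t) \<Rightarrow> ?F s t)) \<partial>(lborel \<Otimes>\<^sub>M lborel)) < \<infinity>" .
  qed
  have c: "exp (- l * t) * (LINT s|lborel. rl_kernel \<alpha> (t - s) * Y s) = (LINT s|lborel. ?F s t)" for t
    by (simp add: mult.assoc)
  show "integrable lborel (\<lambda>t. exp (- l * t) * (LINT s|lborel. rl_kernel \<alpha> (t - s) * Y s))"
    unfolding c by (rule lborel_pair.integrable_snd[OF int])
  have in1: "(LINT t|lborel. ?F s t) = l powr (- \<alpha>) * (exp (- l * s) * Y s)" for s
  proof -
    have "integrable lborel (\<lambda>t. exp (- l * t) * rl_kernel \<alpha> (t - s)) \<and>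
       (LINT t|lborel. exp (- l * t) * rl_kernel \<alpha> (t - s)) = exp (- l * s) * l powr (- \<alpha>)"
      using nn_integral_rl_kernel_exp_shift[OF \<alpha> l, of s] rl_kernel_nonneg[OF \<alpha>]
      by (subst nn_integral_eq_integrable[symmetric]) auto
    then show ?thesis by simp
  qed
  have "(LINT t|lborel. (LINT s|lborel. ?F s t)) = (LINT s|lborel. (LINT t|lborel. ?F s t))"
    by (rule lborel_pair.Fubini_integral[OF int])
  then show "(LINT t|lborel. exp (- l * t) * (LINT s|lborel. rl_kernel \<alpha> (t - s) * Y s)) =
      l powr (- \<alpha>) * (LINT s|lborel. exp (- l * s) * Y s)"
    unfolding c in1 by simp
  have "(\<integral>\<^sup>+t. ennreal \<bar>LINT s|lborel. ?F s t\<bar> \<partial>lborel) \<le> (\<integral>\<^sup>+t. (\<integral>\<^sup>+s. ennreal \<bar>?F s t\<bar> \<partial>lborel) \<partial>lborel)"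
  proof (rule nn_integral_mono)
    fix t
    show "ennreal \<bar>LINT s|lborel. ?F s t\<bar> \<le> (\<integral>\<^sup>+s. ennreal \<bar>?F s t\<bar> \<partial>lborel)"
      using integral_norm_bound_ennreal[of lborel "\<lambda>s. ?F s t"]
      by (cases "integrable lborel (\<lambda>s. ?F s t)") (auto simp: not_integrable_integral_eq)
  qed
  also have "\<dots> = (\<integral>\<^sup>+s. (\<integral>\<^sup>+t. ennreal \<bar>?F s t\<bar> \<partial>lborel) \<partial>lborel)"
    by (rule lborel_pair.Fubini') measurable
  finally show "(\<integral>\<^sup>+t. ennreal \<bar>exp (- l * t) * (LINT s|lborel. rl_kernel \<alpha> (t - s) * Y s)\<bar> \<partial>lborel) \<le>
      ennreal (l powr (- \<alpha>) * (LINT s|lborel. \<bar>Y s\<bar>))"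
    unfolding c using tot by (rule order_trans)
qed

text \<open>Over the whole line the transform of Y - l powr \<alpha> * y vanishes. As Y ends at T,
  the integral over (0, T) equals l powr \<alpha> times the part of the transform of y beyond T,
  where y is the convolution continued past T.\<close>

lemma laplace_truncation:
  fixes Y :: "real \<Rightarrow> real"
  assumes \<alpha>: "\<alpha> > 0" and l: "l \<ge> 1" and T: "T > 0"
    and Y: "integrable lborel Y" "\<And>s. s \<notin> {0<..<T} \<Longrightarrow> Y s = 0"
  defines "y \<equiv> \<lambda>t. LINT s|lborel. rl_kernel \<alpha> (t - s) * Y s"
  shows "integrable lborel (\<lambda>t. indicator {0<..<T} t * (exp (- l * t) * (Y t - l powr \<alpha> * y t)))"
    "\<bar>LINT t|lborel. indicator {0<..<T} t * (exp (- l * t) * (Y t - l powr \<alpha> * y t))\<bar> \<le>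
      l powr \<alpha> * exp (- (l - 1) * T) * (LINT s|lborel. \<bar>Y s\<bar>)"
proof -
  have l0: "l > 0" using l by simp
  have Y0: "Y s = 0" if "s \<le> 0" for s using Y(2)[of s] that by simp
  have y0: "y t = 0" if "t \<le> 0" for t
  proof -
    have 0: "rl_kernel \<alpha> (t - s) * Y s = 0" for s using Y0[of s] that by (cases "s \<le> 0") (auto simp: rl_kernel_def)
    show ?thesis by (simp only: y_def 0 Bochner_Integration.integral_zero)
  qed
  have eYi: "integrable lborel (\<lambda>s. exp (- l * s) * Y s)"
  proof (rule Bochner_Integration.integrable_bound[OF Y(1)])
    show "AE s in lborel. norm (exp (- l * s) * Y s) \<le> norm (Y s)"
    proof (rule AE_I2)
      fix s show "norm (exp (- l * s) * Y s) \<le> norm (Y s)"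
        using Y0[of s] l0 by (cases "s \<le> 0") (auto simp: abs_mult intro!: mult_left_le_one_le)
    qed
  qed (use borel_measurable_integrable[OF Y(1)] in measurable)
  have yf: "(LINT s|lborel. rl_kernel \<alpha> (t - s) * Y s) = y t" for t by (simp only: y_def)
  note L = laplace_rl_conv[OF \<alpha> l0 Y(1) Y0, unfolded yf]
  \<comment> \<open>Rate 1 serves as a reference for the tail: beyond T, exp (- l * t) is at most
    exp (- (l - 1) * T) * exp (- t). This is the origin of l - 1 in the bound.\<close>
  note L1 = laplace_rl_conv[OF \<alpha> zero_less_one Y(1) Y0, unfolded yf]
  have di: "integrable lborel (\<lambda>t. exp (- l * t) * Y t - l powr \<alpha> * (exp (- l * t) * y t))"
    by (intro Bochner_Integration.integrable_diff eYi integrable_mult_right L(1))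
  have zero: "(LINT t|lborel. exp (- l * t) * Y t - l powr \<alpha> * (exp (- l * t) * y t)) = 0"
    using eYi L(1,2) l0 by (simp add: powr_minus)
  let ?d = "\<lambda>t. exp (- l * t) * Y t - l powr \<alpha> * (exp (- l * t) * y t)"
  let ?g = "\<lambda>t. indicator {0<..<T} t * (exp (- l * t) * (Y t - l powr \<alpha> * y t))"
  have ge: "?g t = indicator {0<..<T} t * ?d t" for t by (simp add: algebra_simps)
  have gi: "integrable lborel (\<lambda>t. indicator {0<..<T} t * ?d t)"
    using integrable_mult_indicator[OF _ di, of "{0<..<T}"] by simp
  show "integrable lborel ?g" unfolding ge by (rule gi)
  have ti: "integrable lborel (\<lambda>t. indicator {T..} t * (exp (- l * t) * y t))"
    using integrable_mult_indicator[OF _ L(1), of "{T..}"] by simp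
  have dec: "?d t = indicator {0<..<T} t * ?d t - l powr \<alpha> * (indicator {T..} t * (exp (- l * t) * y t))" for t
    using Y(2)[of t] y0[of t] by (auto simp: indicator_def)
  have "(LINT t|lborel. ?d t) = (LINT t|lborel. indicator {0<..<T} t * ?d t - l powr \<alpha> * (indicator {T..} t * (exp (- l * t) * y t)))"
    by (rule Bochner_Integration.integral_cong[OF refl dec])
  also have "\<dots> = (LINT t|lborel. indicator {0<..<T} t * ?d t) - l powr \<alpha> * (LINT t|lborel. indicator {T..} t * (exp (- l * t) * y t))"
    using gi ti by simp
  finally have eq: "(LINT t|lborel. ?g t) = l powr \<alpha> * (LINT t|lborel. indicator {T..} t * (exp (- l * t) * y t))"
    unfolding ge using zero by simp
  have "ennreal \<bar>LINT t|lborel. indicator {T..} t * (exp (- l * t) * y t)\<bar> \<le>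
      (\<integral>\<^sup>+t. ennreal \<bar>indicator {T..} t * (exp (- l * t) * y t)\<bar> \<partial>lborel)"
    using integral_norm_bound_ennreal[OF ti] by simp
  also have "\<dots> \<le> (\<integral>\<^sup>+t. ennreal (exp (- (l - 1) * T)) * ennreal \<bar>exp (- 1 * t) * y t\<bar> \<partial>lborel)"
  proof (rule nn_integral_mono)
    fix t
    have "\<bar>indicator {T..} t * (exp (- l * t) * y t)\<bar> \<le> exp (- (l - 1) * T) * \<bar>exp (- 1 * t) * y t\<bar>"
    proof (cases "t \<ge> T")
      case True
      have "(l - 1) * T \<le> (l - 1) * t" using True l by (intro mult_left_mono) auto
      then have "- l * t \<le> - (l - 1) * T + (- 1 * t)" by (simp add: algebra_simps)
      then have "exp (- l * t) \<le> exp (- (l - 1) * T) * exp (- 1 * t)" by (simp only: exp_add[symmetric] exp_le_cancel_iff)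
      then have "exp (- l * t) * \<bar>y t\<bar> \<le> exp (- (l - 1) * T) * exp (- 1 * t) * \<bar>y t\<bar>" by (intro mult_right_mono) auto
      then show ?thesis using True by (simp add: abs_mult mult.assoc)
    qed simp
    then show "ennreal \<bar>indicator {T..} t * (exp (- l * t) * y t)\<bar> \<le>
        ennreal (exp (- (l - 1) * T)) * ennreal \<bar>exp (- 1 * t) * y t\<bar>"
      by (simp add: ennreal_mult[symmetric] ennreal_leI)
  qed
  also have "\<dots> = ennreal (exp (- (l - 1) * T)) * (\<integral>\<^sup>+t. ennreal \<bar>exp (- 1 * t) * y t\<bar> \<partial>lborel)"
  proof (rule nn_integral_cmult)
    have "integrable lborel (\<lambda>t. exp (- 1 * t) * y t)" using L1(1) by blast
    note [measurable] = borel_measurable_integrable[OF this]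
    show "(\<lambda>t. ennreal \<bar>exp (- 1 * t) * y t\<bar>) \<in> borel_measurable lborel" by measurable
  qed
  also have "\<dots> \<le> ennreal (exp (- (l - 1) * T)) * ennreal (1 powr (- \<alpha>) * (LINT s|lborel. \<bar>Y s\<bar>))"
    using L1(3) by (intro mult_left_mono) auto
  also have "\<dots> = ennreal (exp (- (l - 1) * T) * (LINT s|lborel. \<bar>Y s\<bar>))"
    by (simp add: ennreal_mult[symmetric])
  finally have "\<bar>LINT t|lborel. indicator {T..} t * (exp (- l * t) * y t)\<bar> \<le> exp (- (l - 1) * T) * (LINT s|lborel. \<bar>Y s\<bar>)"
    by (subst (asm) ennreal_le_iff) (auto intro!: mult_nonneg_nonneg integral_nonneg_AE)
  then show "\<bar>LINT t|lborel. ?g t\<bar> \<le> l powr \<alpha> * exp (- (l - 1) * T) * (LINT s|lborel. \<bar>Y s\<bar>)"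
    unfolding eq by (simp add: abs_mult mult_left_mono mult.assoc)
qed

subsection \<open>Borel representatives\<close>

text \<open>Elements of \<open>L2_L2\<close> are measurable for the completed measure on the product
  space, whereas Fubini is applied on the product of two copies of \<open>lborel\<close>. Vanishing
  outside (0, T) times S lets all integrals run over the whole space.\<close>

definition borel_rep :: "real \<Rightarrow> (real^'d) set \<Rightarrow> (real \<Rightarrow> real^'d \<Rightarrow> real) \<Rightarrow> (real \<Rightarrow> real^'d \<Rightarrow> real) \<Rightarrow> bool" where
  "borel_rep T S w W \<longleftrightarrow> case_prod W \<in> borel_measurable (borel \<Otimes>\<^sub>M borel) \<and>
     (\<forall>t x. t \<notin> {0<..<T} \<or> x \<notin> S \<longrightarrow> W t x = 0) \<and>
     (\<integral>\<^sup>+t. (\<integral>\<^sup>+x. ennreal ((W t x)\<^sup>2) \<partial>lborel) \<partial>lborel) < \<infinity> \<and>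
     (AE p in lborel \<Otimes>\<^sub>M lborel. p \<in> {0<..<T} \<times> S \<longrightarrow> w (fst p) (snd p) = W (fst p) (snd p))"

lemma borel_rep_exists:
  assumes S: "open S" and w: "w \<in> L2_L2 T S"
  shows "\<exists>W. borel_rep T S w W"
proof -
  let ?D = "{0<..<T} \<times> S"
  have D: "open ?D" "?D \<in> sets borel" "?D \<in> sets lebesgue"
    using S by (auto simp: open_Times intro: sets_completionI_sets)
  let ?g = "\<lambda>p. case p of (t, x) \<Rightarrow> w t x"
  have wm: "?g \<in> borel_measurable (lebesgue_on ?D)" and wi: "integrable (lebesgue_on ?D) (\<lambda>p. (?g p)\<^sup>2)"
    using w by (auto simp: L2_L2_def L2_space_def)
  let ?h = "\<lambda>p. if p \<in> ?D then ?g p else 0"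
  have hm: "?h \<in> borel_measurable lebesgue" by (rule borel_measurable_if_I[OF wm D(3)])
  obtain G where G: "G \<in> borel_measurable lborel" "AE p in lborel. ?h p = G p"
    using completion_ex_borel_measurable_real[OF hm] by blast
  have [measurable]: "G \<in> borel_measurable borel" "?D \<in> sets borel" using G(1) D(2) by auto
  define H where "H p = indicator ?D p * G p" for p
  have Hm: "H \<in> borel_measurable borel" unfolding H_def[abs_def] by measurable
  have eq: "AE p in lborel. ?h p = H p" using G(2) by eventually_elim (auto simp: H_def indicator_def split: if_splits)
  have hi: "integrable lebesgue (\<lambda>p. (?h p)\<^sup>2)"
  proof -
    have "integrable lebesgue (\<lambda>p. indicator ?D p *\<^sub>R (?g p)\<^sup>2)"
      using wi D(3) by (subst (asm) integrable_restrict_space) auto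
    moreover have "(\<lambda>p. indicator ?D p *\<^sub>R (?g p)\<^sup>2) = (\<lambda>p. (?h p)\<^sup>2)"
      by (intro ext) (simp add: indicator_def)
    ultimately show ?thesis by simp
  qed
  have "integrable lebesgue (\<lambda>p. (H p)\<^sup>2)"
  proof (rule integrable_cong_AE_imp[OF hi])
    show "(\<lambda>p. (H p)\<^sup>2) \<in> borel_measurable lebesgue" using Hm by (intro borel_measurable_power measurable_completion) simp
    show "AE p in lebesgue. (?h p)\<^sup>2 = (H p)\<^sup>2"
      by (rule AE_completion) (use eq in eventually_elim, simp)
  qed
  then have "integrable lborel (\<lambda>p. (H p)\<^sup>2)" using Hm by (subst (asm) integrable_completion) auto
  then have "(\<integral>\<^sup>+p. ennreal (norm ((H p)\<^sup>2)) \<partial>lborel) < \<infinity>" unfolding integrable_iff_bounded by simp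
  then have fin: "(\<integral>\<^sup>+p. ennreal ((H p)\<^sup>2) \<partial>(lborel \<Otimes>\<^sub>M lborel)) < \<infinity>" by (simp add: lborel_prod)
  have Hm': "H \<in> borel_measurable (lborel \<Otimes>\<^sub>M lborel)" using Hm by (simp add: lborel_prod)
  have Hm2: "H \<in> borel_measurable (borel \<Otimes>\<^sub>M borel)" using Hm by (simp add: borel_prod)
  have "borel_rep T S w (\<lambda>t x. H (t, x))"
    unfolding borel_rep_def
  proof (intro conjI allI impI)
    show "case_prod (\<lambda>t x. H (t, x)) \<in> borel_measurable (borel \<Otimes>\<^sub>M borel)" using Hm2 by simp
    show "H (t, x) = 0" if "t \<notin> {0<..<T} \<or> x \<notin> S" for t x using that by (auto simp: H_def indicator_def)
    have "(\<integral>\<^sup>+t. (\<integral>\<^sup>+x. ennreal ((H (t, x))\<^sup>2) \<partial>lborel) \<partial>lborel) = (\<integral>\<^sup>+p. ennreal ((H p)\<^sup>2) \<partial>(lborel \<Otimes>\<^sub>M lborel))"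
      using Hm' by (subst lborel.nn_integral_fst[symmetric]) auto
    then show "(\<integral>\<^sup>+t. (\<integral>\<^sup>+x. ennreal ((H (t, x))\<^sup>2) \<partial>lborel) \<partial>lborel) < \<infinity>" using fin by simp
    have "AE p in lborel. p \<in> ?D \<longrightarrow> w (fst p) (snd p) = H (fst p, snd p)"
      using eq by eventually_elim (auto simp: case_prod_beta)
    then show "AE p in lborel \<Otimes>\<^sub>M lborel. p \<in> ?D \<longrightarrow> w (fst p) (snd p) = H (fst p, snd p)"
      by (simp only: lborel_prod)
  qed
  then show ?thesis by blast
qed

text \<open>Slices of a null set in the direction of time, for almost every x; the Riemann-Liouville
  integral acts in t at fixed x, so this order is the one it needs.\<close>

lemma AE_pair_swap:
  fixes P :: "'a::euclidean_space \<times> 'b::euclidean_space \<Rightarrow> bool"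
  assumes "AE p in lborel \<Otimes>\<^sub>M lborel. P p"
  shows "AE x in lborel. AE t in lborel. P (t, x)"
proof -
  obtain N where N: "{p \<in> space (lborel \<Otimes>\<^sub>M lborel). \<not> P p} \<subseteq> N" "emeasure (lborel \<Otimes>\<^sub>M lborel) N = 0"
    "N \<in> sets (lborel \<Otimes>\<^sub>M lborel)"
    using AE_E[OF assms] by blast
  have "(\<integral>\<^sup>+x. emeasure lborel ((\<lambda>t. (t, x)) -` N) \<partial>lborel) = 0"
    using lborel_pair.emeasure_pair_measure_alt2[OF N(3)] N(2) by simp
  then have "AE x in lborel. emeasure lborel ((\<lambda>t. (t, x)) -` N) = 0"
    using lborel_pair.measurable_emeasure_Pair2[OF N(3)] by (subst (asm) nn_integral_0_iff_AE) auto
  then show ?thesis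
  proof eventually_elim
    case (elim x)
    have "(\<lambda>t. (t, x)) -` N \<in> sets lborel" using sets_Pair2[OF N(3), of x] by simp
    with elim have "(\<lambda>t. (t, x)) -` N \<in> null_sets lborel" by auto
    then have "AE t in lborel. t \<notin> (\<lambda>t. (t, x)) -` N" by (rule AE_not_in)
    then show ?case
      by eventually_elim (use N(1) in \<open>auto simp: space_pair_measure\<close>)
  qed
qed

lemma LINT_lebesgue_on_rep:
  fixes h H :: "'a::euclidean_space \<Rightarrow> real"
  assumes S: "open S" and eq: "AE x in lborel. x \<in> S \<longrightarrow> h x = H x"
    and H: "H \<in> borel_measurable borel" "\<And>x. x \<notin> S \<Longrightarrow> H x = 0"
  shows "(LINT x|lebesgue_on S. h x) = (LINT x|lborel. H x)"
    "integrable lborel H \<Longrightarrow> integrable (lebesgue_on S) h"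
    "h \<in> borel_measurable (lebesgue_on S)"
proof -
  have SL: "S \<in> sets lebesgue" using S by (simp add: sets_completionI_sets)
  have "AE x in lebesgue. x \<in> S \<longrightarrow> h x = H x" using eq by (rule AE_completion)
  then have ae: "AE x in lebesgue_on S. H x = h x" using SL by (subst AE_restrict_space_iff) auto
  have Hm: "H \<in> borel_measurable (lebesgue_on S)"
    using H(1) by (intro measurable_restrict_space1 measurable_completion) simp
  show hm: "h \<in> borel_measurable (lebesgue_on S)" by (rule borel_measurable_lebesgue_on_AE[OF SL Hm ae])
  have "(LINT x|lebesgue_on S. h x) = (LINT x|lebesgue_on S. H x)"
    using ae by (intro integral_cong_AE hm Hm) auto
  also have "\<dots> = (LINT x|lborel. H x)" by (rule LINT_lebesgue_on_supported[OF S H])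
  finally show "(LINT x|lebesgue_on S. h x) = (LINT x|lborel. H x)" .
  assume "integrable lborel H"
  then have "integrable lebesgue H" using H(1) by (subst integrable_completion) auto
  then have "integrable lebesgue (\<lambda>x. indicator S x *\<^sub>R H x)"
    by (rule integrable_mult_indicator[OF SL])
  then have "integrable (lebesgue_on S) H" using SL by (subst integrable_restrict_space) auto
  then show "integrable (lebesgue_on S) h" by (rule integrable_cong_AE_imp[OF _ hm]) (use ae in auto)
qed

lemma RL_integral_rep:
  assumes eq: "AE s in lborel. s \<in> {0<..<T} \<longrightarrow> v s = V s" and V: "V \<in> borel_measurable borel"
    and zero: "\<And>s. s \<notin> {0<..<T} \<Longrightarrow> V s = 0" and t: "t \<in> {0<..<T}"
  shows "RL_integral \<alpha> v t = (LINT s|lborel. rl_kernel \<alpha> (t - s) * V s)"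
proof -
  note [measurable] = V
  let ?H = "\<lambda>s. indicator {0<..<t} s * ((t - s) powr (\<alpha> - 1) * V s)"
  have "(LINT s|lebesgue_on {0<..<t}. (t - s) powr (\<alpha> - 1) * v s) = (LINT s|lborel. ?H s)"
  proof (rule LINT_lebesgue_on_rep)
    show "AE s in lborel. s \<in> {0<..<t} \<longrightarrow> (t - s) powr (\<alpha> - 1) * v s = ?H s"
      using eq by eventually_elim (use t in auto)
  qed auto
  then have "RL_integral \<alpha> v t = (LINT s|lborel. (1 / Gamma \<alpha>) * ?H s)"
    by (simp add: RL_integral_def)
  also have "\<dots> = (LINT s|lborel. rl_kernel \<alpha> (t - s) * V s)"
    by (intro Bochner_Integration.integral_cong refl) (use zero in \<open>auto simp: rl_kernel_def indicator_def\<close>)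
  finally show ?thesis .
qed

lemma borel_repD:
  assumes "borel_rep T S w W"
  shows "case_prod W \<in> borel_measurable (borel \<Otimes>\<^sub>M borel)"
    "t \<notin> {0<..<T} \<or> x \<notin> S \<Longrightarrow> W t x = 0"
    "(\<integral>\<^sup>+t. (\<integral>\<^sup>+x. ennreal ((W t x)\<^sup>2) \<partial>lborel) \<partial>lborel) < \<infinity>"
    "AE t in lborel. AE x in lborel. t \<in> {0<..<T} \<longrightarrow> x \<in> S \<longrightarrow> w t x = W t x"
    "AE x in lborel. AE t in lborel. t \<in> {0<..<T} \<longrightarrow> x \<in> S \<longrightarrow> w t x = W t x"
  using assms lborel_pair.AE_pair[of "\<lambda>p. p \<in> {0<..<T} \<times> S \<longrightarrow> w (fst p) (snd p) = W (fst p) (snd p)"]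
    AE_pair_swap[of "\<lambda>p. p \<in> {0<..<T} \<times> S \<longrightarrow> w (fst p) (snd p) = W (fst p) (snd p)"]
  by (auto simp: borel_rep_def)

text \<open>The exceptional set of points x is independent of t: for almost every x the two slices
  agree almost everywhere in time, which settles the fractional integral at all t at once.\<close>

lemma borel_rep_RL_slice:
  fixes v :: "real \<Rightarrow> real^'d \<Rightarrow> real"
  assumes V: "borel_rep T S v V"
  shows "AE x in lborel. \<forall>t\<in>{0<..<T}. x \<in> S \<longrightarrow>
      RL_integral \<alpha> (\<lambda>s. v s x) t = (LINT s|lborel. rl_kernel \<alpha> (t - s) * V s x)"
proof -
  note [measurable] = borel_repD(1)[OF V]
  show ?thesis
    using borel_repD(5)[OF V]
  proof eventually_elim
    case (elim x)
    show ?case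
    proof (intro ballI impI)
      fix t assume t: "t \<in> {0<..<T}" and x: "x \<in> S"
      show "RL_integral \<alpha> (\<lambda>s. v s x) t = (LINT s|lborel. rl_kernel \<alpha> (t - s) * V s x)"
      proof (rule RL_integral_rep[OF _ _ _ t])
        show "AE s in lborel. s \<in> {0<..<T} \<longrightarrow> v s x = V s x" using elim by eventually_elim (use x in auto)
      qed (use borel_repD(2)[OF V] in auto)
    qed
  qed
qed

section \<open>Pairing with a fixed function of space\<close>

lemma abs_mult_le_squares: "\<bar>a * b\<bar> \<le> a\<^sup>2 + b\<^sup>2" for a b :: real
proof -
  have "2 * \<bar>a * b\<bar> \<le> a\<^sup>2 + b\<^sup>2"
    using sum_squares_bound[of "\<bar>a\<bar>" "\<bar>b\<bar>"] by (simp add: abs_mult)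
  then show ?thesis using abs_ge_zero[of "a * b"] by linarith
qed

lemma rep_pairing_integrable:
  fixes V :: "real \<Rightarrow> real^'d \<Rightarrow> real"
  assumes S: "open S" and T: "T > 0" and V: "borel_rep T S v V"
    and z: "z \<in> borel_measurable borel" "integrable lborel (\<lambda>x. (z x)\<^sup>2)"
  shows "(\<integral>\<^sup>+t. (\<integral>\<^sup>+x. ennreal \<bar>V t x * z x\<bar> \<partial>lborel) \<partial>lborel) \<le>
    (\<integral>\<^sup>+t. (\<integral>\<^sup>+x. ennreal ((V t x)\<^sup>2) \<partial>lborel) \<partial>lborel) + ennreal (T * (LINT x|lborel. (z x)\<^sup>2))"
proof -
  note [measurable] = borel_repD(1)[OF V] z(1)
  have "(\<integral>\<^sup>+t. (\<integral>\<^sup>+x. ennreal \<bar>V t x * z x\<bar> \<partial>lborel) \<partial>lborel) \<le>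
      (\<integral>\<^sup>+t. ((\<integral>\<^sup>+x. ennreal ((V t x)\<^sup>2) \<partial>lborel) + ennreal (LINT x|lborel. (z x)\<^sup>2) * indicator {0<..<T} t) \<partial>lborel)"
  proof (rule nn_integral_mono)
    fix t
    show "(\<integral>\<^sup>+x. ennreal \<bar>V t x * z x\<bar> \<partial>lborel) \<le>
        (\<integral>\<^sup>+x. ennreal ((V t x)\<^sup>2) \<partial>lborel) + ennreal (LINT x|lborel. (z x)\<^sup>2) * indicator {0<..<T} t"
    proof (cases "t \<in> {0<..<T}")
      case True
      have "(\<integral>\<^sup>+x. ennreal \<bar>V t x * z x\<bar> \<partial>lborel) \<le> (\<integral>\<^sup>+x. ennreal ((V t x)\<^sup>2) + ennreal ((z x)\<^sup>2) \<partial>lborel)"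
        by (intro nn_integral_mono) (simp add: abs_mult_le_squares ennreal_leI flip: ennreal_plus)
      also have "\<dots> = (\<integral>\<^sup>+x. ennreal ((V t x)\<^sup>2) \<partial>lborel) + (\<integral>\<^sup>+x. ennreal ((z x)\<^sup>2) \<partial>lborel)"
        by (rule nn_integral_add) auto
      also have "(\<integral>\<^sup>+x. ennreal ((z x)\<^sup>2) \<partial>lborel) = ennreal (LINT x|lborel. (z x)\<^sup>2)"
        by (rule nn_integral_eq_integral[OF z(2)]) auto
      finally show ?thesis using True by simp
    next
      case False
      then have "V t x = 0" for x using borel_repD(2)[OF V] by blast
      then show ?thesis by simp
    qed
  qed
  also have "\<dots> = (\<integral>\<^sup>+t. (\<integral>\<^sup>+x. ennreal ((V t x)\<^sup>2) \<partial>lborel) \<partial>lborel) +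
      (\<integral>\<^sup>+t. ennreal (LINT x|lborel. (z x)\<^sup>2) * indicator {0<..<T} t \<partial>lborel)"
    by (rule nn_integral_add) measurable
  also have "(\<integral>\<^sup>+t. ennreal (LINT x|lborel. (z x)\<^sup>2) * indicator {0<..<T} t \<partial>lborel) = ennreal (T * (LINT x|lborel. (z x)\<^sup>2))"
    using T by (subst nn_integral_cmult_indicator) (auto simp: ennreal_mult'[symmetric] mult.commute)
  finally show ?thesis .
qed

text \<open>Tonelli moves the time integral onto the kernel, whose mass on the window is at most exp
  T: J^\<alpha> is bounded on L^1(0, T).\<close>

lemma nn_integral_rl_conv_le:
  assumes \<alpha>: "\<alpha> > 0" and [measurable]: "A \<in> borel_measurable borel" and A: "\<And>s. s \<notin> {0<..<T} \<Longrightarrow> A s = 0"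
  shows "(\<integral>\<^sup>+t. (\<integral>\<^sup>+s. ennreal (rl_kernel \<alpha> (t - s)) * A s \<partial>lborel) * indicator {0<..<T} t \<partial>lborel) \<le>
    (\<integral>\<^sup>+s. A s \<partial>lborel) * ennreal (exp T)"
proof -
  have "(\<integral>\<^sup>+t. (\<integral>\<^sup>+s. ennreal (rl_kernel \<alpha> (t - s)) * A s \<partial>lborel) * indicator {0<..<T} t \<partial>lborel) =
      (\<integral>\<^sup>+t. (\<integral>\<^sup>+s. A s * (ennreal (rl_kernel \<alpha> (t - s)) * indicator {0<..<T} t) \<partial>lborel) \<partial>lborel)"
  proof (rule nn_integral_cong)
    fix t
    have "(\<integral>\<^sup>+s. ennreal (rl_kernel \<alpha> (t - s)) * A s \<partial>lborel) * indicator {0<..<T} t =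
        (\<integral>\<^sup>+s. ennreal (rl_kernel \<alpha> (t - s)) * A s * indicator {0<..<T} t \<partial>lborel)"
      by (rule nn_integral_multc[symmetric]) measurable
    then show "(\<integral>\<^sup>+s. ennreal (rl_kernel \<alpha> (t - s)) * A s \<partial>lborel) * indicator {0<..<T} t =
        (\<integral>\<^sup>+s. A s * (ennreal (rl_kernel \<alpha> (t - s)) * indicator {0<..<T} t) \<partial>lborel)"
      by (simp add: mult_ac)
  qed
  also have "\<dots> = (\<integral>\<^sup>+s. (\<integral>\<^sup>+t. A s * (ennreal (rl_kernel \<alpha> (t - s)) * indicator {0<..<T} t) \<partial>lborel) \<partial>lborel)"
    by (rule lborel_pair.Fubini') measurable
  also have "\<dots> \<le> (\<integral>\<^sup>+s. A s * ennreal (exp T) \<partial>lborel)"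
  proof (rule nn_integral_mono)
    fix s
    show "(\<integral>\<^sup>+t. A s * (ennreal (rl_kernel \<alpha> (t - s)) * indicator {0<..<T} t) \<partial>lborel) \<le> A s * ennreal (exp T)"
    proof (cases "s \<in> {0<..<T}")
      case True
      have "(\<integral>\<^sup>+t. ennreal (rl_kernel \<alpha> (t - s)) * indicator {0<..<T} t \<partial>lborel) \<le>
          (\<integral>\<^sup>+t. ennreal (rl_kernel \<alpha> (t - s)) * indicator {..<s + T} t \<partial>lborel)"
        using True by (intro nn_integral_mono) (auto simp: indicator_def)
      also have "\<dots> \<le> ennreal (exp T)" by (rule nn_integral_rl_kernel_le[OF \<alpha>])
      finally show ?thesis by (subst nn_integral_cmult) (auto intro: mult_left_mono)
    next
      case False
      then show ?thesis by (simp add: A)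
    qed
  qed
  also have "\<dots> = (\<integral>\<^sup>+s. A s \<partial>lborel) * ennreal (exp T)"
    by (rule nn_integral_multc) measurable
  finally show ?thesis .
qed

text \<open>Pairing in space commutes with J^\<alpha> in time, so the scalar functions of t obtained
  from v and u inherit the relation between v and u. The evolution problem is thereby reduced to one
  scalar convolution for each exponent.\<close>

lemma dual_pairing:
  fixes V :: "real \<Rightarrow> real^'d \<Rightarrow> real"
  assumes S: "open S" and T: "T > 0" and V: "borel_rep T S v V"
    and z: "z \<in> borel_measurable borel" "integrable lborel (\<lambda>x. (z x)\<^sup>2)" "\<And>x. x \<notin> S \<Longrightarrow> z x = 0"
  defines "Y \<equiv> \<lambda>t. LINT x|lborel. V t x * z x"
  shows "integrable lborel Y" "\<And>t. t \<notin> {0<..<T} \<Longrightarrow> Y t = 0"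
    "ennreal (LINT t|lborel. \<bar>Y t\<bar>) \<le> (\<integral>\<^sup>+t. (\<integral>\<^sup>+x. ennreal ((V t x)\<^sup>2) \<partial>lborel) \<partial>lborel) + ennreal (T * (LINT x|lborel. (z x)\<^sup>2))"
    "AE t in lborel. t \<in> {0<..<T} \<longrightarrow> integrable (lebesgue_on S) (\<lambda>x. v t x * z x) \<and>
       (LINT x|lebesgue_on S. v t x * z x) = Y t"
    "\<lbrakk>0 < \<alpha>; AE (t, x) in lebesgue_on ({0<..<T} \<times> S). u t x = RL_integral \<alpha> (\<lambda>s. v s x) t\<rbrakk> \<Longrightarrow>
      AE t in lborel. t \<in> {0<..<T} \<longrightarrow>
        (LINT x|lebesgue_on S. u t x * z x) = (LINT s|lborel. rl_kernel \<alpha> (t - s) * Y s)"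
proof -
  note [measurable] = borel_repD(1)[OF V] z(1)
  have tot: "(\<integral>\<^sup>+t. (\<integral>\<^sup>+x. ennreal \<bar>V t x * z x\<bar> \<partial>lborel) \<partial>lborel) < \<infinity>"
    by (rule order.strict_trans1[OF rep_pairing_integrable[OF S T V z(1,2)]])
      (use borel_repD(3)[OF V] in simp)
  have int: "integrable (lborel \<Otimes>\<^sub>M lborel) (\<lambda>(t, x). V t x * z x)"
  proof (rule integrableI_bounded)
    have "(\<integral>\<^sup>+p. ennreal (norm (case p of (t, x) \<Rightarrow> V t x * z x)) \<partial>(lborel \<Otimes>\<^sub>M lborel)) =
        (\<integral>\<^sup>+t. (\<integral>\<^sup>+x. ennreal \<bar>V t x * z x\<bar> \<partial>lborel) \<partial>lborel)"
      by (subst lborel.nn_integral_fst[symmetric]) auto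
    then show "(\<integral>\<^sup>+p. ennreal (norm (case p of (t, x) \<Rightarrow> V t x * z x)) \<partial>(lborel \<Otimes>\<^sub>M lborel)) < \<infinity>"
      using tot by simp
  qed measurable
  show Yi: "integrable lborel Y" unfolding Y_def by (rule lborel_pair.integrable_fst[OF int])
  show Y0: "Y t = 0" if "t \<notin> {0<..<T}" for t
  proof -
    have "V t x = 0" for x using borel_repD(2)[OF V] that by blast
    then show ?thesis by (simp add: Y_def)
  qed
  have Yabs: "ennreal \<bar>Y t\<bar> \<le> (\<integral>\<^sup>+x. ennreal \<bar>V t x * z x\<bar> \<partial>lborel)" for t
    using integral_norm_bound_ennreal[of lborel "\<lambda>x. V t x * z x"]
    unfolding Y_def by (cases "integrable lborel (\<lambda>x. V t x * z x)") (auto simp: not_integrable_integral_eq)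
  have "ennreal (LINT t|lborel. \<bar>Y t\<bar>) = (\<integral>\<^sup>+t. ennreal \<bar>Y t\<bar> \<partial>lborel)"
    using Yi by (intro nn_integral_eq_integral[symmetric]) auto
  also have "\<dots> \<le> (\<integral>\<^sup>+t. (\<integral>\<^sup>+x. ennreal \<bar>V t x * z x\<bar> \<partial>lborel) \<partial>lborel)"
    by (intro nn_integral_mono Yabs)
  finally show "ennreal (LINT t|lborel. \<bar>Y t\<bar>) \<le> (\<integral>\<^sup>+t. (\<integral>\<^sup>+x. ennreal ((V t x)\<^sup>2) \<partial>lborel) \<partial>lborel) + ennreal (T * (LINT x|lborel. (z x)\<^sup>2))"
    using rep_pairing_integrable[OF S T V z(1,2)] by (rule order_trans)
  have "AE t in lborel. integrable lborel (\<lambda>x. V t x * z x)"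
    using lborel_pair.AE_integrable_fst[OF int] .
  then show "AE t in lborel. t \<in> {0<..<T} \<longrightarrow> integrable (lebesgue_on S) (\<lambda>x. v t x * z x) \<and>
       (LINT x|lebesgue_on S. v t x * z x) = Y t"
    using borel_repD(4)[OF V]
  proof eventually_elim
    case (elim t)
    show ?case
    proof
      assume t: "t \<in> {0<..<T}"
      have 1: "AE x in lborel. x \<in> S \<longrightarrow> v t x * z x = V t x * z x"
        using elim(2) by eventually_elim (use t in auto)
      have 2: "(\<lambda>x. V t x * z x) \<in> borel_measurable borel" by measurable
      note r = LINT_lebesgue_on_rep[OF S 1 2]
      show "integrable (lebesgue_on S) (\<lambda>x. v t x * z x) \<and> (LINT x|lebesgue_on S. v t x * z x) = Y t"
        using r(1,2) z(3) elim(1) unfolding Y_def by simp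
    qed
  qed
  assume \<alpha>: "0 < \<alpha>" and u: "AE (t, x) in lebesgue_on ({0<..<T} \<times> S). u t x = RL_integral \<alpha> (\<lambda>s. v s x) t"
  have D: "{0<..<T} \<times> S \<in> sets lebesgue" using S by (auto simp: open_Times intro: sets_completionI_sets)
  have "AE p in lebesgue. p \<in> {0<..<T} \<times> S \<longrightarrow> u (fst p) (snd p) = RL_integral \<alpha> (\<lambda>s. v s (snd p)) (fst p)"
    using u D by (subst (asm) AE_restrict_space_iff) (auto simp: case_prod_beta)
  then have "AE p in lborel. p \<in> {0<..<T} \<times> S \<longrightarrow> u (fst p) (snd p) = RL_integral \<alpha> (\<lambda>s. v s (snd p)) (fst p)"
    by (simp only: AE_completion_iff)
  then have "AE p in lborel \<Otimes>\<^sub>M lborel. p \<in> {0<..<T} \<times> S \<longrightarrow> u (fst p) (snd p) = RL_integral \<alpha> (\<lambda>s. v s (snd p)) (fst p)"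
    by (simp only: lborel_prod)
  from lborel_pair.AE_pair[OF this]
  have u1: "AE t in lborel. AE x in lborel. t \<in> {0<..<T} \<longrightarrow> x \<in> S \<longrightarrow> u t x = RL_integral \<alpha> (\<lambda>s. v s x) t"
    by (rule eventually_mono) (auto elim: eventually_mono)
  note v1 = borel_rep_RL_slice[OF V, of \<alpha>]
  \<comment> \<open>Tonelli bounds the time integral of this quantity, so it is finite for almost
    every t, and at such t Fubini in the variables s and x is legitimate.\<close>
  let ?N = "\<lambda>t. (\<integral>\<^sup>+s. (\<integral>\<^sup>+x. ennreal (rl_kernel \<alpha> (t - s)) * ennreal \<bar>V s x * z x\<bar> \<partial>lborel) \<partial>lborel)"
  have "(\<integral>\<^sup>+t. ?N t * indicator {0<..<T} t \<partial>lborel) < \<infinity>"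
  proof -
    have "?N t = (\<integral>\<^sup>+s. ennreal (rl_kernel \<alpha> (t - s)) * (\<integral>\<^sup>+x. ennreal \<bar>V s x * z x\<bar> \<partial>lborel) \<partial>lborel)" for t
      by (intro nn_integral_cong nn_integral_cmult) measurable
    moreover have "(\<integral>\<^sup>+x. ennreal \<bar>V s x * z x\<bar> \<partial>lborel) = 0" if "s \<notin> {0<..<T}" for s
      using borel_repD(2)[OF V] that by simp
    ultimately have "(\<integral>\<^sup>+t. ?N t * indicator {0<..<T} t \<partial>lborel) \<le>
        (\<integral>\<^sup>+s. (\<integral>\<^sup>+x. ennreal \<bar>V s x * z x\<bar> \<partial>lborel) \<partial>lborel) * ennreal (exp T)"
      using nn_integral_rl_conv_le[OF \<alpha>, of "\<lambda>s. \<integral>\<^sup>+x. ennreal \<bar>V s x * z x\<bar> \<partial>lborel" T] by simp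
    also have "\<dots> < \<infinity>" using tot by (simp add: ennreal_mult_less_top)
    finally show ?thesis .
  qed
  then have "AE t in lborel. ?N t * indicator {0<..<T} t \<noteq> \<infinity>"
    by (intro nn_integral_PInf_AE) auto
  then show "AE t in lborel. t \<in> {0<..<T} \<longrightarrow>
        (LINT x|lebesgue_on S. u t x * z x) = (LINT s|lborel. rl_kernel \<alpha> (t - s) * Y s)"
    using u1
  proof eventually_elim
    case (elim t)
    show ?case
    proof
      assume t: "t \<in> {0<..<T}"
      let ?F = "\<lambda>s x. rl_kernel \<alpha> (t - s) * (V s x * z x)"
      have Fi: "integrable (lborel \<Otimes>\<^sub>M lborel) (\<lambda>(s, x). ?F s x)"
      proof (rule integrableI_bounded)
        have "(\<integral>\<^sup>+p. ennreal (norm (case p of (s, x) \<Rightarrow> ?F s x)) \<partial>(lborel \<Otimes>\<^sub>M lborel)) = ?N t"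
          using rl_kernel_nonneg[OF \<alpha>]
          by (subst lborel.nn_integral_fst[symmetric]) (auto simp: abs_mult ennreal_mult intro!: nn_integral_cong)
        then show "(\<integral>\<^sup>+p. ennreal (norm (case p of (s, x) \<Rightarrow> ?F s x)) \<partial>(lborel \<Otimes>\<^sub>M lborel)) < \<infinity>"
          using elim(1) t by (simp add: less_top)
      qed measurable
      have "AE x in lborel. x \<in> S \<longrightarrow> u t x * z x = (LINT s|lborel. ?F s x)"
        using elim(2) v1
      proof eventually_elim
        case (elim x)
        have "(LINT s|lborel. ?F s x) = (LINT s|lborel. rl_kernel \<alpha> (t - s) * V s x) * z x"
          by (subst integral_mult_left_zero[symmetric]) (simp add: mult.assoc)
        with elim t show ?case by simp
      qed
      then have "(LINT x|lebesgue_on S. u t x * z x) = (LINT x|lborel. (LINT s|lborel. ?F s x))"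
        by (rule LINT_lebesgue_on_rep(1)[OF S]) (use z(3) in auto)
      also have "\<dots> = (LINT s|lborel. (LINT x|lborel. ?F s x))"
        by (rule lborel_pair.Fubini_integral[OF Fi])
      also have "\<dots> = (LINT s|lborel. rl_kernel \<alpha> (t - s) * Y s)"
        unfolding Y_def by simp
      finally show "(LINT x|lebesgue_on S. u t x * z x) = (LINT s|lborel. rl_kernel \<alpha> (t - s) * Y s)" .
    qed
  qed
qed

subsection \<open>Fractional derivatives of lower order\<close>

text \<open>Cauchy-Schwarz for the measure with density given by the kernel, whose mass on the
  relevant window is at most exp T. It is the pointwise form of the boundedness of J^\<delta> on
  L^2.\<close>

lemma rl_conv_square:
  fixes h :: "real \<Rightarrow> real"
  assumes \<delta>: "\<delta> > 0" and hm[measurable]: "h \<in> borel_measurable borel"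
    and h0: "\<And>s. s \<notin> {0<..<T} \<Longrightarrow> h s = 0" and t: "t \<in> {0<..<T}"
  shows "ennreal ((LINT s|lborel. rl_kernel \<delta> (t - s) * h s)\<^sup>2) \<le>
    ennreal (exp T) * (\<integral>\<^sup>+s. ennreal (rl_kernel \<delta> (t - s)) * ennreal ((h s)\<^sup>2) \<partial>lborel)"
proof -
  let ?I = "\<integral>\<^sup>+s. ennreal (rl_kernel \<delta> (t - s)) * ennreal ((h s)\<^sup>2) \<partial>lborel"
  define k where "k s = rl_kernel \<delta> (t - s) * indicator {0<..<T} s" for s
  have km[measurable]: "k \<in> borel_measurable borel" unfolding k_def[abs_def] by measurable
  have k0: "k s \<ge> 0" for s using rl_kernel_nonneg[OF \<delta>] by (simp add: k_def)
  have kk: "(\<integral>\<^sup>+s. ennreal (k s) \<partial>lborel) \<le> ennreal (exp T)"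
  proof -
    have "(\<integral>\<^sup>+s. ennreal (k s) \<partial>lborel) = (\<integral>\<^sup>+s. ennreal (k (t + (-1) * s)) \<partial>lborel)"
      using nn_integral_real_affine[of "\<lambda>s. ennreal (k s)" "-1" t] by simp
    also have "\<dots> \<le> (\<integral>\<^sup>+s. ennreal (rl_kernel \<delta> (s - 0)) * indicator {..<0 + T} s \<partial>lborel)"
      by (intro nn_integral_mono) (use t in \<open>auto simp: k_def indicator_def\<close>)
    also have "\<dots> \<le> ennreal (exp T)" by (rule nn_integral_rl_kernel_le[OF \<delta>])
    finally show ?thesis .
  qed
  have ki: "integrable lborel k"
    by (rule integrableI_bounded) (use kk k0 in \<open>auto simp: less_top[symmetric] top_unique\<close>)
  have kl: "(LINT s|lborel. k s) \<le> exp T"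
    using kk nn_integral_eq_integral[OF ki] k0 by (simp add: ennreal_le_iff)
  have kh: "rl_kernel \<delta> (t - s) * h s = k s * h s" for s using h0[of s] by (auto simp: k_def indicator_def)
  have Ieq: "?I = (\<integral>\<^sup>+s. ennreal (k s * (h s)\<^sup>2) \<partial>lborel)"
    by (intro nn_integral_cong) (use h0 rl_kernel_nonneg[OF \<delta>] in \<open>auto simp: k_def indicator_def ennreal_mult\<close>)
  show ?thesis
  proof (cases "?I = \<infinity>")
    case True
    then show ?thesis by (simp add: ennreal_mult_top)
  next
    case False
    have i2: "integrable lborel (\<lambda>s. k s * (h s)\<^sup>2)"
      by (rule integrableI_bounded) (use False k0 in \<open>auto simp: Ieq abs_mult less_top\<close>)
    have s1: "sqint lborel (\<lambda>s. sqrt (k s))" using ki k0 by (simp add: sqint_def)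
    have s2: "sqint lborel (\<lambda>s. sqrt (k s) * h s)" using i2 k0 by (simp add: sqint_def power_mult_distrib)
    have "\<bar>LINT s|lborel. sqrt (k s) * (sqrt (k s) * h s)\<bar> \<le>
        sqrt (LINT s|lborel. (sqrt (k s))\<^sup>2) * sqrt (LINT s|lborel. (sqrt (k s) * h s)\<^sup>2)"
      by (rule sqint_Cauchy_Schwarz[OF s1 s2])
    also have "(\<lambda>s. sqrt (k s) * (sqrt (k s) * h s)) = (\<lambda>s. k s * h s)"
      using k0 by (intro ext) (simp flip: mult.assoc)
    finally have "\<bar>LINT s|lborel. k s * h s\<bar> \<le> sqrt ((LINT s|lborel. k s) * (LINT s|lborel. k s * (h s)\<^sup>2))"
      using k0 by (simp add: power_mult_distrib real_sqrt_mult)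
    then have "\<bar>LINT s|lborel. k s * h s\<bar>\<^sup>2 \<le> (sqrt ((LINT s|lborel. k s) * (LINT s|lborel. k s * (h s)\<^sup>2)))\<^sup>2"
      by (intro power_mono) auto
    also have "\<dots> = (LINT s|lborel. k s) * (LINT s|lborel. k s * (h s)\<^sup>2)"
      using k0 by (intro real_sqrt_pow2 mult_nonneg_nonneg integral_nonneg_AE) auto
    also have "\<dots> \<le> exp T * (LINT s|lborel. k s * (h s)\<^sup>2)"
      using kl k0 by (intro mult_right_mono integral_nonneg_AE) auto
    finally have "(LINT s|lborel. k s * h s)\<^sup>2 \<le> exp T * (LINT s|lborel. k s * (h s)\<^sup>2)" by simp
    then have "ennreal ((LINT s|lborel. k s * h s)\<^sup>2) \<le> ennreal (exp T) * ennreal (LINT s|lborel. k s * (h s)\<^sup>2)"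
      by (simp add: ennreal_leI ennreal_mult'[symmetric])
    also have "ennreal (LINT s|lborel. k s * (h s)\<^sup>2) = ?I"
      unfolding Ieq by (rule nn_integral_eq_integral[symmetric, OF i2]) (use k0 in auto)
    finally show ?thesis unfolding kh .
  qed
qed

lemma borel_rep_RL_AE:
  fixes v :: "real \<Rightarrow> real^'d \<Rightarrow> real"
  assumes V: "borel_rep T S v V"
  shows "AE p in lborel \<Otimes>\<^sub>M lborel. p \<in> {0<..<T} \<times> S \<longrightarrow>
    RL_integral \<alpha> (\<lambda>s. v s (snd p)) (fst p) = (LINT s|lborel. rl_kernel \<alpha> (fst p - s) * V s (snd p))"
proof -
  note [measurable] = borel_repD(1)[OF V]
  from borel_rep_RL_slice[OF V] obtain N where N: "{x \<in> space lborel. \<not> (\<forall>t\<in>{0<..<T}. x \<in> S \<longrightarrow>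
      RL_integral \<alpha> (\<lambda>s. v s x) t = (LINT s|lborel. rl_kernel \<alpha> (t - s) * V s x))} \<subseteq> N"
    "emeasure lborel N = 0" "N \<in> sets lborel"
    by (rule AE_E)
  have "AE x in lborel. x \<notin> N" using N(2,3) by (intro AE_not_in) auto
  then have "AE p in (lborel :: real measure) \<Otimes>\<^sub>M lborel. snd p \<notin> N"
  proof (intro lborel_pair.AE_pair_measure)
    note [measurable] = N(3)
    show "{p \<in> space ((lborel :: real measure) \<Otimes>\<^sub>M lborel). snd p \<notin> N} \<in> sets (lborel \<Otimes>\<^sub>M lborel)"
      by measurable
  qed simp
  then show ?thesis
  proof eventually_elim
    case (elim p)
    then have "snd p \<notin> {x \<in> space lborel. \<not> (\<forall>t\<in>{0<..<T}. x \<in> S \<longrightarrow>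
      RL_integral \<alpha> (\<lambda>s. v s x) t = (LINT s|lborel. rl_kernel \<alpha> (t - s) * V s x))}"
      using N(1) by blast
    then show ?case by (auto simp: mem_Times_iff)
  qed
qed

text \<open>By the semigroup law u = J^\<beta> (J^\<delta> v), so J^\<delta> v restricted to (0, T)
  is the derivative of lower order. A solution is required to be regular for the largest exponent,
  while its equation contains the chosen \<open>frac_deriv\<close> for every exponent; this lemma
  makes those choices meaningful.\<close>

lemma frac_deriv_lower:
  fixes u :: "real \<Rightarrow> real^'d \<Rightarrow> real"
  assumes S: "open S" "bounded S" and T: "T > 0" and \<beta>: "\<beta> > 0" and \<delta>: "\<delta> > 0"
    and v: "has_frac_deriv (\<beta> + \<delta>) T S u v"
  shows "\<exists>w. has_frac_deriv \<beta> T S u w"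
proof -
  let ?D = "{0<..<T} \<times> S"
  have D: "?D \<in> sets lebesgue" "?D \<in> sets borel" using S by (auto simp: open_Times intro: sets_completionI_sets)
  obtain V where V: "borel_rep T S v V"
    using borel_rep_exists[OF S(1)] v unfolding has_frac_deriv_def by blast
  note [measurable] = borel_repD(1)[OF V]
  note V0 = borel_repD(2)[OF V] and Vfin = borel_repD(3)[OF V]
  define W where "W t x = indicator {0<..<T} t * (LINT s|lborel. rl_kernel \<delta> (t - s) * V s x)" for t x
  have Wm[measurable]: "case_prod W \<in> borel_measurable (borel \<Otimes>\<^sub>M borel)"
    unfolding W_def[abs_def] by measurable
  have W0: "W t x = 0" if "t \<notin> {0<..<T} \<or> x \<notin> S" for t x
  proof (cases "x \<in> S")
    case False
    then have "rl_kernel \<delta> (t - s) * V s x = 0" for s using V0 by simp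
    then show ?thesis unfolding W_def by (simp only: Bochner_Integration.integral_zero mult_zero_right)
  qed (use that in \<open>simp add: W_def\<close>)
  have Wfin: "(\<integral>\<^sup>+t. (\<integral>\<^sup>+x. ennreal ((W t x)\<^sup>2) \<partial>lborel) \<partial>lborel) < \<infinity>"
  proof -
    let ?A = "\<lambda>s. \<integral>\<^sup>+x. ennreal ((V s x)\<^sup>2) \<partial>lborel"
    have A0: "?A s = 0" if "s \<notin> {0<..<T}" for s using V0 that by simp
    have "(\<integral>\<^sup>+x. ennreal ((W t x)\<^sup>2) \<partial>lborel) \<le> ennreal (exp T) * ((\<integral>\<^sup>+s. ennreal (rl_kernel \<delta> (t - s)) * ?A s \<partial>lborel) * indicator {0<..<T} t)" for t
    proof (cases "t \<in> {0<..<T}")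
      case True
      have "(\<integral>\<^sup>+x. ennreal ((W t x)\<^sup>2) \<partial>lborel) \<le>
          (\<integral>\<^sup>+x. ennreal (exp T) * (\<integral>\<^sup>+s. ennreal (rl_kernel \<delta> (t - s)) * ennreal ((V s x)\<^sup>2) \<partial>lborel) \<partial>lborel)"
      proof (rule nn_integral_mono)
        fix x
        show "ennreal ((W t x)\<^sup>2) \<le> ennreal (exp T) * (\<integral>\<^sup>+s. ennreal (rl_kernel \<delta> (t - s)) * ennreal ((V s x)\<^sup>2) \<partial>lborel)"
          using rl_conv_square[OF \<delta>, of "\<lambda>s. V s x" T t] V0 True by (simp add: W_def)
      qed
      also have "\<dots> = ennreal (exp T) * (\<integral>\<^sup>+x. (\<integral>\<^sup>+s. ennreal (rl_kernel \<delta> (t - s)) * ennreal ((V s x)\<^sup>2) \<partial>lborel) \<partial>lborel)"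
        by (rule nn_integral_cmult) measurable
      also have "(\<integral>\<^sup>+x. (\<integral>\<^sup>+s. ennreal (rl_kernel \<delta> (t - s)) * ennreal ((V s x)\<^sup>2) \<partial>lborel) \<partial>lborel) =
          (\<integral>\<^sup>+s. (\<integral>\<^sup>+x. ennreal (rl_kernel \<delta> (t - s)) * ennreal ((V s x)\<^sup>2) \<partial>lborel) \<partial>lborel)"
        by (rule lborel_pair.Fubini') measurable
      also have "\<dots> = (\<integral>\<^sup>+s. ennreal (rl_kernel \<delta> (t - s)) * ?A s \<partial>lborel)"
        by (intro nn_integral_cong nn_integral_cmult) measurable
      finally show ?thesis using True by simp
    qed (simp add: W_def)
    then have "(\<integral>\<^sup>+t. (\<integral>\<^sup>+x. ennreal ((W t x)\<^sup>2) \<partial>lborel) \<partial>lborel) \<le>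
        (\<integral>\<^sup>+t. ennreal (exp T) * ((\<integral>\<^sup>+s. ennreal (rl_kernel \<delta> (t - s)) * ?A s \<partial>lborel) * indicator {0<..<T} t) \<partial>lborel)"
      by (intro nn_integral_mono)
    also have "\<dots> = ennreal (exp T) * (\<integral>\<^sup>+t. (\<integral>\<^sup>+s. ennreal (rl_kernel \<delta> (t - s)) * ?A s \<partial>lborel) * indicator {0<..<T} t \<partial>lborel)"
      by (rule nn_integral_cmult) measurable
    also have "\<dots> \<le> ennreal (exp T) * ((\<integral>\<^sup>+s. ?A s \<partial>lborel) * ennreal (exp T))"
      using nn_integral_rl_conv_le[OF \<delta>, of ?A T] A0 by (intro mult_left_mono) auto
    also have "\<dots> < \<infinity>" using Vfin by (simp add: ennreal_mult_less_top)
    finally show ?thesis .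
  qed
  have Wb: "case_prod W \<in> borel_measurable borel" using Wm by (simp add: borel_prod)
  have WL: "W \<in> L2_L2 T S"
    unfolding L2_L2_def L2_space_def mem_Collect_eq
  proof
    have "(\<integral>\<^sup>+p. ennreal ((case_prod W p)\<^sup>2) \<partial>(lborel \<Otimes>\<^sub>M lborel)) = (\<integral>\<^sup>+t. (\<integral>\<^sup>+x. ennreal ((W t x)\<^sup>2) \<partial>lborel) \<partial>lborel)"
      by (subst lborel.nn_integral_fst[symmetric]) auto
    then have "integrable (lborel \<Otimes>\<^sub>M lborel) (\<lambda>p. (case_prod W p)\<^sup>2)"
      using Wfin by (intro integrableI_bounded) auto
    then have i: "integrable lborel (\<lambda>p. (case_prod W p)\<^sup>2)" by (simp only: lborel_prod)
    show "case_prod W \<in> borel_measurable (lebesgue_on ?D)"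
      using Wb by (intro measurable_restrict_space1 measurable_completion) simp
    have "AE p in lborel. p \<in> ?D \<longrightarrow> (case_prod W p)\<^sup>2 = (case_prod W p)\<^sup>2" by simp
    from LINT_lebesgue_on_rep(2)[OF _ this] show "integrable (lebesgue_on ?D) (\<lambda>p. (case_prod W p)\<^sup>2)"
      using i W0 S Wb by (auto simp: open_Times intro!: borel_measurable_power)
  qed
  have "borel_rep T S W W"
    unfolding borel_rep_def using Wm W0 Wfin by auto
  note RW = borel_rep_RL_AE[OF this, of \<beta>]
  note RV = borel_rep_RL_AE[OF V, of "\<beta> + \<delta>"]
  have "AE (t, x) in lebesgue_on ?D. u t x = RL_integral (\<beta> + \<delta>) (\<lambda>s. v s x) t"
    using v by (simp add: has_frac_deriv_def)
  then have "AE p in lebesgue. p \<in> ?D \<longrightarrow> u (fst p) (snd p) = RL_integral (\<beta> + \<delta>) (\<lambda>s. v s (snd p)) (fst p)"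
    using D by (subst (asm) AE_restrict_space_iff) (auto simp: case_prod_beta)
  then have u1: "AE p in lborel \<Otimes>\<^sub>M lborel. p \<in> ?D \<longrightarrow> u (fst p) (snd p) = RL_integral (\<beta> + \<delta>) (\<lambda>s. v s (snd p)) (fst p)"
    by (simp only: AE_completion_iff lborel_prod)
  \<comment> \<open>Finiteness of this integral at almost every p allows the two time integrals to
    be exchanged there, which is where the semigroup law of the kernels enters.\<close>
  let ?N = "\<lambda>p. (\<integral>\<^sup>+r. ennreal (rl_kernel (\<beta> + \<delta>) (fst p - r)) * ennreal \<bar>V r (snd p)\<bar> \<partial>lborel) * indicator {0<..<T} (fst p)"
  have "(\<integral>\<^sup>+p. ?N p \<partial>(lborel \<Otimes>\<^sub>M lborel)) < \<infinity>"
  proof -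
    let ?A = "\<lambda>r. \<integral>\<^sup>+x. ennreal \<bar>V r x\<bar> \<partial>lborel"
    have A0: "?A r = 0" if "r \<notin> {0<..<T}" for r using V0 that by simp
    have "(\<integral>\<^sup>+p. ?N p \<partial>(lborel \<Otimes>\<^sub>M lborel)) =
        (\<integral>\<^sup>+t. (\<integral>\<^sup>+x. (\<integral>\<^sup>+r. ennreal (rl_kernel (\<beta> + \<delta>) (t - r)) * ennreal \<bar>V r x\<bar> \<partial>lborel) * indicator {0<..<T} t \<partial>lborel) \<partial>lborel)"
      by (subst lborel.nn_integral_fst[symmetric]) auto
    also have "\<dots> = (\<integral>\<^sup>+t. (\<integral>\<^sup>+r. ennreal (rl_kernel (\<beta> + \<delta>) (t - r)) * ?A r \<partial>lborel) * indicator {0<..<T} t \<partial>lborel)"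
    proof (rule nn_integral_cong)
      fix t
      have "(\<integral>\<^sup>+x. (\<integral>\<^sup>+r. ennreal (rl_kernel (\<beta> + \<delta>) (t - r)) * ennreal \<bar>V r x\<bar> \<partial>lborel) * indicator {0<..<T} t \<partial>lborel)
        = (\<integral>\<^sup>+x. (\<integral>\<^sup>+r. ennreal (rl_kernel (\<beta> + \<delta>) (t - r)) * ennreal \<bar>V r x\<bar> \<partial>lborel) \<partial>lborel) * indicator {0<..<T} t"
        by (rule nn_integral_multc) measurable
      also have "(\<integral>\<^sup>+x. (\<integral>\<^sup>+r. ennreal (rl_kernel (\<beta> + \<delta>) (t - r)) * ennreal \<bar>V r x\<bar> \<partial>lborel) \<partial>lborel) =
          (\<integral>\<^sup>+r. (\<integral>\<^sup>+x. ennreal (rl_kernel (\<beta> + \<delta>) (t - r)) * ennreal \<bar>V r x\<bar> \<partial>lborel) \<partial>lborel)"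
        by (rule lborel_pair.Fubini') measurable
      also have "\<dots> = (\<integral>\<^sup>+r. ennreal (rl_kernel (\<beta> + \<delta>) (t - r)) * ?A r \<partial>lborel)"
        by (intro nn_integral_cong nn_integral_cmult) measurable
      finally show "(\<integral>\<^sup>+x. (\<integral>\<^sup>+r. ennreal (rl_kernel (\<beta> + \<delta>) (t - r)) * ennreal \<bar>V r x\<bar> \<partial>lborel) * indicator {0<..<T} t \<partial>lborel)
        = (\<integral>\<^sup>+r. ennreal (rl_kernel (\<beta> + \<delta>) (t - r)) * ?A r \<partial>lborel) * indicator {0<..<T} t" .
    qed
    also have "\<dots> \<le> (\<integral>\<^sup>+r. ?A r \<partial>lborel) * ennreal (exp T)"
      using \<beta> \<delta> A0 by (intro nn_integral_rl_conv_le) auto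
    also have "\<dots> < \<infinity>"
    proof -
      have SB: "S \<in> sets borel" using S by simp
      have "indicat_real S \<in> borel_measurable borel" "integrable lborel (\<lambda>x. (indicat_real S x)\<^sup>2)"
      proof -
        show "indicat_real S \<in> borel_measurable borel" using SB by simp
        have "(\<lambda>x. (indicat_real S x)\<^sup>2) = indicat_real S" by (auto simp: indicator_def)
        moreover have "integrable lborel (indicat_real S)"
          using SB emeasure_bounded_finite[OF S(2)] by (intro integrable_real_indicator) auto
        ultimately show "integrable lborel (\<lambda>x. (indicat_real S x)\<^sup>2)" by simp
      qed
      from rep_pairing_integrable[OF S(1) T V this]
      have "(\<integral>\<^sup>+t. (\<integral>\<^sup>+x. ennreal \<bar>V t x * indicator S x\<bar> \<partial>lborel) \<partial>lborel) < \<infinity>"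
        by (rule order.strict_trans1) (use Vfin in simp)
      moreover have "V t x * indicator S x = V t x" for t x using V0[of t x] by (auto simp: indicator_def)
      ultimately show ?thesis by (simp add: ennreal_mult_less_top)
    qed
    finally show ?thesis .
  qed
  then have N: "AE p in lborel \<Otimes>\<^sub>M lborel. ?N p \<noteq> \<infinity>"
    by (intro nn_integral_PInf_AE) auto
  have "AE p in lborel \<Otimes>\<^sub>M lborel. p \<in> ?D \<longrightarrow> u (fst p) (snd p) = RL_integral \<beta> (\<lambda>s. W s (snd p)) (fst p)"
    using u1 RV RW N
  proof eventually_elim
    case (elim p)
    show ?case
    proof
      assume p: "p \<in> ?D"
      obtain t x where tx: "p = (t, x)" by (cases p)
      have t: "t \<in> {0<..<T}" using p tx by simp
      let ?F = "\<lambda>s r. rl_kernel \<beta> (t - s) * rl_kernel \<delta> (s - r) * V r x"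
      have inner: "(\<integral>\<^sup>+s. ennreal \<bar>?F s r\<bar> \<partial>lborel) = ennreal (rl_kernel (\<beta> + \<delta>) (t - r)) * ennreal \<bar>V r x\<bar>" for r
      proof -
        have "(\<integral>\<^sup>+s. ennreal \<bar>?F s r\<bar> \<partial>lborel) = (\<integral>\<^sup>+s. ennreal (rl_kernel \<beta> (t - s) * rl_kernel \<delta> (s - r)) * ennreal \<bar>V r x\<bar> \<partial>lborel)"
          using rl_kernel_nonneg[OF \<beta>] rl_kernel_nonneg[OF \<delta>]
          by (intro nn_integral_cong) (simp add: abs_mult ennreal_mult)
        also have "\<dots> = (\<integral>\<^sup>+s. ennreal (rl_kernel \<beta> (t - s) * rl_kernel \<delta> (s - r)) \<partial>lborel) * ennreal \<bar>V r x\<bar>"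
          by (rule nn_integral_multc) measurable
        finally show ?thesis unfolding nn_integral_rl_kernel_conv[OF \<beta> \<delta>] .
      qed
      have Fi: "integrable (lborel \<Otimes>\<^sub>M lborel) (\<lambda>(s, r). ?F s r)"
      proof (rule integrableI_bounded)
        have "(\<integral>\<^sup>+q. ennreal (norm (case q of (s, r) \<Rightarrow> ?F s r)) \<partial>(lborel \<Otimes>\<^sub>M lborel)) =
            (\<integral>\<^sup>+r. (\<integral>\<^sup>+s. ennreal \<bar>?F s r\<bar> \<partial>lborel) \<partial>lborel)"
          by (subst lborel_pair.nn_integral_snd[symmetric]) auto
        also have "\<dots> < \<infinity>" unfolding inner using elim(4) t tx by (simp add: less_top)
        finally show "(\<integral>\<^sup>+q. ennreal (norm (case q of (s, r) \<Rightarrow> ?F s r)) \<partial>(lborel \<Otimes>\<^sub>M lborel)) < \<infinity>" .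
      qed measurable
      have in1: "(LINT s|lborel. ?F s r) = rl_kernel (\<beta> + \<delta>) (t - r) * V r x" for r
      proof -
        have "integrable lborel (\<lambda>s. rl_kernel \<beta> (t - s) * rl_kernel \<delta> (s - r)) \<and>
           (LINT s|lborel. rl_kernel \<beta> (t - s) * rl_kernel \<delta> (s - r)) = rl_kernel (\<beta> + \<delta>) (t - r)"
          using nn_integral_rl_kernel_conv[OF \<beta> \<delta>, of t r] rl_kernel_nonneg[of \<beta>] rl_kernel_nonneg[of \<delta>]
            rl_kernel_nonneg[of "\<beta> + \<delta>"] \<beta> \<delta>
          by (subst nn_integral_eq_integrable[symmetric]) auto
        then show ?thesis by simp
      qed
      have in2: "(LINT r|lborel. ?F s r) = rl_kernel \<beta> (t - s) * W s x" for s
      proof -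
        have "(LINT r|lborel. ?F s r) = rl_kernel \<beta> (t - s) * (LINT r|lborel. rl_kernel \<delta> (s - r) * V r x)"
          by (simp add: mult.assoc)
        \<comment> \<open>Outside (0, T), where W is cut off, both sides vanish: the inner integral
          for s \<le> 0, and the outer kernel for s \<ge> T because t < T.\<close>
        also have "\<dots> = rl_kernel \<beta> (t - s) * W s x"
        proof (cases "s \<in> {0<..<T}")
          case True then show ?thesis by (simp add: W_def)
        next
          case False
          show ?thesis
          proof (cases "s \<le> 0")
            case True
            have 0: "rl_kernel \<delta> (s - r) * V r x = 0" for r using V0[of r x] True by (cases "r \<le> 0") (auto simp: rl_kernel_def)
            show ?thesis unfolding 0 using True by (simp add: W_def)
          next
            case False
            with \<open>s \<notin> {0<..<T}\<close> t have "rl_kernel \<beta> (t - s) = 0" by (auto simp: rl_kernel_def)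
            then show ?thesis by simp
          qed
        qed
        finally show ?thesis .
      qed
      have "(LINT r|lborel. (LINT s|lborel. ?F s r)) = (LINT s|lborel. (LINT r|lborel. ?F s r))"
        by (rule lborel_pair.Fubini_integral[OF Fi])
      then have "(LINT r|lborel. rl_kernel (\<beta> + \<delta>) (t - r) * V r x) = (LINT s|lborel. rl_kernel \<beta> (t - s) * W s x)"
        unfolding in1 in2 .
      then show "u (fst p) (snd p) = RL_integral \<beta> (\<lambda>s. W s (snd p)) (fst p)"
        using elim(1-3) p tx by simp
    qed
  qed
  then have "AE p in lebesgue. p \<in> ?D \<longrightarrow> u (fst p) (snd p) = RL_integral \<beta> (\<lambda>s. W s (snd p)) (fst p)"
    by (simp only: AE_completion_iff lborel_prod)
  then have "AE (t, x) in lebesgue_on ?D. u t x = RL_integral \<beta> (\<lambda>s. W s x) t"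
    using D by (subst AE_restrict_space_iff) (auto simp: case_prod_beta)
  with WL show ?thesis unfolding has_frac_deriv_def by blast
qed

subsection \<open>Exponential moments\<close>

text \<open>Mikusinski's argument: \<open>1 - exp (- exp (n * (\<tau> - t)))\<close> tends to the indicator of \<open>t < \<tau>\<close>, and
  its expansion into powers of \<open>exp (- n * t)\<close> only involves moments that are small.\<close>

lemma exp_moments_zero:
  fixes g :: "real \<Rightarrow> real"
  assumes g: "integrable lborel g" and g0: "\<And>t. t \<le> 0 \<Longrightarrow> g t = 0"
    and mom: "\<And>n::nat. n \<ge> n0 \<Longrightarrow> \<bar>LINT t|lborel. exp (- real n * t) * g t\<bar> \<le> B * exp (- real n * b)"
    and \<tau>: "\<tau> < b"
  shows "(LINT t|lborel. indicator {..<\<tau>} t * g t) = 0"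
proof -
  note [measurable] = borel_measurable_integrable[OF g]
  have B: "B \<ge> 0"
  proof -
    have "0 \<le> B * exp (- real n0 * b)" using mom[of n0] by linarith
    then show ?thesis by (simp add: zero_le_mult_iff)
  qed
  define X where "X n t = exp (real n * (\<tau> - t))" for n t
  have Xm[measurable]: "X n \<in> borel_measurable borel" for n unfolding X_def[abs_def] by measurable
  have key: "\<bar>LINT t|lborel. (1 - exp (- X n t)) * g t\<bar> \<le> B * (exp (exp (- real n * (b - \<tau>))) - 1)"
    if n: "n \<ge> n0" "n \<ge> 1" for n
  proof -
    define q where "q = exp (- real n * (b - \<tau>))"
    define P where "P N t = (\<Sum>k<N. (- X n t) ^ k / fact k)" for N t
    \<comment> \<open>A power of X n is again an exponential, of rate k * n, so the hypothesis on
      moments applies at k * n. For k \<ge> 1 this index is at least n0; the term k = 0 is the one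
      cancelled by the 1 in 1 - exp (- X n t).\<close>
    have moment: "\<bar>LINT t|lborel. (X n t) ^ k * g t\<bar> \<le> B * q ^ k" if "k \<ge> 1" for k
    proof -
      have kn: "k * n \<ge> n0" using n that by (metis le_trans mult_le_mono1 mult_1)
      have pw: "(X n t) ^ k * g t = exp (real (k * n) * \<tau>) * (exp (- real (k * n) * t) * g t)" for t
      proof -
        have "(X n t) ^ k = exp (real k * (real n * (\<tau> - t)))" by (simp only: X_def exp_of_nat_mult)
        also have "real k * (real n * (\<tau> - t)) = real (k * n) * \<tau> + - real (k * n) * t"
          by (simp add: algebra_simps)
        finally show ?thesis by (simp only: exp_add mult.assoc)
      qed
      have "\<bar>LINT t|lborel. (X n t) ^ k * g t\<bar> = exp (real (k * n) * \<tau>) * \<bar>LINT t|lborel. exp (- real (k * n) * t) * g t\<bar>"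
        unfolding pw by (simp add: abs_mult)
      also have "\<dots> \<le> exp (real (k * n) * \<tau>) * (B * exp (- real (k * n) * b))"
        using mom[OF kn] by (intro mult_left_mono) auto
      also have "\<dots> = B * q ^ k"
      proof -
        have "q ^ k = exp (real k * (- real n * (b - \<tau>)))" by (simp only: q_def exp_of_nat_mult)
        also have "real k * (- real n * (b - \<tau>)) = real (k * n) * \<tau> + - real (k * n) * b"
          by (simp add: algebra_simps)
        finally show ?thesis by (simp only: exp_add mult.left_commute)
      qed
      finally show ?thesis .
    qed
    have Xb: "\<bar>X n t\<bar> \<le> exp (real n * \<bar>\<tau>\<bar>)" if "t > 0" for t
    proof -
      have "\<tau> - t \<le> \<bar>\<tau>\<bar>" using that by linarith
      then show ?thesis unfolding X_def by (simp add: mult_left_mono)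
    qed
    have pk: "integrable lborel (\<lambda>t. (X n t) ^ k * g t)" for k
    proof (rule Bochner_Integration.integrable_bound)
      show "integrable lborel (\<lambda>t. exp (real n * \<bar>\<tau>\<bar>) ^ k * g t)" using g by simp
      show "AE t in lborel. norm ((X n t) ^ k * g t) \<le> norm (exp (real n * \<bar>\<tau>\<bar>) ^ k * g t)"
      proof (rule AE_I2)
        fix t
        show "norm ((X n t) ^ k * g t) \<le> norm (exp (real n * \<bar>\<tau>\<bar>) ^ k * g t)"
        proof (cases "t > 0")
          case True
          show ?thesis using power_mono[OF Xb[OF True], of k]
            by (simp add: abs_mult power_abs mult_right_mono)
        qed (simp add: g0)
      qed
    qed measurable
    \<comment> \<open>For fixed n the exponential series may be integrated termwise, since X n is
      bounded on positive times and g vanishes elsewhere.\<close>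
    have Plim: "(\<lambda>N. LINT t|lborel. (1 - P N t) * g t) \<longlonglongrightarrow> (LINT t|lborel. (1 - exp (- X n t)) * g t)"
    proof (rule integral_dominated_convergence)
      show "integrable lborel (\<lambda>t. (1 + exp (exp (real n * \<bar>\<tau>\<bar>))) * \<bar>g t\<bar>)" using g by simp
      show "AE t in lborel. (\<lambda>N. (1 - P N t) * g t) \<longlonglongrightarrow> (1 - exp (- X n t)) * g t"
      proof (rule AE_I2)
        fix t
        have "(\<lambda>N. P N t) \<longlonglongrightarrow> exp (- X n t)"
          using exp_converges[of "- X n t"] unfolding sums_def P_def by (simp add: divide_inverse mult.commute)
        then show "(\<lambda>N. (1 - P N t) * g t) \<longlonglongrightarrow> (1 - exp (- X n t)) * g t" by (intro tendsto_intros)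
      qed
      show "AE t in lborel. norm ((1 - P N t) * g t) \<le> (1 + exp (exp (real n * \<bar>\<tau>\<bar>))) * \<bar>g t\<bar>" for N
      proof (rule AE_I2)
        fix t
        show "norm ((1 - P N t) * g t) \<le> (1 + exp (exp (real n * \<bar>\<tau>\<bar>))) * \<bar>g t\<bar>"
        proof (cases "t > 0")
          case True
          have "\<bar>P N t\<bar> \<le> (\<Sum>k<N. \<bar>(- X n t) ^ k / fact k\<bar>)" unfolding P_def by (rule sum_abs)
          also have "\<dots> \<le> (\<Sum>k<N. exp (real n * \<bar>\<tau>\<bar>) ^ k / fact k)"
            using Xb[OF True] by (intro sum_mono) (auto simp: power_abs intro!: divide_right_mono power_mono)
          also have "\<dots> \<le> exp (exp (real n * \<bar>\<tau>\<bar>))"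
          proof -
            have "(\<lambda>k. exp (real n * \<bar>\<tau>\<bar>) ^ k / fact k) sums exp (exp (real n * \<bar>\<tau>\<bar>))"
              using exp_converges[of "exp (real n * \<bar>\<tau>\<bar>)"] by (simp add: divide_inverse mult.commute)
            from sum_le_suminf[OF sums_summable[OF this], of "{..<N}"] sums_unique[OF this] show ?thesis by simp
          qed
          finally have "\<bar>1 - P N t\<bar> \<le> 1 + exp (exp (real n * \<bar>\<tau>\<bar>))" by linarith
          then show ?thesis by (simp add: abs_mult mult_right_mono)
        qed (simp add: g0)
      qed
    qed (auto simp: P_def)
    have "\<bar>LINT t|lborel. (1 - P (Suc N) t) * g t\<bar> \<le> B * (exp q - 1)" for N
    proof -
      have "(1 - P (Suc N) t) * g t = - (\<Sum>k<N. ((-1) ^ Suc k / fact (Suc k)) * ((X n t) ^ Suc k * g t))" for t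
      proof -
        have "P (Suc N) t = 1 + (\<Sum>k<N. (- X n t) ^ Suc k / fact (Suc k))"
          unfolding P_def by (subst sum.lessThan_Suc_shift) simp
        moreover have "(- X n t) ^ Suc k / fact (Suc k) = ((-1) ^ Suc k / fact (Suc k)) * (X n t) ^ Suc k" for k
          using power_minus[of "X n t" "Suc k"] by simp
        ultimately show ?thesis by (simp only: sum_distrib_right mult.assoc) (simp add: sum_distrib_right mult.assoc)
      qed
      then have "(LINT t|lborel. (1 - P (Suc N) t) * g t) =
          - (\<Sum>k<N. ((-1) ^ Suc k / fact (Suc k)) * (LINT t|lborel. (X n t) ^ Suc k * g t))"
        using pk by (simp only:) (subst Bochner_Integration.integral_minus, subst Bochner_Integration.integral_sum,
          auto simp del: power_Suc fact_Suc)
      then have "\<bar>LINT t|lborel. (1 - P (Suc N) t) * g t\<bar> \<le>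
          (\<Sum>k<N. \<bar>((-1) ^ Suc k / fact (Suc k)) * (LINT t|lborel. (X n t) ^ Suc k * g t)\<bar>)"
        by (simp only: abs_minus_cancel sum_abs)
      also have "\<dots> \<le> (\<Sum>k<N. B * (q ^ Suc k / fact (Suc k)))"
      proof (rule sum_mono)
        fix k
        have "\<bar>((-1) ^ Suc k / fact (Suc k)) * (LINT t|lborel. (X n t) ^ Suc k * g t)\<bar> =
            (1 / fact (Suc k)) * \<bar>LINT t|lborel. (X n t) ^ Suc k * g t\<bar>"
          by (simp add: abs_mult power_abs del: power_Suc fact_Suc)
        also have "\<dots> \<le> (1 / fact (Suc k)) * (B * q ^ Suc k)"
          by (intro mult_left_mono moment) auto
        finally show "\<bar>((-1) ^ Suc k / fact (Suc k)) * (LINT t|lborel. (X n t) ^ Suc k * g t)\<bar> \<le> B * (q ^ Suc k / fact (Suc k))"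
          by simp
      qed
      also have "\<dots> = B * ((\<Sum>k<Suc N. q ^ k / fact k) - 1)"
        by (subst sum.lessThan_Suc_shift) (simp add: sum_distrib_left)
      also have "\<dots> \<le> B * (exp q - 1)"
      proof -
        have "(\<lambda>k. q ^ k / fact k) sums exp q"
          using exp_converges[of q] by (simp add: divide_inverse mult.commute)
        from sum_le_suminf[OF sums_summable[OF this], of "{..<Suc N}"] sums_unique[OF this]
        have "(\<Sum>k<Suc N. q ^ k / fact k) \<le> exp q" by (simp add: q_def)
        then show ?thesis using B by (intro mult_left_mono) auto
      qed
      finally show ?thesis .
    qed
    then have "\<exists>N0. \<forall>N\<ge>N0. \<bar>LINT t|lborel. (1 - P N t) * g t\<bar> \<le> B * (exp q - 1)"
      by (intro exI[of _ 1]) (metis Suc_le_D One_nat_def)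
    from LIMSEQ_le_const2[OF tendsto_rabs[OF Plim] this] show ?thesis unfolding q_def .
  qed
  have lim1: "(\<lambda>n. LINT t|lborel. (1 - exp (- X n t)) * g t) \<longlonglongrightarrow> (LINT t|lborel. indicator {..<\<tau>} t * g t)"
  proof (rule integral_dominated_convergence)
    show "integrable lborel (\<lambda>t. \<bar>g t\<bar>)" using g by simp
    show "AE t in lborel. (\<lambda>n. (1 - exp (- X n t)) * g t) \<longlonglongrightarrow> indicator {..<\<tau>} t * g t"
      \<comment> \<open>At t = \<tau> the value X n t is 1 for all n and the pointwise limit fails;
        a single point does not matter.\<close>
      using AE_lborel_singleton[of \<tau>]
    proof eventually_elim
      case (elim t)
      have "(\<lambda>n. 1 - exp (- X n t)) \<longlonglongrightarrow> indicator {..<\<tau>} t"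
      proof (cases "t < \<tau>")
        case True
        then have "filterlim (\<lambda>n. (\<tau> - t) * real n) at_top sequentially"
          by (intro filterlim_tendsto_pos_mult_at_top[OF tendsto_const _ filterlim_real_sequentially]) auto
        then have "filterlim (\<lambda>n. real n * (\<tau> - t)) at_top sequentially" by (simp only: mult.commute)
        then have "filterlim (\<lambda>n. X n t) at_top sequentially"
          unfolding X_def by (rule filterlim_compose[OF exp_at_top])
        then have "filterlim (\<lambda>n. - X n t) at_bot sequentially" by (simp add: filterlim_uminus_at_top)
        then have "(\<lambda>n. exp (- X n t)) \<longlonglongrightarrow> 0" by (rule filterlim_compose[OF exp_at_bot])
        from tendsto_diff[OF tendsto_const this, of 1] True show ?thesis by simp
      next
        case False
        with elim have "\<tau> - t < 0" by simp
        then have "filterlim (\<lambda>n. (t - \<tau>) * real n) at_top sequentially"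
          by (intro filterlim_tendsto_pos_mult_at_top[OF tendsto_const _ filterlim_real_sequentially]) auto
        then have "filterlim (\<lambda>n. - ((t - \<tau>) * real n)) at_bot sequentially" by (simp add: filterlim_uminus_at_top)
        moreover have "- ((t - \<tau>) * real n) = real n * (\<tau> - t)" for n by (simp add: algebra_simps)
        ultimately have "filterlim (\<lambda>n. real n * (\<tau> - t)) at_bot sequentially" by (simp only:)
        then have "(\<lambda>n. X n t) \<longlonglongrightarrow> 0"
          unfolding X_def by (rule filterlim_compose[OF exp_at_bot])
        then have "(\<lambda>n. 1 - exp (- X n t)) \<longlonglongrightarrow> 1 - exp (- 0)" by (intro tendsto_intros)
        with False show ?thesis by simp
      qed
      then show ?case by (intro tendsto_intros)
    qed
    show "AE t in lborel. norm ((1 - exp (- X n t)) * g t) \<le> \<bar>g t\<bar>" for n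
    proof (rule AE_I2)
      fix t
      have "0 \<le> X n t" by (simp add: X_def)
      then have "\<bar>1 - exp (- X n t)\<bar> \<le> 1" by simp
      then show "norm ((1 - exp (- X n t)) * g t) \<le> \<bar>g t\<bar>" by (simp add: abs_mult mult_left_le_one_le)
    qed
  qed auto
  have lim2: "(\<lambda>n. B * (exp (exp (- real n * (b - \<tau>))) - 1)) \<longlonglongrightarrow> B * (exp 0 - 1)"
  proof -
    have "filterlim (\<lambda>n. (b - \<tau>) * real n) at_top sequentially"
      using \<tau> by (intro filterlim_tendsto_pos_mult_at_top[OF tendsto_const _ filterlim_real_sequentially]) auto
    then have "filterlim (\<lambda>n. - ((b - \<tau>) * real n)) at_bot sequentially" by (simp add: filterlim_uminus_at_top)
    then have "(\<lambda>n. exp (- ((b - \<tau>) * real n))) \<longlonglongrightarrow> 0" by (rule filterlim_compose[OF exp_at_bot])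
    then have "(\<lambda>n. exp (- real n * (b - \<tau>))) \<longlonglongrightarrow> 0" by (simp add: mult.commute)
    then show ?thesis by (intro tendsto_intros)
  qed
  have "\<bar>LINT t|lborel. indicator {..<\<tau>} t * g t\<bar> \<le> B * (exp 0 - 1)"
    by (rule LIMSEQ_le[OF tendsto_rabs[OF lim1] lim2]) (use key in \<open>auto intro!: exI[of _ "max n0 1"]\<close>)
  then show ?thesis by simp
qed

section \<open>From vanishing primitives to a vanishing source\<close>

lemma L2_space_real_rep:
  fixes g :: "real \<Rightarrow> real"
  assumes g: "g \<in> L2_space {0<..<T}"
  shows "\<exists>G. integrable lborel G \<and> (\<forall>t. t \<notin> {0<..<T} \<longrightarrow> G t = 0) \<and>
    (AE t in lborel. t \<in> {0<..<T} \<longrightarrow> g t = G t)"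
proof -
  let ?S = "{0<..<T}"
  have S: "?S \<in> sets lebesgue" "?S \<in> lmeasurable" by (auto intro: sets_completionI_sets)
  have gs: "sqint (lebesgue_on ?S) g" using g by (simp add: L2_space_iff)
  have gi: "integrable (lebesgue_on ?S) g" by (rule sqint_imp_integrable[OF gs finite_measure_lebesgue_on[OF S(2)]])
  let ?h = "\<lambda>t. indicator ?S t *\<^sub>R g t"
  have hi: "integrable lebesgue ?h" using gi S(1) by (subst (asm) integrable_restrict_space) auto
  obtain G where G: "G \<in> borel_measurable lborel" "AE t in lborel. ?h t = G t"
    using completion_ex_borel_measurable_real[OF borel_measurable_integrable[OF hi]] by blast
  have Gm[measurable]: "G \<in> borel_measurable borel" using G(1) by simp
  define H where "H t = indicator ?S t * G t" for t
  have Hm[measurable]: "H \<in> borel_measurable borel" unfolding H_def[abs_def] by measurable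
  have eq: "AE t in lborel. ?h t = H t"
    using G(2) by eventually_elim (auto simp: H_def indicator_def of_bool_def split: if_splits)
  have "integrable lebesgue H"
    by (rule integrable_cong_AE_imp[OF hi _ AE_completion[OF eq]]) (intro measurable_completion, simp)
  then have "integrable lborel H" by (subst (asm) integrable_completion) auto
  moreover have "AE t in lborel. t \<in> ?S \<longrightarrow> g t = H t" using eq by eventually_elim auto
  ultimately show ?thesis by (intro exI[of _ H]) (auto simp: H_def)
qed

text \<open>Below b < T the integral of G over an interval is a difference of two vanishing
  primitives, so the criterion on boxes applies; then b increases to T along a sequence.\<close>

lemma AE_zero_of_primitive_zero:
  fixes G :: "real \<Rightarrow> real"
  assumes G: "integrable lborel G" and prim: "\<And>\<tau>. \<tau> < T \<Longrightarrow> (LINT t|lborel. indicator {..<\<tau>} t * G t) = 0"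
  shows "AE t in lborel. t < T \<longrightarrow> G t = 0"
proof -
  have step: "AE t in lborel. t < b \<longrightarrow> G t = 0" if b: "b < T" for b
  proof -
    let ?H = "\<lambda>t. indicator {..<b} t * G t"
    have int: "integrable lborel (\<lambda>t. indicator {..<\<tau>} t * G t)" for \<tau>
      using integrable_mult_indicator[OF _ G, of "{..<\<tau>}"] by simp
    have "(LINT t|lborel. indicator (box c d) t * ?H t) = 0" for c d
    proof (cases "c < min d b")
      case True
      have "AE t in lborel. indicator (box c d) t * ?H t = indicator {..<min d b} t * G t - indicator {..<c} t * G t"
        using AE_lborel_singleton[of c] by eventually_elim (use True in \<open>auto simp: indicator_def\<close>)
      then have "(LINT t|lborel. indicator (box c d) t * ?H t) =
          (LINT t|lborel. indicator {..<min d b} t * G t - indicator {..<c} t * G t)"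
        using borel_measurable_integrable[OF G] by (intro integral_cong_AE) auto
      also have "\<dots> = 0" using int b True by (simp add: prim)
      finally show ?thesis .
    next
      case False
      then have 0: "indicator (box c d) t * ?H t = 0" for t by (auto simp: indicator_def)
      show ?thesis unfolding 0 by simp
    qed
    from integral_borel_sets_zero[OF int this] show ?thesis by eventually_elim auto
  qed
  have "AE t in lborel. \<forall>n::nat. t < T - inverse (real (Suc n)) \<longrightarrow> G t = 0"
    unfolding AE_all_countable by (intro allI step) simp
  then show ?thesis
  proof eventually_elim
    case (elim t)
    show ?case
    proof
      assume "t < T"
      then obtain n where "inverse (real (Suc n)) < T - t" using reals_Archimedean[of "T - t"] by auto
      then show "G t = 0" using elim by (auto simp: algebra_simps)
    qed
  qed
qed

section \<open>Laplace estimate for the source\<close>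

context source_problem
begin

text \<open>The choice of \<open>\<mu>\<close> makes \<open>\<mu> z\<close> cancel the Laplace transform of the fractional derivatives.\<close>

lemma laplace_source_bound:
  fixes u :: "real \<Rightarrow> real^'d \<Rightarrow> real" and q \<alpha> :: "nat \<Rightarrow> real"
  assumes T: "T > 0" and l: "l \<ge> 1"
    and q: "\<And>j. j \<in> {1..l} \<Longrightarrow> q j > 0" and \<alpha>: "\<And>j. j \<in> {1..l} \<Longrightarrow> \<alpha> j > 0"
    and v: "\<And>j. j \<in> {1..l} \<Longrightarrow> has_frac_deriv (\<alpha> j) T \<Omega> u (v j)"
    and V: "\<And>j. j \<in> {1..l} \<Longrightarrow> borel_rep T \<Omega> (v j) (V j)"
    and B: "\<And>j. j \<in> {1..l} \<Longrightarrow> (\<integral>\<^sup>+t. (\<integral>\<^sup>+x. ennreal ((V j t x)\<^sup>2) \<partial>lborel) \<partial>lborel) = ennreal (B j)"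
    and B0: "\<And>j. j \<in> {1..l} \<Longrightarrow> B j \<ge> 0"
    and u: "u \<in> L2_H2_H10 T \<Omega>"
    and eq: "AE t in lebesgue_on {0<..<T}. AE x in M.
        (\<Sum>j=1..l. q j * v j t x) + elliptic_op \<Omega> a c (u t) x = g t * f x"
    and f: "f \<in> L2_space \<Omega>"
    and obs0: "AE t in lebesgue_on {0<..<T}. (LINT x|lebesgue_on \<omega>. u t x) = 0"
    and G: "integrable lborel G" "\<And>t. t \<notin> {0<..<T} \<Longrightarrow> G t = 0"
    and gG: "AE t in lborel. t \<in> {0<..<T} \<longrightarrow> g t = G t"
    and s: "s \<ge> 1" and \<mu>: "\<mu> = (\<Sum>j=1..l. q j * s powr \<alpha> j)" "\<mu> \<ge> 1"
    and \<epsilon>: "0 < \<epsilon>" "\<epsilon> \<le> 1" and z: "approx_sol \<mu> \<epsilon> z"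
  shows "\<bar>(LINT x|M. f x * z x) * (LINT t|lborel. exp (- s * t) * G t)\<bar> \<le>
    \<epsilon> * sqrt (A1 + cmax + \<mu>) * (LINT t|lebesgue_on {0<..<T}. 1 + (H2_norm \<Omega> (u t))\<^sup>2) +
    (\<Sum>j=1..l. q j * (s powr \<alpha> j * exp (- (s - 1) * T) * (B j + T * (4 * vol + 2))))"
proof -
  let ?I = "{0<..<T}" and ?L = "lebesgue_on {0<..<T}"
  note zt = approx_solD(1)[OF z]
  have zc: "continuous_on UNIV z" by (rule smooth_continuous[OF test_function_smooth[OF zt]])
  have zb: "z \<in> borel_measurable borel" by (rule borel_measurable_continuous_onI[OF zc])
  obtain K where K: "compact K" "K \<subseteq> \<Omega>" "\<And>x. x \<notin> K \<Longrightarrow> z x = 0" using test_function_support[OF zt] by blast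
  have z2: "integrable lborel (\<lambda>x. (z x)\<^sup>2)"
    by (rule integrable_continuous_compact[OF _ K(1)]) (use zc K(3) in \<open>auto intro!: continuous_intros\<close>)
  have z0: "z x = 0" if "x \<notin> \<Omega>" for x using K(2,3) that by blast
  have zI: "(LINT x|lborel. (z x)\<^sup>2) \<le> 4 * vol + 2"
    using approx_solD(3)[OF z] LINT_lebesgue_on_supported[OF open_dom, of "\<lambda>x. (z x)\<^sup>2"] zb z0 by simp
  have zs: "sqint M z" by (rule test_function_sqint(1)[OF open_dom zt])
  have fs: "sqint M f" using f by (simp add: L2_space_iff)
  have fz: "integrable M (\<lambda>x. f x * z x)" by (rule sqint_mult[OF fs zs])
  define \<Phi> where "\<Phi> = (LINT x|M. f x * z x)"
  define Y where "Y j t = (LINT x|lborel. V j t x * z x)" for j t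
  define y where "y j t = (LINT s'|lborel. rl_kernel (\<alpha> j) (t - s') * Y j s')" for j t
  have Yi: "integrable lborel (Y j)" and Y0: "\<And>t. t \<notin> ?I \<Longrightarrow> Y j t = 0" if "j \<in> {1..l}" for j
    using dual_pairing(1,2)[OF open_dom T V[OF that] zb z2 z0] by (auto simp: Y_def[abs_def])
  have Yb: "(LINT t|lborel. \<bar>Y j t\<bar>) \<le> B j + T * (4 * vol + 2)" if j: "j \<in> {1..l}" for j
  proof -
    have "ennreal (LINT t|lborel. \<bar>Y j t\<bar>) \<le> ennreal (B j) + ennreal (T * (LINT x|lborel. (z x)\<^sup>2))"
      using dual_pairing(3)[OF open_dom T V[OF j] zb z2 z0, folded Y_def] unfolding B[OF j] .
    also have "\<dots> = ennreal (B j + T * (LINT x|lborel. (z x)\<^sup>2))"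
      using B0[OF j] T by (intro ennreal_plus[symmetric] mult_nonneg_nonneg integral_nonneg_AE) auto
    also have "\<dots> \<le> ennreal (B j + T * (4 * vol + 2))"
      using zI T by (intro ennreal_leI add_left_mono mult_left_mono) auto
    finally show ?thesis
      using B0[OF j] T vol_nonneg by (subst (asm) ennreal_le_iff) auto
  qed
  have a4: "AE t in lborel. \<forall>j\<in>{1..l}. t \<in> ?I \<longrightarrow> integrable M (\<lambda>x. v j t x * z x) \<and> (LINT x|M. v j t x * z x) = Y j t"
    by (rule AE_finite_allI) (use dual_pairing(4)[OF open_dom T V zb z2 z0, folded Y_def] in auto)
  have a5: "AE t in lborel. \<forall>j\<in>{1..l}. t \<in> ?I \<longrightarrow> (LINT x|M. u t x * z x) = y j t"
  proof (rule AE_finite_allI)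
    fix j assume j: "j \<in> {1..l}"
    show "AE t in lborel. t \<in> ?I \<longrightarrow> (LINT x|M. u t x * z x) = y j t"
      using dual_pairing(5)[OF open_dom T V[OF j] zb z2 z0 \<alpha>[OF j], of u, folded Y_def] v[OF j] unfolding y_def has_frac_deriv_def by blast
  qed simp
  have IL: "?I \<in> sets lebesgue" by (simp add: sets_completionI_sets)
  have to_lborel: "AE t in lborel. t \<in> ?I \<longrightarrow> P t" if "AE t in ?L. P t" for P
    using that IL by (subst (asm) AE_restrict_space_iff) (auto simp: AE_completion_iff)
  have uH: "AE t in ?L. u t \<in> H2_space \<Omega> \<inter> H10_space \<Omega>" and Hi: "integrable ?L (\<lambda>t. (H2_norm \<Omega> (u t))\<^sup>2)"
    using u by (auto simp: L2_H2_H10_def)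
  let ?r = "sqrt (A1 + cmax + \<mu>)"
  \<comment> \<open>By the equation paired with z, F t equals the pairing of A u with z plus \<mu>
    times that of u with z. As the observation vanishes, this is the residual of z tested with u t,
    and therefore small.\<close>
  define F where "F t = \<Phi> * G t - (\<Sum>j=1..l. q j * (Y j t - s powr \<alpha> j * y j t))" for t
  have main: "AE t in lborel. t \<in> ?I \<longrightarrow> \<bar>F t\<bar> \<le> \<epsilon> * ?r * H2_norm \<Omega> (u t)"
    using to_lborel[OF uH] to_lborel[OF eq] to_lborel[OF obs0] gG a4 a5
  proof eventually_elim
    case (elim t)
    show ?case
    proof
      assume t: "t \<in> ?I"
      have uH2: "u t \<in> H2_space \<Omega>" "u t \<in> H10_space \<Omega>" using elim(1) t by auto
      note wf = weak_form_bound[OF uH2 \<mu>(2) \<epsilon>(1) z]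
      have vi: "integrable M (\<lambda>x. v j t x * z x)" "(LINT x|M. v j t x * z x) = Y j t"
        and yj: "(LINT x|M. u t x * z x) = y j t" if "j \<in> {1..l}" for j
        using elim(5,6) t that by blast+
      have si: "integrable M (\<lambda>x. \<Sum>j=1..l. q j * (v j t x * z x))"
        using vi by (intro Bochner_Integration.integrable_sum integrable_mult_right)
      have "AE x in M. (\<Sum>j=1..l. q j * (v j t x * z x)) + elliptic_op \<Omega> a c (u t) x * z x = g t * (f x * z x)"
        using elim(2) t by (auto elim!: eventually_mono)
          (metis (no_types, lifting) distrib_right mult.assoc sum.cong sum_distrib_right)
      then have "(LINT x|M. (\<Sum>j=1..l. q j * (v j t x * z x)) + elliptic_op \<Omega> a c (u t) x * z x) = (LINT x|M. g t * (f x * z x))"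
        by (intro integral_cong_AE borel_measurable_integrable Bochner_Integration.integrable_add si wf(1) integrable_mult_right fz)
      moreover have "(LINT x|M. (\<Sum>j=1..l. q j * (v j t x * z x)) + elliptic_op \<Omega> a c (u t) x * z x) =
          (\<Sum>j=1..l. q j * Y j t) + (LINT x|M. elliptic_op \<Omega> a c (u t) x * z x)"
        using vi by (subst Bochner_Integration.integral_add[OF si wf(1)]) (simp add: Bochner_Integration.integral_sum)
      moreover have "g t = G t" using elim(4) t by blast
      ultimately have e1: "(\<Sum>j=1..l. q j * Y j t) + (LINT x|M. elliptic_op \<Omega> a c (u t) x * z x) = G t * \<Phi>"
        by (simp add: \<Phi>_def)
      have "obs (u t) = 0"
      proof -
        have "obs (u t) = (LINT x|lebesgue. indicator \<Omega> x * (indicator \<omega> x * u t x))"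
          unfolding obs_def by (rule LINT_lebesgue_on_open[OF open_dom])
        also have "\<dots> = (LINT x|lebesgue. indicator \<omega> x * u t x)"
          using obs_sub by (intro Bochner_Integration.integral_cong) (auto simp: indicator_def)
        also have "\<dots> = (LINT x|lebesgue_on \<omega>. u t x)" by (rule LINT_lebesgue_on_open[OF open_obs, symmetric])
        also have "\<dots> = 0" using elim(3) t by blast
        finally show ?thesis .
      qed
      then have e2: "\<bar>(LINT x|M. elliptic_op \<Omega> a c (u t) x * z x) + \<mu> * (LINT x|M. u t x * z x)\<bar> \<le> \<epsilon> * ?r * H2_norm \<Omega> (u t)"
        using wf(2) by simp
      \<comment> \<open>One scalar, the pairing of u with z, is at the same time the fractional
        integral y j of Y j for every exponent; multiplying it by \<mu> distributes the right power
        of s to each of them.\<close>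
      have "\<mu> * (LINT x|M. u t x * z x) = (\<Sum>j=1..l. q j * (s powr \<alpha> j * y j t))"
        unfolding \<mu>(1) sum_distrib_right using yj by (intro sum.cong) (auto simp: mult.assoc)
      then have "F t = (LINT x|M. elliptic_op \<Omega> a c (u t) x * z x) + \<mu> * (LINT x|M. u t x * z x)"
        using e1 unfolding F_def by (simp add: right_diff_distrib sum_subtractf mult.commute)
      with e2 show "\<bar>F t\<bar> \<le> \<epsilon> * ?r * H2_norm \<Omega> (u t)" by simp
    qed
  qed
  let ?E = "\<lambda>t. indicator ?I t * (exp (- s * t) * F t)"
  let ?P = "\<lambda>j t. indicator ?I t * (exp (- s * t) * (Y j t - s powr \<alpha> j * y j t))"
  have s0: "s > 0" using s by simp
  \<comment> \<open>The weights s powr \<alpha> j take effect here: over the whole line the two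
    parts of the integrand would cancel, so only the tail beyond T contributes.\<close>
  have Pi: "integrable lborel (?P j)" and Pb: "\<bar>LINT t|lborel. ?P j t\<bar> \<le> s powr \<alpha> j * exp (- (s - 1) * T) * (B j + T * (4 * vol + 2))"
    if j: "j \<in> {1..l}" for j
  proof -
    note lt = laplace_truncation[OF \<alpha>[OF j] s T Yi[OF j] Y0[OF j]]
    show "integrable lborel (?P j)" using lt(1) unfolding y_def .
    have "\<bar>LINT t|lborel. ?P j t\<bar> \<le> s powr \<alpha> j * exp (- (s - 1) * T) * (LINT t|lborel. \<bar>Y j t\<bar>)"
      using lt(2) unfolding y_def .
    also have "\<dots> \<le> s powr \<alpha> j * exp (- (s - 1) * T) * (B j + T * (4 * vol + 2))"
      using Yb[OF j] by (intro mult_left_mono) auto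
    finally show "\<bar>LINT t|lborel. ?P j t\<bar> \<le> s powr \<alpha> j * exp (- (s - 1) * T) * (B j + T * (4 * vol + 2))" .
  qed
  have eG: "integrable lborel (\<lambda>t. exp (- s * t) * G t)"
  proof (rule Bochner_Integration.integrable_bound[OF G(1)])
    show "AE t in lborel. norm (exp (- s * t) * G t) \<le> norm (G t)"
    proof (rule AE_I2)
      fix t show "norm (exp (- s * t) * G t) \<le> norm (G t)"
        using G(2)[of t] s0 by (cases "t \<le> 0") (auto simp: abs_mult intro!: mult_left_le_one_le)
    qed
  qed (use borel_measurable_integrable[OF G(1)] in measurable)
  have E_eq: "?E t = \<Phi> * (exp (- s * t) * G t) - (\<Sum>j=1..l. q j * ?P j t)" for t
  proof (cases "t \<in> ?I")
    case True
    then show ?thesis by (simp add: F_def right_diff_distrib sum_distrib_left mult_ac)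
  next
    case False
    then show ?thesis using G(2)[OF False] by simp
  qed
  have sumi: "integrable lborel (\<lambda>t. \<Sum>j=1..l. q j * ?P j t)"
    using Pi by (intro Bochner_Integration.integrable_sum integrable_mult_right)
  have Ei: "integrable lborel ?E"
    unfolding E_eq by (intro Bochner_Integration.integrable_diff integrable_mult_right eG sumi)
  have "(LINT t|lborel. ?E t) = \<Phi> * (LINT t|lborel. exp (- s * t) * G t) - (\<Sum>j=1..l. q j * (LINT t|lborel. ?P j t))"
    unfolding E_eq using eG sumi Pi by (simp add: Bochner_Integration.integral_sum)
  then have split: "\<Phi> * (LINT t|lborel. exp (- s * t) * G t) = (LINT t|lborel. ?E t) + (\<Sum>j=1..l. q j * (LINT t|lborel. ?P j t))"
    by simp
  have EL: "\<bar>LINT t|lborel. ?E t\<bar> \<le> \<epsilon> * ?r * (LINT t|?L. 1 + (H2_norm \<Omega> (u t))\<^sup>2)"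
  proof -
    have r0: "0 \<le> \<epsilon> * ?r" using \<epsilon> A1_pos cmax(1) \<mu>(2) by simp
    have ae: "AE t in lborel. t \<in> ?I \<longrightarrow> ?E t = ?E t" by simp
    have Em: "?E \<in> borel_measurable borel" using borel_measurable_integrable[OF Ei] by simp
    have E0: "?E t = 0" if "t \<notin> ?I" for t using that by simp
    have rep: "(LINT t|?L. ?E t) = (LINT t|lborel. ?E t)"
      by (rule LINT_lebesgue_on_rep(1)[OF open_greaterThanLessThan ae Em E0])
    have EiL: "integrable ?L ?E"
      by (rule LINT_lebesgue_on_rep(2)[OF open_greaterThanLessThan ae Em E0 Ei])
    have "(LINT t|lborel. ?E t) = (LINT t|?L. ?E t)" using rep by (rule sym)
    also have "\<bar>\<dots>\<bar> \<le> (LINT t|?L. \<bar>?E t\<bar>)" by (rule integral_abs_bound)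
    \<comment> \<open>The norm is replaced by 1 plus its square because the square is what is
      integrable in time.\<close>
    also have "\<dots> \<le> (LINT t|?L. \<epsilon> * ?r * (1 + (H2_norm \<Omega> (u t))\<^sup>2))"
    proof (rule integral_mono_AE)
      show "integrable ?L (\<lambda>t. \<bar>?E t\<bar>)" using EiL by (rule integrable_abs)
      show "integrable ?L (\<lambda>t. \<epsilon> * ?r * (1 + (H2_norm \<Omega> (u t))\<^sup>2))"
      proof -
        interpret fm: finite_measure ?L by (rule finite_measure_lebesgue_on) simp
        show ?thesis using Hi by (intro integrable_mult_right Bochner_Integration.integrable_add) auto
      qed
      have "AE t in lebesgue. t \<in> ?I \<longrightarrow> \<bar>F t\<bar> \<le> \<epsilon> * ?r * H2_norm \<Omega> (u t)" using main by (rule AE_completion)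
      then have "AE t in ?L. \<bar>F t\<bar> \<le> \<epsilon> * ?r * H2_norm \<Omega> (u t)" using IL by (subst AE_restrict_space_iff) auto
      then show "AE t in ?L. \<bar>?E t\<bar> \<le> \<epsilon> * ?r * (1 + (H2_norm \<Omega> (u t))\<^sup>2)"
      proof eventually_elim
        case (elim t)
        have h: "H2_norm \<Omega> (u t) \<le> 1 + (H2_norm \<Omega> (u t))\<^sup>2"
        proof -
          have "0 \<le> (H2_norm \<Omega> (u t) - 1)\<^sup>2" by simp
          then have "2 * H2_norm \<Omega> (u t) \<le> 1 + (H2_norm \<Omega> (u t))\<^sup>2" by (simp add: power2_diff)
          moreover have "0 \<le> 1 + (H2_norm \<Omega> (u t))\<^sup>2" by simp
          ultimately show ?thesis by linarith
        qed
        have "\<bar>?E t\<bar> \<le> \<bar>F t\<bar>"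
          using s0 by (auto simp: indicator_def abs_mult intro!: mult_left_le_one_le)
        also have "\<dots> \<le> \<epsilon> * ?r * H2_norm \<Omega> (u t)" by (rule elim)
        also have "\<dots> \<le> \<epsilon> * ?r * (1 + (H2_norm \<Omega> (u t))\<^sup>2)" by (rule mult_left_mono[OF h r0])
        finally show ?case .
      qed
    qed
    also have "\<dots> = \<epsilon> * ?r * (LINT t|?L. 1 + (H2_norm \<Omega> (u t))\<^sup>2)" by simp
    finally show ?thesis .
  qed
  have "\<bar>\<Sum>j=1..l. q j * (LINT t|lborel. ?P j t)\<bar> \<le>
      (\<Sum>j=1..l. q j * (s powr \<alpha> j * exp (- (s - 1) * T) * (B j + T * (4 * vol + 2))))"
  proof (rule order_trans[OF sum_abs], rule sum_mono)
    fix j assume j: "j \<in> {1..l}"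
    show "\<bar>q j * (LINT t|lborel. ?P j t)\<bar> \<le> q j * (s powr \<alpha> j * exp (- (s - 1) * T) * (B j + T * (4 * vol + 2)))"
      unfolding abs_mult abs_of_pos[OF q[OF j]] by (rule mult_left_mono[OF Pb[OF j]]) (use q[OF j] in simp)
  qed
  with EL show ?thesis unfolding \<Phi>_def[symmetric] split by linarith
qed

end

section \<open>Sublinear exponents against exponential decay: the conclusion\<close>

lemma eventually_powr_le:
  fixes K a d :: real
  assumes "a < 1" "d > 0"
  shows "\<forall>\<^sub>F n in sequentially. K * real n powr a \<le> d * real n"
proof -
  have "((\<lambda>x. x powr (a - 1)) \<longlongrightarrow> 0) at_top" using assms(1) by (intro tendsto_neg_powr filterlim_ident) auto
  then have "(\<lambda>n. real n powr (a - 1)) \<longlonglongrightarrow> 0" by (rule filterlim_compose[OF _ filterlim_real_sequentially])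
  then have "(\<lambda>n. K * real n powr (a - 1)) \<longlonglongrightarrow> K * 0" by (intro tendsto_intros)
  then have "\<forall>\<^sub>F n in sequentially. K * real n powr (a - 1) < d"
    using assms(2) by (intro order_tendstoD(2)) auto
  then show ?thesis
    using eventually_gt_at_top[of 0]
  proof eventually_elim
    case (elim n)
    have "K * real n powr a = (K * real n powr (a - 1)) * real n"
      using elim(2) by (simp add: powr_diff)
    also have "\<dots> \<le> d * real n" using elim(1) by (intro mult_right_mono) auto
    finally show ?case .
  qed
qed

theorem theorem1p2:
  fixes T :: real and \<Omega> \<omega> :: "(real^'d) set"
    and l :: nat and q \<alpha> :: "nat \<Rightarrow> real"
    and a :: "'d \<Rightarrow> 'd \<Rightarrow> real^'d \<Rightarrow> real" and c :: "real^'d \<Rightarrow> real" and a0 :: real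
    and f :: "real^'d \<Rightarrow> real" and g :: "real \<Rightarrow> real" and u :: "real \<Rightarrow> real^'d \<Rightarrow> real"
  assumes "T > 0"
    and "open \<Omega>" "connected \<Omega>" "bounded \<Omega>" "Ck_boundary 2 \<Omega>"
    and "l \<ge> 1"
    and "\<And>j. j \<in> {1..l} \<Longrightarrow> q j > 0"
    and "\<And>j. j \<in> {1..l} \<Longrightarrow> 0 < \<alpha> j \<and> \<alpha> j < 1"
    and "\<And>i j. i \<in> {1..l} \<Longrightarrow> j \<in> {1..l} \<Longrightarrow> i < j \<Longrightarrow> \<alpha> j < \<alpha> i"
    and "\<And>i j. C1_closure \<Omega> (a i j)"
    and "\<And>i j x. x \<in> closure \<Omega> \<Longrightarrow> a i j x = a j i x"
    and "a0 > 0"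
    and "\<And>x \<xi>. x \<in> closure \<Omega> \<Longrightarrow>
           (\<Sum>i\<in>UNIV. \<Sum>j\<in>UNIV. a i j x * \<xi> $ i * \<xi> $ j) \<ge> a0 * (\<Sum>i\<in>UNIV. (\<xi> $ i)\<^sup>2)"
    and "c \<in> Linf_space \<Omega>" "AE x in lebesgue_on \<Omega>. c x \<ge> 0"
    and "f \<in> L2_space \<Omega>" "AE x in lebesgue_on \<Omega>. f x \<ge> 0" "\<not> (AE x in lebesgue_on \<Omega>. f x = 0)"
    and "g \<in> L2_space {0<..<T}"
    and "is_solution T \<Omega> l q \<alpha> a c (\<lambda>t x. g t * f x) u"
    and "open \<omega>" "connected \<omega>" "\<omega> \<noteq> {}" "\<omega> \<subseteq> \<Omega>"
    and "AE t in lebesgue_on {0<..<T}. (LINT x|lebesgue_on \<omega>. u t x) = 0"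
  shows "AE t in lebesgue_on {0<..<T}. g t = 0"
proof -
  note T = \<open>T > 0\<close> and l = \<open>l \<ge> 1\<close> and q = assms(7)
  have \<alpha>0: "\<alpha> j > 0" and \<alpha>1: "\<alpha> j < 1" if "j \<in> {1..l}" for j using assms(8)[OF that] by auto
  interpret source_problem \<Omega> a c a0 \<omega>
    by unfold_locales (use assms in auto)
  note sol = \<open>is_solution T \<Omega> l q \<alpha> a c (\<lambda>t x. g t * f x) u\<close>
  have u: "u \<in> L2_H2_H10 T \<Omega>" and uF: "u \<in> H_frac (\<alpha> 1) T \<Omega>"
    and eq: "AE t in lebesgue_on {0<..<T}. AE x in M.
        (\<Sum>j=1..l. q j * frac_deriv (\<alpha> j) T \<Omega> u t x) + elliptic_op \<Omega> a c (u t) x = g t * f x"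
    using sol by (auto simp: is_solution_def)
  define v where "v j = frac_deriv (\<alpha> j) T \<Omega> u" for j
  have v: "has_frac_deriv (\<alpha> j) T \<Omega> u (v j)" if j: "j \<in> {1..l}" for j
  proof -
    obtain w where w: "has_frac_deriv (\<alpha> 1) T \<Omega> u w" using uF by (auto simp: H_frac_def)
    \<comment> \<open>Regularity for \<alpha> 1 descends to the smaller exponents, so every chosen
      \<open>frac_deriv\<close> in the equation really inverts its fractional integral.\<close>
    have "\<exists>w. has_frac_deriv (\<alpha> j) T \<Omega> u w"
    proof (cases "j = 1")
      case True
      then show ?thesis using w by blast
    next
      case False
      then have "\<alpha> j < \<alpha> 1" using assms(9)[of 1 j] j l by auto
      then have "\<alpha> 1 - \<alpha> j > 0" by simp
      moreover have "has_frac_deriv (\<alpha> j + (\<alpha> 1 - \<alpha> j)) T \<Omega> u w" using w by simp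
      ultimately show ?thesis
        using frac_deriv_lower[OF open_dom bounded_dom T \<alpha>0[OF j]] by blast
    qed
    then show ?thesis unfolding v_def frac_deriv_def by (rule someI_ex)
  qed
  have "\<exists>W. borel_rep T \<Omega> (v j) W" if "j \<in> {1..l}" for j
    using v[OF that] borel_rep_exists[OF open_dom] unfolding has_frac_deriv_def by blast
  then have "\<forall>j\<in>{1..l}. \<exists>W. borel_rep T \<Omega> (v j) W" by blast
  from bchoice[OF this] obtain V where V: "\<And>j. j \<in> {1..l} \<Longrightarrow> borel_rep T \<Omega> (v j) (V j)" by blast
  define B where "B j = enn2real (\<integral>\<^sup>+t. (\<integral>\<^sup>+x. ennreal ((V j t x)\<^sup>2) \<partial>lborel) \<partial>lborel)" for j
  have B: "(\<integral>\<^sup>+t. (\<integral>\<^sup>+x. ennreal ((V j t x)\<^sup>2) \<partial>lborel) \<partial>lborel) = ennreal (B j)" if "j \<in> {1..l}" for j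
    using borel_repD(3)[OF V[OF that]] unfolding B_def by simp
  have B0: "B j \<ge> 0" for j by (simp add: B_def)
  obtain G where G: "integrable lborel G" "\<And>t. t \<notin> {0<..<T} \<Longrightarrow> G t = 0"
    and gG: "AE t in lborel. t \<in> {0<..<T} \<longrightarrow> g t = G t"
    using L2_space_real_rep[OF assms(19)] by blast
  obtain m C where m: "m > 0" and C: "C \<ge> 0"
    and low: "\<And>\<mu> \<epsilon> z. 1 \<le> \<mu> \<Longrightarrow> 0 < \<epsilon> \<Longrightarrow> \<epsilon> \<le> 1 \<Longrightarrow> approx_sol \<mu> \<epsilon> z \<Longrightarrow>
      m * exp (- C * \<mu>) - \<epsilon> * vol \<le> (LINT x|M. f x * z x)"
    using source_lower_bound[OF assms(16-18)] by metis
  \<comment> \<open>The Laplace variable runs through the natural numbers only, which is all that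
    the moment argument uses.\<close>
  define \<mu> where "\<mu> n = (\<Sum>j=1..l. q j * real n powr \<alpha> j)" for n
  define Q where "Q = (\<Sum>j=1..l. q j)"
  define IH where "IH = (LINT t|lebesgue_on {0<..<T}. 1 + (H2_norm \<Omega> (u t))\<^sup>2)"
  have IH: "IH \<ge> 0" unfolding IH_def by (intro integral_nonneg_AE) auto
  define Gn where "Gn n = \<bar>LINT t|lborel. exp (- real n * t) * G t\<bar>" for n
  have one: "1 \<in> {1..l}" using l by simp
  have Q0: "Q \<ge> 0" unfolding Q_def using q by (intro sum_nonneg) (auto simp: less_imp_le)
  have powr_mono1: "real n powr \<alpha> j \<le> real n powr \<alpha> 1" if "n \<ge> 1" "j \<in> {1..l}" for n j
    using that assms(9)[of 1 j] one by (cases "j = 1") (auto intro!: powr_mono)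
  have powr_le: "real n powr \<alpha> j \<le> real n" if "n \<ge> 1" "j \<in> {1..l}" for n j
    using powr_mono[of "\<alpha> j" 1 "real n"] \<alpha>1[OF that(2)] that(1) by simp
  \<comment> \<open>Of the two bounds the first, sublinear in n, is for the exponent C * \<mu> n;
    the second, linear in n, is for the factor in front of the exponential.\<close>
  have \<mu>_le: "\<mu> n \<le> Q * real n powr \<alpha> 1" "\<mu> n \<le> Q * real n" if n: "n \<ge> 1" for n
    unfolding \<mu>_def Q_def sum_distrib_right
    using powr_mono1[OF n] powr_le[OF n] q by (intro sum_mono mult_left_mono; simp add: less_imp_le)+
  have \<mu>_nonneg: "\<mu> n \<ge> 0" for n unfolding \<mu>_def using q by (intro sum_nonneg mult_nonneg_nonneg) (auto simp: less_imp_le)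
  \<comment> \<open>Approximate solutions are constructed for \<mu> \<ge> 1; the summand with j = 1
    alone exceeds 1 for large n.\<close>
  have \<mu>1: "\<forall>\<^sub>F n in sequentially. \<mu> n \<ge> 1"
  proof -
    have "filterlim (\<lambda>n. \<alpha> 1 * ln (real n)) at_top sequentially"
      using \<alpha>0[OF one]
      by (intro filterlim_tendsto_pos_mult_at_top[OF tendsto_const]
          filterlim_compose[OF ln_at_top filterlim_real_sequentially]) auto
    then have "filterlim (\<lambda>n. exp (\<alpha> 1 * ln (real n))) at_top sequentially"
      by (rule filterlim_compose[OF exp_at_top])
    moreover have "\<forall>\<^sub>F n in sequentially. exp (\<alpha> 1 * ln (real n)) = real n powr \<alpha> 1"
      using eventually_gt_at_top[of 0] by eventually_elim (simp add: powr_def)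
    ultimately have "filterlim (\<lambda>n. real n powr \<alpha> 1) at_top sequentially"
      by (rule filterlim_cong[THEN iffD1, rotated -1, OF _ refl refl])
    then have "filterlim (\<lambda>n. q 1 * real n powr \<alpha> 1) at_top sequentially"
      using q[OF one] by (intro filterlim_tendsto_pos_mult_at_top[OF tendsto_const]) auto
    then have "\<forall>\<^sub>F n in sequentially. q 1 * real n powr \<alpha> 1 \<ge> 1" by (simp add: filterlim_at_top)
    then show ?thesis
    proof eventually_elim
      case (elim n)
      have "q 1 * real n powr \<alpha> 1 \<le> \<mu> n"
        unfolding \<mu>_def using one q by (intro member_le_sum[of 1 "{1..l}" "\<lambda>j. q j * real n powr \<alpha> j"]) (auto simp: less_imp_le)
      with elim show ?case by simp
    qed
  qed
  \<comment> \<open>Collects what multiplies n * exp (- n * T): the square root of A1 + cmax + \<mu>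
    n is at most linear in n, and exp (- (n - 1) * T) contributes the additional exp T.\<close>
  define K where "K = (A1 + cmax + Q + 1) * IH + (\<Sum>j=1..l. q j * (exp T * (B j + T * (4 * vol + 2))))"
  have K0: "K \<ge> 0"
    unfolding K_def using IH A1_pos cmax(1) Q0 q B0 T vol_nonneg
    by (intro add_nonneg_nonneg mult_nonneg_nonneg sum_nonneg) (auto simp: less_imp_le)
  have est: "\<forall>\<^sub>F n in sequentially. Gn n * (m * exp (- C * \<mu> n) - exp (- real n * T) * vol) \<le> K * real n * exp (- real n * T)"
    using \<mu>1 eventually_ge_at_top[of 1]
  proof eventually_elim
    case (elim n)
    \<comment> \<open>The tolerance of the approximate solution is matched to the truncation error,
      so that both parts of the bound have the same exponential rate.\<close>
    define \<epsilon> where "\<epsilon> = exp (- real n * T)"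
    have \<epsilon>: "0 < \<epsilon>" "\<epsilon> \<le> 1" using T by (auto simp: \<epsilon>_def)
    have n1: "real n \<ge> 1" using elim(2) by simp
    obtain z where z: "approx_sol (\<mu> n) \<epsilon> z" using approx_sol_exists[OF elim(1) \<epsilon>] by blast
    let ?\<Phi> = "LINT x|M. f x * z x"
    have "?\<Phi> \<ge> m * exp (- C * \<mu> n) - \<epsilon> * vol" by (rule low[OF elim(1) \<epsilon> z])
    then have "Gn n * (m * exp (- C * \<mu> n) - \<epsilon> * vol) \<le> Gn n * ?\<Phi>"
      by (intro mult_left_mono) (simp_all add: Gn_def)
    also have "\<dots> \<le> \<bar>?\<Phi> * (LINT t|lborel. exp (- real n * t) * G t)\<bar>"
      unfolding abs_mult Gn_def by (subst mult.commute, rule mult_right_mono) auto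
    also have "\<dots> \<le> \<epsilon> * sqrt (A1 + cmax + \<mu> n) * IH +
        (\<Sum>j=1..l. q j * (real n powr \<alpha> j * exp (- (real n - 1) * T) * (B j + T * (4 * vol + 2))))"
      unfolding IH_def
      by (rule laplace_source_bound[OF T l q \<alpha>0 v V B B0 u _ assms(16) assms(25) G gG n1 \<mu>_def elim(1) \<epsilon> z])
        (use eq in \<open>simp_all add: v_def\<close>)
    also have "\<dots> \<le> \<epsilon> * ((A1 + cmax + Q + 1) * real n) * IH +
        (\<Sum>j=1..l. real n * \<epsilon> * (q j * (exp T * (B j + T * (4 * vol + 2)))))"
    proof (intro add_mono mult_right_mono mult_left_mono sum_mono)
      let ?x = "A1 + cmax + \<mu> n"
      have x0: "?x \<ge> 1" using A1_pos cmax(1) elim(1) by simp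
      then have "sqrt ?x \<le> sqrt (?x * ?x)" by (intro real_sqrt_le_mono) simp
      also have "\<dots> = ?x" using x0 by simp
      also have "\<dots> \<le> A1 * real n + cmax * real n + Q * real n + 1 * real n"
        using A1_pos cmax(1) n1 \<mu>_le(2)[OF elim(2)] mult_left_mono[OF n1, of A1] mult_left_mono[OF n1, of cmax] by linarith
      finally show "sqrt ?x \<le> (A1 + cmax + Q + 1) * real n" by (simp add: algebra_simps)
      fix j assume j: "j \<in> {1..l}"
      have e: "exp (- (real n - 1) * T) = \<epsilon> * exp T" by (simp add: \<epsilon>_def exp_add[symmetric] algebra_simps)
      have "real n powr \<alpha> j * (exp (- (real n - 1) * T) * (B j + T * (4 * vol + 2))) \<le>
          real n * (exp (- (real n - 1) * T) * (B j + T * (4 * vol + 2)))"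
        using powr_le[OF elim(2) j] B0 T vol_nonneg by (intro mult_right_mono mult_nonneg_nonneg) auto
      then have "q j * (real n powr \<alpha> j * (exp (- (real n - 1) * T) * (B j + T * (4 * vol + 2)))) \<le>
          q j * (real n * (exp (- (real n - 1) * T) * (B j + T * (4 * vol + 2))))"
        using q[OF j] by (intro mult_left_mono) auto
      then show "q j * (real n powr \<alpha> j * exp (- (real n - 1) * T) * (B j + T * (4 * vol + 2))) \<le>
          real n * \<epsilon> * (q j * (exp T * (B j + T * (4 * vol + 2))))"
        unfolding e by (simp add: mult_ac)
    qed (use IH \<epsilon> in auto)
    also have "\<dots> = K * real n * \<epsilon>"
      unfolding K_def sum_distrib_left[symmetric] by (simp add: algebra_simps)
    finally show ?case unfolding \<epsilon>_def .
  qed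
  have moments: "\<exists>n0. \<forall>n\<ge>n0. Gn n \<le> (2 * K / m) * exp (- real n * b)" if b: "b < T" for b
  proof -
    \<comment> \<open>The gap between T and b is spent in two halves: one absorbs the factor n, the
      other the loss exp (C * \<mu> n).\<close>
    define d where "d = (T - b) / 2"
    have d: "d > 0" using b by (simp add: d_def)
    have "\<forall>\<^sub>F n in sequentially. (C * Q) * real n powr \<alpha> 1 \<le> d * real n"
      by (rule eventually_powr_le[OF \<alpha>1[OF one] d])
    moreover have "\<forall>\<^sub>F n in sequentially. (C * Q) * real n powr \<alpha> 1 \<le> T / 2 * real n"
      using T by (intro eventually_powr_le[OF \<alpha>1[OF one]]) simp
    moreover have "\<forall>\<^sub>F n in sequentially. ln (real n) \<le> d * real n"
    proof -
      have "\<forall>\<^sub>F n in sequentially. ln (real n) / real n < d"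
        using order_tendstoD(2)[OF lim_ln_over_n d] .
      then show ?thesis using eventually_gt_at_top[of 0] by eventually_elim (simp add: field_simps)
    qed
    moreover have "\<forall>\<^sub>F n in sequentially. vol * exp (- (real n * (T / 2))) \<le> m / 2"
    proof -
      have "filterlim (\<lambda>n. T / 2 * real n) at_top sequentially"
        using T by (intro filterlim_tendsto_pos_mult_at_top[OF tendsto_const _ filterlim_real_sequentially]) auto
      then have "filterlim (\<lambda>n. - (T / 2 * real n)) at_bot sequentially" by (simp add: filterlim_uminus_at_top)
      then have "(\<lambda>n. exp (- (T / 2 * real n))) \<longlonglongrightarrow> 0" by (rule filterlim_compose[OF exp_at_bot])
      then have "(\<lambda>n. vol * exp (- (T / 2 * real n))) \<longlonglongrightarrow> vol * 0" by (intro tendsto_intros)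
      then have "\<forall>\<^sub>F n in sequentially. vol * exp (- (T / 2 * real n)) < m / 2"
        using m by (intro order_tendstoD(2)) auto
      then show ?thesis by eventually_elim (simp add: mult.commute)
    qed
    ultimately have "\<forall>\<^sub>F n in sequentially. Gn n \<le> (2 * K / m) * exp (- real n * b)"
      using est eventually_ge_at_top[of 1]
    proof eventually_elim
      case (elim n)
      have n: "real n > 0" using elim(6) by simp
      have C\<mu>: "C * \<mu> n \<le> (C * Q) * real n powr \<alpha> 1" using mult_left_mono[OF \<mu>_le(1)[OF elim(6)] C] by (simp add: mult.assoc)
      \<comment> \<open>One factor exp (- n * T / 2) beats exp (- C * \<mu> n), the other brings vol
        below m / 2. The regularisation error thus takes away at most half of the lower bound for
        the source.\<close>
      have "exp (- real n * T) * vol \<le> (m / 2) * exp (- C * \<mu> n)"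
      proof -
        have "exp (- real n * T) * vol = exp (- (real n * (T / 2))) * (vol * exp (- (real n * (T / 2))))"
          by (simp add: exp_add[symmetric] algebra_simps flip: mult.assoc)
        also have "\<dots> \<le> exp (- C * \<mu> n) * (m / 2)"
          using elim(2,4) C\<mu> vol_nonneg by (intro mult_mono) (auto simp: mult.commute)
        finally show ?thesis by (simp add: mult.commute)
      qed
      then have "Gn n * ((m / 2) * exp (- C * \<mu> n)) \<le> Gn n * (m * exp (- C * \<mu> n) - exp (- real n * T) * vol)"
        by (intro mult_left_mono) (simp_all add: Gn_def)
      also have "\<dots> \<le> K * real n * exp (- real n * T)" by (rule elim(5))
      finally have "Gn n * ((m / 2) * exp (- C * \<mu> n)) * exp (C * \<mu> n) \<le> K * real n * exp (- real n * T) * exp (C * \<mu> n)"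
        by (intro mult_right_mono) auto
      then have 1: "Gn n * (m / 2) \<le> K * (real n * exp (- real n * T) * exp (C * \<mu> n))"
        by (simp add: exp_minus mult.assoc)
      have "real n * exp (- real n * T) * exp (C * \<mu> n) = exp (ln (real n) + - real n * T + C * \<mu> n)"
        using n by (simp only: exp_add exp_ln of_nat_0_less_iff)
      also have "\<dots> \<le> exp (- real n * b)"
      proof -
        have "2 * (d * real n) = real n * T - real n * b" by (simp add: d_def field_simps)
        then show ?thesis using elim(1,3) C\<mu> by (simp add: algebra_simps)
      qed
      finally have "Gn n * (m / 2) \<le> K * exp (- real n * b)"
        using 1 K0 by (meson mult_left_mono order_trans)
      then show ?case using m by (simp add: field_simps)
    qed
    then show ?thesis unfolding eventually_sequentially .
  qed
  have prim: "(LINT t|lborel. indicator {..<\<tau>} t * G t) = 0" if \<tau>: "\<tau> < T" for \<tau>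
  proof -
    \<comment> \<open>The moments decay at every rate below T, and the moment argument wants a rate
      strictly above \<tau>; the midpoint satisfies both.\<close>
    define b where "b = (\<tau> + T) / 2"
    have b: "\<tau> < b" "b < T" using \<tau> by (auto simp: b_def)
    obtain n0 where n0: "\<And>n. n \<ge> n0 \<Longrightarrow> Gn n \<le> (2 * K / m) * exp (- real n * b)" using moments[OF b(2)] by blast
    show ?thesis
      by (rule exp_moments_zero[OF G(1) _ n0[unfolded Gn_def] b(1)]) (use G(2) in auto)
  qed
  have "AE t in lborel. t < T \<longrightarrow> G t = 0" by (rule AE_zero_of_primitive_zero[OF G(1) prim])
  then have "AE t in lborel. t \<in> {0<..<T} \<longrightarrow> g t = 0"
    using gG by eventually_elim auto
  then have "AE t in lebesgue. t \<in> {0<..<T} \<longrightarrow> g t = 0" by (rule AE_completion)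
  then show ?thesis by (subst AE_restrict_space_iff) (auto intro: sets_completionI_sets)
qed

end
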